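(* Let $k\ge1$ be a fixed integer and let $\varphi_k:(0,1)^{k+1}\to\mathbb{R}$ be a nonconstant square-integrable function which is a score-generating function for the scores $a^{(n)}_{\varphi_k;\mathrm{ex}}$ (respectively $a^{(n)}_{\varphi_k;\mathrm{appr}}$) of the statistic $S^{(n)}_{\varphi_k;\mathrm{ex}}$ (respectively $S^{(n)}_{\varphi_k;\mathrm{appr}}$). Whenever approximate scores are considered, assume that $\varphi_k$ is a linear combination of square-integrable functions that are monotone in all their arguments. Then, writing $S_k^{(n)}$ for either $S^{(n)}_{\varphi_k;\mathrm{ex}}$ or $S^{(n)}_{\varphi_k;\mathrm{appr}}$: (i) (Asymptotic representation) for every $f\in\mathcal{F}_0$, under $\mathcal{H}^{(n)}_{0;f}$, as $n\to\infty$, $$\begin{aligned}S_k^{(n)}-\mathrm{E}[S_k^{(n)}]={}&T^{(n)}_{\varphi_k;f;k}-\mathrm{E}[T^{(n)}_{\varphi_k;f;k}\mid\mathbf{Z}^{(n)}_{(\cdot)}]\\&+2^{k+1}[n(n-1)\cdots(n-k)]^{-1}\Big\{I[N_-^{(n)}\ge k+1]\,N_-^{(n)}(N_-^{(n)}-1)\cdots(N_-^{(n)}-k)\,\mu^{(0)}_{\varphi_k}\\&\quad+\sum_{\nu=1}^k I[k+1-\nu\le N_-^{(n)}\le n-\nu]\,N_-^{(n)}(N_-^{(n)}-1)\cdots(N_-^{(n)}-k+\nu)\\&\qquad\qquad\times N_+^{(n)}(N_+^{(n)}-1)\cdots(N_+^{(n)}-\nu+1)\,\mu^{(\nu)}_{\varphi_k}\\&\quad+I[N_+^{(n)}\ge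 k+1]\,N_+^{(n)}(N_+^{(n)}-1)\cdots(N_+^{(n)}-k)\,\mu^{(k+1)}_{\varphi_k}\Big\}-\mu_{\varphi_k}+o_{\mathrm P}(1/\sqrt n);\end{aligned}$$ (ii) (Asymptotic normality) if, moreover, $\varphi_k$ is $(2+\delta)$-integrable for some $\delta>0$, then, under $\mathcal{H}_0^{(n)}$ (i.e. under $\mathcal{H}^{(n)}_{0;f}$ for any $f\in\mathcal{F}_0$), as $n\to\infty$, $$\sqrt{n-k}\,(S_k^{(n)}-\mathrm{E}[S_k^{(n)}])\Big/\sqrt{V^2+(k+1)^2\Big[\mu_{\varphi_k}-2\sum_{\nu=1}^{k+1}\nu\,\mu^{(\nu)}_{\varphi_k}/(k+1)\Big]^2}$$ converges in distribution to $\mathcal{N}(0,1)$, where $$V^2:=\mathrm{E}[\{\varphi_k^*(U_{k+1},\dots,U_1)\}^2]+2\sum_{j=1}^k\mathrm{E}[\varphi_k^*(U_{k+1},\dots,U_1)\,\varphi_k^*(U_{k+1+j},\dots,U_{1+j})],$$ $U_1,U_2,\dots$ are i.i.d. uniform on $(0,1)$, and for $u_1,\dots,u_{k+1}\in(0,1)$ $$\varphi_k^*(u_{k+1},\dots,u_1):=\varphi_k(u_{k+1},\dots,u_1)-\sum_{l=1}^{k+1}\mathrm{E}[\varphi_k(U_{k+1},\dots,U_1)\mid U_l=u_1]+k\,\mathrm{E}[\varphi_k(U_{k+1},\dots,U_1)].$$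
   Context: $\mathcal{F}_0$ is the set of probability densities $f$ on $\mathbb{R}$ with $f(x)>0$ for all $x$ and $\int_{-\infty}^0 f=\int_0^\infty f=1/2$. Under $\mathcal{H}^{(n)}_{0;f}$, $\mathbf{Z}^{(n)}=(Z_1^{(n)},\dots,Z_n^{(n)})'$ has i.i.d. components with density $f\in\mathcal{F}_0$ and distribution function $F$; $\mathcal{H}_0^{(n)}$ denotes the same hypothesis with $f\in\mathcal{F}_0$ unspecified. $R_t^{(n)}$ is the rank of $Z_t^{(n)}$ among $Z_1^{(n)},\dots,Z_n^{(n)}$; $N_-^{(n)}=\sum_i I[Z_i^{(n)}<0]$, $N_+^{(n)}=\sum_i I[Z_i^{(n)}>0]$, $\mathbf{N}^{(n)}=(N_-^{(n)},N_+^{(n)})$; $\mathbf{Z}^{(n)}_{(\cdot)}$ is the vector of order statistics of $\mathbf{Z}^{(n)}$. Expectations are taken under $\mathcal{H}^{(n)}_{0;f}$ (for functions of signs and ranks they do not depend on $f$). Score-generating function: $\varphi_k$ is a score-generating function for $a_k^{(n)}$ if, under $\mathcal{H}^{(n)}_{0;f}$, as $n\to\infty$, $\mathrm{E}[\{a_k^{(n)}(\mathbf{N}^{(n)};R_{k+1}^{(n)},\dots,R_1^{(n)})-\varphi_k(F(Z_{k+1}^{(n)}),\dots,F(Z_1^{(n)}))\}^2\mid\mathbf{Z}^{(n)}_{(\cdot)}]=o_{\mathrm P}(1)$ (this does not depend on $f\in\mathcal{F}_0$). Exact and approximate scores: let $U_1^{(n)},\dots,U_n^{(n)}$ be i.i.d.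 uniform on $(0,1)$, $R_{U_i}^{(n)}$ the rank of $U_i^{(n)}$ among them, $N_{\mathbf{U};-}^{(n)}:=\sum_i I[U_i^{(n)}<1/2]$, $N_{\mathbf{U};+}^{(n)}:=\sum_i I[U_i^{(n)}>1/2]$. For distinct $i_1,\dots,i_{k+1}\in\{1,\dots,n\}$, $$a^{(n)}_{\varphi_k;\mathrm{ex}}((\eta,\nu);i_1,\dots,i_{k+1}):=\mathrm{E}[\varphi_k(U_1^{(n)},\dots,U_{k+1}^{(n)})\mid N_{\mathbf{U};-}^{(n)}=\eta,\,N_{\mathbf{U};+}^{(n)}=\nu,\,R_{U_1}^{(n)}=i_1,\dots,R_{U_{k+1}}^{(n)}=i_{k+1}],$$ $$a^{(n)}_{\varphi_k;\mathrm{appr}}((\eta,\nu);i_1,\dots,i_{k+1}):=\varphi_k(r(i_1),\dots,r(i_{k+1})),\quad r(i):=I[i\le\eta]\frac{i}{2(\eta+1)}+I[i>n-\nu]\Big(\frac12+\frac{i-(n-\nu)}{2(\nu+1)}\Big).$$ With ex/appr meaning either, $S^{(n)}_{\varphi_k;\mathrm{ex/appr}}:=\frac1{n-k}\sum_{t=k+1}^n a^{(n)}_{\varphi_k;\mathrm{ex/appr}}(\mathbf{N}^{(n)};R_t^{(n)},R_{t-1}^{(n)},\dots,R_{t-k}^{(n)})$. Further notation: $T^{(n)}_{\varphi_k;f;k}:=\frac1{n-k}\sum_{t=k+1}^n\varphi_k(F(Z_t^{(n)}),\dots,F(Z_{t-k}^{(n)}))$, for which $\mathrm{E}[T^{(n)}_{\varphi_k;f;k}\mid\mathbf{Z}^{(n)}_{(\cdot)}]=[n(n-1)\cdots(n-k)]^{-1}\sum\varphi_k(F(Z_{t_1}^{(n)}),\dots,F(Z_{t_{k+1}}^{(n)}))$,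 the sum being over all $(k+1)$-tuples of pairwise distinct indices $t_1,\dots,t_{k+1}\in\{1,\dots,n\}$. Also $\mu_{\varphi_k}:=\int_{[0,1]^{k+1}}\varphi_k(u_0,\dots,u_k)\,du_0\cdots du_k$, $\mu^{(0)}_{\varphi_k}:=\int_{[0,1/2]^{k+1}}\varphi_k\,du_0\cdots du_k$, $\mu^{(k+1)}_{\varphi_k}:=\int_{[1/2,1]^{k+1}}\varphi_k\,du_0\cdots du_k$, and, for $\nu=1,\dots,k$, $\mu^{(\nu)}_{\varphi_k}$ is the sum, over all $0\le i_1<\cdots<i_\nu\le k$, of the integral of $\varphi_k(u_0,\dots,u_k)$ over the set where $u_{i_1},\dots,u_{i_\nu}\in[1/2,1]$ and all other coordinates lie in $[0,1/2]$.
   Formalization: In (ii) the quantity under the square root in the denominator is assumed to be positive; nonconstancy does not ensure this (for k=1, φ(u0,u1)=g(u0)−g(u1) makes it zero and the quotient undefined). *)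

theory Defs
  imports "HOL-Probability.Probability"
begin

section \<open>Densities and the sample under the null hypothesis\<close>

text \<open>Nonintegrable functions have integral 0, so the two values 1/2 force \<open>f\<close> to be a probability density.\<close>

definition \<F>0 :: "(real \<Rightarrow> real) set" where
  "\<F>0 = {f. f \<in> borel_measurable borel \<and> (\<forall>x. 0 < f x)
            \<and> (LBINT x:{..0}. f x) = 1/2 \<and> (LBINT x:{0..}. f x) = 1/2}"

definition law :: "(real \<Rightarrow> real) \<Rightarrow> real measure" where
  "law f = density lborel (\<lambda>x. ennreal (f x))"

text \<open>The law of \<open>(Z\<^sub>1, \<dots>, Z\<^sub>n)\<close> under the hypothesis indexed by \<open>f\<close>. All statistics below are
  functions of the observed vector \<open>z\<close>, with \<open>z t\<close> (for \<open>1 \<le> t \<le> n\<close>) in the role of \<open>Z\<^sub>t\<close>.\<close>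

definition H0 :: "(real \<Rightarrow> real) \<Rightarrow> nat \<Rightarrow> (nat \<Rightarrow> real) measure" where
  "H0 f n = (\<Pi>\<^sub>M t\<in>{1..n}. law f)"

definition rank :: "nat \<Rightarrow> (nat \<Rightarrow> real) \<Rightarrow> nat \<Rightarrow> nat" where
  "rank n z t = card {s\<in>{1..n}. z s \<le> z t}"

text \<open>Numbers of observations below and above \<open>c\<close>: \<open>c = 0\<close> for \<open>Z\<close>, \<open>c = 1/2\<close> for uniform variables.\<close>

definition n_below :: "real \<Rightarrow> nat \<Rightarrow> (nat \<Rightarrow> real) \<Rightarrow> nat" where
  "n_below c n z = card {i\<in>{1..n}. z i < c}"

definition n_above :: "real \<Rightarrow> nat \<Rightarrow> (nat \<Rightarrow> real) \<Rightarrow> nat" where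
  "n_above c n z = card {i\<in>{1..n}. z i > c}"

abbreviation N_minus :: "nat \<Rightarrow> (nat \<Rightarrow> real) \<Rightarrow> nat" where
  "N_minus \<equiv> n_below 0"

abbreviation N_plus :: "nat \<Rightarrow> (nat \<Rightarrow> real) \<Rightarrow> nat" where
  "N_plus \<equiv> n_above 0"

definition order_stat :: "nat \<Rightarrow> (nat \<Rightarrow> real) \<Rightarrow> nat \<Rightarrow> real" where
  "order_stat n z = (\<lambda>i\<in>{1..n}. sort (map z [1..<Suc n]) ! (i - 1))"

text \<open>Conditional expectation given the vector of order statistics.\<close>

definition cond_order ::
    "(real \<Rightarrow> real) \<Rightarrow> nat \<Rightarrow> ((nat \<Rightarrow> real) \<Rightarrow> real) \<Rightarrow> (nat \<Rightarrow> real) \<Rightarrow> real" where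
  "cond_order f n X =
     real_cond_exp (H0 f n)
       (vimage_algebra (space (H0 f n)) (order_stat n) (\<Pi>\<^sub>M i\<in>{1..n}. borel)) X"

text \<open>\<open>X n = o\<^sub>P(r n)\<close> under the probability measures \<open>P n\<close>.\<close>

definition small_oP :: "(nat \<Rightarrow> 'a measure) \<Rightarrow> (nat \<Rightarrow> 'a \<Rightarrow> real) \<Rightarrow> (nat \<Rightarrow> real) \<Rightarrow> bool" where
  "small_oP P X r \<longleftrightarrow>
     (\<forall>\<epsilon>>0. (\<lambda>n. measure (P n) {\<omega>\<in>space (P n). \<bar>X n \<omega>\<bar> > \<epsilon> * \<bar>r n\<bar>}) \<longlonglongrightarrow> 0)"

section \<open>Functions on the open unit cube\<close>

definition uniform01 :: "real measure" where
  "uniform01 = restrict_space lborel {0<..<1}"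

text \<open>Lebesgue measure on \<open>(0,1)\<^bsup>k+1\<^esup>\<close>. Points are functions with domain \<open>{..k}\<close>, the value at \<open>j\<close> being
  the coordinate \<open>u\<^sub>j\<close>, i.e. the argument number \<open>j+1\<close> of \<open>\<phi>\<close>.\<close>

definition cube :: "nat \<Rightarrow> (nat \<Rightarrow> real) measure" where
  "cube k = (\<Pi>\<^sub>M j\<in>{..k}. uniform01)"

definition square_integrable :: "nat \<Rightarrow> ((nat \<Rightarrow> real) \<Rightarrow> real) \<Rightarrow> bool" where
  "square_integrable k g \<longleftrightarrow>
     g \<in> borel_measurable (cube k) \<and> integrable (cube k) (\<lambda>u. (g u)\<^sup>2)"

definition nonconstant :: "nat \<Rightarrow> ((nat \<Rightarrow> real) \<Rightarrow> real) \<Rightarrow> bool" where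
  "nonconstant k g \<longleftrightarrow> \<not> (\<exists>c. \<forall>u\<in>space (cube k). g u = c)"

text \<open>For each argument, and each choice of the others, monotone (in either direction) in that
  argument.\<close>

definition monotone_in_each :: "nat \<Rightarrow> ((nat \<Rightarrow> real) \<Rightarrow> real) \<Rightarrow> bool" where
  "monotone_in_each k g \<longleftrightarrow>
     (\<forall>u\<in>space (cube k). \<forall>j\<le>k.
        monotone_on {0<..<1} (\<le>) (\<le>) (\<lambda>x. g (u(j := x))) \<or>
        monotone_on {0<..<1} (\<le>) (\<ge>) (\<lambda>x. g (u(j := x))))"

definition comb_of_monotone :: "nat \<Rightarrow> ((nat \<Rightarrow> real) \<Rightarrow> real) \<Rightarrow> bool" where
  "comb_of_monotone k \<phi> \<longleftrightarrow>
     (\<exists>(m::nat) (c :: nat \<Rightarrow> real) g.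
        (\<forall>i<m. square_integrable k (g i) \<and> monotone_in_each k (g i)) \<and>
        (\<forall>u\<in>space (cube k). \<phi> u = (\<Sum>i<m. c i * g i u)))"

text \<open>The tuple \<open>(x\<^sub>t, x\<^bsub>t-1\<^esub>, \<dots>, x\<^bsub>t-k\<^esub>)\<close>.\<close>

definition lags :: "nat \<Rightarrow> (nat \<Rightarrow> 'a) \<Rightarrow> nat \<Rightarrow> nat \<Rightarrow> 'a" where
  "lags k x t = (\<lambda>j\<in>{..k}. x (t - j))"

section \<open>Scores and statistics\<close>

text \<open>A score \<open>a n \<eta> \<nu> i\<close> has as arguments the sample size, the values of \<open>(N\<^sub>-, N\<^sub>+)\<close>, and
  the \<open>(k+1)\<close>-tuple of ranks \<open>(i 0, \<dots>, i k)\<close>.\<close>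

type_synonym score = "nat \<Rightarrow> nat \<Rightarrow> nat \<Rightarrow> (nat \<Rightarrow> nat) \<Rightarrow> real"

definition cond_exp_event :: "'a measure \<Rightarrow> ('a \<Rightarrow> real) \<Rightarrow> 'a set \<Rightarrow> real" where
  "cond_exp_event M X A = (LINT \<omega>:A|M. X \<omega>) / measure M A"

definition exact_score :: "nat \<Rightarrow> ((nat \<Rightarrow> real) \<Rightarrow> real) \<Rightarrow> score" where
  "exact_score k \<phi> n \<eta> \<nu> i =
     (let M = (\<Pi>\<^sub>M t\<in>{1..n}. uniform01) in
      cond_exp_event M (\<lambda>U. \<phi> (\<lambda>j\<in>{..k}. U (j + 1)))
        {U \<in> space M. n_below (1/2) n U = \<eta> \<and> n_above (1/2) n U = \<nu>
                       \<and> (\<forall>j\<le>k. rank n U (j + 1) = i j)})"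

definition appr_point :: "nat \<Rightarrow> nat \<Rightarrow> nat \<Rightarrow> nat \<Rightarrow> real" where
  "appr_point n \<eta> \<nu> i =
     of_bool (i \<le> \<eta>) * (real i / (2 * (real \<eta> + 1)))
     + of_bool (real i > real n - real \<nu>)
         * (1/2 + (real i - (real n - real \<nu>)) / (2 * (real \<nu> + 1)))"

definition appr_score :: "nat \<Rightarrow> ((nat \<Rightarrow> real) \<Rightarrow> real) \<Rightarrow> score" where
  "appr_score k \<phi> n \<eta> \<nu> i = \<phi> (\<lambda>j\<in>{..k}. appr_point n \<eta> \<nu> (i j))"

definition score_generating :: "nat \<Rightarrow> score \<Rightarrow> ((nat \<Rightarrow> real) \<Rightarrow> real) \<Rightarrow> bool" where
  "score_generating k a \<phi> \<longleftrightarrow>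
     (\<forall>f\<in>\<F>0. small_oP (H0 f)
        (\<lambda>n. cond_order f n (\<lambda>z.
           (a n (N_minus n z) (N_plus n z) (lags k (rank n z) (k + 1))
            - \<phi> (lags k (\<lambda>i. cdf (law f) (z i)) (k + 1)))\<^sup>2))
        (\<lambda>n. 1))"

definition S_stat :: "nat \<Rightarrow> score \<Rightarrow> nat \<Rightarrow> (nat \<Rightarrow> real) \<Rightarrow> real" where
  "S_stat k a n z =
     (\<Sum>t=k+1..n. a n (N_minus n z) (N_plus n z) (lags k (rank n z) t)) / (real n - real k)"

definition T_stat ::
    "nat \<Rightarrow> ((nat \<Rightarrow> real) \<Rightarrow> real) \<Rightarrow> (real \<Rightarrow> real) \<Rightarrow> nat \<Rightarrow> (nat \<Rightarrow> real) \<Rightarrow> real" where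
  "T_stat k \<phi> f n z =
     (\<Sum>t=k+1..n. \<phi> (lags k (\<lambda>i. cdf (law f) (z i)) t)) / (real n - real k)"

section \<open>Centering and asymptotic variance\<close>

definition mu :: "nat \<Rightarrow> ((nat \<Rightarrow> real) \<Rightarrow> real) \<Rightarrow> real" where
  "mu k \<phi> = (LINT u|cube k. \<phi> u)"

text \<open>For \<open>\<nu> = 0\<close> and \<open>\<nu> = k + 1\<close> the sum has the single term \<open>A = {}\<close>, respectively \<open>A = {..k}\<close>.\<close>

definition mu_part :: "nat \<Rightarrow> ((nat \<Rightarrow> real) \<Rightarrow> real) \<Rightarrow> nat \<Rightarrow> real" where
  "mu_part k \<phi> \<nu> =
     (\<Sum>A | A \<subseteq> {..k} \<and> card A = \<nu>.
        LINT u:{u \<in> space (cube k). (\<forall>j\<in>A. 1/2 \<le> u j) \<and> (\<forall>j\<in>{..k} - A. u j \<le> 1/2)}|cube k. \<phi> u)"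

text \<open>The falling factorial \<open>x (x - 1) \<cdots> (x - m + 1)\<close> with \<open>m\<close> factors.\<close>

definition falling :: "nat \<Rightarrow> nat \<Rightarrow> real" where
  "falling x m = (\<Prod>j<m. real x - real j)"

definition sign_term :: "nat \<Rightarrow> ((nat \<Rightarrow> real) \<Rightarrow> real) \<Rightarrow> nat \<Rightarrow> (nat \<Rightarrow> real) \<Rightarrow> real" where
  "sign_term k \<phi> n z =
     2 ^ (k + 1) / falling n (k + 1) *
       (of_bool (N_minus n z \<ge> k + 1) * falling (N_minus n z) (k + 1) * mu_part k \<phi> 0
        + (\<Sum>\<nu>=1..k. of_bool (k + 1 - \<nu> \<le> N_minus n z \<and> N_minus n z \<le> n - \<nu>)
                       * falling (N_minus n z) (k + 1 - \<nu>) * falling (N_plus n z) \<nu> * mu_part k \<phi> \<nu>)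
        + of_bool (N_plus n z \<ge> k + 1) * falling (N_plus n z) (k + 1) * mu_part k \<phi> (k + 1))"

text \<open>A version of \<open>y \<mapsto> E[X | Y = y]\<close>; it is determined up to null sets of the law of \<open>Y\<close>.\<close>

definition cond_exp_at :: "'a measure \<Rightarrow> ('a \<Rightarrow> real) \<Rightarrow> ('a \<Rightarrow> real) \<Rightarrow> real \<Rightarrow> real" where
  "cond_exp_at M X Y =
     (SOME g. g \<in> borel_measurable borel \<and>
        (AE \<omega> in M. real_cond_exp M (vimage_algebra (space M) Y borel) X \<omega> = g (Y \<omega>)))"

text \<open>The law of the sequence \<open>U\<^sub>1, U\<^sub>2, \<dots>\<close> of i.i.d. uniform variables.\<close>

definition uniform_seq :: "(nat \<Rightarrow> real) measure" where
  "uniform_seq = (\<Pi>\<^sub>M i\<in>{1..}. uniform01)"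

text \<open>\<open>u = (u\<^bsub>k+1\<^esub>, \<dots>, u\<^sub>1)\<close>, so that \<open>u\<^sub>1\<close> is the last coordinate \<open>u k\<close>.\<close>

definition phi_star :: "nat \<Rightarrow> ((nat \<Rightarrow> real) \<Rightarrow> real) \<Rightarrow> (nat \<Rightarrow> real) \<Rightarrow> real" where
  "phi_star k \<phi> u =
     \<phi> u
     - (\<Sum>l=1..k+1. cond_exp_at uniform_seq (\<lambda>U. \<phi> (lags k U (k + 1))) (\<lambda>U. U l) (u k))
     + real k * (LINT U|uniform_seq. \<phi> (lags k U (k + 1)))"

definition V_sq :: "nat \<Rightarrow> ((nat \<Rightarrow> real) \<Rightarrow> real) \<Rightarrow> real" where
  "V_sq k \<phi> =
     (LINT U|uniform_seq. (phi_star k \<phi> (lags k U (k + 1)))\<^sup>2)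
     + 2 * (\<Sum>j=1..k. LINT U|uniform_seq.
              phi_star k \<phi> (lags k U (k + 1)) * phi_star k \<phi> (lags k U (k + 1 + j)))"

definition asymp_var :: "nat \<Rightarrow> ((nat \<Rightarrow> real) \<Rightarrow> real) \<Rightarrow> real" where
  "asymp_var k \<phi> =
     V_sq k \<phi>
     + (real k + 1)\<^sup>2 * (mu k \<phi> - 2 * (\<Sum>\<nu>=1..k+1. real \<nu> * mu_part k \<phi> \<nu> / (real k + 1)))\<^sup>2"

end

theory Submission
 imports Defs
begin

text \<open>Applying the distribution function turns the sample into i.i.d. uniform variables. By the conditional
 Chebyshev inequality under random permutations, the rank statistic and the average of \<open>phi\<close> over the lags
 differ, up to \<open>o(1 / sqrt n)\<close>, by the difference of their averages over all \<open>(k+1)\<close>-tuples. The average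
 of the scores is a function of the signs: it is the U-statistic whose kernel \<open>step_kernel\<close> replaces
 \<open>phi\<close> by its means over the orthants, exactly so for exact scores and up to \<open>o(1 / sqrt n)\<close> in mean
 for approximate ones, by monotonicity.

 For the limit law, Hoeffding's projection replaces the U-statistic of \<open>phi - step_kernel\<close> by a sum of
 functions of one observation, which leaves a sum of functions of \<open>k+1\<close> successive observations. A blocking
 argument reduces it to the central limit theorem for i.i.d. variables.\<close>

section \<open>Tuples and product measures\<close>

text \<open>The hypothesis on the scores says only that a conditional mean square error is small in
  probability, with no rate. The missing factor \<open>1 / sqrt n\<close> comes from averaging over
  \<open>n - k\<close> lags whose tuples mostly do not overlap, and this gain concerns only the
  fluctuation around the average over all tuples. The average itself needs the form of the scores:
  for approximate scores it is a quadrature error on a grid, and it must be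
  \<open>o(1 / sqrt n)\<close> although the function is merely square-integrable. Monotonicity turns
  that error into an integral over strips of width \<open>O(1/n)\<close>, and the vanishing tails of
  the square supply the little o. Orthant means are the right replacement for \<open>phi\<close>
  because \<open>phi - step_kernel\<close> is then orthogonal to every function of the signs. The
  two summands of the variance come from the same split: the projection of the step kernel is a
  multiple of the sign of one observation, and its total covariance with the part that gives
  \<open>V_sq\<close> is 0.\<close>

lemmas L1_integrable_diff = Bochner_Integration.integrable_diff
lemmas L1_integrable_add = Bochner_Integration.integrable_add
lemmas L1_integral_add = Bochner_Integration.integral_add
lemmas L1_integral_cong = Bochner_Integration.integral_cong
lemmas L1_integrable_sum = Bochner_Integration.integrable_sum
lemmas L1_integral_diff = Bochner_Integration.integral_diff
lemmas L1_integral_sum = Bochner_Integration.integral_sum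
lemmas L1_integrable_cong = Bochner_Integration.integrable_cong
lemmas L1_integrable_bound = Bochner_Integration.integrable_bound

abbreviation seq_mean :: "((nat => real) => real) => real" (binder "EU " 10) where
 "seq_mean X \<equiv> integral\<^sup>L uniform_seq X"

abbreviation "unif J \<equiv> \<Pi>\<^sub>M i\<in>J. uniform01"

definition tup :: "nat => (nat => 'a) => (nat => nat) => nat => 'a" where
 "tup k x I = (\<lambda>j\<in>{..k}. x (I j))"

definition lag_index :: "nat => nat => nat => nat" where
 "lag_index k t = (\<lambda>j\<in>{..k}. t - j)"

text \<open>Extensionality makes a tuple determined by its \<open>k+1\<close> values, so that
  counting tuples and moving them by permutations are genuine bijections of one finite set.\<close>

definition tuples :: "nat => nat => (nat => nat) set" where
 "tuples k n = {I \<in> {..k} \<rightarrow>\<^sub>E {1..n}. inj_on I {..k}}"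

text \<open>For a family compatible with relabelling the sample, this average over all injective
  index tuples is the conditional expectation given the order statistics.\<close>

definition tuple_avg :: "nat => nat => ((nat => nat) => real) => real" where
 "tuple_avg k n E = (\<Sum>I\<in>tuples k n. E I) / real (card (tuples k n))"

text \<open>Resampling of the coordinates in \<open>K\<close>. It stands in for splitting a product
  space into two factors: both arguments stay in the same, possibly infinite, product.\<close>

definition mix :: "'i set => ('i => 'a) => ('i => 'a) => 'i => 'a" where
 "mix K v u = (\<lambda>i. if i \<in> K then v i else u i)"

lemma lags_eq_tup: "lags k x t = tup k x (lag_index k t)"
 by (auto simp: lags_def tup_def lag_index_def)

lemma lag_index_in_tuples: "k + 1 <= t ==> t <= n ==> lag_index k t \<in> tuples k n"
 by (auto simp: lag_index_def tuples_def inj_on_def)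

lemma finite_tuples [simp, intro]: "finite (tuples k n)"
 unfolding tuples_def by (rule finite_subset[of _ "{..k} \<rightarrow>\<^sub>E {1..n}"]) (auto intro!: finite_PiE)

lemma card_tuples_pos: "k < n ==> card (tuples k n) > 0"
 using lag_index_in_tuples[of k n n] by (auto simp: card_gt_0_iff)

lemma tuplesD:
 assumes "I \<in> tuples k n"
 shows "inj_on I {..k}" "\<And>j. j <= k ==> I j \<in> {1..n}" "I \<in> {..k} \<rightarrow> {1..n}" "I \<in> extensional {..k}"
 using assms by (auto simp: tuples_def PiE_iff)

lemma tup_measurable [measurable]:
 assumes "\<And>j. j <= k ==> I j \<in> S"
 shows "(\<lambda>u. tup k u I) \<in> measurable (\<Pi>\<^sub>M i\<in>S. L) (\<Pi>\<^sub>M j\<in>{..k}. L)"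
 unfolding tup_def using assms by (intro measurable_restrict) auto

lemma prob_space_uniform01: "prob_space uniform01"
 unfolding uniform01_def by (rule prob_space_restrict_space) auto

interpretation U01: prob_space uniform01 by (rule prob_space_uniform01)

lemma space_uniform01 [simp]: "space uniform01 = {0<..<1}"
 by (simp add: uniform01_def space_restrict_space)

lemma prob_space_cube: "prob_space (cube k)"
 unfolding cube_def by (intro prob_space_PiM prob_space_uniform01)

lemma prob_space_uniform_seq: "prob_space uniform_seq"
 unfolding uniform_seq_def by (intro prob_space_PiM prob_space_uniform01)

interpretation CU: prob_space "cube k" for k by (rule prob_space_cube)
interpretation US: prob_space uniform_seq by (rule prob_space_uniform_seq)

lemma space_uniform_seq: "space uniform_seq = {1..} \<rightarrow>\<^sub>E {0<..<1}"
 by (simp add: uniform_seq_def space_PiM)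

lemma space_cube: "space (cube k) = {..k} \<rightarrow>\<^sub>E {0<..<1}"
 by (simp add: cube_def space_PiM)

lemma tup_measurable_cube [measurable]:
 "(\<And>j. j <= k ==> 1 <= I j) ==> (\<lambda>u. tup k u I) \<in> measurable uniform_seq (cube k)"
 unfolding uniform_seq_def cube_def by (rule tup_measurable) auto

lemma distr_tup:
 assumes "inj_on I {..k}" "\<And>j. j <= k ==> 1 <= I j"
 shows "distr uniform_seq (cube k) (\<lambda>u. tup k u I) = cube k"
 unfolding uniform_seq_def cube_def tup_def
 by (rule distr_PiM_reindex) (use assms prob_space_uniform01 in auto)

lemma distr_PiM_permute:
 assumes L: "prob_space L" and per: "per permutes S" and S: "S \<subseteq> J"
 shows "distr (\<Pi>\<^sub>M i\<in>J. L) (\<Pi>\<^sub>M i\<in>J. L) (\<lambda>u. u \<circ> per) = (\<Pi>\<^sub>M i\<in>J. L)"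
proof -
 have perJ: "per i \<in> J \<longleftrightarrow> i \<in> J" for i
  using per S permutes_in_image[OF per] permutes_not_in[OF per] by (metis subsetD)
 have "distr (\<Pi>\<^sub>M i\<in>J. L) (\<Pi>\<^sub>M i\<in>J. L) (\<lambda>u. \<lambda>i\<in>J. u (per i)) = (\<Pi>\<^sub>M i\<in>J. L)"
  using distr_PiM_reindex[of J "\<lambda>_. L" per J] L perJ permutes_inj_on[OF per] by auto
 moreover have "distr (\<Pi>\<^sub>M i\<in>J. L) (\<Pi>\<^sub>M i\<in>J. L) (\<lambda>u. u \<circ> per)
   = distr (\<Pi>\<^sub>M i\<in>J. L) (\<Pi>\<^sub>M i\<in>J. L) (\<lambda>u. \<lambda>i\<in>J. u (per i))"
  by (rule distr_cong) (auto simp: space_PiM PiE_iff extensional_def fun_eq_iff restrict_def perJ)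
 ultimately show ?thesis by simp
qed

lemma permute_measurable [measurable]:
 assumes per: "per permutes S" and S: "S \<subseteq> J"
 shows "(\<lambda>u. u \<circ> per) \<in> measurable (\<Pi>\<^sub>M i\<in>J. L) (\<Pi>\<^sub>M i\<in>J. L)"
proof -
 have perJ: "per i \<in> J \<longleftrightarrow> i \<in> J" for i
  using per S permutes_in_image[OF per] permutes_not_in[OF per] by (metis subsetD)
 have "(\<lambda>u. \<lambda>i\<in>J. u (per i)) \<in> measurable (\<Pi>\<^sub>M i\<in>J. L) (\<Pi>\<^sub>M i\<in>J. L)"
  by (intro measurable_restrict measurable_component_singleton) (simp add: perJ)
 then show ?thesis
  by (rule measurable_cong[THEN iffD1, rotated])
    (auto simp: space_PiM PiE_iff extensional_def fun_eq_iff restrict_def perJ)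
qed

lemma integral_PiM_permute:
 fixes X :: "('i => 'a) => real"
 assumes L: "prob_space L" and per: "per permutes S" and S: "S \<subseteq> J"
  and X: "X \<in> borel_measurable (\<Pi>\<^sub>M i\<in>J. L)"
 shows "(LINT u|(\<Pi>\<^sub>M i\<in>J. L). X (u \<circ> per)) = (LINT u|(\<Pi>\<^sub>M i\<in>J. L). X u)"
 using integral_distr[OF permute_measurable[OF per S] X] distr_PiM_permute[OF L per S] by simp

section \<open>Fubini by resampling a set of coordinates\<close>

lemma mix_in_space:
 "v \<in> space (PiM J M) ==> u \<in> space (PiM J M) ==> mix K v u \<in> space (PiM J M)"
 by (auto simp: space_PiM PiE_iff extensional_def mix_def)

lemma mix_measurable [measurable]:
 "(\<lambda>x. mix K (fst x) (snd x)) \<in> measurable (PiM J M \<Otimes>\<^sub>M PiM J M) (PiM J M)"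
proof -
 have "(\<lambda>x. \<lambda>i\<in>J. if i \<in> K then fst x i else snd x i) \<in> measurable (PiM J M \<Otimes>\<^sub>M PiM J M) (PiM J M)"
  by (intro measurable_restrict) auto
 then show ?thesis
  by (rule measurable_cong[THEN iffD1, rotated])
    (auto simp: space_pair_measure space_PiM PiE_iff extensional_def fun_eq_iff restrict_def mix_def)
qed

text \<open>A product measure is determined by boxes over finitely many coordinates, and the measure
  of a box factors into the coordinates inside and outside \<open>K\<close>, which come from
  independent copies.\<close>

lemma distr_mix:
 assumes M: "\<And>i. i \<in> J ==> prob_space (M i)"
 shows "distr (PiM J M \<Otimes>\<^sub>M PiM J M) (PiM J M) (\<lambda>x. mix K (fst x) (snd x)) = PiM J M"
  (is "distr ?PP ?P ?f = _")
proof (rule measure_eqI_PiM_infinite[symmetric, OF refl])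
 interpret P: prob_space ?P using M by (rule prob_space_PiM)
 show "finite_measure ?P" by unfold_locales
 fix A and H assume H: "finite H" "H \<subseteq> J" and A: "\<And>i. i \<in> H ==> A i \<in> sets (M i)"
 let ?E = "\<lambda>H. prod_emb J M H (Pi\<^sub>E H A)"
 have "?P (?E H) = (\<Prod>i\<in>H. M i (A i))"
  using M H A by (intro emeasure_PiM_emb) auto
 also have "... = (\<Prod>i\<in>H \<inter> K. M i (A i)) * (\<Prod>i\<in>H - K. M i (A i))"
  using H by (subst prod.Int_Diff[of H _ K]) auto
 also have "(\<Prod>i\<in>H \<inter> K. M i (A i)) = ?P (?E (H \<inter> K))"
  using M H A by (intro emeasure_PiM_emb[symmetric]) auto
 also have "(\<Prod>i\<in>H - K. M i (A i)) = ?P (?E (H - K))"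
  using M H A by (intro emeasure_PiM_emb[symmetric]) auto
 also have "?P (?E (H \<inter> K)) * ?P (?E (H - K)) = ?PP (?E (H \<inter> K) \<times> ?E (H - K))"
  using H A by (intro P.emeasure_pair_measure_Times[symmetric] sets_PiM_I) auto
 also have "?E (H \<inter> K) \<times> ?E (H - K) = ?f -` ?E H \<inter> space ?PP"
 proof -
  have E: "?E H' = {x \<in> space ?P. \<forall>i\<in>H'. x i \<in> A i}" if "H' \<subseteq> J" for H'
   using that by (auto simp: prod_emb_def space_PiM PiE_iff extensional_def)
  have "(\<forall>i\<in>H. mix K v u i \<in> A i) \<longleftrightarrow> (\<forall>i\<in>H \<inter> K. v i \<in> A i) \<and> (\<forall>i\<in>H - K. u i \<in> A i)" for v u
   by (auto simp: mix_def Ball_def)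
  moreover have "H \<inter> K \<subseteq> J" "H - K \<subseteq> J" using H by auto
  ultimately show ?thesis
   using H(2) mix_in_space[of _ J M _ K] by (auto simp: E space_pair_measure)
 qed
 also have "?PP ... = distr ?PP ?P ?f (?E H)"
  using H A by (intro emeasure_distr[symmetric] sets_PiM_I) auto
 finally show "?P (?E H) = distr ?PP ?P ?f (?E H)" .
qed simp

lemma nn_integral_mix:
 assumes M: "\<And>i. i \<in> J ==> prob_space (M i)" and X: "X \<in> borel_measurable (PiM J M)"
 shows "(\<integral>\<^sup>+u. \<integral>\<^sup>+v. X (mix K v u) \<partial>PiM J M \<partial>PiM J M) = (\<integral>\<^sup>+u. X u \<partial>PiM J M)"
proof -
 interpret P: prob_space "PiM J M" using M by (rule prob_space_PiM)
 interpret PP: pair_sigma_finite "PiM J M" "PiM J M" ..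
 note X[measurable]
 have "(\<integral>\<^sup>+u. X u \<partial>PiM J M) = (\<integral>\<^sup>+x. X (mix K (fst x) (snd x)) \<partial>(PiM J M \<Otimes>\<^sub>M PiM J M))"
  by (subst (1) distr_mix[where J=J and M=M and K=K, OF M, symmetric]) (auto simp: nn_integral_distr X)
 also have "... = (\<integral>\<^sup>+u. \<integral>\<^sup>+v. X (mix K v u) \<partial>PiM J M \<partial>PiM J M)"
  by (subst PP.nn_integral_snd[symmetric]) (auto simp: case_prod_unfold)
 finally show ?thesis by simp
qed

text \<open>With \<open>u\<close> fixed, the inner integral is a version of the conditional
  expectation given the coordinates outside \<open>K\<close>. Later conditioning on coordinates is
  done in this form.\<close>

lemma integral_mix:
 fixes X :: "_ => real"
 assumes M: "\<And>i. i \<in> J ==> prob_space (M i)" and X: "integrable (PiM J M) X"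
 shows "integrable (PiM J M) (\<lambda>u. LINT v|PiM J M. X (mix K v u))"
  "(LINT u|PiM J M. LINT v|PiM J M. X (mix K v u)) = (LINT u|PiM J M. X u)"
  "AE u in PiM J M. integrable (PiM J M) (\<lambda>v. X (mix K v u))"
proof -
 interpret P: prob_space "PiM J M" using M by (rule prob_space_PiM)
 interpret PP: pair_sigma_finite "PiM J M" "PiM J M" ..
 have Xm[measurable]: "X \<in> borel_measurable (PiM J M)" using X by auto
 have i: "integrable (PiM J M \<Otimes>\<^sub>M PiM J M) (\<lambda>x. X (mix K (fst x) (snd x)))"
  using X by (subst (asm) distr_mix[where J=J and M=M and K=K, OF M, symmetric]) (auto simp: integrable_distr_eq)
 then have i': "integrable (PiM J M \<Otimes>\<^sub>M PiM J M) (\<lambda>(v, u). X (mix K v u))"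
  by (simp add: case_prod_unfold)
 show "integrable (PiM J M) (\<lambda>u. LINT v|PiM J M. X (mix K v u))"
  using PP.integrable_snd[OF i'] .
 show "AE u in PiM J M. integrable (PiM J M) (\<lambda>v. X (mix K v u))"
  using PP.AE_integrable_snd[OF i'] .
 have "(LINT u|PiM J M. X u) = (LINT x|(PiM J M \<Otimes>\<^sub>M PiM J M). X (mix K (fst x) (snd x)))"
  by (subst (1) distr_mix[where J=J and M=M and K=K, OF M, symmetric]) (auto simp: integral_distr)
 also have "... = (LINT u|PiM J M. LINT v|PiM J M. X (mix K v u))"
  using PP.integral_snd[OF i'] by (simp add: case_prod_unfold)
 finally show "(LINT u|PiM J M. LINT v|PiM J M. X (mix K v u)) = (LINT u|PiM J M. X u)" ..
qed

section \<open>Counting injective tuples\<close>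

text \<open>The complements of the two images have the same size, so the partial map from
  \<open>p x\<close> to \<open>q x\<close> extends to a permutation. This transitivity is behind the
  symmetry arguments below: index configurations in one orbit give one value.\<close>

lemma injections_conjugate:
 assumes "finite S" "inj_on p K" "inj_on q K" "p ` K \<subseteq> S" "q ` K \<subseteq> S"
 shows "\<exists>per. per permutes S \<and> (\<forall>x\<in>K. per (p x) = q x)"
proof -
 have fK: "finite K" using assms finite_imageD finite_subset by metis
 have "card (S - p ` K) = card (S - q ` K)"
  using assms fK by (simp add: card_Diff_subset card_image)
 then obtain h where h: "bij_betw h (S - p ` K) (S - q ` K)"
  using assms by (metis finite_Diff finite_same_card_bij)
 define per where "per y = (if y \<in> p ` K then q (the_inv_into K p y) else if y \<in> S then h y else y)" for y
 have e: "per (p x) = q x" if "x \<in> K" for x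
  using that assms(2) by (auto simp: per_def the_inv_into_f_f)
 have b1: "bij_betw per (p ` K) (q ` K)"
  unfolding bij_betw_def using e assms(2,3) by (auto simp: inj_on_def image_iff)
 have b2: "bij_betw per (S - p ` K) (S - q ` K)"
  using h by (rule bij_betw_cong[THEN iffD1, rotated]) (auto simp: per_def)
 have "bij_betw per (p ` K \<union> (S - p ` K)) (q ` K \<union> (S - q ` K))"
  by (rule bij_betw_combine[OF b1 b2]) auto
 then have "bij_betw per S S"
  using assms(4,5) by (simp add: Un_absorb1)
 then have "per permutes S"
  by (rule bij_imp_permutes) (use assms(4) in \<open>auto simp: per_def\<close>)
 then show ?thesis using e by blast
qed

lemma tup_permutes:
 assumes per: "per permutes {1..n}" and I: "I \<in> tuples k n"
 shows "tup k per I \<in> tuples k n"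
 using tuplesD[OF I] permutes_in_image[OF per] permutes_inj[OF per]
 by (auto simp: tuples_def tup_def inj_on_def inj_def)

lemma tup_comp: "tup k (u \<circ> per) I = tup k u (tup k per I)"
 by (auto simp: tup_def)

lemma bij_betw_tup_permutes:
 assumes per: "per permutes {1..n}"
 shows "bij_betw (tup k per) (tuples k n) (tuples k n)"
proof (rule bij_betwI[of _ _ _ "tup k (inv per)"])
 show "tup k per \<in> tuples k n \<rightarrow> tuples k n" using tup_permutes[OF per] by auto
 show "tup k (inv per) \<in> tuples k n \<rightarrow> tuples k n"
  using tup_permutes[OF permutes_inv[OF per]] by auto
qed (use permutes_inverses[OF per] tuplesD(4) in \<open>fastforce simp: tup_def fun_eq_iff extensional_def\<close>)+

lemma tuple_avg_permute:
 assumes per: "per permutes {1..n}"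
 shows "tuple_avg k n (\<lambda>I. E (tup k per I)) = tuple_avg k n E"
 unfolding tuple_avg_def by (subst sum.reindex_bij_betw[OF bij_betw_tup_permutes[OF per]]) simp

lemma tuples_conjugate:
 assumes I: "I \<in> tuples k n" and J: "J \<in> tuples k n"
 obtains per where "per permutes {1..n}" "tup k per I = J"
proof -
 have "\<exists>per. per permutes {1..n} \<and> (\<forall>x\<in>{..k}. per (I x) = J x)"
  by (rule injections_conjugate) (use tuplesD[OF I] tuplesD[OF J] in auto)
 then obtain per where per: "per permutes {1..n}" "\<And>x. x \<in> {..k} ==> per (I x) = J x" by blast
 then show ?thesis using tuplesD(4)[OF J]
  by (intro that[of per]) (auto simp: tup_def extensional_def)
qed

text \<open>Permutations act transitively on the possible values at one position, so the
  \<open>n\<close> fibres have equal size.\<close>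

lemma card_tuples_fix1:
 assumes a: "a <= k" and i: "i \<in> {1..n}"
 shows "real (card {J \<in> tuples k n. J a = i}) * real n = real (card (tuples k n))"
proof -
 have eq: "card {J \<in> tuples k n. J a = i'} = card {J \<in> tuples k n. J a = i}" if i': "i' \<in> {1..n}" for i'
 proof -
  obtain per where per: "per permutes {1..n}" "per i' = i"
   using injections_conjugate[of "{1..n}" "\<lambda>_. i'" "{()}" "\<lambda>_. i"] i i' by auto
  have "bij_betw (tup k per) {J \<in> tuples k n. J a = i'} {J \<in> tuples k n. J a = i}"
   unfolding bij_betw_def
  proof
   show "inj_on (tup k per) {J \<in> tuples k n. J a = i'}"
    using bij_betw_tup_permutes[OF per(1)] by (auto simp: bij_betw_def inj_on_def)
   show "tup k per ` {J \<in> tuples k n. J a = i'} = {J \<in> tuples k n. J a = i}"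
   proof (intro equalityI subsetI)
    fix J assume "J \<in> {J \<in> tuples k n. J a = i}"
    then obtain I where "I \<in> tuples k n" "J = tup k per I" "J a = i"
     using bij_betw_tup_permutes[OF per(1), of k] by (auto simp: bij_betw_def)
    moreover from this have "I a = i'" using a per permutes_inj[OF per(1)]
     by (auto simp: tup_def inj_def)
    ultimately show "J \<in> tup k per ` {J \<in> tuples k n. J a = i'}" by auto
   qed (use a per tup_permutes in \<open>auto simp: tup_def\<close>)
  qed
  then show ?thesis by (rule bij_betw_same_card)
 qed
 have "tuples k n = (\<Union>i'\<in>{1..n}. {J \<in> tuples k n. J a = i'})"
  using a tuplesD(2) by auto
 then have "card (tuples k n) = card (\<Union>i'\<in>{1..n}. {J \<in> tuples k n. J a = i'})" by simp
 also have "... = (\<Sum>i'\<in>{1..n}. card {J \<in> tuples k n. J a = i'})"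
  by (rule card_UN_disjoint) auto
 also have "... = n * card {J \<in> tuples k n. J a = i}" using eq by simp
 finally show ?thesis by simp
qed

lemma card_tuples_fix2:
 assumes a: "a <= k" "b <= k" "a \<noteq> b" and i: "i \<in> {1..n}" "j \<in> {1..n}" "i \<noteq> j"
 shows "real (card {J \<in> tuples k n. J a = i \<and> J b = j}) * (real n * (real n - 1)) = real (card (tuples k n))"
proof -
 let ?S = "\<lambda>p. {J \<in> tuples k n. J a = fst p \<and> J b = snd p}"
 let ?D = "{p \<in> {1..n} \<times> {1..n}. fst p \<noteq> snd p}"
 have eq: "card (?S p) = card (?S (i, j))" if p: "p \<in> ?D" for p
 proof -
  \<comment> \<open>An ordered pair of distinct indices is an injection of \<open>bool\<close>; the
    truth value selects the component.\<close>
  have "\<exists>per. per permutes {1..n} \<and> (\<forall>x\<in>UNIV. per (if x then fst p else snd p) = (if x then i else j))"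
   by (rule injections_conjugate) (use i p in \<open>auto simp: inj_on_def split: if_splits\<close>)
  then obtain per where per: "per permutes {1..n}" "\<And>x. per (if x then fst p else snd p) = (if x then i else j)" by blast
  have per': "per (fst p) = i" "per (snd p) = j" using per(2)[of True] per(2)[of False] by auto
  have "bij_betw (tup k per) (?S p) (?S (i, j))"
   unfolding bij_betw_def
  proof
   show "inj_on (tup k per) (?S p)"
    using bij_betw_tup_permutes[OF per(1)] by (auto simp: bij_betw_def inj_on_def)
   show "tup k per ` ?S p = ?S (i, j)"
   proof (intro equalityI subsetI)
    fix J assume "J \<in> ?S (i, j)"
    then obtain I where "I \<in> tuples k n" "J = tup k per I" "J a = i" "J b = j"
     using bij_betw_tup_permutes[OF per(1), of k] by (auto simp: bij_betw_def)
    moreover from this have "I a = fst p" "I b = snd p" using a per' permutes_inj[OF per(1)]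
     by (auto simp: tup_def inj_def)
    ultimately show "J \<in> tup k per ` ?S p" by auto
   qed (use a per' tup_permutes[OF per(1)] in \<open>auto simp: tup_def\<close>)
  qed
  then show ?thesis by (rule bij_betw_same_card)
 qed
 have "tuples k n = (\<Union>p\<in>?D. ?S p)"
  using a tuplesD(1,2) by (fastforce simp: inj_on_def)
 then have "card (tuples k n) = card (\<Union>p\<in>?D. ?S p)" by simp
 also have "... = (\<Sum>p\<in>?D. card (?S p))"
  by (rule card_UN_disjoint) auto
 also have "... = card ?D * card (?S (i, j))" using eq by simp
 finally have *: "card (tuples k n) = card ?D * card {J \<in> tuples k n. J a = i \<and> J b = j}" by simp
 have "?D = {1..n} \<times> {1..n} - (\<lambda>x. (x, x)) ` {1..n}" by auto
 then have "card ?D = card ({1..n} \<times> {1..n}) - card ((\<lambda>x. (x, x)) ` {1..n})"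
  by (simp only:) (rule card_Diff_subset; auto)
 then have "card ?D = n * n - n"
  by (simp add: card_image inj_on_def card_cartesian_product)
 then have "real (card ?D) = real n * (real n - 1)"
  by (simp add: of_nat_diff algebra_simps)
 then show ?thesis using * by simp
qed


text \<open>Truncated subtraction does no harm: once \<open>m > a\<close>, both products contain the
  factor with \<open>x = a\<close>, which is zero.\<close>

lemma real_prod_falling: "real (\<Prod>x = 0..<m. a - x) = falling a m"
proof (cases "m <= a")
 case True
 then show ?thesis unfolding falling_def of_nat_prod atLeast0LessThan
  by (intro prod.cong) auto
next
 case False
 then have "(\<Prod>x = 0..<m. a - x) = 0" "(\<Prod>j<m. real a - real j) = 0"
  by (auto intro!: prod_zero bexI[of _ a])
 then show ?thesis unfolding falling_def by (metis of_nat_0)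
qed

lemma card_inj_PiE:
 assumes "finite B" "finite C"
 shows "real (card {f \<in> B \<rightarrow>\<^sub>E C. inj_on f B}) = falling (card C) (card B)"
 using card_inj_on_subset_funcset[OF assms subset_refl] real_prod_falling by simp

lemma card_tuples: "real (card (tuples k n)) = falling n (k + 1)"
 unfolding tuples_def using card_inj_PiE[of "{..k}" "{1..n}"] by simp

section \<open>Ranks, signs and order statistics\<close>

lemma card_Collect_permutes:
 assumes "per permutes S"
 shows "card {s \<in> S. Q (per s)} = card {s \<in> S. Q s}"
proof -
 have "bij_betw per {s \<in> S. Q (per s)} {s \<in> S. Q s}"
  by (rule bij_betwI[where g = "inv per"])
    (use permutes_in_image[OF assms] permutes_inverses[OF assms] permutes_in_image[OF permutes_inv[OF assms]] in auto)
 then show ?thesis by (rule bij_betw_same_card)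
qed

lemma rank_permute: "per permutes {1..n} ==> rank n (u \<circ> per) t = rank n u (per t)"
 using card_Collect_permutes[of per "{1..n}" "\<lambda>s. u s <= u (per t)"] by (simp add: rank_def)

lemma rank_permute': "per permutes {1..n} ==> rank n (u \<circ> per) = rank n u \<circ> per"
 by (auto simp: rank_permute)

lemma n_below_permute: "per permutes {1..n} ==> n_below c n (u \<circ> per) = n_below c n u"
 using card_Collect_permutes[of per "{1..n}" "\<lambda>s. u s < c"] by (simp add: n_below_def)

lemma n_above_permute: "per permutes {1..n} ==> n_above c n (u \<circ> per) = n_above c n u"
 using card_Collect_permutes[of per "{1..n}" "\<lambda>s. u s > c"] by (simp add: n_above_def)

lemma rank_cong: "(\<And>i. i \<in> {1..n} ==> u i = v i) ==> t \<in> {1..n} ==> rank n u t = rank n v t"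
 unfolding rank_def by (rule arg_cong[of _ _ card]) auto

lemma n_below_cong: "(\<And>i. i \<in> {1..n} ==> u i = v i) ==> n_below c n u = n_below c n v"
 unfolding n_below_def by (rule arg_cong[of _ _ card]) auto

lemma n_above_cong: "(\<And>i. i \<in> {1..n} ==> u i = v i) ==> n_above c n u = n_above c n v"
 unfolding n_above_def by (rule arg_cong[of _ _ card]) auto

lemma rank_strict_mono: "strict_mono F ==> rank n (\<lambda>i. F (z i)) t = rank n z t"
 by (simp add: rank_def strict_mono_less_eq)

lemma n_below_strict_mono: "strict_mono F ==> n_below (F c) n (\<lambda>i. F (z i)) = n_below c n z"
 by (simp add: n_below_def strict_mono_less)

lemma n_above_strict_mono: "strict_mono F ==> n_above (F c) n (\<lambda>i. F (z i)) = n_above c n z"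
 by (simp add: n_above_def strict_mono_less)

lemma rank_le: "rank n u t <= n"
 unfolding rank_def by (rule order_trans[OF card_mono[of "{1..n}"]]) auto

lemma n_below_le: "n_below c n u <= n"
 unfolding n_below_def by (rule order_trans[OF card_mono[of "{1..n}"]]) auto

lemma n_above_le: "n_above c n u <= n"
 unfolding n_above_def by (rule order_trans[OF card_mono[of "{1..n}"]]) auto

lemma rank_bij:
 assumes "inj_on u {1..n}"
 shows "bij_betw (rank n u) {1..n} {1..n}"
proof -
 have "rank n u s < rank n u t" if "s \<in> {1..n}" "t \<in> {1..n}" "u s < u t" for s t
  proof -
  have "t \<in> {r\<in>{1..n}. u r <= u t}" "t \<notin> {r\<in>{1..n}. u r <= u s}" using that by auto
  moreover have "{r\<in>{1..n}. u r <= u s} \<subseteq> {r\<in>{1..n}. u r <= u t}" using that by auto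
  ultimately have "{r\<in>{1..n}. u r <= u s} \<subset> {r\<in>{1..n}. u r <= u t}" by blast
  then show ?thesis unfolding rank_def by (intro psubset_card_mono) simp
 qed
 then have "inj_on (rank n u) {1..n}"
  using assms unfolding inj_on_def by (metis linorder_neqE_linordered_idom less_irrefl)
 moreover have "rank n u ` {1..n} \<subseteq> {1..n}"
  using rank_le by (auto simp: rank_def card_gt_0_iff Suc_le_eq)
 ultimately show ?thesis
  by (simp add: bij_betw_def endo_inj_surj)
qed

lemma n_below_add_above:
 assumes "\<And>i. i \<in> {1..n} ==> u i \<noteq> c"
 shows "n_below c n u + n_above c n u = n"
proof -
 have "{1..n} = {i\<in>{1..n}. u i < c} \<union> {i\<in>{1..n}. u i > c}" using assms by force
 from arg_cong[OF this, of card]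
 have "n = card ({i\<in>{1..n}. u i < c} \<union> {i\<in>{1..n}. u i > c})" by (simp only: card_atLeastAtMost)
 also have "... = n_below c n u + n_above c n u"
  unfolding n_below_def n_above_def by (rule card_Un_disjoint) auto
 finally show ?thesis ..
qed

lemma card_as_sum: "finite S ==> card {s \<in> S. Q s} = (\<Sum>s\<in>S. if Q s then 1 else 0)"
 by (simp add: sum.If_cases Int_def)

lemma component_borel:
 assumes "(\<lambda>x. x) \<in> borel_measurable L" "i \<in> J"
 shows "(\<lambda>u. u i) \<in> borel_measurable (\<Pi>\<^sub>M i\<in>J. L)"
 using measurable_compose[OF measurable_component_singleton[OF assms(2)] assms(1)] .

lemma rank_measurable:
 fixes L :: "real measure"
 assumes id: "(\<lambda>x. x) \<in> borel_measurable L" and J: "{1..n} \<subseteq> J" "t \<in> J"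
 shows "(\<lambda>u. rank n u t) \<in> measurable (\<Pi>\<^sub>M i\<in>J. L) (count_space UNIV)"
proof -
 have [measurable]: "Measurable.pred (\<Pi>\<^sub>M i\<in>J. L) (\<lambda>u. u s <= u t)" if "s \<in> {1..n}" for s
  unfolding pred_def
  using J that by (intro borel_measurable_le component_borel[OF id]) auto
 show ?thesis unfolding rank_def card_as_sum[OF finite_atLeastAtMost]
  by measurable
qed

lemma n_below_measurable:
 fixes L :: "real measure"
 assumes id: "(\<lambda>x. x) \<in> borel_measurable L" and J: "{1..n} \<subseteq> J"
 shows "(\<lambda>u. n_below c n u) \<in> measurable (\<Pi>\<^sub>M i\<in>J. L) (count_space UNIV)"
proof -
 have [measurable]: "Measurable.pred (\<Pi>\<^sub>M i\<in>J. L) (\<lambda>u. u s < c)" if "s \<in> {1..n}" for s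
  unfolding pred_def
  using J that by (intro borel_measurable_less component_borel[OF id]) auto
 show ?thesis unfolding n_below_def card_as_sum[OF finite_atLeastAtMost]
  by measurable
qed

lemma n_above_measurable:
 fixes L :: "real measure"
 assumes id: "(\<lambda>x. x) \<in> borel_measurable L" and J: "{1..n} \<subseteq> J"
 shows "(\<lambda>u. n_above c n u) \<in> measurable (\<Pi>\<^sub>M i\<in>J. L) (count_space UNIV)"
proof -
 have [measurable]: "Measurable.pred (\<Pi>\<^sub>M i\<in>J. L) (\<lambda>u. u s > c)" if "s \<in> {1..n}" for s
  unfolding pred_def
  using J that by (intro borel_measurable_less component_borel[OF id]) auto
 show ?thesis unfolding n_above_def card_as_sum[OF finite_atLeastAtMost]
  by measurable
qed

text \<open>Turns an event about one order statistic into a count of observations, which is how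
  measurability of \<open>order_stat\<close> is obtained.\<close>

lemma nth_sorted_le_iff:
 fixes c :: "'a::linorder"
 assumes "sorted xs" "m < length xs"
 shows "xs ! m <= c \<longleftrightarrow> m < length (filter (\<lambda>x. x <= c) xs)"
 using assms
proof (induction xs arbitrary: m)
 case (Cons x xs)
 show ?case
 proof (cases "x <= c")
  case True
  then show ?thesis using Cons by (cases m) auto
 next
  case False
  then have "filter (\<lambda>x. x <= c) (x # xs) = []"
   using Cons.prems(1) by (auto simp: filter_empty_conv)
  moreover have "x <= (x # xs) ! m"
   using Cons.prems by (cases m) auto
  ultimately show ?thesis using False by auto
 qed
qed simp

lemma order_stat_permute:
 assumes "per permutes {1..n}"
 shows "order_stat n (z \<circ> per) = order_stat n z"
proof -
 have "mset (map (z \<circ> per) [1..<Suc n]) = image_mset z (image_mset per (mset_set {1..<Suc n}))"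
  by (simp add: multiset.map_comp o_def del: upt_Suc)
 also have "image_mset per (mset_set {1..<Suc n}) = mset_set (per ` {1..<Suc n})"
  by (rule image_mset_mset_set) (rule permutes_inj_on[OF assms])
 also have "per ` {1..<Suc n} = {1..<Suc n}"
  using permutes_image[OF assms] by (simp add: atLeastLessThanSuc_atLeastAtMost)
 also have "image_mset z (mset_set {1..<Suc n}) = mset (map z [1..<Suc n])" by (simp del: upt_Suc)
 finally have "sort (map (z \<circ> per) [1..<Suc n]) = sort (map z [1..<Suc n])"
  by (intro properties_for_sort) (simp_all add: o_def del: upt_Suc)
 then show ?thesis by (simp add: order_stat_def)
qed

text \<open>A symmetric function thus has the same value at \<open>z\<close> and at
  \<open>order_stat n z\<close>, that is, it factors through the order statistics. Extensionality
  enters because \<open>order_stat\<close> returns an extensional vector.\<close>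

lemma order_stat_as_permute:
 assumes "z \<in> extensional {1..n}"
 obtains per where "per permutes {1..n}" "order_stat n z = z \<circ> per"
proof -
 let ?xs = "map z [1..<Suc n]"
 have "mset (sort ?xs) = mset ?xs" by simp
 from mset_eq_permutation[OF this] obtain p
  where p: "p permutes {..<length ?xs}" "permute_list p ?xs = sort ?xs" by blast
 define per where "per i = (if i \<in> {1..n} then Suc (p (i - 1)) else i)" for i
 have p': "p permutes {..<n}" using p(1) by (simp del: upt_Suc)
 have pl: "p i < n" if "i < n" for i using permutes_in_image[OF p'] that by auto
 have "inj_on per {1..n}"
 proof (rule inj_onI)
  fix i j assume "i \<in> {1..n}" "j \<in> {1..n}" "per i = per j"
  then have "p (i - 1) = p (j - 1)" "i >= 1" "j >= 1" by (auto simp: per_def)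
  then have "i - 1 = j - 1" using permutes_inj[OF p'] by (auto simp: inj_def)
  then show "i = j" using \<open>i >= 1\<close> \<open>j >= 1\<close> by auto
 qed
 moreover have "per ` {1..n} \<subseteq> {1..n}" using pl by (auto simp: per_def Suc_le_eq)
 ultimately have "bij_betw per {1..n} {1..n}" by (simp add: bij_betw_def endo_inj_surj)
 then have per: "per permutes {1..n}" by (rule bij_imp_permutes) (auto simp: per_def)
 have "sort ?xs ! (i - 1) = z (per i)" if "i \<in> {1..n}" for i
 proof -
  have i: "i - 1 < n" using that by auto
  have "sort ?xs ! (i - 1) = permute_list p ?xs ! (i - 1)" using p by simp
  also have "... = ?xs ! p (i - 1)"
   using permute_list_nth[OF p(1)] i by (simp del: upt_Suc)
  also have "... = z (Suc (p (i - 1)))" using pl[OF i] by (simp del: upt_Suc)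
  finally show ?thesis using that by (simp add: per_def)
 qed
 then have "order_stat n z = z \<circ> per"
  using assms by (auto simp: order_stat_def fun_eq_iff extensional_def per_def)
 with per show ?thesis by (rule that)
qed

lemma order_stat_measurable:
 assumes L: "sets L = sets borel"
 shows "order_stat n \<in> measurable (\<Pi>\<^sub>M i\<in>{1..n}. L) (\<Pi>\<^sub>M i\<in>{1..n}. borel)"
 unfolding order_stat_def
proof (rule measurable_restrict)
 fix i assume i: "i \<in> {1..n}"
 have id: "(\<lambda>x. x) \<in> borel_measurable L" using L by (rule measurable_ident_sets)
 show "(\<lambda>z. sort (map z [1..<Suc n]) ! (i - 1)) \<in> borel_measurable (\<Pi>\<^sub>M i\<in>{1..n}. L)"
 proof (rule borel_measurableI_le)
  fix c :: real
  have [measurable]: "Measurable.pred (\<Pi>\<^sub>M i\<in>{1..n}. L) (\<lambda>u. u s <= c)" if "s \<in> {1..n}" for s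
   unfolding pred_def
   using that by (intro borel_measurable_le component_borel[OF id]) auto
  have "length (filter (\<lambda>x. x <= c) (sort (map z [1..<Suc n]))) = card {s\<in>{1..n}. z s <= c}" for z
  proof -
   have "length (filter (\<lambda>x. x <= c) (sort (map z [1..<Suc n])))
     = size (filter_mset (\<lambda>x. x <= c) (mset (map z [1..<Suc n])))"
    by (metis mset_filter mset_sort size_mset)
   also have "... = size (filter_mset (\<lambda>s. z s <= c) (mset_set {1..<Suc n}))"
    by (simp add: filter_mset_image_mset del: upt_Suc)
   also have "... = card {s\<in>{1..n}. z s <= c}"
    by (simp add: atLeastLessThanSuc_atLeastAtMost)
   finally show ?thesis .
  qed
  then have *: "sort (map z [1..<Suc n]) ! (i - 1) <= c \<longleftrightarrow> i - 1 < card {s\<in>{1..n}. z s <= c}" for z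
   using nth_sorted_le_iff[of "sort (map z [1..<Suc n])" "i - 1" c] i by (auto simp del: upt_Suc)
  have "{z \<in> space (\<Pi>\<^sub>M i\<in>{1..n}. L). sort (map z [1..<Suc n]) ! (i - 1) <= c}
   = {z \<in> space (\<Pi>\<^sub>M i\<in>{1..n}. L). i - 1 < (\<Sum>s\<in>{1..n}. if z s <= c then 1 else 0)}"
   unfolding * card_as_sum[OF finite_atLeastAtMost] ..
  also have "... \<in> sets (\<Pi>\<^sub>M i\<in>{1..n}. L)" by measurable
  finally show "{z \<in> space (\<Pi>\<^sub>M i\<in>{1..n}. L). sort (map z [1..<Suc n]) ! (i - 1) <= c} \<in> sets (\<Pi>\<^sub>M i\<in>{1..n}. L)" .
 qed
qed

section \<open>Exchangeability\<close>

lemma permute_in_space: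
 assumes "per permutes S" "S \<subseteq> J" "u \<in> space (\<Pi>\<^sub>M i\<in>J. L)"
 shows "u \<circ> per \<in> space (\<Pi>\<^sub>M i\<in>J. L)"
 using measurable_space[OF permute_measurable[OF assms(1,2)] assms(3)] .

text \<open>Relabelling the observations amounts to relabelling the tuple. Score errors, kernels at
  tuples and their products with symmetric functions all have this property, which makes their
  tuple-indexed families exchangeable.\<close>

definition equivariant :: "(nat => 'a) measure => nat => nat => ((nat => 'a) => (nat => nat) => real) => bool" where
 "equivariant M k n e \<longleftrightarrow>
   (\<forall>per u I. per permutes {1..n} --> u \<in> space M --> I \<in> tuples k n --> e (u \<circ> per) I = e u (tup k per I))"

lemma equivariantI:
 "(\<And>per u I. per permutes {1..n} ==> u \<in> space M ==> I \<in> tuples k n ==> e (u \<circ> per) I = e u (tup k per I)) ==> equivariant M k n e"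
 by (simp add: equivariant_def)

lemma equivariantD:
 "equivariant M k n e ==> per permutes {1..n} ==> u \<in> space M ==> I \<in> tuples k n ==> e (u \<circ> per) I = e u (tup k per I)"
 by (simp add: equivariant_def)

lemma equivariant_avg:
 assumes "equivariant M k n e" "per permutes {1..n}" "u \<in> space M"
 shows "tuple_avg k n (e (u \<circ> per)) = tuple_avg k n (e u)"
proof -
 have "tuple_avg k n (e (u \<circ> per)) = tuple_avg k n (\<lambda>I. e u (tup k per I))"
  unfolding tuple_avg_def using assms by (auto simp: equivariantD intro!: sum.cong)
 then show ?thesis using tuple_avg_permute[OF assms(2)] by simp
qed

text \<open>The product measure is invariant under permutations, and these act transitively on
  tuples.\<close>

lemma integral_equivariant:
 assumes L: "prob_space L" and J: "{1..n} \<subseteq> J" and e: "equivariant (\<Pi>\<^sub>M i\<in>J. L) k n e"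
  and m: "\<And>I. I \<in> tuples k n ==> (\<lambda>u. e u I) \<in> borel_measurable (\<Pi>\<^sub>M i\<in>J. L)"
  and I: "I \<in> tuples k n" "I' \<in> tuples k n"
 shows "(LINT u|(\<Pi>\<^sub>M i\<in>J. L). e u I) = (LINT u|(\<Pi>\<^sub>M i\<in>J. L). e u I')"
proof -
 obtain per where per: "per permutes {1..n}" "tup k per I = I'"
  using tuples_conjugate[OF I] by blast
 have "(LINT u|(\<Pi>\<^sub>M i\<in>J. L). e u I) = (LINT u|(\<Pi>\<^sub>M i\<in>J. L). e (u \<circ> per) I)"
  using integral_PiM_permute[OF L per(1) J m[OF I(1)]] by simp
 also have "... = (LINT u|(\<Pi>\<^sub>M i\<in>J. L). e u I')"
  using equivariantD[OF e per(1) _ I(1)] per(2) by (intro L1_integral_cong) auto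
 finally show ?thesis .
qed

lemma integral_equivariant_sum:
 assumes L: "prob_space L" and J: "{1..n} \<subseteq> J" and e: "equivariant (\<Pi>\<^sub>M i\<in>J. L) k n e"
  and i: "\<And>I. I \<in> tuples k n ==> integrable (\<Pi>\<^sub>M i\<in>J. L) (\<lambda>u. e u I)" and I: "I \<in> tuples k n"
 shows "(LINT u|(\<Pi>\<^sub>M i\<in>J. L). e u I) * real (card (tuples k n)) = (LINT u|(\<Pi>\<^sub>M i\<in>J. L). (\<Sum>I\<in>tuples k n. e u I))"
proof -
 have "(\<Sum>I'\<in>tuples k n. LINT u|(\<Pi>\<^sub>M i\<in>J. L). e u I) = (\<Sum>I'\<in>tuples k n. LINT u|(\<Pi>\<^sub>M i\<in>J. L). e u I')"
  by (intro sum.cong refl integral_equivariant[OF L J e _ I] borel_measurable_integrable i)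
 then show ?thesis using i by (subst L1_integral_sum) (simp_all add: mult.commute)
qed

text \<open>Two disjoint tuples together form one injection of \<open>bool\<close> times
  \<open>{..k}\<close>, so ordered pairs of disjoint tuples form a single orbit and share one
  covariance.\<close>

lemma integral_equivariant_pair:
 assumes L: "prob_space L" and J: "{1..n} \<subseteq> J" and e: "equivariant (\<Pi>\<^sub>M i\<in>J. L) k n e"
  and m: "\<And>I. I \<in> tuples k n ==> (\<lambda>u. e u I) \<in> borel_measurable (\<Pi>\<^sub>M i\<in>J. L)"
  and I: "I1 \<in> tuples k n" "I2 \<in> tuples k n" "I1 ` {..k} \<inter> I2 ` {..k} = {}"
  and I': "J1 \<in> tuples k n" "J2 \<in> tuples k n" "J1 ` {..k} \<inter> J2 ` {..k} = {}"
 shows "(LINT u|(\<Pi>\<^sub>M i\<in>J. L). e u I1 * e u I2) = (LINT u|(\<Pi>\<^sub>M i\<in>J. L). e u J1 * e u J2)"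
proof -
 let ?p = "\<lambda>I I' x. if fst x then (I::nat=>nat) (snd x) else I' (snd x)"
 have inj: "inj_on (?p I I') (UNIV \<times> {..k})"
  if "I \<in> tuples k n" "I' \<in> tuples k n" "I ` {..k} \<inter> I' ` {..k} = {}" for I I'
  using tuplesD(1)[OF that(1)] tuplesD(1)[OF that(2)] that(3)
  by (force simp: inj_on_def)
 have "\<exists>per. per permutes {1..n} \<and> (\<forall>x\<in>UNIV \<times> {..k}. per (?p I1 I2 x) = ?p J1 J2 x)"
  by (rule injections_conjugate[OF _ inj[OF I] inj[OF I']])
    (use tuplesD(2)[OF I(1)] tuplesD(2)[OF I(2)] tuplesD(2)[OF I'(1)] tuplesD(2)[OF I'(2)] in auto)
 then obtain per where per: "per permutes {1..n}" "\<And>b j. j <= k ==> per (?p I1 I2 (b, j)) = ?p J1 J2 (b, j)"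
  by auto
 have per': "tup k per I1 = J1" "tup k per I2 = J2"
  using per(2)[of _ True] per(2)[of _ False] tuplesD(4)[OF I'(1)] tuplesD(4)[OF I'(2)]
  by (auto simp: tup_def extensional_def)
 have "(LINT u|(\<Pi>\<^sub>M i\<in>J. L). e u I1 * e u I2) = (LINT u|(\<Pi>\<^sub>M i\<in>J. L). e (u \<circ> per) I1 * e (u \<circ> per) I2)"
  using integral_PiM_permute[OF L per(1) J borel_measurable_times[OF m[OF I(1)] m[OF I(2)]]] by simp
 also have "... = (LINT u|(\<Pi>\<^sub>M i\<in>J. L). e u J1 * e u J2)"
  using equivariantD[OF e per(1) _ I(1)] equivariantD[OF e per(1) _ I(2)] per'
  by (intro L1_integral_cong) auto
 finally show ?thesis .
qed

section \<open>Conditioning on the order statistics\<close>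

text \<open>Events generated by the order statistics are invariant under permutations, and a
  symmetric \<open>Y\<close> equals \<open>Y\<close> composed with \<open>order_stat\<close>, hence
  is measurable for them. It therefore suffices to test the integrals on symmetric events.\<close>

lemma cond_order_eq:
 assumes L: "prob_space (law f)"
  and X: "integrable (H0 f n) X" and Y: "integrable (H0 f n) Y"
  and Ysym: "\<And>per z. per permutes {1..n} ==> z \<in> space (H0 f n) ==> Y (z \<circ> per) = Y z"
  and eq: "\<And>A. A \<in> sets (H0 f n) ==>
    (\<And>per z. per permutes {1..n} ==> z \<in> space (H0 f n) ==> z \<circ> per \<in> A \<longleftrightarrow> z \<in> A) ==>
    (LINT z|H0 f n. indicator A z * X z) = (LINT z|H0 f n. indicator A z * Y z)"
 shows "AE z in H0 f n. cond_order f n X z = Y z"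
proof -
 let ?H = "H0 f n" and ?B = "\<Pi>\<^sub>M i\<in>{1..n}. (borel :: real measure)"
 let ?F = "vimage_algebra (space ?H) (order_stat n) ?B"
 have sl: "sets (law f) = sets borel" by (simp add: law_def)
 have sH: "sets ?H = sets ?B" unfolding H0_def by (intro sets_PiM_cong) (auto simp: sl)
 have spH: "space ?H = space ?B" using sets_eq_imp_space_eq[OF sH] .
 have om: "order_stat n \<in> measurable ?H ?B"
  unfolding H0_def by (rule order_stat_measurable) (rule sl)
 have os: "order_stat n \<in> space ?H \<rightarrow> space ?B"
  using measurable_space[OF om] by auto
 interpret H: prob_space ?H unfolding H0_def using L by (intro prob_space_PiM)
 have sub: "subalgebra ?H ?F"
  unfolding subalgebra_def sets_vimage_algebra2[OF os]
  using measurable_sets[OF om] by auto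
 interpret finite_measure_subalgebra ?H ?F
  by standard (rule sub)
 show ?thesis unfolding cond_order_def
 proof (rule real_cond_exp_charact)
  fix A assume A: "A \<in> sets ?F"
  then obtain B where B: "B \<in> sets ?B" "A = order_stat n -` B \<inter> space ?H"
   unfolding sets_vimage_algebra2[OF os] by auto
  have "z \<circ> per \<in> A \<longleftrightarrow> z \<in> A" if "per permutes {1..n}" "z \<in> space ?H" for per z
   using that permute_in_space[OF that(1) subset_refl] by (auto simp: B(2) order_stat_permute H0_def)
  moreover have "A \<in> sets ?H" using A sub by (auto simp: subalgebra_def)
  ultimately show "(\<integral>z\<in>A. X z \<partial>?H) = (\<integral>z\<in>A. Y z \<partial>?H)"
   using eq[of A] by (simp add: set_lebesgue_integral_def)
 next
  have Ym: "Y \<in> borel_measurable ?B"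
   using Y sH by (simp add: measurable_cong_sets[OF sH refl, symmetric])
  have "(\<lambda>z. Y (order_stat n z)) \<in> borel_measurable ?F"
   using measurable_compose[OF measurable_vimage_algebra1[OF os] Ym] .
  moreover have "Y (order_stat n z) = Y z" if "z \<in> space ?H" for z
  proof -
   have "z \<in> extensional {1..n}" using that by (auto simp: H0_def space_PiM PiE_iff)
   then obtain per where "per permutes {1..n}" "order_stat n z = z \<circ> per" by (rule order_stat_as_permute)
   then show ?thesis using Ysym that by simp
  qed
  ultimately show "Y \<in> borel_measurable ?F"
   by (subst measurable_cong[where g = "\<lambda>z. Y (order_stat n z)"]) auto
 qed (use X Y in auto)
qed

text \<open>Given the order statistics all arrangements are equally likely, so whichever tuples are
  averaged, conditioning replaces them by all tuples. It serves for a single tuple in the score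
  condition and for all lags in \<open>T_stat\<close>.\<close>

lemma cond_order_tuples:
 assumes L: "prob_space (law f)" and e: "equivariant (H0 f n) k n e"
  and i: "\<And>I. I \<in> tuples k n ==> integrable (H0 f n) (\<lambda>z. e z I)"
  and Q: "finite A" "A \<noteq> {}" "\<And>t. t \<in> A ==> q t \<in> tuples k n"
 shows "AE z in H0 f n. cond_order f n (\<lambda>z. (\<Sum>t\<in>A. e z (q t)) / real (card A)) z = tuple_avg k n (e z)"
proof (rule cond_order_eq[OF L])
 show "integrable (H0 f n) (\<lambda>z. (\<Sum>t\<in>A. e z (q t)) / real (card A))"
  using i Q by auto
 show "integrable (H0 f n) (\<lambda>z. tuple_avg k n (e z))"
  unfolding tuple_avg_def using i by auto
 fix B assume B[measurable]: "B \<in> sets (H0 f n)" and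
  Bs: "\<And>per z. per permutes {1..n} ==> z \<in> space (H0 f n) ==> z \<circ> per \<in> B \<longleftrightarrow> z \<in> B"
 let ?e = "\<lambda>z I. indicator B z * e z I"
 obtain t0 where t0: "t0 \<in> A" using Q by auto
 have iB: "integrable (H0 f n) (\<lambda>z. ?e z I)" if "I \<in> tuples k n" for I
  using integrable_mult_indicator[OF B i[OF that]] by simp
 have eB: "equivariant (H0 f n) k n ?e"
  using e Bs by (auto simp: equivariant_def indicator_def)
 have eq: "(LINT z|H0 f n. ?e z I) = (LINT z|H0 f n. ?e z (q t0))" if "I \<in> tuples k n" for I
  unfolding H0_def
  by (rule integral_equivariant[OF L subset_refl eB[unfolded H0_def] _ that Q(3)[OF t0]])
    (use iB in \<open>auto simp: H0_def\<close>)
 have "(LINT z|H0 f n. indicator B z * ((\<Sum>t\<in>A. e z (q t)) / real (card A)))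
   = (LINT z|H0 f n. (\<Sum>t\<in>A. ?e z (q t)) / real (card A))"
  by (simp only: sum_distrib_left times_divide_eq_right)
 also have "... = (\<Sum>t\<in>A. LINT z|H0 f n. ?e z (q t)) / real (card A)"
  by (subst integral_divide_zero, subst L1_integral_sum) (use iB Q in auto)
 also have "(\<Sum>t\<in>A. LINT z|H0 f n. ?e z (q t)) = (\<Sum>t\<in>A. LINT z|H0 f n. ?e z (q t0))"
  by (rule sum.cong[OF refl], rule eq, rule Q)
 also have "... / real (card A) = (LINT z|H0 f n. ?e z (q t0))" using Q by simp
 also have "... = (\<Sum>I\<in>tuples k n. LINT z|H0 f n. ?e z (q t0)) / real (card (tuples k n))"
  using Q(3)[OF t0] by auto
 also have "(\<Sum>I\<in>tuples k n. LINT z|H0 f n. ?e z (q t0)) = (\<Sum>I\<in>tuples k n. LINT z|H0 f n. ?e z I)"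
  by (rule sum.cong[OF refl], rule eq[symmetric])
 also have "... / real (card (tuples k n)) = (LINT z|H0 f n. (\<Sum>I\<in>tuples k n. ?e z I) / real (card (tuples k n)))"
  by (subst integral_divide_zero, subst L1_integral_sum) (use iB in auto)
 also have "... = (LINT z|H0 f n. indicator B z * tuple_avg k n (e z))"
  unfolding tuple_avg_def by (simp only: sum_distrib_left times_divide_eq_right)
 finally show "(LINT z|H0 f n. indicator B z * ((\<Sum>t\<in>A. e z (q t)) / real (card A))) = ..." .
qed (rule equivariant_avg[OF e])

section \<open>Second moments\<close>

lemma integrable_product_of_squares:
 fixes X Y :: "'a => real"
 assumes [measurable]: "X \<in> borel_measurable M" "Y \<in> borel_measurable M"
  and X: "integrable M (\<lambda>x. (X x)^2)" and Y: "integrable M (\<lambda>x. (Y x)^2)"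
 shows "integrable M (\<lambda>x. X x * Y x)"
proof (rule L1_integrable_bound[OF L1_integrable_add[OF X Y]])
 have "\<bar>X x * Y x\<bar> <= (X x)^2 + (Y x)^2" for x
 proof -
  have "2 * (\<bar>X x\<bar> * \<bar>Y x\<bar>) <= (X x)^2 + (Y x)^2"
   using sum_squares_bound[of "\<bar>X x\<bar>" "\<bar>Y x\<bar>"] by (simp add: mult.assoc)
  moreover have "0 <= \<bar>X x\<bar> * \<bar>Y x\<bar>" by simp
  ultimately show ?thesis unfolding abs_mult by linarith
 qed
 then show "AE x in M. norm (X x * Y x) <= norm ((X x)^2 + (Y x)^2)" by auto
qed measurable

lemma integral_product_le:
 fixes X Y :: "'a => real"
 assumes [measurable]: "X \<in> borel_measurable M" "Y \<in> borel_measurable M"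
  and X: "integrable M (\<lambda>x. (X x)^2)" and Y: "integrable M (\<lambda>x. (Y x)^2)"
 shows "\<bar>LINT x|M. X x * Y x\<bar> <= ((LINT x|M. (X x)^2) + (LINT x|M. (Y x)^2)) / 2"
proof -
 have "\<bar>LINT x|M. X x * Y x\<bar> <= (LINT x|M. \<bar>X x * Y x\<bar>)" by (rule integral_abs_bound)
 also have "... <= (LINT x|M. ((X x)^2 + (Y x)^2) / 2)"
 proof (rule integral_mono)
  show "\<bar>X x * Y x\<bar> <= ((X x)^2 + (Y x)^2) / 2" for x
   using sum_squares_bound[of "\<bar>X x\<bar>" "\<bar>Y x\<bar>"] by (simp add: abs_mult)
 qed (use integrable_product_of_squares[OF assms] X Y in auto)
 also have "... = ((LINT x|M. (X x)^2) + (LINT x|M. (Y x)^2)) / 2" using X Y by simp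
 finally show ?thesis .
qed

lemma integrable_sum_square:
 fixes X :: "'b => 'a => real"
 assumes m: "\<And>t. t \<in> A ==> X t \<in> borel_measurable M"
  and sq: "\<And>t. t \<in> A ==> integrable M (\<lambda>x. (X t x)^2)"
 shows "integrable M (\<lambda>x. (\<Sum>t\<in>A. X t x)^2)"
  "(LINT x|M. (\<Sum>t\<in>A. X t x)^2) = (\<Sum>t\<in>A. \<Sum>s\<in>A. LINT x|M. X t x * X s x)"
proof -
 have i: "integrable M (\<lambda>x. X t x * X s x)" if "t \<in> A" "s \<in> A" for t s
  using that by (intro integrable_product_of_squares m sq)
 have e: "(\<Sum>t\<in>A. X t x)^2 = (\<Sum>t\<in>A. \<Sum>s\<in>A. X t x * X s x)" for x
  by (simp add: power2_eq_square sum_product)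
 show "integrable M (\<lambda>x. (\<Sum>t\<in>A. X t x)^2)"
  unfolding e using i by (intro L1_integrable_sum)
 show "(LINT x|M. (\<Sum>t\<in>A. X t x)^2) = (\<Sum>t\<in>A. \<Sum>s\<in>A. LINT x|M. X t x * X s x)"
  unfolding e using i by (simp add: L1_integral_sum L1_integrable_sum)
qed

text \<open>Each row of the covariance matrix has at most \<open>2k+1\<close> entries with indices
  within distance \<open>k\<close>. It is used with a small nonzero \<open>c\<close> for random
  permutations and with \<open>c = 0\<close> for independent terms.\<close>

lemma second_moment_local_dependence:
 fixes X :: "nat => 'a => real"
 assumes A: "finite A"
  and m: "\<And>t. t \<in> A ==> X t \<in> borel_measurable M"
  and sq: "\<And>t. t \<in> A ==> integrable M (\<lambda>x. (X t x)^2)"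
  and near: "\<And>t s. t \<in> A ==> s \<in> A ==> \<bar>LINT x|M. X t x * X s x\<bar> <= v"
  and far: "\<And>t s. t \<in> A ==> s \<in> A ==> t + k < s \<or> s + k < t ==> \<bar>LINT x|M. X t x * X s x\<bar> <= c"
  and c: "c >= 0" and v: "v >= 0"
 shows "(LINT x|M. (\<Sum>t\<in>A. X t x)^2) <= real (card A) * (2 * real k + 1) * v + (real (card A))^2 * c"
proof -
 let ?N = "\<lambda>t. {s \<in> A. \<not> (t + k < s \<or> s + k < t)}"
 have row: "(\<Sum>s\<in>A. LINT x|M. X t x * X s x) <= (2 * real k + 1) * v + real (card A) * c" if t: "t \<in> A" for t
 proof -
  have "?N t \<subseteq> {t - k..t + k}" by auto
  then have "card (?N t) <= 2 * k + 1"
   using card_mono[of "{t - k..t + k}" "?N t"] by (cases "k <= t") auto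
  then have cN: "real (card (?N t)) <= 2 * real k + 1" by linarith
  have "(\<Sum>s\<in>A. LINT x|M. X t x * X s x) <= (\<Sum>s\<in>A. (if s \<in> ?N t then v else 0) + c)"
  proof (rule sum_mono)
   fix s assume s: "s \<in> A"
   show "(LINT x|M. X t x * X s x) <= (if s \<in> ?N t then v else 0) + c"
    using near[OF t s] far[OF t s] c s by (cases "s \<in> ?N t") (auto simp: abs_le_iff)
  qed
  also have "... = real (card (?N t)) * v + real (card A) * c"
   using A by (simp add: sum.distrib sum.If_cases Int_absorb1 subset_iff flip: Collect_conj_eq)
    (simp add: Int_def conj_commute)?
  also have "... <= (2 * real k + 1) * v + real (card A) * c"
   using cN v by (intro add_right_mono mult_right_mono)
  finally show ?thesis .
 qed
 have "(LINT x|M. (\<Sum>t\<in>A. X t x)^2) = (\<Sum>t\<in>A. \<Sum>s\<in>A. LINT x|M. X t x * X s x)"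
  by (rule integrable_sum_square(2)[OF m sq])
 also have "... <= (\<Sum>t\<in>A. (2 * real k + 1) * v + real (card A) * c)"
  by (rule sum_mono) (rule row)
 also have "... = real (card A) * (2 * real k + 1) * v + (real (card A))^2 * c"
  by (simp add: algebra_simps power2_eq_square)
 finally show ?thesis .
qed

lemma sum_square_deviation_le:
 fixes x :: "'b => real"
 assumes "finite A"
 shows "(\<Sum>i\<in>A. (x i - (\<Sum>j\<in>A. x j) / real (card A))^2) <= (\<Sum>i\<in>A. (x i)^2)"
proof (cases "A = {}")
 case False
 define m where "m = (\<Sum>j\<in>A. x j) / real (card A)"
 have c: "real (card A) > 0" using False assms by (simp add: card_gt_0_iff)
 then have s: "(\<Sum>j\<in>A. x j) = m * real (card A)" by (simp add: m_def)
 have "(\<Sum>i\<in>A. (x i - m)^2) = (\<Sum>i\<in>A. (x i)^2) - 2 * m * (\<Sum>i\<in>A. x i) + real (card A) * m^2"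
  by (simp add: power2_diff sum.distrib sum_subtractf sum_distrib_left sum_distrib_right mult_ac)
 also have "... = (\<Sum>i\<in>A. (x i)^2) - real (card A) * m^2"
  by (simp add: s power2_eq_square algebra_simps)
 also have "... <= (\<Sum>i\<in>A. (x i)^2)" by simp
 finally show ?thesis by (simp add: m_def)
qed simp

text \<open>The deviations of \<open>e u I\<close> from their average over all tuples sum to zero, so that the common
 covariance of two disjoint tuples is balanced by the \<open>O(1/n)\<close> proportion of overlapping tuples.\<close>

lemma permutation_variance:
 assumes L: "prob_space L" and J: "{1..n} \<subseteq> J" and e: "equivariant (\<Pi>\<^sub>M i\<in>J. L) k n e"
  and m: "\<And>I. I \<in> tuples k n ==> (\<lambda>u. e u I) \<in> borel_measurable (\<Pi>\<^sub>M i\<in>J. L)"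
  and sq: "\<And>I. I \<in> tuples k n ==> integrable (\<Pi>\<^sub>M i\<in>J. L) (\<lambda>u. (e u I)^2)"
  and n: "n >= 2 * (k + 1)^2" and I0: "I0 \<in> tuples k n"
 shows "(LINT u|(\<Pi>\<^sub>M i\<in>J. L). ((\<Sum>t=k+1..n. e u (lag_index k t)) / (real n - real k) - tuple_avg k n (e u))^2)
  <= 6 * (real k + 1)^2 / real n * (LINT u|(\<Pi>\<^sub>M i\<in>J. L). (e u I0)^2)"
proof -
 let ?M = "\<Pi>\<^sub>M i\<in>J. L" and ?T = "tuples k n" and ?K = "(real k + 1)^2"
 interpret M: prob_space ?M using L by (rule prob_space_PiM)
 have "(k + 1)^2 >= k + 1" by (simp add: power2_eq_square)
 then have "2 * (k + 1) <= 2 * (k + 1)^2" by (rule mult_le_mono2)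
 then have nk: "n >= 2 * (k + 1)" using n by (rule order_trans)
 have n0: "real n > 0" using nk by auto
 have n': "2 * ?K <= real n"
 proof -
  have "real (2 * (k + 1)^2) <= real n" using n by (simp only: of_nat_le_iff)
  then show ?thesis by (simp only: of_nat_mult of_nat_power of_nat_add of_nat_1 of_nat_numeral)
 qed
 define C where "C = real (card ?T)"
 have C: "C > 0" using card_tuples_pos[of k n] nk by (simp add: C_def)
 define b where "b u I = e u I - tuple_avg k n (e u)" for u I
 have am: "(\<lambda>u. tuple_avg k n (e u)) \<in> borel_measurable ?M"
  unfolding tuple_avg_def using m by auto
 have bm: "(\<lambda>u. b u I) \<in> borel_measurable ?M" if "I \<in> ?T" for I
  unfolding b_def using m[OF that] am by auto
 have isum: "integrable ?M (\<lambda>u. (tuple_avg k n (e u))^2)"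
  unfolding tuple_avg_def power_divide using integrable_sum_square(1)[of ?T "\<lambda>I u. e u I" ?M] m sq by auto
 have bsq: "integrable ?M (\<lambda>u. (b u I)^2)" if I: "I \<in> ?T" for I
  unfolding b_def power2_diff
  using sq[OF I] isum integrable_product_of_squares[OF m[OF I] am sq[OF I] isum]
  by (auto simp: mult.assoc)
 have beq: "equivariant ?M k n b"
  using e equivariant_avg[OF e] by (auto simp: equivariant_def b_def)
 define v where "v = (LINT u|?M. (b u I0)^2)"
 have vI: "(LINT u|?M. (b u I)^2) = v" if "I \<in> ?T" for I
  unfolding v_def
  by (rule integral_equivariant[OF L J _ _ that I0]) (use beq bm in \<open>auto simp: equivariant_def\<close>)
 have v0: "v >= 0" unfolding v_def by simp
 define w where "w = (LINT u|?M. (e u I0)^2)"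
 have wI: "(LINT u|?M. (e u I)^2) = w" if "I \<in> ?T" for I
  unfolding w_def
  by (rule integral_equivariant[OF L J _ _ that I0]) (use e m in \<open>auto simp: equivariant_def\<close>)
 have w0: "w >= 0" unfolding w_def by simp
 \<comment> \<open>Centering at the mean does not increase a sum of squares, so the second moment of
   the deviations is at most that of the values.\<close>
 have "C * v = (LINT u|?M. (\<Sum>I\<in>?T. (b u I)^2))"
  using vI bsq by (simp add: L1_integral_sum C_def)
 also have "... <= (LINT u|?M. (\<Sum>I\<in>?T. (e u I)^2))"
  by (rule integral_mono)
    (use bsq sq sum_square_deviation_le[OF finite_tuples] in \<open>auto simp: b_def tuple_avg_def\<close>)
 also have "... = C * w"
  using wI sq by (simp add: L1_integral_sum C_def)
 finally have vw: "v <= w" using C by simp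
 have bb: "\<bar>LINT u|?M. b u I * b u I'\<bar> <= v" if "I \<in> ?T" "I' \<in> ?T" for I I'
  using integral_product_le[OF bm[OF that(1)] bm[OF that(2)] bsq[OF that(1)] bsq[OF that(2)]]
  by (simp add: vI that)
 have disj: "\<bar>LINT u|?M. b u I * b u I'\<bar> <= 2 * ?K * v / real n"
  if I: "I \<in> ?T" "I' \<in> ?T" "I ` {..k} \<inter> I' ` {..k} = {}" for I I'
 proof -
  define c where "c = (LINT u|?M. b u I * b u I')"
  let ?D = "{I2 \<in> ?T. I ` {..k} \<inter> I2 ` {..k} = {}}" and ?O = "{I2 \<in> ?T. I ` {..k} \<inter> I2 ` {..k} \<noteq> {}}"
  \<comment> \<open>A tuple that meets \<open>I\<close> agrees with it at one of
    \<open>(k+1)^2\<close> pairs of positions, and each such agreement concerns a proportion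
    \<open>1/n\<close> of all tuples.\<close>
  have "?O \<subseteq> (\<Union>p\<in>{..k} \<times> {..k}. {I2 \<in> ?T. I2 (fst p) = I (snd p)})"
  proof
   fix I2 assume "I2 \<in> ?O"
   then obtain a b where "a <= k" "b <= k" "I a = I2 b" "I2 \<in> ?T" by blast
   then have "(b, a) \<in> {..k} \<times> {..k}" "I2 \<in> {I2 \<in> ?T. I2 (fst (b, a)) = I (snd (b, a))}" by simp_all
   then show "I2 \<in> (\<Union>p\<in>{..k} \<times> {..k}. {I2 \<in> ?T. I2 (fst p) = I (snd p)})" by (rule UN_I)
  qed
  then have "card ?O <= card (\<Union>p\<in>{..k} \<times> {..k}. {I2 \<in> ?T. I2 (fst p) = I (snd p)})"
   by (intro card_mono) auto
  also have "... <= (\<Sum>p\<in>{..k} \<times> {..k}. card {I2 \<in> ?T. I2 (fst p) = I (snd p)})"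
   by (rule card_UN_le) auto
  finally have "real (card ?O) <= (\<Sum>p\<in>{..k} \<times> {..k}. real (card {I2 \<in> ?T. I2 (fst p) = I (snd p)}))"
   unfolding of_nat_sum[symmetric] of_nat_le_iff .
  also have "... = (\<Sum>p\<in>{..k} \<times> {..k}. C / real n)"
  proof (rule sum.cong)
   fix p assume p: "p \<in> {..k} \<times> {..k}"
   then have "real (card {I2 \<in> ?T. I2 (fst p) = I (snd p)}) * real n = C"
    unfolding C_def using tuplesD(2)[OF I(1)] by (intro card_tuples_fix1) auto
   then show "real (card {I2 \<in> ?T. I2 (fst p) = I (snd p)}) = C / real n"
    using n0 by (simp add: field_simps)
  qed simp
  also have "... = ?K * C / real n" by (simp add: power2_eq_square add_divide_distrib algebra_simps)
  finally have O: "real (card ?O) <= ?K * C / real n" .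
  have "C = real (card ?D) + real (card ?O)"
  proof -
   have "?T = ?D \<union> ?O" by auto
   from arg_cong[OF this, of card] have "card ?T = card ?D + card ?O"
    by (subst (asm) card_Un_disjoint) auto
   then show ?thesis by (simp add: C_def)
  qed
  \<comment> \<open>The lower bound on \<open>n\<close> is chosen for this: at least half of all
    tuples are disjoint from \<open>I\<close>, so dividing by their number costs a factor 2.\<close>
  moreover have "?K * C / real n <= C / 2"
  proof -
   have "?K * C * 2 <= real n * C" using mult_right_mono[OF n', of C] C by simp
   then show ?thesis using n0 by (simp add: field_simps)
  qed
  ultimately have D: "real (card ?D) >= C / 2" using O by linarith
  have "(LINT u|?M. b u I * (\<Sum>I2\<in>?T. b u I2)) = 0"
  proof -
   have "(\<Sum>I2\<in>?T. b u I2) = 0" for u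
    using C by (simp add: b_def sum_subtractf tuple_avg_def C_def)
   then show ?thesis by simp
  qed
  moreover have "(LINT u|?M. b u I * (\<Sum>I2\<in>?T. b u I2)) = (\<Sum>I2\<in>?T. LINT u|?M. b u I * b u I2)"
   unfolding sum_distrib_left
   by (rule L1_integral_sum) (use bm bsq I in \<open>auto intro!: integrable_product_of_squares\<close>)
  moreover have "(\<Sum>I2\<in>?T. LINT u|?M. b u I * b u I2)
    = (\<Sum>I2\<in>?D. LINT u|?M. b u I * b u I2) + (\<Sum>I2\<in>?O. LINT u|?M. b u I * b u I2)"
   by (subst sum.union_disjoint[symmetric]) (auto intro!: sum.cong)
  moreover have "(\<Sum>I2\<in>?D. LINT u|?M. b u I * b u I2) = (\<Sum>I2\<in>?D. c)"
   unfolding c_def by (rule sum.cong) (use I in \<open>auto intro!: integral_equivariant_pair[OF L J beq bm]\<close>)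
  ultimately have "real (card ?D) * c = - (\<Sum>I2\<in>?O. LINT u|?M. b u I * b u I2)" by simp
  then have "real (card ?D) * \<bar>c\<bar> = \<bar>\<Sum>I2\<in>?O. LINT u|?M. b u I * b u I2\<bar>"
   by (subst abs_of_nat[symmetric], subst abs_mult[symmetric]) simp
  also have "... <= (\<Sum>I2\<in>?O. \<bar>LINT u|?M. b u I * b u I2\<bar>)" by (rule sum_abs)
  also have "... <= (\<Sum>I2\<in>?O. v)" using I bb by (intro sum_mono) auto
  also have "... = real (card ?O) * v" by simp
  also have "... <= ?K * C / real n * v" using O v0 by (rule mult_right_mono)
  finally have "real (card ?D) * \<bar>c\<bar> <= ?K * C / real n * v" .
  then have "C / 2 * \<bar>c\<bar> <= ?K * C / real n * v"
   by (rule order_trans[OF mult_right_mono[OF D abs_ge_zero]])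
  then have "C * (\<bar>c\<bar> / 2) <= C * (?K / real n * v)" by (simp add: mult_ac)
  then have "\<bar>c\<bar> / 2 <= ?K / real n * v" using C by (simp only: mult_le_cancel_left_pos)
  then show ?thesis unfolding c_def[symmetric] by (simp add: field_simps)
 qed
 have lag: "lag_index k t \<in> ?T" if "t \<in> {k+1..n}" for t
  using that by (intro lag_index_in_tuples) auto
 have cd: "real (card {k+1..n}) = real n - real k" using nk by (simp add: of_nat_diff)
 have ml: "(LINT u|?M. (\<Sum>t=k+1..n. b u (lag_index k t))^2)
  <= real (card {k+1..n}) * (2 * real k + 1) * v + (real (card {k+1..n}))^2 * (2 * ?K * v / real n)"
 proof (rule second_moment_local_dependence)
  fix t s assume ts: "t \<in> {k+1..n}" "s \<in> {k+1..n}" "t + k < s \<or> s + k < t"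
  have "lag_index k t ` {..k} \<inter> lag_index k s ` {..k} = {}"
   using ts by (auto simp: lag_index_def)
  then show "\<bar>LINT u|?M. b u (lag_index k t) * b u (lag_index k s)\<bar> <= 2 * ?K * v / real n"
   by (intro disj lag ts)
 qed (use lag bm bsq bb v0 in auto)
 have sumb: "(\<Sum>t=k+1..n. e u (lag_index k t)) / (real n - real k) - tuple_avg k n (e u)
   = (\<Sum>t=k+1..n. b u (lag_index k t)) / (real n - real k)" for u
 proof -
  have "(\<Sum>t=k+1..n. b u (lag_index k t)) = (\<Sum>t=k+1..n. e u (lag_index k t)) - (real n - real k) * tuple_avg k n (e u)"
   unfolding b_def sum_subtractf using cd by simp
  then show ?thesis using nk by (simp add: diff_divide_distrib)
 qed
 define N where "N = real n - real k"
 have N: "N > 0" "2 * N >= real n" using nk by (auto simp: N_def)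
 have "(LINT u|?M. ((\<Sum>t=k+1..n. e u (lag_index k t)) / (real n - real k) - tuple_avg k n (e u))^2)
   = (LINT u|?M. (\<Sum>t=k+1..n. b u (lag_index k t))^2) / N^2"
  unfolding sumb by (simp add: power_divide N_def)
 also have "... <= (N * (2 * real k + 1) * v + N^2 * (2 * ?K * v / real n)) / N^2"
  using ml cd by (intro divide_right_mono) (auto simp: N_def)
 also have "... = (2 * real k + 1) * v / N + 2 * ?K * v / real n"
  using N by (simp add: add_divide_distrib power2_eq_square)
 \<comment> \<open>From \<open>2k+1 <= 2(k+1)^2\<close> and \<open>N >= n/2\<close>. Together with
   the 2 from disjoint tuples this gives the constant 6.\<close>
 also have "(2 * real k + 1) * v / N <= 4 * ?K * v / real n"
 proof -
  have "(2 * real k + 1) * v <= 2 * ?K * v"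
   using v0 by (intro mult_right_mono) (auto simp: power2_eq_square algebra_simps)
  then have "(2 * real k + 1) * v * real n <= 2 * ?K * v * (2 * N)"
   by (rule mult_mono) (use N n0 v0 in auto)
  then show ?thesis using N n0 by (simp add: field_simps)
 qed
 also have "4 * ?K * v / real n + 2 * ?K * v / real n = 6 * ?K / real n * v"
  by (simp add: add_divide_distrib[symmetric])
 also have "... <= 6 * ?K / real n * w" using vw by (intro mult_left_mono) auto
 finally show ?thesis unfolding w_def by simp
qed

section \<open>The probability integral transform\<close>

lemma id_uniform01: "(\<lambda>x. x) \<in> borel_measurable uniform01"
 by (simp add: uniform01_def measurable_restrict_space1)

lemma sets_uniform01: "A \<in> sets uniform01 \<longleftrightarrow> A \<in> sets borel \<and> A \<subseteq> {0<..<1}"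
 by (auto simp: uniform01_def sets_restrict_space_iff)

lemma emeasure_uniform01: "A \<in> sets uniform01 ==> emeasure uniform01 A = emeasure lborel A"
 unfolding sets_uniform01 unfolding uniform01_def by (subst emeasure_restrict_space) auto

lemma measure_uniform01_Iio:
 assumes "0 <= c" "c <= 1"
 shows "measure uniform01 {x \<in> {0<..<1}. x < c} = c" "measure uniform01 {x \<in> {0<..<1}. x <= c} = c"
proof -
 have e: "{x \<in> {0<..<1}. x < c} = {0<..<c}" using assms by auto
 show "measure uniform01 {x \<in> {0<..<1}. x < c} = c"
  unfolding e using assms by (subst measure_def, subst emeasure_uniform01) (auto simp: sets_uniform01)
 have e: "{x \<in> {0<..<1}. x <= c} = (if c = 1 then {0<..<c} else {0<..c})" using assms by auto
 show "measure uniform01 {x \<in> {0<..<1}. x <= c} = c"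
  unfolding e using assms by (subst measure_def, subst emeasure_uniform01) (auto simp: sets_uniform01)
qed

lemma uniform01_null_point: "emeasure uniform01 ({c} \<inter> {0<..<1}) = 0"
 by (subst emeasure_uniform01) (auto simp: sets_uniform01 Int_insert_left)

context
 fixes f assumes f: "f \<in> \<F>0"
begin

lemma F0_facts:
 shows "f \<in> borel_measurable borel" "\<And>x. 0 < f x"
  "(LBINT x:{..0}. f x) = 1/2" "(LBINT x:{0..}. f x) = 1/2"
 using f by (auto simp: \<F>0_def)

text \<open>A nonzero Bochner integral forces integrability, so the value 1/2 carries over to the
  nonnegative integral.\<close>

lemma law_measure_halves:
 "emeasure (law f) {..0} = ennreal (1/2)" "emeasure (law f) {0..} = ennreal (1/2)"
proof -
 have "emeasure (law f) A = ennreal (1/2)" if A[measurable]: "A \<in> sets borel" and 1: "(LBINT x:A. f x) = 1/2" for A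
 proof -
  note [measurable] = F0_facts(1)
  have "integrable lborel (\<lambda>x. indicator A x * f x)"
   using 1 not_integrable_integral_eq[of lborel "\<lambda>x. indicator A x * f x"]
   by (auto simp: set_lebesgue_integral_def)
  moreover have e: "(LBINT x. indicator A x * f x) = 1/2"
   using 1 by (simp add: set_lebesgue_integral_def)
  ultimately have "(\<integral>\<^sup>+x. ennreal (indicator A x * f x) \<partial>lborel) = ennreal (1/2)"
   unfolding e[symmetric] using F0_facts(2) by (intro nn_integral_eq_integral) (auto simp: less_imp_le)
  moreover have "emeasure (law f) A = (\<integral>\<^sup>+x. ennreal (indicator A x * f x) \<partial>lborel)"
   unfolding law_def by (subst emeasure_density) (auto intro!: nn_integral_cong simp: indicator_def)
  ultimately show ?thesis by simp
 qed
 then show "emeasure (law f) {..0} = ennreal (1/2)" "emeasure (law f) {0..} = ennreal (1/2)"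
  using F0_facts by auto
qed

lemma sets_law [simp]: "sets (law f) = sets borel"
 by (simp add: law_def)

lemma law_point: "emeasure (law f) {x} = 0"
 unfolding law_def using F0_facts(1)
 by (subst emeasure_density) (auto intro!: nn_integral_0_iff_AE[THEN iffD2] AE_I[of _ _ "{x}"] simp: indicator_def)

lemma prob_space_law: "prob_space (law f)"
proof
 have "space (law f) = {..0} \<union> {0<..}" by (auto simp: law_def)
 then have "emeasure (law f) (space (law f)) = emeasure (law f) ({..0} \<union> {0<..})" by simp
 also have "... = emeasure (law f) {..0} + emeasure (law f) {0<..}"
  by (rule plus_emeasure[symmetric]) auto
 also have "emeasure (law f) {0<..} = emeasure (law f) {0..}"
 proof -
  have "emeasure (law f) {0..} = emeasure (law f) ({0} \<union> {0<..})"
   by (rule arg_cong2[of _ _ _ _ emeasure]) auto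
  also have "... = emeasure (law f) {0} + emeasure (law f) {0<..}"
   by (rule plus_emeasure[symmetric]) auto
  finally show ?thesis by (simp add: law_point)
 qed
 finally show "emeasure (law f) (space (law f)) = 1"
  unfolding law_measure_halves by (subst (asm) ennreal_plus[symmetric]) auto
qed

lemma real_distribution_law: "real_distribution (law f)"
 unfolding real_distribution_def real_distribution_axioms_def
 using prob_space_law by (simp add: law_def)

text \<open>Positivity of \<open>f\<close> gives every interval positive mass. Strictness makes
  ranks and signs invariant under the transform at every sample point, not merely almost
  surely.\<close>

lemma cdf_law_strict_mono: "strict_mono (cdf (law f))"
proof
 fix x y :: real assume xy: "x < y"
 interpret real_distribution "law f" by (rule real_distribution_law)
 have "emeasure (law f) {x<..y} \<noteq> 0"
 proof
  assume 0: "emeasure (law f) {x<..y} = 0"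
  have "emeasure (law f) {x<..y} = (\<integral>\<^sup>+z. ennreal (f z) * indicator {x<..y} z \<partial>lborel)"
   unfolding law_def using F0_facts(1) by (subst emeasure_density) auto
  then have "(\<integral>\<^sup>+z. ennreal (f z) * indicator {x<..y} z \<partial>lborel) = 0" using 0 by simp
  then have "AE z in lborel. ennreal (f z) * indicator {x<..y} z = 0"
   using F0_facts(1) by (subst (asm) nn_integral_0_iff_AE) auto
  then have "AE z in lborel. z \<notin> {x<..y}"
   by eventually_elim (use F0_facts(2) in \<open>auto simp: indicator_def split: if_splits, metis ennreal_eq_0_iff not_le\<close>)
  then have "emeasure lborel {x<..y} = 0"
   by (subst (asm) AE_iff_measurable[of "{x<..y}"]) auto
  then show False using xy by simp
 qed
 then have "measure (law f) {x<..y} > 0"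
  by (simp add: emeasure_eq_measure zero_less_measure_iff)
 then show "cdf (law f) x < cdf (law f) y" using cdf_diff_eq[OF xy] by simp
qed

lemma cdf_law_range: "0 < cdf (law f) x" "cdf (law f) x < 1"
proof -
 interpret real_distribution "law f" by (rule real_distribution_law)
 show "0 < cdf (law f) x"
  using strict_monoD[OF cdf_law_strict_mono, of "x - 1" x] cdf_nonneg[of "x - 1"] by simp
 show "cdf (law f) x < 1"
  using strict_monoD[OF cdf_law_strict_mono, of x "x + 1"] cdf_bounded_prob[of "x + 1"] by simp
qed

lemma cdf_law_0: "cdf (law f) 0 = 1/2"
 unfolding cdf_def measure_def law_measure_halves by (rule enn2real_ennreal) simp

lemma cdf_law_measurable: "cdf (law f) \<in> measurable (law f) uniform01"
proof -
 interpret real_distribution "law f" by (rule real_distribution_law)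
 have "cdf (law f) \<in> borel_measurable borel"
  by (intro borel_measurable_mono monoI cdf_nondecreasing)
 then have "cdf (law f) \<in> borel_measurable (law f)"
  by (simp add: measurable_cong_sets[OF sets_law refl])
 then show ?thesis unfolding uniform01_def
  by (intro measurable_restrict_space2) (auto simp: cdf_law_range)
qed

lemma distr_cdf_law: "distr (law f) uniform01 (cdf (law f)) = uniform01"
proof -
 interpret real_distribution "law f" by (rule real_distribution_law)
 let ?F = "cdf (law f)"
 note Fm = cdf_law_measurable
 have Fb: "?F \<in> borel_measurable (law f)"
  using measurable_compose[OF Fm id_uniform01] by simp
 have "distr (law f) borel ?F = distr uniform01 borel (\<lambda>x. x)"
 proof (rule cdf_unique)
  show "real_distribution (distr (law f) borel ?F)" using Fb by (rule real_distribution_distr)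
  show "real_distribution (distr uniform01 borel (\<lambda>x. x))"
   using id_uniform01 by (rule U01.real_distribution_distr)
  show "cdf (distr (law f) borel ?F) = cdf (distr uniform01 borel (\<lambda>x. x))"
  proof
   fix c :: real
   have d1: "cdf (distr (law f) borel ?F) c = measure (law f) {x. ?F x <= c}"
    unfolding cdf_def[of "distr (law f) borel ?F"] using Fb
    by (subst measure_distr) (auto simp: vimage_def)
   have d2: "cdf (distr uniform01 borel (\<lambda>x. x)) c = measure uniform01 {x \<in> {0<..<1}. x <= c}"
    unfolding cdf_def using id_uniform01
    by (subst measure_distr) (auto intro!: arg_cong2[of _ _ _ _ measure])
   consider "c <= 0" | "c >= 1" | "0 < c" "c < 1" by linarith
   then show "cdf (distr (law f) borel ?F) c = cdf (distr uniform01 borel (\<lambda>x. x)) c"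
   proof cases
    case 1
    then have e: "{x. ?F x <= c} = {}" "{x \<in> {0<..<1}. x <= c} = {}"
     using cdf_law_range(1) by (auto simp: not_le intro: le_less_trans)
    show ?thesis unfolding d1 d2 e by simp
   next
    case 2
    then have e: "{x. ?F x <= c} = UNIV" "{x \<in> {0<..<1}. x <= c} = {0<..<1}"
     using cdf_law_range(2) by (auto intro: less_imp_le less_le_trans)
    show ?thesis using prob_space U01.prob_space unfolding d1 d2 e by simp
   next
    case 3
    \<comment> \<open>Without atoms the distribution function is continuous and attains the level
      \<open>c\<close>; strict monotonicity then identifies the event with a half line.\<close>
    have cont: "isCont ?F x" for x
     using isCont_cdf law_point by (simp add: measure_def)
    have "\<forall>\<^sub>F x in at_top. ?F x > c" using order_tendstoD(1)[OF cdf_lim_at_top_prob 3(2)] .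
    then obtain b where b: "?F b > c" by (metis eventually_at_top_linorder order_refl)
    have "\<forall>\<^sub>F x in at_bot. ?F x < c" using order_tendstoD(2)[OF cdf_lim_at_bot 3(1)] .
    then obtain a where a: "?F a < c" by (metis eventually_at_bot_linorder order_refl)
    have ab: "a <= b" using a b strict_mono_less[OF cdf_law_strict_mono, of a b] by linarith
    obtain x where x: "?F x = c"
     using IVT[of ?F a c b] a b ab cont by (auto simp: less_imp_le)
    have "{y. ?F y <= c} = {..x}"
     using strict_mono_less_eq[OF cdf_law_strict_mono] by (auto simp: x[symmetric])
    then have "measure (law f) {y. ?F y <= c} = c" using x by (simp add: cdf_def)
    then show ?thesis
     using 3 measure_uniform01_Iio(2)[of c] unfolding d1 d2 by simp
   qed
  qed
 qed
 then have eq: "emeasure (distr (law f) borel ?F) A = emeasure (distr uniform01 borel (\<lambda>x. x)) A" for A by simp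
 show ?thesis
 proof (rule measure_eqI)
  fix A assume "A \<in> sets (distr (law f) uniform01 ?F)"
  then have A: "A \<in> sets uniform01" by simp
  then have Ab: "A \<in> sets borel" "A \<subseteq> {0<..<1}" by (auto simp: sets_uniform01)
  have "emeasure (distr (law f) uniform01 ?F) A = emeasure (law f) (?F -` A \<inter> space (law f))"
   using A Fm by (simp add: emeasure_distr)
  also have "... = emeasure (distr (law f) borel ?F) A"
   using Ab Fb by (simp add: emeasure_distr)
  also have "... = emeasure uniform01 A"
   unfolding eq using Ab id_uniform01 by (subst emeasure_distr) (auto simp: Int_absorb2)
  finally show "emeasure (distr (law f) uniform01 ?F) A = emeasure uniform01 A" .
 qed simp
qed

lemma distr_H0:
 "distr (H0 f n) (unif {1..n}) (compose {1..n} (cdf (law f))) = (unif {1..n})"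
 unfolding H0_def
 by (subst distr_PiM_finite_prob_space') (auto intro: prob_space_law prob_space_uniform01 cdf_law_measurable simp: distr_cdf_law)

lemma compose_cdf_measurable:
 "compose {1..n} (cdf (law f)) \<in> measurable (H0 f n) (unif {1..n})"
 unfolding H0_def compose_def
 by (intro measurable_restrict measurable_compose[OF measurable_component_singleton[of _ "{1..n}" "\<lambda>_. law f"] cdf_law_measurable])

text \<open>Samples of different sizes are replaced by one infinite uniform sequence, so that
  convergence statements live on one probability space. The condition \<open>loc\<close> says that
  \<open>Y\<close> reads only the first \<open>n\<close> coordinates.\<close>

lemma distr_transfer:
 assumes Y: "Y \<in> borel_measurable (unif {1..n})"
  and loc: "\<And>u. u \<in> space uniform_seq ==> Y (restrict u {1..n}) = Y u"
 shows "distr (H0 f n) borel (\<lambda>z. Y (compose {1..n} (cdf (law f)) z)) = distr uniform_seq borel Y"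
proof -
 let ?Q = "unif {1..n}"
 have rm: "(\<lambda>u. restrict u {1..n}) \<in> measurable uniform_seq ?Q"
  unfolding uniform_seq_def by (intro measurable_restrict) auto
 have r: "distr uniform_seq ?Q (\<lambda>u. restrict u {1..n}) = ?Q"
  unfolding uniform_seq_def restrict_def[abs_def]
  using distr_PiM_reindex[of "{1..}" "\<lambda>_. uniform01" "\<lambda>i. i" "{1..n}"] prob_space_uniform01
  by (auto simp: restrict_def)
 have "distr (H0 f n) borel (\<lambda>z. Y (compose {1..n} (cdf (law f)) z)) = distr ?Q borel Y"
  by (rule distr_distr[OF Y compose_cdf_measurable, unfolded distr_H0 o_def, symmetric])
 also have "... = distr uniform_seq borel (\<lambda>u. Y (restrict u {1..n}))"
  by (rule distr_distr[OF Y rm, unfolded r o_def])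
 also have "... = distr uniform_seq borel Y" by (rule distr_cong[OF refl refl loc])
 finally show ?thesis .
qed

end

section \<open>Convergence in probability\<close>

lemma small_oP_cong_AE:
 assumes X: "small_oP P X r"
  and m: "\<And>n. X n \<in> borel_measurable (P n)" "\<And>n. Y n \<in> borel_measurable (P n)"
  and eq: "\<forall>\<^sub>F n in sequentially. AE \<omega> in P n. X n \<omega> = Y n \<omega>"
 shows "small_oP P Y r"
 unfolding small_oP_def
proof (intro allI impI)
 fix eps :: real assume "eps > 0"
 then have "(\<lambda>n. measure (P n) {\<omega> \<in> space (P n). \<bar>X n \<omega>\<bar> > eps * \<bar>r n\<bar>}) \<longlonglongrightarrow> 0"
  using X by (simp add: small_oP_def)
 moreover have "\<forall>\<^sub>F n in sequentially. measure (P n) {\<omega> \<in> space (P n). \<bar>X n \<omega>\<bar> > eps * \<bar>r n\<bar>}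
   = measure (P n) {\<omega> \<in> space (P n). \<bar>Y n \<omega>\<bar> > eps * \<bar>r n\<bar>}"
  using eq
 proof eventually_elim
  case (elim n)
  note [measurable] = m[of n]
  show ?case
   by (rule measure_eq_AE) (use elim in \<open>auto elim: eventually_mono\<close>)
 qed
 ultimately show "(\<lambda>n. measure (P n) {\<omega> \<in> space (P n). \<bar>Y n \<omega>\<bar> > eps * \<bar>r n\<bar>}) \<longlonglongrightarrow> 0"
  by (rule Lim_transform_eventually)
qed

lemma small_oP_add:
 assumes P: "\<And>n. prob_space (P n)"
  and m[measurable]: "\<And>n. X n \<in> borel_measurable (P n)" "\<And>n. Y n \<in> borel_measurable (P n)"
  and X: "small_oP P X r" and Y: "small_oP P Y r"
 shows "small_oP P (\<lambda>n \<omega>. X n \<omega> + Y n \<omega>) r"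
 unfolding small_oP_def
proof (intro allI impI)
 fix eps :: real assume eps: "eps > 0"
 let ?A = "\<lambda>n. {\<omega> \<in> space (P n). \<bar>X n \<omega>\<bar> > eps/2 * \<bar>r n\<bar>}" and ?B = "\<lambda>n. {\<omega> \<in> space (P n). \<bar>Y n \<omega>\<bar> > eps/2 * \<bar>r n\<bar>}"
 have lim: "(\<lambda>n. measure (P n) (?A n) + measure (P n) (?B n)) \<longlonglongrightarrow> 0 + 0"
  using X[unfolded small_oP_def, rule_format, of "eps/2"] Y[unfolded small_oP_def, rule_format, of "eps/2"] eps
  by (intro tendsto_add) simp_all
 show "(\<lambda>n. measure (P n) {\<omega> \<in> space (P n). \<bar>X n \<omega> + Y n \<omega>\<bar> > eps * \<bar>r n\<bar>}) \<longlonglongrightarrow> 0"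
 proof (rule tendsto_sandwich[OF _ _ tendsto_const])
  show "(\<lambda>n. measure (P n) (?A n) + measure (P n) (?B n)) \<longlonglongrightarrow> 0" using lim by simp
  show "\<forall>\<^sub>F n in sequentially. measure (P n) {\<omega> \<in> space (P n). \<bar>X n \<omega> + Y n \<omega>\<bar> > eps * \<bar>r n\<bar>}
    <= measure (P n) (?A n) + measure (P n) (?B n)"
  proof (rule always_eventually, rule allI)
   fix n
   interpret prob_space "P n" by (rule P)
   have "measure (P n) {\<omega> \<in> space (P n). \<bar>X n \<omega> + Y n \<omega>\<bar> > eps * \<bar>r n\<bar>} <= measure (P n) (?A n \<union> ?B n)"
    by (intro finite_measure_mono) (auto simp: field_simps abs_if split: if_splits)
   also have "... <= measure (P n) (?A n) + measure (P n) (?B n)"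
    by (rule measure_Un_le) auto
   finally show "measure (P n) {\<omega> \<in> space (P n). \<bar>X n \<omega> + Y n \<omega>\<bar> > eps * \<bar>r n\<bar>}
    <= measure (P n) (?A n) + measure (P n) (?B n)" .
  qed
 qed auto
qed

lemma small_oP_second_moment:
 assumes P: "\<And>n. prob_space (P n)" and r: "\<And>n. n > 0 ==> r n > 0"
  and m: "\<And>n. X n \<in> borel_measurable (P n)"
  and i: "\<And>n. integrable (P n) (\<lambda>\<omega>. (X n \<omega>)^2)"
  and lim: "(\<lambda>n. (LINT \<omega>|P n. (X n \<omega>)^2) / (r n)^2) \<longlonglongrightarrow> 0"
 shows "small_oP P X r"
 unfolding small_oP_def
proof (intro allI impI)
 fix eps :: real assume eps: "eps > 0"
 show "(\<lambda>n. measure (P n) {\<omega> \<in> space (P n). \<bar>X n \<omega>\<bar> > eps * \<bar>r n\<bar>}) \<longlonglongrightarrow> 0"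
 proof (rule tendsto_sandwich[OF _ _ tendsto_const])
  show "(\<lambda>n. (LINT \<omega>|P n. (X n \<omega>)^2) / (r n)^2 / eps^2) \<longlonglongrightarrow> 0"
   using tendsto_divide[OF lim tendsto_const[of "eps^2"]] eps by simp
  show "\<forall>\<^sub>F n in sequentially. measure (P n) {\<omega> \<in> space (P n). \<bar>X n \<omega>\<bar> > eps * \<bar>r n\<bar>}
    <= (LINT \<omega>|P n. (X n \<omega>)^2) / (r n)^2 / eps^2"
   using eventually_gt_at_top[of 0]
  proof eventually_elim
   case (elim n)
   interpret prob_space "P n" by (rule P)
   note [measurable] = m[of n]
   have c: "eps * r n > 0" using eps r[OF elim] by simp
   have "measure (P n) {\<omega> \<in> space (P n). \<bar>X n \<omega>\<bar> > eps * \<bar>r n\<bar>}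
    <= measure (P n) {\<omega> \<in> space (P n). (eps * r n)^2 <= (X n \<omega>)^2}"
   proof (intro finite_measure_mono subsetI)
    fix \<omega> assume "\<omega> \<in> {\<omega> \<in> space (P n). \<bar>X n \<omega>\<bar> > eps * \<bar>r n\<bar>}"
    then have "\<omega> \<in> space (P n)" "eps * r n <= \<bar>X n \<omega>\<bar>" using r[OF elim] by auto
    then show "\<omega> \<in> {\<omega> \<in> space (P n). (eps * r n)^2 <= (X n \<omega>)^2}"
     using power_mono[of "eps * r n" "\<bar>X n \<omega>\<bar>" 2] c by simp
   qed measurable
   also have "... <= (LINT \<omega>|P n. (X n \<omega>)^2) / (eps * r n)^2"
    by (rule integral_Markov_inequality_measure[OF i, where A = "{}"]) (use c in auto)
   finally show ?case by (simp add: power_mult_distrib mult.commute)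
  qed
 qed auto
qed

lemma small_oP_first_moment:
 assumes P: "\<And>n. prob_space (P n)" and r: "\<And>n. n > 0 ==> r n > 0"
  and i: "\<And>n. integrable (P n) (X n)"
  and lim: "(\<lambda>n. (LINT \<omega>|P n. \<bar>X n \<omega>\<bar>) / r n) \<longlonglongrightarrow> 0"
 shows "small_oP P X r"
 unfolding small_oP_def
proof (intro allI impI)
 fix eps :: real assume eps: "eps > 0"
 show "(\<lambda>n. measure (P n) {\<omega> \<in> space (P n). \<bar>X n \<omega>\<bar> > eps * \<bar>r n\<bar>}) \<longlonglongrightarrow> 0"
 proof (rule tendsto_sandwich[OF _ _ tendsto_const])
  show "(\<lambda>n. (LINT \<omega>|P n. \<bar>X n \<omega>\<bar>) / r n / eps) \<longlonglongrightarrow> 0"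
   using tendsto_divide[OF lim tendsto_const[of "eps"]] eps by simp
  show "\<forall>\<^sub>F n in sequentially. measure (P n) {\<omega> \<in> space (P n). \<bar>X n \<omega>\<bar> > eps * \<bar>r n\<bar>}
    <= (LINT \<omega>|P n. \<bar>X n \<omega>\<bar>) / r n / eps"
   using eventually_gt_at_top[of 0]
  proof eventually_elim
   case (elim n)
   interpret prob_space "P n" by (rule P)
   have [measurable]: "X n \<in> borel_measurable (P n)" using i by auto
   have c: "eps * r n > 0" using eps r[OF elim] by simp
   have "measure (P n) {\<omega> \<in> space (P n). \<bar>X n \<omega>\<bar> > eps * \<bar>r n\<bar>}
    <= measure (P n) {\<omega> \<in> space (P n). eps * r n <= \<bar>X n \<omega>\<bar>}"
    using r[OF elim] by (intro finite_measure_mono) auto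
   also have "... <= (LINT \<omega>|P n. \<bar>X n \<omega>\<bar>) / (eps * r n)"
    by (rule integral_Markov_inequality_measure[OF integrable_abs[OF i], where A = "{}"]) (use c in auto)
   finally show ?case by (simp add: mult.commute)
  qed
 qed auto
qed

section \<open>Scores as functions of uniform variables\<close>

definition score_at :: "nat => score => nat => real => (nat => real) => (nat => nat) => real" where
 "score_at k a n c u I = a n (n_below c n u) (n_above c n u) (tup k (rank n u) I)"

text \<open>For fixed \<open>n\<close> a score takes finitely many values. This crude bound serves
  integrability only and never enters a rate.\<close>

definition score_bound :: "nat => score => nat => real" where
 "score_bound k a n = (\<Sum>x\<in>{..n} \<times> {..n} \<times> ({..k} \<rightarrow>\<^sub>E {..n}). \<bar>a n (fst x) (fst (snd x)) (snd (snd x))\<bar>)"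

definition uniform_stat :: "nat => score => nat => (nat => real) => real" where
 "uniform_stat k a n u = (\<Sum>t=k+1..n. score_at k a n (1/2) u (lag_index k t)) / (real n - real k)"

definition lag_avg :: "nat => ((nat => real) => real) => nat => (nat => real) => real" where
 "lag_avg k g n u = (\<Sum>t=k+1..n. g (tup k u (lag_index k t))) / (real n - real k)"

definition U_stat :: "nat => ((nat => real) => real) => nat => (nat => real) => real" where
 "U_stat k g n u = tuple_avg k n (\<lambda>I. g (tup k u I))"

definition score_diff :: "nat => score => ((nat => real) => real) => nat => (nat => real) => (nat => nat) => real" where
 "score_diff k a phi n u I = score_at k a n (1/2) u I - phi (tup k u I)"

lemma tup_rank_in: "tup k (rank n u) I \<in> {..k} \<rightarrow>\<^sub>E {..n}"
 by (auto simp: tup_def rank_le)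

lemma score_at_bounded: "\<bar>score_at k a n c u I\<bar> <= score_bound k a n"
proof -
 let ?x = "(n_below c n u, n_above c n u, tup k (rank n u) I)"
 have "?x \<in> {..n} \<times> {..n} \<times> ({..k} \<rightarrow>\<^sub>E {..n})"
  using tup_rank_in n_below_le n_above_le by auto
 then have "\<bar>a n (fst ?x) (fst (snd ?x)) (snd (snd ?x))\<bar> <= score_bound k a n"
  unfolding score_bound_def by (rule member_le_sum) (auto intro!: finite_PiE)
 then show ?thesis by (simp add: score_at_def)
qed

text \<open>The score itself is an arbitrary function; measurability comes from its arguments, which
  are measurable with countably many values.\<close>

lemma score_at_measurable:
 fixes L :: "real measure"
 assumes id: "(\<lambda>x. x) \<in> borel_measurable L" and J: "{1..n} \<subseteq> J" and I: "I \<in> tuples k n"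
 shows "(\<lambda>u. score_at k a n c u I) \<in> borel_measurable (\<Pi>\<^sub>M i\<in>J. L)"
proof -
 let ?M = "\<Pi>\<^sub>M i\<in>J. L" and ?R = "{..k} \<rightarrow>\<^sub>E {..n}"
 have cR: "countable ?R" by (intro countable_finite finite_PiE) auto
 have t: "(\<lambda>u. tup k (rank n u) I) \<in> measurable ?M (count_space ?R)"
  unfolding measurable_count_space_eq_countable[OF cR]
 proof (intro conjI ballI funcsetI)
  fix a
  have [measurable]: "(\<lambda>u. rank n u (I j)) \<in> measurable ?M (count_space UNIV)" if "j \<in> {..k}" for j
   using tuplesD(2)[OF I] that J by (intro rank_measurable[OF id J]) auto
  assume a: "a \<in> ?R"
  then have "(\<lambda>u. tup k (rank n u) I) -` {a} \<inter> space ?M = {u \<in> space ?M. \<forall>j\<in>{..k}. rank n u (I j) = a j}"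
   by (fastforce simp: tup_def fun_eq_iff PiE_iff extensional_def)
  also have "... \<in> sets ?M" by measurable
  finally show "(\<lambda>u. tup k (rank n u) I) -` {a} \<inter> space ?M \<in> sets ?M" .
 qed (rule tup_rank_in)
 show ?thesis unfolding score_at_def
 proof (rule measurable_compose_countable'[OF _ t cR])
  fix i assume "i \<in> ?R"
  show "(\<lambda>u. a n (n_below c n u) (n_above c n u) i) \<in> borel_measurable ?M"
  proof (rule measurable_compose_countable[OF _ n_below_measurable[OF id J]])
   show "(\<lambda>u. a n \<eta> (n_above c n u) i) \<in> borel_measurable ?M" for \<eta>
    by (rule measurable_compose[OF n_above_measurable[OF id J]]) simp
  qed
 qed
qed

lemma score_at_permute:
 assumes "per permutes {1..n}"
 shows "score_at k a n c (u \<circ> per) I = score_at k a n c u (tup k per I)"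
 using assms by (simp add: score_at_def n_below_permute n_above_permute rank_permute' tup_comp)

lemma tup_cong: "(\<And>j. j <= k ==> u (I j) = v (I j)) ==> tup k u I = tup k v I"
 by (auto simp: tup_def)

lemma score_at_cong:
 assumes "\<And>i. i \<in> {1..n} ==> u i = v i" "I \<in> tuples k n"
 shows "score_at k a n c u I = score_at k a n c v I"
proof -
 have "tup k (rank n u) I = tup k (rank n v) I"
  by (intro tup_cong rank_cong assms tuplesD(2)[OF assms(2)])
 then show ?thesis unfolding score_at_def
  using n_below_cong[of n u v c, OF assms(1)] n_above_cong[of n u v c, OF assms(1)] by simp
qed

lemma phi_tup_measurable:
 assumes g: "g \<in> borel_measurable (cube k)" and I: "I \<in> tuples k n" and J: "{1..n} \<subseteq> J"
 shows "(\<lambda>u. g (tup k u I)) \<in> borel_measurable (unif J)"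
proof -
 have "\<And>j. j <= k ==> I j \<in> J" using tuplesD(2)[OF I] J by blast
 then show ?thesis by (rule measurable_compose[OF tup_measurable g[unfolded cube_def]])
qed

lemma phi_tup_measurable':
 assumes g: "g \<in> borel_measurable (cube k)" and I: "I \<in> tuples k n"
 shows "(\<lambda>u. g (tup k u I)) \<in> borel_measurable uniform_seq"
 unfolding uniform_seq_def by (rule phi_tup_measurable[OF g I]) auto

lemma
 assumes I: "I \<in> tuples k n" and g: "g \<in> borel_measurable (cube k)"
 shows integral_tup: "(EU u. (g (tup k u I) :: real)) = (LINT w|cube k. g w)"
  and integrable_tup: "integrable uniform_seq (\<lambda>u. (g (tup k u I) :: real)) \<longleftrightarrow> integrable (cube k) g"
proof -
 have 1: "distr uniform_seq (cube k) (\<lambda>u. tup k u I) = cube k"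
  by (rule distr_tup) (use tuplesD[OF I] in auto)
 have 2: "(\<lambda>u. tup k u I) \<in> measurable uniform_seq (cube k)"
  by (rule tup_measurable_cube) (use tuplesD(2)[OF I] in auto)
 show "(EU u. (g (tup k u I) :: real)) = (LINT w|cube k. g w)"
  using integral_distr[OF 2 g] 1 by simp
 show "integrable uniform_seq (\<lambda>u. (g (tup k u I) :: real)) \<longleftrightarrow> integrable (cube k) g"
  using integrable_distr_eq[OF 2 g] 1 by simp
qed

context
 fixes k :: nat and a :: score and phi :: "(nat => real) => real"
 assumes phi: "square_integrable k phi"
begin

lemma phi_facts:
 "phi \<in> borel_measurable (cube k)" "integrable (cube k) (\<lambda>u. (phi u)^2)" "integrable (cube k) phi"
proof -
 show 1: "phi \<in> borel_measurable (cube k)" "integrable (cube k) (\<lambda>u. (phi u)^2)"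
  using phi by (simp_all add: square_integrable_def)
 show "integrable (cube k) phi" by (rule CU.square_integrable_imp_integrable[OF 1])
qed

lemma score_diff_measurable:
 assumes "{1..n} \<subseteq> J" "I \<in> tuples k n"
 shows "(\<lambda>u. score_diff k a phi n u I) \<in> borel_measurable (unif J)"
 unfolding score_diff_def
 using score_at_measurable[OF id_uniform01 assms, of a "1/2"] phi_tup_measurable[OF phi_facts(1) assms(2,1)] by auto

lemma uniform_stat_measurable:
 assumes "{1..n} \<subseteq> J"
 shows "uniform_stat k a n \<in> borel_measurable (unif J)"
 unfolding uniform_stat_def[abs_def]
 using score_at_measurable[OF id_uniform01 assms lag_index_in_tuples, of k _ a "1/2"] by auto

lemma lag_avg_measurable:
 assumes "{1..n} \<subseteq> J" "g \<in> borel_measurable (cube k)"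
 shows "lag_avg k g n \<in> borel_measurable (unif J)"
 unfolding lag_avg_def[abs_def]
 using phi_tup_measurable[OF assms(2) lag_index_in_tuples assms(1)] by auto

lemma U_stat_measurable:
 assumes "{1..n} \<subseteq> J" "g \<in> borel_measurable (cube k)"
 shows "U_stat k g n \<in> borel_measurable (unif J)"
 unfolding U_stat_def[abs_def] tuple_avg_def
 using phi_tup_measurable[OF assms(2) _ assms(1)] by auto

lemma score_diff_square_integrable:
 assumes I: "I \<in> tuples k n"
 shows "integrable uniform_seq (\<lambda>u. (score_diff k a phi n u I)^2)"
proof -
 have [measurable]: "(\<lambda>u. score_diff k a phi n u I) \<in> borel_measurable uniform_seq"
  unfolding uniform_seq_def by (rule score_diff_measurable) (use I in auto)
 have i: "integrable uniform_seq (\<lambda>u. (phi (tup k u I))^2)"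
  using integrable_tup[OF I, of "\<lambda>w. (phi w)^2"] phi_facts by auto
 show ?thesis
 proof (rule L1_integrable_bound)
  show "integrable uniform_seq (\<lambda>u. 2 * (score_bound k a n)^2 + 2 * (phi (tup k u I))^2)"
   using i by auto
  show "AE u in uniform_seq. norm ((score_diff k a phi n u I)^2) <= norm (2 * (score_bound k a n)^2 + 2 * (phi (tup k u I))^2)"
  proof (rule AE_I2)
   fix u
   let ?s = "score_at k a n (1/2) u I"
   have "?s^2 <= (score_bound k a n)^2"
    using power_mono[OF score_at_bounded[of k a n "1/2" u I] abs_ge_zero, of 2] by simp
   moreover have "(score_diff k a phi n u I)^2 <= 2 * ?s^2 + 2 * (phi (tup k u I))^2"
    unfolding score_diff_def using sum_squares_bound[of ?s "- phi (tup k u I)"] by (simp add: power2_diff)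
   ultimately show "norm ((score_diff k a phi n u I)^2) <= norm (2 * (score_bound k a n)^2 + 2 * (phi (tup k u I))^2)"
    by simp
  qed
 qed auto
qed

lemma score_diff_equivariant:
 "equivariant M k n (score_diff k a phi n)"
 by (rule equivariantI) (simp add: score_diff_def score_at_permute tup_comp)

lemma score_diff_cong:
 assumes "\<And>i. i \<in> {1..n} ==> u i = v i" "I \<in> tuples k n"
 shows "score_diff k a phi n u I = score_diff k a phi n v I"
proof -
 have "tup k u I = tup k v I" by (intro tup_cong assms tuplesD(2)[OF assms(2)])
 then show ?thesis using score_at_cong[OF assms] by (simp add: score_diff_def)
qed

lemma score_diff_lag_avg:
 "(\<Sum>t=k+1..n. score_diff k a phi n u (lag_index k t)) / (real n - real k) = uniform_stat k a n u - lag_avg k phi n u"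
 by (simp add: score_diff_def sum_subtractf diff_divide_distrib uniform_stat_def lag_avg_def)

lemma score_diff_tuple_avg:
 "tuple_avg k n (score_diff k a phi n u) = tuple_avg k n (score_at k a n (1/2) u) - U_stat k phi n u"
 unfolding tuple_avg_def U_stat_def by (simp add: score_diff_def[abs_def] sum_subtractf diff_divide_distrib)

text \<open>Conditional Chebyshev inequality: \<open>permutation_variance\<close> is applied on the symmetric event that the
 mean square of \<open>score_diff\<close> over all tuples is small.\<close>

lemma score_diff_negligible:
 assumes sg: "small_oP (\<lambda>n. uniform_seq) (\<lambda>n u. tuple_avg k n (\<lambda>I. (score_diff k a phi n u I)^2)) (\<lambda>n. 1)"
 shows "small_oP (\<lambda>n. uniform_seq)
  (\<lambda>n u. uniform_stat k a n u - lag_avg k phi n u - tuple_avg k n (score_diff k a phi n u)) (\<lambda>n. 1 / sqrt (real n))"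
 unfolding small_oP_def
proof (intro allI impI)
 fix eps :: real assume eps: "eps > 0"
 let ?W = "\<lambda>n u. uniform_stat k a n u - lag_avg k phi n u - tuple_avg k n (score_diff k a phi n u)"
 let ?B = "\<lambda>n. {u \<in> space uniform_seq. \<bar>?W n u\<bar> > eps * \<bar>1 / sqrt (real n)\<bar>}"
 let ?D = "\<lambda>n u. tuple_avg k n (\<lambda>I. (score_diff k a phi n u I)^2)"
 have dm[measurable]: "(\<lambda>u. score_diff k a phi n u I) \<in> borel_measurable uniform_seq" if "I \<in> tuples k n" for n I
  unfolding uniform_seq_def by (rule score_diff_measurable) (use that in auto)
 have Dm[measurable]: "?D n \<in> borel_measurable uniform_seq" for n
  unfolding tuple_avg_def[abs_def] by auto
 have am[measurable]: "(\<lambda>u. tuple_avg k n (score_diff k a phi n u)) \<in> borel_measurable uniform_seq" for n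
  unfolding tuple_avg_def[abs_def] by auto
 have Wm[measurable]: "?W n \<in> borel_measurable uniform_seq" for n
 proof -
  have [measurable]: "uniform_stat k a n \<in> borel_measurable uniform_seq" "lag_avg k phi n \<in> borel_measurable uniform_seq"
   unfolding uniform_seq_def by (auto intro!: uniform_stat_measurable lag_avg_measurable phi_facts)
  show ?thesis by measurable
 qed
 show "(\<lambda>n. measure uniform_seq (?B n)) \<longlonglongrightarrow> 0"
 proof (rule order_tendstoI)
  fix c :: real assume "c < 0"
  then show "\<forall>\<^sub>F n in sequentially. c < measure uniform_seq (?B n)"
   by (intro always_eventually allI less_le_trans[OF _ measure_nonneg])
 next
  fix \<delta> :: real assume \<delta>: "0 < \<delta>"
  \<comment> \<open>Chosen so that \<open>6 (k+1)^2 \<eta> / eps^2 = \<delta> / 2\<close> in the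
    final Chebyshev bound; the factor \<open>6 (k+1)^2\<close> is that of
    \<open>permutation_variance\<close>.\<close>
  define \<eta> where "\<eta> = eps^2 * \<delta> / (12 * (real k + 1)^2)"
  have \<eta>: "\<eta> > 0" using eps \<delta> by (simp add: \<eta>_def)
  have "(\<lambda>n. measure uniform_seq {u \<in> space uniform_seq. \<bar>?D n u\<bar> > \<eta> * \<bar>1\<bar>}) \<longlonglongrightarrow> 0"
   using sg \<eta> unfolding small_oP_def by blast
  then have "\<forall>\<^sub>F n in sequentially. measure uniform_seq {u \<in> space uniform_seq. \<bar>?D n u\<bar> > \<eta> * \<bar>1\<bar>} < \<delta> / 2"
   using \<delta> by (intro order_tendstoD(2)) auto
  moreover have "\<forall>\<^sub>F n in sequentially. n >= 2 * (k + 1)^2" by (rule eventually_ge_at_top)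
  ultimately show "\<forall>\<^sub>F n in sequentially. measure uniform_seq (?B n) < \<delta>"
  proof eventually_elim
   case (elim n)
   have "(k + 1) <= (k + 1)^2" by (simp add: power2_eq_square)
   also have "... <= 2 * (k + 1)^2" by simp
   finally have nk: "k + 1 <= n" using elim(2) by (rule order_trans)
   define G where "G = {u \<in> space uniform_seq. ?D n u <= \<eta>}"
   have Gm[measurable]: "G \<in> sets uniform_seq" unfolding G_def by measurable
   let ?e = "\<lambda>u I. indicator G u * score_diff k a phi n u I"
   have eqv: "equivariant uniform_seq k n ?e"
   proof (rule equivariantI)
    fix per u I assume s: "per permutes {1..n}" and u: "u \<in> space uniform_seq" and I: "I \<in> tuples k n"
    have sp: "u \<circ> per \<in> space uniform_seq"
     using permute_in_space[OF s, of "{1..}" u uniform01] u by (auto simp: uniform_seq_def)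
    have "equivariant uniform_seq k n (\<lambda>u I. (score_diff k a phi n u I)^2)"
     using score_diff_equivariant[of uniform_seq n] by (simp add: equivariant_def)
    from equivariant_avg[OF this s u] have "indicator G (u \<circ> per) = (indicator G u :: real)"
     using u sp by (simp add: G_def indicator_def)
    then show "?e (u \<circ> per) I = ?e u (tup k per I)"
     using equivariantD[OF score_diff_equivariant s u I] by simp
   qed
   have em: "(\<lambda>u. ?e u I) \<in> borel_measurable uniform_seq" if "I \<in> tuples k n" for I
    using that by measurable
   have esq: "integrable uniform_seq (\<lambda>u. (?e u I)^2)" if I: "I \<in> tuples k n" for I
   proof -
    have "(\<lambda>u. (?e u I)^2) = (\<lambda>u. indicator G u * (score_diff k a phi n u I)^2)"
     by (auto simp: indicator_def)
    then show ?thesis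
     using integrable_mult_indicator[OF Gm score_diff_square_integrable[OF I]] by simp
   qed
   let ?I0 = "lag_index k n"
   have I0: "?I0 \<in> tuples k n" using nk by (intro lag_index_in_tuples) auto
   have avg: "tuple_avg k n (?e u) = indicator G u * tuple_avg k n (score_diff k a phi n u)" for u
    unfolding tuple_avg_def by (simp add: sum_distrib_left)
   have lag: "(\<Sum>t=k+1..n. ?e u (lag_index k t)) / (real n - real k) - tuple_avg k n (?e u)
     = indicator G u * ?W n u" for u
   proof -
    have "(\<Sum>t=k+1..n. ?e u (lag_index k t)) / (real n - real k)
     = indicator G u * ((\<Sum>t=k+1..n. score_diff k a phi n u (lag_index k t)) / (real n - real k))"
     by (simp only: sum_distrib_left times_divide_eq_right)
    then show ?thesis unfolding avg score_diff_lag_avg by (simp add: algebra_simps)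
   qed
   have A: "(EU u. (indicator G u * ?W n u)^2)
     <= 6 * (real k + 1)^2 / real n * (EU u. (?e u ?I0)^2)"
    using permutation_variance[OF prob_space_uniform01, of n "{1..}" k ?e ?I0] eqv em esq elim(2) I0
    unfolding lag uniform_seq_def by auto
   \<comment> \<open>By exchangeability the second moment at a single tuple is the mean of the
     average over all tuples, which is at most \<open>\<eta>\<close> on \<open>G\<close> and cut off
     elsewhere.\<close>
   have B: "(EU u. (?e u ?I0)^2) <= \<eta>"
   proof -
    have "(EU u. (?e u ?I0)^2) * real (card (tuples k n)) = (EU u. (\<Sum>I\<in>tuples k n. (?e u I)^2))"
     unfolding uniform_seq_def
     by (rule integral_equivariant_sum[OF prob_space_uniform01 _ _ _ I0, where e = "\<lambda>u I. (?e u I)^2"])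
       (use eqv esq in \<open>auto simp: equivariant_def uniform_seq_def\<close>)
    also have "... <= (EU u. \<eta> * real (card (tuples k n)))"
    proof (rule integral_mono)
     show "integrable uniform_seq (\<lambda>u. \<Sum>I\<in>tuples k n. (?e u I)^2)" using esq by auto
     fix u assume u: "u \<in> space uniform_seq"
     have c: "real (card (tuples k n)) > 0" using card_tuples_pos[of k n] nk by simp
     show "(\<Sum>I\<in>tuples k n. (?e u I)^2) <= \<eta> * real (card (tuples k n))"
     proof (cases "u \<in> G")
      case True
      then have "?D n u <= \<eta>" by (simp add: G_def)
      then show ?thesis using True c by (simp add: tuple_avg_def field_simps)
     qed (use \<eta> in simp)
    qed auto
    also have "... = \<eta> * real (card (tuples k n))" using US.prob_space by simp
    finally show ?thesis using card_tuples_pos[of k n] nk by simp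
   qed
   have main: "(EU u. (indicator G u * ?W n u)^2) <= 6 * (real k + 1)^2 / real n * \<eta>"
    by (rule order_trans[OF A]) (intro mult_left_mono B; simp)
   have Wsq: "integrable uniform_seq (\<lambda>u. (indicator G u * ?W n u)^2)"
   proof -
    have "integrable uniform_seq (\<lambda>u. (\<Sum>t=k+1..n. ?e u (lag_index k t) / (real n - real k) - tuple_avg k n (?e u) / (real n - real k))^2)"
    proof (rule integrable_sum_square(1))
     fix t assume t: "t \<in> {k+1..n}"
     have lt: "lag_index k t \<in> tuples k n" using t by (intro lag_index_in_tuples) auto
     have asq: "integrable uniform_seq (\<lambda>u. (tuple_avg k n (?e u))^2)"
      unfolding tuple_avg_def power_divide
      using integrable_sum_square(1)[of "tuples k n" "\<lambda>I u. ?e u I" uniform_seq] em esq by auto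
     have am': "(\<lambda>u. tuple_avg k n (?e u)) \<in> borel_measurable uniform_seq"
      unfolding avg by measurable
     show "(\<lambda>u. ?e u (lag_index k t) / (real n - real k) - tuple_avg k n (?e u) / (real n - real k)) \<in> borel_measurable uniform_seq"
      using em[OF lt] am' by auto
     show "integrable uniform_seq (\<lambda>u. (?e u (lag_index k t) / (real n - real k) - tuple_avg k n (?e u) / (real n - real k))^2)"
      unfolding diff_divide_distrib[symmetric] power_divide power2_diff
      using esq[OF lt] asq integrable_product_of_squares[OF em[OF lt] am' esq[OF lt] asq]
      by (auto simp: mult.assoc)
    qed
    also have "(\<lambda>u. (\<Sum>t=k+1..n. ?e u (lag_index k t) / (real n - real k) - tuple_avg k n (?e u) / (real n - real k))^2)
     = (\<lambda>u. (indicator G u * ?W n u)^2)"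
    proof
     fix u
     have "(\<Sum>t=k+1..n. ?e u (lag_index k t) / (real n - real k) - tuple_avg k n (?e u) / (real n - real k))
      = (\<Sum>t=k+1..n. ?e u (lag_index k t)) / (real n - real k) - tuple_avg k n (?e u)"
      using nk by (simp add: sum_subtractf sum_divide_distrib[symmetric] of_nat_diff)
     then show "(\<Sum>t=k+1..n. ?e u (lag_index k t) / (real n - real k) - tuple_avg k n (?e u) / (real n - real k))^2
      = (indicator G u * ?W n u)^2" unfolding lag by simp
    qed
    finally show ?thesis .
   qed
   have n0: "real n > 0" using nk by auto
   have "measure uniform_seq (?B n) <= measure uniform_seq ({u \<in> space uniform_seq. \<bar>?D n u\<bar> > \<eta> * \<bar>1\<bar>}
      \<union> {u \<in> space uniform_seq. eps^2 / real n <= (indicator G u * ?W n u)^2})"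
   proof (rule US.finite_measure_mono)
    show "?B n \<subseteq> {u \<in> space uniform_seq. \<bar>?D n u\<bar> > \<eta> * \<bar>1\<bar>} \<union> {u \<in> space uniform_seq. eps^2 / real n <= (indicator G u * ?W n u)^2}"
    proof
     fix u assume u: "u \<in> ?B n"
     show "u \<in> {u \<in> space uniform_seq. \<bar>?D n u\<bar> > \<eta> * \<bar>1\<bar>} \<union> {u \<in> space uniform_seq. eps^2 / real n <= (indicator G u * ?W n u)^2}"
     proof (cases "u \<in> G")
      case True
      have "eps / sqrt (real n) <= \<bar>?W n u\<bar>" using u by auto
      then have "(eps / sqrt (real n))^2 <= (?W n u)^2"
       using power_mono[of "eps / sqrt (real n)" "\<bar>?W n u\<bar>" 2] eps by simp
      then show ?thesis using True u by (simp add: power_divide)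
     qed (use u in \<open>auto simp: G_def\<close>)
    qed
   qed measurable
   also have "... <= measure uniform_seq {u \<in> space uniform_seq. \<bar>?D n u\<bar> > \<eta> * \<bar>1\<bar>}
      + measure uniform_seq {u \<in> space uniform_seq. eps^2 / real n <= (indicator G u * ?W n u)^2}"
    by (rule measure_Un_le) measurable
   also have "measure uniform_seq {u \<in> space uniform_seq. eps^2 / real n <= (indicator G u * ?W n u)^2}
     <= (EU u. (indicator G u * ?W n u)^2) / (eps^2 / real n)"
    by (rule integral_Markov_inequality_measure[OF Wsq, where A = "{}"]) (use eps n0 in auto)
   also have "... <= (6 * (real k + 1)^2 / real n * \<eta>) / (eps^2 / real n)"
    using main n0 eps by (intro divide_right_mono) auto
   also have "... = \<delta> / 2"
    using n0 eps by (simp add: \<eta>_def)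
   finally show "measure uniform_seq (?B n) < \<delta>" using elim(1) by linarith
  qed
 qed
qed

end

declare permute_measurable[measurable del] tup_measurable[measurable del] tup_measurable_cube[measurable del]

section \<open>The step kernel of the signs\<close>

definition pattern :: "nat => (nat => real) => nat set" where
 "pattern k w = {j \<in> {..k}. 1/2 <= w j}"

definition orth_int :: "nat => ((nat => real) => real) => nat set => real" where
 "orth_int k phi A = (LINT w|cube k. of_bool (pattern k w = A) * phi w)"

text \<open>The conditional expectation of \<open>phi\<close> given in which half each coordinate
  lies; \<open>2 ^ (k + 1)\<close> is the reciprocal of the measure of an orthant.\<close>

definition step_kernel :: "nat => ((nat => real) => real) => (nat => real) => real" where
 "step_kernel k phi w = 2 ^ (k + 1) * orth_int k phi (pattern k w)"

definition sign_value :: "nat => ((nat => real) => real) => nat => nat => nat => real" where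
 "sign_value k phi n \<eta> \<nu> =
   2 ^ (k + 1) / falling n (k + 1) *
    (of_bool (\<eta> >= k + 1) * falling \<eta> (k + 1) * mu_part k phi 0
    + (\<Sum>m=1..k. of_bool (k + 1 - m <= \<eta> \<and> \<eta> <= n - m) * falling \<eta> (k + 1 - m) * falling \<nu> m * mu_part k phi m)
    + of_bool (\<nu> >= k + 1) * falling \<nu> (k + 1) * mu_part k phi (k + 1))"

lemma sign_term_eq: "sign_term k phi n z = sign_value k phi n (N_minus n z) (N_plus n z)"
 by (simp add: sign_term_def sign_value_def)

lemma AE_uniform01_neq: "AE x in uniform01. x \<noteq> c"
proof (rule AE_I)
 show "{x \<in> space uniform01. \<not> x \<noteq> c} \<subseteq> {c} \<inter> {0<..<1}" by auto
 show "emeasure uniform01 ({c} \<inter> {0<..<1}) = 0" by (rule uniform01_null_point)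
 show "{c} \<inter> {0<..<1} \<in> sets uniform01" by (auto simp: sets_uniform01)
qed

lemma AE_component_neq: "i \<in> J ==> AE u in (unif J). u i \<noteq> c"
 using AE_PiM_component[of J "\<lambda>_. uniform01" i "\<lambda>x. x \<noteq> c"] prob_space_uniform01 AE_uniform01_neq by auto

lemma uniform_component_measurable:
 "i \<in> J ==> (\<lambda>u. u i) \<in> borel_measurable (unif J)"
 by (rule component_borel[OF id_uniform01])

text \<open>Resample coordinate \<open>i\<close> with the others fixed: it would have to hit the
  single point \<open>u j\<close>, a null event.\<close>

lemma AE_components_distinct:
 assumes "i \<in> J" "j \<in> J" "i \<noteq> j"
 shows "AE u in (unif J). u i \<noteq> u j"
proof -
 let ?M = "unif J"
 interpret prob_space ?M by (intro prob_space_PiM prob_space_uniform01)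
 let ?E = "{u \<in> space ?M. u i = u j}"
 note [measurable] = uniform_component_measurable[OF assms(1)] uniform_component_measurable[OF assms(2)]
 have m[measurable]: "?E \<in> sets ?M" by measurable
 have "emeasure ?M ?E = (\<integral>\<^sup>+u. indicator ?E u \<partial>?M)" by simp
 also have "... = (\<integral>\<^sup>+u. \<integral>\<^sup>+v. indicator ?E (mix {i} v u) \<partial>?M \<partial>?M)"
  by (rule nn_integral_mix[symmetric]) (auto intro: prob_space_uniform01)
 also have "... = (\<integral>\<^sup>+u. 0 \<partial>?M)"
 proof (rule nn_integral_cong)
  fix u assume u: "u \<in> space ?M"
  have "AE v in ?M. v i \<noteq> u j" using assms by (intro AE_component_neq)
  then have "AE v in ?M. indicator ?E (mix {i} v u) = (0::ennreal)"
   by eventually_elim (use assms in \<open>auto simp: mix_def indicator_def\<close>)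
  then have "(\<integral>\<^sup>+v. indicator ?E (mix {i} v u) \<partial>?M) = (\<integral>\<^sup>+v. 0 \<partial>?M)"
   by (rule nn_integral_cong_AE)
  then show "(\<integral>\<^sup>+v. indicator ?E (mix {i} v u) \<partial>?M) = 0" by simp
 qed
 finally show ?thesis by (intro AE_I[of _ _ ?E]) (auto simp: m)
qed

text \<open>Off this null set the ranks form a permutation of \<open>{1..n}\<close> and the two sign
  counts add up to \<open>n\<close>.\<close>

lemma AE_generic:
 fixes n :: nat
 assumes "{1..n} \<subseteq> J"
 shows "AE u in (unif J). inj_on u {1..n} \<and> (\<forall>i\<in>{1..n}. u i \<noteq> 1/2)"
proof -
 have "AE u in (unif J). \<forall>i\<in>{1..n}. \<forall>j\<in>{1..n}. i \<noteq> j --> u i \<noteq> u j"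
 proof (intro AE_finite_allI finite_atLeastAtMost)
  fix i j assume "i \<in> {1..n}" "j \<in> {1..n}"
  then show "AE u in (unif J). i \<noteq> j --> u i \<noteq> u j"
   using AE_components_distinct[of i J j] subsetD[OF assms, of i] subsetD[OF assms, of j]
   by (cases "i = j") simp_all
 qed
 moreover have "AE u in (unif J). \<forall>i\<in>{1..n}. u i \<noteq> 1/2"
  by (intro AE_finite_allI finite_atLeastAtMost AE_component_neq) (use assms in auto)
 ultimately show ?thesis by eventually_elim (auto simp: inj_on_def)
qed

lemma distr_tup_PiM:
 assumes I: "I \<in> tuples k n" and J: "{1..n} \<subseteq> J"
 shows "distr (unif J) (cube k) (\<lambda>u. tup k u I) = cube k"
 unfolding cube_def tup_def
 by (rule distr_PiM_reindex) (use tuplesD[OF I] J prob_space_uniform01 in auto)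

lemma tup_measurable_PiM:
 assumes I: "I \<in> tuples k n" and J: "{1..n} \<subseteq> J"
 shows "(\<lambda>u. tup k u I) \<in> measurable (unif J) (cube k)"
 unfolding cube_def using tuplesD(2)[OF I] J by (intro tup_measurable) auto

lemma
 assumes I: "I \<in> tuples k n" and J: "{1..n} \<subseteq> J" and g: "g \<in> borel_measurable (cube k)"
 shows integral_tup_PiM: "(LINT u|(unif J). (g (tup k u I) :: real)) = (LINT w|cube k. g w)"
  and integrable_tup_PiM: "integrable (unif J) (\<lambda>u. (g (tup k u I) :: real)) \<longleftrightarrow> integrable (cube k) g"
 using integral_distr[OF tup_measurable_PiM[OF I J] g] integrable_distr_eq[OF tup_measurable_PiM[OF I J] g]
 by (simp_all add: distr_tup_PiM[OF I J])

lemma pattern_subset: "pattern k w \<subseteq> {..k}"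
 by (auto simp: pattern_def)

lemma cube_halfspaces:
 assumes "j <= k"
 shows "{w \<in> space (cube k). c <= w j} \<in> sets (cube k)" "{w \<in> space (cube k). w j <= c} \<in> sets (cube k)"
  "{w \<in> space (cube k). w j < c} \<in> sets (cube k)"
proof -
 have "(\<lambda>w. w j) \<in> borel_measurable (cube k)"
  unfolding cube_def using assms by (intro uniform_component_measurable) simp
 then show "{w \<in> space (cube k). c <= w j} \<in> sets (cube k)" "{w \<in> space (cube k). w j <= c} \<in> sets (cube k)"
  "{w \<in> space (cube k). w j < c} \<in> sets (cube k)"
  by (intro borel_measurable_le borel_measurable_less borel_measurable_const; assumption)+
qed

lemma pattern_measurable: "pattern k \<in> measurable (cube k) (count_space (Pow {..k}))"
proof -
 have c: "countable (Pow {..k})" by (intro countable_finite) simp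
 show ?thesis
  unfolding measurable_count_space_eq_countable[OF c]
 proof (intro conjI ballI funcsetI)
  show "pattern k w \<in> Pow {..k}" for w by (rule PowI) (rule pattern_subset)
 next
  fix A assume "A \<in> Pow {..k}"
  then have "pattern k -` {A} \<inter> space (cube k) = {w \<in> space (cube k). \<forall>j\<in>{..k}. (1/2 <= w j) = (j \<in> A)}"
   unfolding pattern_def by blast
  also have "... \<in> sets (cube k)"
  proof (rule sets.sets_Collect_finite_All)
   fix j assume "j \<in> {..k}"
   then show "{w \<in> space (cube k). (1/2 <= w j) = (j \<in> A)} \<in> sets (cube k)"
    using cube_halfspaces[of j k "1/2"] by (cases "j \<in> A") (simp_all add: not_le)
  qed simp
  finally show "pattern k -` {A} \<inter> space (cube k) \<in> sets (cube k)" .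
 qed
qed

lemma pattern_fun_measurable:
 fixes c :: "nat set => real"
 shows "(\<lambda>w. c (pattern k w)) \<in> borel_measurable (cube k)"
proof -
 have "c \<in> measurable (count_space (Pow {..k})) borel" by simp
 from measurable_compose[OF pattern_measurable this] show ?thesis .
qed

lemma pattern_decomposition:
 fixes c :: "nat set => real"
 shows "c (pattern k w) = (\<Sum>A\<in>Pow {..k}. c A * of_bool (pattern k w = A))"
proof -
 have "(\<Sum>A\<in>Pow {..k}. c A * of_bool (pattern k w = A)) = (\<Sum>A\<in>Pow {..k}. if pattern k w = A then c A else 0)"
  by (intro sum.cong) auto
 then show ?thesis using pattern_subset[of k w] by (subst (asm) sum.delta') auto
qed

lemma integral_pattern_eq:
 assumes "A \<subseteq> {..k}"
 shows "(LINT w|cube k. of_bool (pattern k w = A)) = (1/2 :: real) ^ (k + 1)"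
proof -
 interpret finite_product_prob_space "\<lambda>_. uniform01" "{..k}" by unfold_locales auto
 let ?S = "\<lambda>j. if j \<in> A then {x \<in> {0<..<1}. 1/2 <= x} else {x \<in> {0<..<1}. x < (1/2::real)}"
 have e: "{w \<in> space (cube k). pattern k w = A} = Pi\<^sub>E {..k} ?S"
 proof (intro set_eqI iffI)
  fix w assume "w \<in> {w \<in> space (cube k). pattern k w = A}"
  then show "w \<in> Pi\<^sub>E {..k} ?S"
   by (auto simp: space_cube pattern_def PiE_iff)
 next
  fix w assume w: "w \<in> Pi\<^sub>E {..k} ?S"
  have "1/2 <= w j \<longleftrightarrow> j \<in> A" if "j <= k" for j
   using PiE_mem[OF w, of j] that by (auto split: if_splits)
  moreover have "w j \<in> {0<..<1}" if "j <= k" for j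
   using PiE_mem[OF w, of j] that by (auto split: if_splits)
  ultimately show "w \<in> {w \<in> space (cube k). pattern k w = A}"
   using w assms by (auto simp: space_cube pattern_def PiE_iff)
 qed
 have mS: "?S j \<in> sets uniform01" for j by (auto simp: sets_uniform01)
 have half: "measure uniform01 {x \<in> {0<..<1}. x < (1/2::real)} = 1/2"
  by (rule measure_uniform01_Iio) auto
 have "measure uniform01 {x \<in> {0<..<1}. 1/2 <= (x::real)} = 1 - measure uniform01 {x \<in> {0<..<1}. x < (1/2::real)}"
  by (subst U01.prob_compl[symmetric]) (auto simp: sets_uniform01 intro!: arg_cong2[of _ _ _ _ measure])
 then have half': "measure uniform01 {x \<in> {0<..<1}. 1/2 <= (x::real)} = 1/2" using half by simp
 have "(LINT w|cube k. of_bool (pattern k w = A)) = (LINT w|cube k. indicator {w \<in> space (cube k). pattern k w = A} w)"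
  by (intro L1_integral_cong) (auto simp: indicator_def)
 also have "... = measure (cube k) (Pi\<^sub>E {..k} ?S)"
  unfolding e using sets_PiM_I_finite[of "{..k}" ?S "\<lambda>_. uniform01"] mS
  by (simp add: cube_def sets.Int_space_eq1)
 also have "... = (\<Prod>j\<in>{..k}. measure uniform01 (?S j))"
  unfolding cube_def using mS by (intro prob_times) auto
 also have "... = (\<Prod>j\<in>{..k}. 1/2)" by (intro prod.cong refl) (simp only: half half' split: if_split, simp)
 finally show ?thesis by simp
qed

text \<open>\<open>mu_part\<close> integrates over closed orthants, which share boundaries, whereas
  patterns are disjoint; the two differ only where some coordinate equals 1/2.\<close>

lemma orth_int_eq:
 assumes phi: "phi \<in> borel_measurable (cube k)" and A: "A \<subseteq> {..k}"
 shows "(LINT u:{u \<in> space (cube k). (\<forall>j\<in>A. 1/2 <= u j) \<and> (\<forall>j\<in>{..k} - A. u j <= 1/2)}|cube k. phi u) = orth_int k phi A"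
proof -
 have j: "j \<in> A ==> j \<in> {..k}" for j using A by auto
 have fA: "finite A" using A finite_subset by auto
 have g: "AE w in cube k. \<forall>j\<in>{..k}. w j \<noteq> 1/2"
  unfolding cube_def by (intro AE_finite_allI finite_atMost AE_component_neq)
 have pm: "(\<lambda>w. of_bool (pattern k w = A) * phi w) \<in> borel_measurable (cube k)"
  by (rule borel_measurable_times[OF pattern_fun_measurable[of "\<lambda>B. of_bool (B = A)"] phi])
 show ?thesis unfolding orth_int_def set_lebesgue_integral_def
 proof (rule integral_cong_AE)
  show "(\<lambda>x. indicat_real {u \<in> space (cube k). (\<forall>j\<in>A. 1 / 2 <= u j) \<and> (\<forall>j\<in>{..k} - A. u j <= 1 / 2)} x *\<^sub>R phi x) \<in> borel_measurable (cube k)"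
  proof (intro borel_measurable_scaleR borel_measurable_indicator phi sets.sets_Collect_conj sets.sets_Collect_finite_All)
   show "{x \<in> space (cube k). 1 / 2 <= x i} \<in> sets (cube k)" if "i \<in> A" for i
    using j[OF that] by (intro cube_halfspaces) simp
   show "{x \<in> space (cube k). x i <= 1 / 2} \<in> sets (cube k)" if "i \<in> {..k} - A" for i
    using that by (intro cube_halfspaces) simp
  qed (use fA in simp_all)
  show "AE x in cube k. indicat_real {u \<in> space (cube k). (\<forall>j\<in>A. 1 / 2 <= u j) \<and> (\<forall>j\<in>{..k} - A. u j <= 1 / 2)} x *\<^sub>R phi x =
     of_bool (pattern k x = A) * phi x"
   using g AE_space
  proof eventually_elim
   case (elim w)
   have "pattern k w = A \<longleftrightarrow> (\<forall>j\<in>{..k}. (1/2 <= w j) = (j \<in> A))"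
    unfolding pattern_def using A by blast
   also have "... \<longleftrightarrow> (\<forall>j\<in>{..k}. (j \<in> A --> 1/2 <= w j) \<and> (j \<notin> A --> w j <= 1/2))"
    using elim(1) by (intro ball_cong refl) force
   also have "... \<longleftrightarrow> (\<forall>j\<in>A. 1/2 <= w j) \<and> (\<forall>j\<in>{..k} - A. w j <= 1/2)"
    using A by blast
   finally show ?case using elim by (auto simp: indicator_def)
  qed
 qed (rule pm)
qed

lemma mu_part_eq:
 assumes "phi \<in> borel_measurable (cube k)"
 shows "mu_part k phi \<nu> = (\<Sum>A | A \<subseteq> {..k} \<and> card A = \<nu>. orth_int k phi A)"
 unfolding mu_part_def by (intro sum.cong refl) (rule orth_int_eq[OF assms], simp)

text \<open>Such a tuple is a pair of injections, of the positions outside \<open>A\<close> into the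
  indices below 1/2 and of \<open>A\<close> into the others; their images cannot meet.\<close>

lemma card_tuples_pattern:
 assumes A: "A \<subseteq> {..k}"
 shows "real (card {I \<in> tuples k n. pattern k (tup k u I) = A})
  = falling (n_below (1/2) n u) (k + 1 - card A) * falling (card {i\<in>{1..n}. 1/2 <= u i}) (card A)"
proof -
 let ?N = "{i\<in>{1..n}. u i < 1/2}" and ?P = "{i\<in>{1..n}. 1/2 <= u i}" and ?B = "{..k} - A"
 let ?X = "{I \<in> tuples k n. pattern k (tup k u I) = A}"
 let ?Y = "{f \<in> ?B \<rightarrow>\<^sub>E ?N. inj_on f ?B} \<times> {f \<in> A \<rightarrow>\<^sub>E ?P. inj_on f A}"
 have fA: "finite A" using A finite_subset by auto
 have pat: "pattern k (tup k u I) = A \<longleftrightarrow> (\<forall>j\<in>{..k}. (1/2 <= u (I j)) = (j \<in> A))" for I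
  using A by (auto simp: pattern_def tup_def)
 have "bij_betw (\<lambda>I. (restrict I ?B, restrict I A)) ?X ?Y"
 proof (rule bij_betwI[where g = "\<lambda>(f, g). \<lambda>j\<in>{..k}. if j \<in> A then g j else f j"])
  show "(\<lambda>I. (restrict I ?B, restrict I A)) \<in> ?X \<rightarrow> ?Y"
  proof
   fix I assume "I \<in> ?X"
   then have I: "I \<in> tuples k n" "\<And>j. j <= k ==> (1/2 <= u (I j)) = (j \<in> A)" by (auto simp: pat)
   have "restrict I ?B \<in> ?B \<rightarrow>\<^sub>E ?N" "restrict I A \<in> A \<rightarrow>\<^sub>E ?P"
    using I(2) tuplesD(2)[OF I(1)] A by (auto simp: subset_iff not_le[symmetric])
   moreover have "inj_on (restrict I ?B) ?B" "inj_on (restrict I A) A"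
    using tuplesD(1)[OF I(1)] A by (auto simp: inj_on_def subset_iff)
   ultimately show "(restrict I ?B, restrict I A) \<in> ?Y" by auto
  qed
  show "(\<lambda>(f, g). \<lambda>j\<in>{..k}. if j \<in> A then g j else f j) \<in> ?Y \<rightarrow> ?X"
  proof clarify
   fix f g assume f: "f \<in> ?B \<rightarrow>\<^sub>E ?N" "inj_on f ?B" and g: "g \<in> A \<rightarrow>\<^sub>E ?P" "inj_on g A"
   let ?I = "\<lambda>j\<in>{..k}. if j \<in> A then g j else f j"
   have fg: "j \<in> A ==> g j \<in> ?P" "j \<in> ?B ==> f j \<in> ?N" for j using f g by auto
   have ne: "g i \<noteq> f j" if "i \<in> A" "j \<in> ?B" for i j
    using fg(1)[OF that(1)] fg(2)[OF that(2)] by auto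
   have "inj_on ?I {..k}"
   proof (rule inj_onI)
    fix i j assume ij: "i \<in> {..k}" "j \<in> {..k}" "?I i = ?I j"
    then show "i = j"
     using f(2) g(2) ne[of i j] ne[of j i] by (auto simp: inj_on_def split: if_splits)
   qed
   moreover have "?I \<in> {..k} \<rightarrow>\<^sub>E {1..n}" using fg by auto
   moreover have "pattern k (tup k u ?I) = A"
    unfolding pat using fg by (auto simp: not_le)
   ultimately show "?I \<in> tuples k n \<and> pattern k (tup k u ?I) = A" by (simp add: tuples_def)
  qed
  show "(case (restrict I ?B, restrict I A) of (f, g) => \<lambda>j\<in>{..k}. if j \<in> A then g j else f j) = I" if "I \<in> ?X" for I
   using that tuplesD(4)[of I k n] by (auto simp: fun_eq_iff extensional_def)
  show "(restrict (case y of (f, g) => \<lambda>j\<in>{..k}. if j \<in> A then g j else f j) ?B,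
    restrict (case y of (f, g) => \<lambda>j\<in>{..k}. if j \<in> A then g j else f j) A) = y" if "y \<in> ?Y" for y
   using that A by (cases y) (auto simp: fun_eq_iff PiE_iff extensional_def restrict_def subset_iff)
 qed
 then have "card ?X = card ?Y" by (rule bij_betw_same_card)
 also have "... = card {f \<in> ?B \<rightarrow>\<^sub>E ?N. inj_on f ?B} * card {f \<in> A \<rightarrow>\<^sub>E ?P. inj_on f A}"
  by (rule card_cartesian_product)
 finally have "real (card ?X) = falling (card ?N) (card ?B) * falling (card ?P) (card A)"
  using card_inj_PiE[of ?B ?N] card_inj_PiE[of A ?P] fA by simp
 moreover have "card ?B = k + 1 - card A" using A fA by (simp add: card_Diff_subset)
 ultimately show ?thesis by (simp add: n_below_def)
qed

lemma falling_eq_0: "x < m ==> falling x m = 0"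
 unfolding falling_def by (intro prod_zero) auto

text \<open>The origin of the bracket of falling factorials in the theorem: the kernel is constant
  on tuples with the same pattern, and their number depends only on the size of the pattern and the
  two counts.\<close>

lemma U_stat_step_kernel:
 assumes phi: "phi \<in> borel_measurable (cube k)" and g: "\<forall>i\<in>{1..n}. u i \<noteq> 1/2"
 shows "U_stat k (step_kernel k phi) n u = sign_value k phi n (n_below (1/2) n u) (n_above (1/2) n u)"
proof -
 let ?\<eta> = "n_below (1/2) n u" and ?\<nu> = "n_above (1/2) n u"
 let ?f = "\<lambda>m. falling ?\<eta> (k + 1 - m) * falling ?\<nu> m"
 have sum: "?\<eta> + ?\<nu> = n" using g by (intro n_below_add_above) auto
 have P: "card {i\<in>{1..n}. 1/2 <= u i} = ?\<nu>"
  unfolding n_above_def using g by (intro arg_cong[of _ _ card]) force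
 have "(\<Sum>I\<in>tuples k n. step_kernel k phi (tup k u I))
   = (\<Sum>I\<in>tuples k n. \<Sum>A\<in>Pow {..k}. 2 ^ (k + 1) * (orth_int k phi A * of_bool (pattern k (tup k u I) = A)))"
  unfolding step_kernel_def
  by (intro sum.cong refl) (subst pattern_decomposition[where c = "orth_int k phi"], simp only: sum_distrib_left)
 also have "... = (\<Sum>A\<in>Pow {..k}. \<Sum>I\<in>tuples k n. 2 ^ (k + 1) * (orth_int k phi A * of_bool (pattern k (tup k u I) = A)))"
  by (rule sum.swap)
 also have "... = (\<Sum>A\<in>Pow {..k}. 2 ^ (k + 1) * (orth_int k phi A * ?f (card A)))"
 proof (rule sum.cong)
  fix A assume A: "A \<in> Pow {..k}"
  have "(\<Sum>I\<in>tuples k n. of_bool (pattern k (tup k u I) = A)) = real (card {I \<in> tuples k n. pattern k (tup k u I) = A})"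
   by (simp add: Int_def of_bool_def sum.If_cases)
  also have "... = ?f (card A)" using card_tuples_pattern[of A k n u] A P by simp
  finally have "(\<Sum>I\<in>tuples k n. of_bool (pattern k (tup k u I) = A)) = ?f (card A)" .
  then show "(\<Sum>I\<in>tuples k n. 2 ^ (k + 1) * (orth_int k phi A * of_bool (pattern k (tup k u I) = A)))
   = 2 ^ (k + 1) * (orth_int k phi A * ?f (card A))"
   by (simp add: sum_distrib_left[symmetric])
 qed simp
 also have "... = 2 ^ (k + 1) * (\<Sum>A\<in>Pow {..k}. orth_int k phi A * ?f (card A))"
  by (simp add: sum_distrib_left)
 also have "(\<Sum>A\<in>Pow {..k}. orth_int k phi A * ?f (card A))
   = (\<Sum>m\<in>{0..k + 1}. \<Sum>A | A \<in> Pow {..k} \<and> card A = m. orth_int k phi A * ?f (card A))"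
 proof (rule sum.group[symmetric])
  show "card ` Pow {..k} \<subseteq> {0..k + 1}"
   using card_mono[of "{..k}"] by fastforce
 qed auto
 also have "... = (\<Sum>m\<in>{0..k + 1}. ?f m * mu_part k phi m)"
  unfolding mu_part_eq[OF phi] sum_distrib_left by (intro sum.cong) (auto simp: mult.commute)
 also have "... = ?f 0 * mu_part k phi 0 + (\<Sum>m=1..k. ?f m * mu_part k phi m) + ?f (k + 1) * mu_part k phi (k + 1)"
  by (simp add: sum.atLeast_Suc_atMost[of 0])
 also have "?f 0 * mu_part k phi 0 = of_bool (?\<eta> >= k + 1) * falling ?\<eta> (k + 1) * mu_part k phi 0"
  using falling_eq_0[of ?\<eta> "k + 1"] by (cases "k + 1 <= ?\<eta>") (simp_all add: falling_def[of _ 0])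
 also have "(\<Sum>m=1..k. ?f m * mu_part k phi m) = (\<Sum>m=1..k. of_bool (k + 1 - m <= ?\<eta> \<and> ?\<eta> <= n - m)
   * falling ?\<eta> (k + 1 - m) * falling ?\<nu> m * mu_part k phi m)"
 proof (rule sum.cong)
  fix m assume m: "m \<in> {1..k}"
  show "?f m * mu_part k phi m = of_bool (k + 1 - m <= ?\<eta> \<and> ?\<eta> <= n - m) * falling ?\<eta> (k + 1 - m) * falling ?\<nu> m * mu_part k phi m"
  proof (cases "k + 1 - m <= ?\<eta> \<and> ?\<eta> <= n - m")
   case False
   \<comment> \<open>If the condition fails, \<open>\<eta> + \<nu> = n\<close> makes one of the two
     falling factorials vanish, so both sides are 0.\<close>
   then have "?\<eta> < k + 1 - m \<or> ?\<nu> < m" using sum m by linarith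
   then show ?thesis using falling_eq_0[of ?\<eta> "k + 1 - m"] falling_eq_0[of ?\<nu> m] False by auto
  qed simp
 qed simp
 also have "?f (k + 1) * mu_part k phi (k + 1) = of_bool (?\<nu> >= k + 1) * falling ?\<nu> (k + 1) * mu_part k phi (k + 1)"
  using falling_eq_0[of ?\<nu> "k + 1"] by (cases "k + 1 <= ?\<nu>") (simp_all add: falling_def[of _ 0])
 finally have "(\<Sum>I\<in>tuples k n. step_kernel k phi (tup k u I)) = sign_value k phi n ?\<eta> ?\<nu> * falling n (k + 1)"
  if "falling n (k + 1) \<noteq> 0"
  using that unfolding sign_value_def by simp
 \<comment> \<open>For \<open>n <= k\<close> there are no tuples, and both sides are 0 by the
   convention on division.\<close>
 then show ?thesis unfolding U_stat_def tuple_avg_def card_tuples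
  by (cases "falling n (k + 1) = 0") (auto simp: sign_value_def)
qed

context
 fixes k :: nat and phi :: "(nat => real) => real"
 assumes phi: "square_integrable k phi"
begin

lemma step_kernel_measurable: "step_kernel k phi \<in> borel_measurable (cube k)"
 unfolding step_kernel_def[abs_def] by (rule pattern_fun_measurable[of "\<lambda>A. 2 ^ (k + 1) * orth_int k phi A"])

lemma step_kernel_bounded: "\<exists>B. \<forall>w. \<bar>step_kernel k phi w\<bar> <= B"
proof (intro exI allI)
 fix w
 have "\<bar>orth_int k phi (pattern k w)\<bar> <= (\<Sum>A\<in>Pow {..k}. \<bar>orth_int k phi A\<bar>)"
  using pattern_subset[of k w] by (intro member_le_sum[of _ _ "\<lambda>A. \<bar>orth_int k phi A\<bar>"]) auto
 then show "\<bar>step_kernel k phi w\<bar> <= 2 ^ (k + 1) * (\<Sum>A\<in>Pow {..k}. \<bar>orth_int k phi A\<bar>)"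
  unfolding step_kernel_def by (simp add: abs_mult)
qed

lemma step_kernel_square_integrable: "square_integrable k (step_kernel k phi)"
proof -
 obtain B where B: "\<And>w. \<bar>step_kernel k phi w\<bar> <= B" using step_kernel_bounded by auto
 note step_kernel_measurable[measurable]
 have "integrable (cube k) (\<lambda>w. (step_kernel k phi w)^2)"
  by (rule CU.integrable_const_bound[where B = "B^2"])
    (use power_mono[OF B abs_ge_zero, of _ 2] in auto)
 then show ?thesis by (simp add: square_integrable_def step_kernel_measurable)
qed


end

section \<open>Exact scores\<close>

text \<open>Averaging over the rank tuples of an untied sample is thereby the same as averaging over
  all tuples.\<close>

lemma rank_permutation:
 assumes "inj_on u {1..n}"
 shows "\<exists>per. per permutes {1..n} \<and> (\<forall>I\<in>tuples k n. tup k (rank n u) I = tup k per I)"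
proof -
 define per where "per i = (if i \<in> {1..n} then rank n u i else i)" for i
 have "bij_betw per {1..n} {1..n}"
  using rank_bij[OF assms] by (rule bij_betw_cong[THEN iffD1, rotated]) (simp add: per_def)
 then have "per permutes {1..n}" by (rule bij_imp_permutes) (auto simp: per_def)
 moreover have "tup k (rank n u) I = tup k per I" if "I \<in> tuples k n" for I
  unfolding tup_def using tuplesD(2)[OF that] by (intro restrict_ext) (auto simp: per_def)
 ultimately show ?thesis by blast
qed

lemma sum_of_bool_bij:
 assumes "bij_betw f S S" "finite S" "i \<in> S"
 shows "(\<Sum>I\<in>S. of_bool (f I = i)) = (1 :: real)"
proof -
 have "(\<Sum>I\<in>S. of_bool (f I = i)) = (\<Sum>I\<in>S. of_bool (I = i) :: real)"
  using sum.reindex_bij_betw[OF assms(1), of "\<lambda>I. of_bool (I = i)"] .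
 also have "... = (\<Sum>I\<in>S. if I = i then 1 else 0)" by (intro sum.cong) auto
 finally show ?thesis using assms by simp
qed

lemma n_below_fun_measurable:
 fixes \<Psi> :: "nat => real"
 assumes "{1..n} \<subseteq> J"
 shows "(\<lambda>u. \<Psi> (n_below c n u)) \<in> borel_measurable (unif J)"
proof -
 have "\<Psi> \<in> measurable (count_space UNIV) borel" by simp
 from measurable_compose[OF n_below_measurable[OF id_uniform01 assms] this] show ?thesis .
qed

lemma n_below_fun_bounded:
 fixes \<Psi> :: "nat => real"
 shows "\<bar>\<Psi> (n_below c n u)\<bar> <= (\<Sum>m\<le>n. \<bar>\<Psi> m\<bar>)"
 using n_below_le by (intro member_le_sum[of _ _ "\<lambda>m. \<bar>\<Psi> m\<bar>"]) auto

text \<open>With the coordinates outside the tuple fixed, the sign count depends on the resampled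
  ones only through their pattern. This reduces \<open>residual_sign_orthogonal\<close> to
  orthogonality on the cube.\<close>

lemma n_below_mix:
 assumes I: "I \<in> tuples k n"
 shows "n_below (1/2) n (mix (I ` {..k}) v u)
  = card {i \<in> {1..n} - I ` {..k}. u i < 1/2} + (k + 1 - card (pattern k (tup k v I)))"
proof -
 let ?K = "I ` {..k}" and ?Q = "{j \<in> {..k}. v (I j) < 1/2}"
 have K: "?K \<subseteq> {1..n}" using tuplesD(2)[OF I] by auto
 have "{i \<in> {1..n}. mix ?K v u i < 1/2} = {i \<in> {1..n} - ?K. u i < 1/2} \<union> I ` ?Q"
  using K by (auto simp: mix_def split: if_splits)
 then have "n_below (1/2) n (mix ?K v u) = card {i \<in> {1..n} - ?K. u i < 1/2} + card (I ` ?Q)"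
  unfolding n_below_def by (simp only:) (rule card_Un_disjoint; auto)
 also have "card (I ` ?Q) = card ?Q"
  by (rule card_image) (rule inj_on_subset[OF tuplesD(1)[OF I]], auto)
 also have "?Q = {..k} - pattern k (tup k v I)"
  by (auto simp: pattern_def tup_def)
 also have "card ... = k + 1 - card (pattern k (tup k v I))"
  using pattern_subset[of k "tup k v I"] by (subst card_Diff_subset) (auto intro: finite_subset)
 finally show ?thesis .
qed

lemma square_integrable_diff:
 assumes "square_integrable k g" "square_integrable k h"
 shows "square_integrable k (\<lambda>w. g w - h w)"
 unfolding square_integrable_def power2_diff
 using phi_facts[OF assms(1)] phi_facts[OF assms(2)] integrable_product_of_squares[of g "cube k" h]
 by (auto simp: mult.assoc)

context
 fixes k :: nat and phi :: "(nat => real) => real"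
 assumes phi: "square_integrable k phi"
begin

lemma residual_square_integrable: "square_integrable k (\<lambda>w. phi w - step_kernel k phi w)"
 by (intro square_integrable_diff phi step_kernel_square_integrable)

lemma pattern_product_integrable:
 fixes c :: "nat set => real"
 assumes g: "integrable (cube k) g"
 shows "integrable (cube k) (\<lambda>w. c (pattern k w) * g w)"
proof (rule L1_integrable_bound)
 let ?B = "\<Sum>A\<in>Pow {..k}. \<bar>c A\<bar>"
 show "integrable (cube k) (\<lambda>w. ?B * g w)" using g by simp
 show "(\<lambda>w. c (pattern k w) * g w) \<in> borel_measurable (cube k)"
  by (rule borel_measurable_times[OF pattern_fun_measurable borel_measurable_integrable[OF g]])
 have "\<bar>c (pattern k w)\<bar> <= ?B" for w
  using pattern_subset[of k w] by (intro member_le_sum[of _ _ "\<lambda>A. \<bar>c A\<bar>"]) auto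
 then have "norm (c (pattern k w) * g w) <= norm (?B * g w)" for w
  unfolding norm_mult by (intro mult_right_mono) (auto simp: abs_of_nonneg sum_nonneg)
 then show "AE w in cube k. norm (c (pattern k w) * g w) <= norm (?B * g w)" by simp
qed

text \<open>A function of the pattern is a finite combination of indicators of orthants, and on each
  orthant the residual integrates to 0 because the factor \<open>2 ^ (k + 1)\<close> cancels the
  measure of the orthant.\<close>

lemma residual_pattern_orthogonal:
 fixes c :: "nat set => real"
 shows "(LINT w|cube k. c (pattern k w) * (phi w - step_kernel k phi w)) = 0"
proof -
 note f = phi_facts[OF phi]
 let ?b = "\<lambda>A w. of_bool (pattern k w = A) :: real"
 have i: "integrable (cube k) (\<lambda>w. ?b A w * g w)" if "integrable (cube k) g" for A g
  using pattern_product_integrable[OF that, of "\<lambda>B. of_bool (B = A)"] .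
 have z: "(LINT w|cube k. ?b A w * (phi w - step_kernel k phi w)) = 0" if A: "A \<subseteq> {..k}" for A
 proof -
  have "(LINT w|cube k. ?b A w * (phi w - step_kernel k phi w))
   = (LINT w|cube k. ?b A w * phi w - (2 ^ (k + 1) * orth_int k phi A) * ?b A w)"
   by (intro L1_integral_cong refl) (auto simp: step_kernel_def algebra_simps)
  also have "... = orth_int k phi A - (2 ^ (k + 1) * orth_int k phi A) * (LINT w|cube k. ?b A w)"
   using i[OF f(3), of A] i[of "\<lambda>_. 1" A] by (subst L1_integral_diff) (auto simp: orth_int_def)
  also have "(LINT w|cube k. ?b A w) = (1/2) ^ (k + 1)" by (rule integral_pattern_eq[OF A])
  finally show ?thesis by (simp add: power_one_over field_simps)
 qed
 have "(LINT w|cube k. c (pattern k w) * (phi w - step_kernel k phi w))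
   = (LINT w|cube k. (\<Sum>A\<in>Pow {..k}. c A * (?b A w * (phi w - step_kernel k phi w))))"
  by (intro L1_integral_cong refl)
    (subst pattern_decomposition[where c = c], simp only: sum_distrib_right mult.assoc)
 also have "... = (\<Sum>A\<in>Pow {..k}. c A * (LINT w|cube k. ?b A w * (phi w - step_kernel k phi w)))"
  using i[OF phi_facts(3)[OF residual_square_integrable]]
  by (subst L1_integral_sum) auto
 also have "... = 0" using z by (intro sum.neutral) auto
 finally show ?thesis .
qed

lemma integral_step_kernel: "(LINT w|cube k. step_kernel k phi w) = mu k phi"
 using residual_pattern_orthogonal[of "\<lambda>_. 1"] phi_facts(3)[OF phi] phi_facts(3)[OF step_kernel_square_integrable[OF phi]]
 by (simp add: mu_def)

lemma residual_sign_orthogonal: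
 assumes I: "I \<in> tuples k n" and J: "{1..n} \<subseteq> J"
 shows "(LINT u|(unif J). \<Psi> (n_below (1/2) n u) * (phi (tup k u I) - step_kernel k phi (tup k u I))) = 0"
proof -
 let ?M = "unif J" and ?K = "I ` {..k}"
 let ?r = "\<lambda>w. phi w - step_kernel k phi w"
 note r = phi_facts[OF residual_square_integrable]
 have ri: "integrable ?M (\<lambda>u. ?r (tup k u I))"
  using integrable_tup_PiM[OF I J r(1)] r(3) by simp
 have int: "integrable ?M (\<lambda>u. \<Psi> (n_below (1/2) n u) * ?r (tup k u I))"
 proof (rule L1_integrable_bound)
  let ?B = "\<Sum>m\<le>n. \<bar>\<Psi> m\<bar>"
  show "integrable ?M (\<lambda>u. ?B * ?r (tup k u I))" using ri by simp
  show "(\<lambda>u. \<Psi> (n_below (1/2) n u) * ?r (tup k u I)) \<in> borel_measurable ?M"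
   by (rule borel_measurable_times[OF n_below_fun_measurable[OF J] borel_measurable_integrable[OF ri]])
  have "norm (\<Psi> (n_below (1/2) n u) * ?r (tup k u I)) <= norm (?B * ?r (tup k u I))" for u
   unfolding norm_mult using n_below_fun_bounded[of \<Psi> "1/2" n u]
   by (intro mult_right_mono) (auto simp: abs_of_nonneg sum_nonneg)
  then show "AE u in ?M. norm (\<Psi> (n_below (1/2) n u) * ?r (tup k u I)) <= norm (?B * ?r (tup k u I))" by simp
 qed
 have "(LINT u|?M. \<Psi> (n_below (1/2) n u) * ?r (tup k u I))
   = (LINT u|?M. LINT v|?M. \<Psi> (n_below (1/2) n (mix ?K v u)) * ?r (tup k (mix ?K v u) I))"
  using integral_mix(2)[OF prob_space_uniform01 int, of ?K] by simp
 also have "... = (LINT u|?M. 0)"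
 proof (rule L1_integral_cong[OF refl])
  fix u :: "nat => real"
  let ?c = "\<lambda>A. \<Psi> (card {i \<in> {1..n} - I ` {..k}. u i < 1/2} + (k + 1 - card A))"
  have "tup k (mix ?K v u) I = tup k v I" for v :: "nat => real"
   by (auto simp: tup_def mix_def)
  then have "(LINT v|?M. \<Psi> (n_below (1/2) n (mix ?K v u)) * ?r (tup k (mix ?K v u) I))
   = (LINT v|?M. ?c (pattern k (tup k v I)) * ?r (tup k v I))"
   by (simp only: n_below_mix[OF I])
  also have "... = (LINT w|cube k. ?c (pattern k w) * ?r w)"
  proof (rule integral_tup_PiM[OF I J, where g = "\<lambda>w. ?c (pattern k w) * ?r w"])
   show "(\<lambda>w. ?c (pattern k w) * ?r w) \<in> borel_measurable (cube k)"
    by (rule borel_measurable_times[OF pattern_fun_measurable[of ?c] r(1)])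
  qed
  also have "... = 0" by (rule residual_pattern_orthogonal)
  finally show "(LINT v|?M. \<Psi> (n_below (1/2) n (mix ?K v u)) * ?r (tup k (mix ?K v u) I)) = 0" .
 qed
 finally show ?thesis by simp
qed

text \<open>Averaging the exact scores over all rank tuples leaves the conditional expectation of \<open>phi\<close> given the
 signs, and that is the average of the step kernel over all tuples of observations.\<close>

lemma exact_score_average:
 assumes n: "k + 1 <= n"
 shows "AE u in (unif {1..n}).
  tuple_avg k n (score_at k (exact_score k phi) n (1/2) u) = U_stat k (step_kernel k phi) n u"
proof -
 let ?M = "unif {1..n}" and ?T = "tuples k n"
 interpret M: prob_space ?M by (intro prob_space_PiM prob_space_uniform01)
 define C where "C = real (card ?T)"
 have C: "C > 0" using card_tuples_pos[of k n] n by (simp add: C_def)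
 define J0 where "J0 = (\<lambda>j\<in>{..k}. j + 1)"
 have J0: "J0 \<in> ?T" using n by (auto simp: J0_def tuples_def inj_on_def)
 note f = phi_facts[OF phi]
 define b where "b nm np u = (of_bool (n_below (1/2) n u = nm \<and> n_above (1/2) n u = np) :: real)" for nm np and u :: "nat => real"
 define r where "r i u I = (of_bool (tup k (rank n u) I = i) :: real)" for i I and u :: "nat => real"
 have gen: "AE u in ?M. inj_on u {1..n} \<and> (\<forall>i\<in>{1..n}. u i \<noteq> 1/2)" by (rule AE_generic) simp
 have bm: "b nm np \<in> borel_measurable ?M" for nm np
  using score_at_measurable[OF id_uniform01 subset_refl J0, of "\<lambda>n nm' np' i'. of_bool (nm' = nm \<and> np' = np)" "1/2"]
  by (simp add: score_at_def b_def[abs_def])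
 have rm: "(\<lambda>u. r i u I) \<in> borel_measurable ?M" if "I \<in> ?T" for i I
  using score_at_measurable[OF id_uniform01 subset_refl that, of "\<lambda>n nm' np' i'. of_bool (i' = i)" "1/2"]
  by (simp add: score_at_def r_def[abs_def])
 have bi: "integrable ?M (\<lambda>u. b nm np u * g u)" if "integrable ?M g" for nm np g
  by (rule L1_integrable_bound[OF that borel_measurable_times[OF bm borel_measurable_integrable[OF that]]])
    (auto simp: b_def)
 have ri: "integrable ?M (\<lambda>u. r i u I * g u)" if "integrable ?M g" "I \<in> ?T" for i I g
  by (rule L1_integrable_bound[OF that(1) borel_measurable_times[OF rm[OF that(2)] borel_measurable_integrable[OF that(1)]]])
    (auto simp: r_def)
 have gi: "integrable ?M (\<lambda>u. g (tup k u I))" if "square_integrable k g" "I \<in> ?T" for g I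
  using integrable_tup_PiM[OF that(2) subset_refl phi_facts(1)[OF that(1)]] phi_facts(3)[OF that(1)] by simp
 have sumI: "AE u in ?M. (\<Sum>I\<in>?T. r i u I) = 1" if i: "i \<in> ?T" for i
  using gen
 proof eventually_elim
  case (elim u)
  then obtain per where per: "per permutes {1..n}" "\<forall>I\<in>?T. tup k (rank n u) I = tup k per I"
   using rank_permutation by blast
  then have "(\<Sum>I\<in>?T. r i u I) = (\<Sum>I\<in>?T. of_bool (tup k per I = i))"
   unfolding r_def by (intro sum.cong) auto
  also have "... = 1" by (rule sum_of_bool_bij[OF bij_betw_tup_permutes[OF per(1)] finite_tuples i])
  finally show ?case .
 qed
 have sumi: "AE u in ?M. (\<Sum>i\<in>?T. r i u I) = 1" if I: "I \<in> ?T" for I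
  using gen
 proof eventually_elim
  case (elim u)
  then obtain per where per: "per permutes {1..n}" "\<forall>I\<in>?T. tup k (rank n u) I = tup k per I"
   using rank_permutation by blast
  then have t: "tup k (rank n u) I \<in> ?T" using tup_permutes[OF per(1) I] I by simp
  have "(\<Sum>i\<in>?T. r i u I) = (\<Sum>i\<in>?T. if tup k (rank n u) I = i then 1 else 0)"
   unfolding r_def by (intro sum.cong) auto
  then show ?case using t by (subst (asm) sum.delta') auto
 qed
 define P where "P nm np = (LINT u|?M. b nm np u)" for nm np
 \<comment> \<open>Given the signs, the rank tuple of the first \<open>k+1\<close> observations is
   uniform over all tuples, each having probability \<open>P / C\<close> jointly with the signs. The
   equal denominators let the exact scores be added up.\<close>
 have D: "(LINT u|?M. b nm np u * r i u J0) * C = P nm np" if i: "i \<in> ?T" for nm np i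
 proof -
  let ?e = "\<lambda>u I. b nm np u * r i u I"
  have eqv: "equivariant ?M k n ?e"
   by (rule equivariantI) (simp add: b_def r_def n_below_permute n_above_permute rank_permute' tup_comp)
  have m: "(\<lambda>u. ?e u I) \<in> borel_measurable ?M" if "I \<in> ?T" for I
   using bm rm[OF that] by (rule borel_measurable_times)
  have ei: "integrable ?M (\<lambda>u. ?e u I)" if "I \<in> ?T" for I
   using bi[OF ri[OF M.integrable_const that, of i 1]] by simp
  have "(LINT u|?M. ?e u J0) * C = (LINT u|?M. (\<Sum>I\<in>?T. ?e u I))"
   unfolding C_def by (rule integral_equivariant_sum[OF prob_space_uniform01 subset_refl eqv ei J0])
  also have "... = (LINT u|?M. b nm np u)"
  proof (rule integral_cong_AE)
   show "(\<lambda>u. \<Sum>I\<in>?T. ?e u I) \<in> borel_measurable ?M" using m by (intro borel_measurable_sum)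
   show "AE u in ?M. (\<Sum>I\<in>?T. ?e u I) = b nm np u"
    using sumI[OF i] by eventually_elim (simp add: sum_distrib_left[symmetric])
  qed (rule bm)
  finally show ?thesis by (simp add: P_def)
 qed
 \<comment> \<open>Summing over all rank tuples removes the rank condition, and the sign counts do
   not distinguish \<open>phi\<close> from its step kernel.\<close>
 have N: "(\<Sum>i\<in>?T. LINT u|?M. b nm np u * (r i u J0 * phi (tup k u J0))) = sign_value k phi n nm np * P nm np"
  if nmnp: "nm + np = n" for nm np
 proof -
  let ?h = "step_kernel k phi"
  note h = step_kernel_square_integrable[OF phi]
  have "(\<Sum>i\<in>?T. LINT u|?M. b nm np u * (r i u J0 * phi (tup k u J0)))
    = (LINT u|?M. (\<Sum>i\<in>?T. b nm np u * (r i u J0 * phi (tup k u J0))))"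
   using bi[OF ri[OF gi[OF phi J0] J0]] by (subst L1_integral_sum) auto
  also have "... = (LINT u|?M. b nm np u * phi (tup k u J0))"
  proof (rule integral_cong_AE)
   show "(\<lambda>u. \<Sum>i\<in>?T. b nm np u * (r i u J0 * phi (tup k u J0))) \<in> borel_measurable ?M"
    using bi[OF ri[OF gi[OF phi J0] J0]] by (intro borel_measurable_sum borel_measurable_integrable)
   show "(\<lambda>u. b nm np u * phi (tup k u J0)) \<in> borel_measurable ?M"
    using bi[OF gi[OF phi J0]] by (rule borel_measurable_integrable)
   show "AE u in ?M. (\<Sum>i\<in>?T. b nm np u * (r i u J0 * phi (tup k u J0))) = b nm np u * phi (tup k u J0)"
    using sumi[OF J0] by eventually_elim (simp add: sum_distrib_left[symmetric] sum_distrib_right[symmetric])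
  qed
  also have "... = (LINT u|?M. b nm np u * ?h (tup k u J0))"
  proof -
   have "(LINT u|?M. b nm np u * phi (tup k u J0)) - (LINT u|?M. b nm np u * ?h (tup k u J0))
     = (LINT u|?M. b nm np u * phi (tup k u J0) - b nm np u * ?h (tup k u J0))"
    by (rule L1_integral_diff[symmetric, OF bi[OF gi[OF phi J0]] bi[OF gi[OF h J0]]])
   also have "... = (LINT u|?M. of_bool (n_below (1/2) n u = nm) * (phi (tup k u J0) - ?h (tup k u J0)))"
   proof (rule integral_cong_AE)
    show "(\<lambda>u. b nm np u * phi (tup k u J0) - b nm np u * ?h (tup k u J0)) \<in> borel_measurable ?M"
     by (intro borel_measurable_diff borel_measurable_integrable bi[OF gi[OF phi J0]] bi[OF gi[OF h J0]])
    show "(\<lambda>u. of_bool (n_below (1/2) n u = nm) * (phi (tup k u J0) - ?h (tup k u J0))) \<in> borel_measurable ?M"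
     by (intro borel_measurable_times borel_measurable_diff borel_measurable_integrable gi[OF phi J0] gi[OF h J0]
       n_below_fun_measurable[of n "{1..n}" "\<lambda>m. of_bool (m = nm)"]) simp
    show "AE u in ?M. b nm np u * phi (tup k u J0) - b nm np u * ?h (tup k u J0)
      = of_bool (n_below (1/2) n u = nm) * (phi (tup k u J0) - ?h (tup k u J0))"
     using gen
    proof eventually_elim
     case (elim u)
     then have "n_below (1/2) n u + n_above (1/2) n u = n" by (intro n_below_add_above) auto
     \<comment> \<open>Because \<open>nm + np = n\<close>, the sign event is determined by the lower
       count alone, which is the form that the orthogonality requires.\<close>
     then have "b nm np u = of_bool (n_below (1/2) n u = nm)" using nmnp by (auto simp: b_def)
     then show ?case by (simp add: algebra_simps)
    qed
   qed
   also have "... = 0" using residual_sign_orthogonal[OF J0 subset_refl, of "\<lambda>m. of_bool (m = nm)"] .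
   finally show ?thesis by simp
  qed
  also have "... = sign_value k phi n nm np * P nm np"
  proof -
   let ?e = "\<lambda>u I. b nm np u * ?h (tup k u I)"
   have eqv: "equivariant ?M k n ?e"
    by (rule equivariantI) (simp add: b_def n_below_permute n_above_permute tup_comp)
   have "(LINT u|?M. ?e u J0) * C = (LINT u|?M. (\<Sum>I\<in>?T. ?e u I))"
    unfolding C_def by (rule integral_equivariant_sum[OF prob_space_uniform01 subset_refl eqv bi[OF gi[OF h]] J0])
   also have "... = (LINT u|?M. C * sign_value k phi n nm np * b nm np u)"
   proof (rule integral_cong_AE)
    show "(\<lambda>u. \<Sum>I\<in>?T. ?e u I) \<in> borel_measurable ?M"
     by (intro borel_measurable_sum borel_measurable_integrable[OF bi[OF gi[OF h]]])
    show "(\<lambda>u. C * sign_value k phi n nm np * b nm np u) \<in> borel_measurable ?M" using bm by simp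
    show "AE u in ?M. (\<Sum>I\<in>?T. ?e u I) = C * sign_value k phi n nm np * b nm np u"
     using gen
    proof eventually_elim
     case (elim u)
     have CU: "C * U_stat k ?h n u = (\<Sum>I\<in>?T. ?h (tup k u I))"
      unfolding U_stat_def tuple_avg_def C_def[symmetric] using C by simp
     have "(\<Sum>I\<in>?T. ?e u I) = b nm np u * (C * U_stat k ?h n u)"
      unfolding CU by (rule sum_distrib_left[symmetric])
     also have "... = C * sign_value k phi n nm np * b nm np u"
      using U_stat_step_kernel[OF f(1), of n u] elim by (cases "b nm np u = 0") (auto simp: b_def)
     finally show ?case .
    qed
   qed
   also have "... = C * (sign_value k phi n nm np * P nm np)" by (simp add: P_def)
   finally show ?thesis using C by simp
  qed
  finally show ?thesis .
 qed
 have ex: "exact_score k phi n nm np i = (LINT u|?M. b nm np u * (r i u J0 * phi (tup k u J0))) / (LINT u|?M. b nm np u * r i u J0)"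
  if i: "i \<in> ?T" for nm np i
 proof -
  let ?E = "{U \<in> space ?M. n_below (1/2) n U = nm \<and> n_above (1/2) n U = np \<and> (\<forall>j\<le>k. rank n U (j + 1) = i j)}"
  have t: "tup k U J0 = (\<lambda>j\<in>{..k}. U (j + 1))" for U :: "nat => real"
   by (auto simp: tup_def J0_def)
  have "tup k (rank n U) J0 = i \<longleftrightarrow> (\<forall>j\<le>k. rank n U (j + 1) = i j)" for U
   using tuplesD(4)[OF i] by (auto simp: tup_def J0_def fun_eq_iff extensional_def)
  then have ind: "indicator ?E u = b nm np u * r i u J0" if "u \<in> space ?M" for u
   using that by (auto simp: b_def r_def indicator_def)
  have Em: "?E \<in> sets ?M"
  proof -
   have "(\<lambda>u. b nm np u * r i u J0) \<in> borel_measurable ?M" using bm rm[OF J0] by (rule borel_measurable_times)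
   then have "(\<lambda>u. indicator ?E u :: real) \<in> borel_measurable ?M"
    by (subst measurable_cong[OF ind]) auto
   then have "?E \<inter> space ?M \<in> sets ?M" unfolding borel_measurable_indicator_iff .
   moreover have "?E \<inter> space ?M = ?E" by blast
   ultimately show ?thesis by (simp only:)
  qed
  have "measure ?M ?E = (LINT u|?M. indicator ?E u)"
   using Em by simp
  also have "... = (LINT u|?M. b nm np u * r i u J0)"
   by (rule L1_integral_cong[OF refl ind])
  finally have me: "measure ?M ?E = ..." .
  have "(LINT U:?E|?M. phi (\<lambda>j\<in>{..k}. U (j + 1))) = (LINT u|?M. b nm np u * (r i u J0 * phi (tup k u J0)))"
   unfolding set_lebesgue_integral_def t[symmetric]
   by (rule L1_integral_cong[OF refl]) (subst ind, auto)
  then show ?thesis unfolding exact_score_def Let_def cond_exp_event_def me by simp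
 qed
 \<comment> \<open>Sign counts of probability 0 would put 0 into the denominator of an exact score;
   almost no sample shows them.\<close>
 have "AE u in ?M. \<forall>nm\<in>{..n}. \<forall>np\<in>{..n}. P nm np = 0 --> b nm np u = 0"
 proof (intro AE_finite_allI finite_atMost)
  fix nm np
  have "integrable ?M (b nm np)" using bi[OF M.integrable_const, of nm np 1] by simp
  then have "P nm np = 0 \<longleftrightarrow> (AE u in ?M. b nm np u = 0)"
   unfolding P_def by (intro integral_nonneg_eq_0_iff_AE) (auto simp: b_def)
  then show "AE u in ?M. P nm np = 0 --> b nm np u = 0" by (cases "P nm np = 0") auto
 qed
 with gen show ?thesis
 proof eventually_elim
  case (elim u)
  let ?nm = "n_below (1/2) n u" and ?np = "n_above (1/2) n u"
  have b1: "b ?nm ?np u = 1" by (simp add: b_def)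
  have P: "P ?nm ?np \<noteq> 0" using elim(2) b1 n_below_le n_above_le by force
  have sum: "?nm + ?np = n" using elim(1) by (intro n_below_add_above) auto
  obtain per where per: "per permutes {1..n}" "\<forall>I\<in>?T. tup k (rank n u) I = tup k per I"
   using rank_permutation elim(1) by blast
  have "tuple_avg k n (score_at k (exact_score k phi) n (1/2) u) = tuple_avg k n (\<lambda>I. exact_score k phi n ?nm ?np (tup k per I))"
   unfolding tuple_avg_def score_at_def using per(2) by (intro arg_cong2[of _ _ _ _ "(/)"] sum.cong) auto
  also have "... = tuple_avg k n (exact_score k phi n ?nm ?np)" by (rule tuple_avg_permute[OF per(1)])
  also have "... = (\<Sum>i\<in>?T. (LINT u|?M. b ?nm ?np u * (r i u J0 * phi (tup k u J0))) / P ?nm ?np)"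
  proof -
   have "exact_score k phi n ?nm ?np i / C = (LINT u|?M. b ?nm ?np u * (r i u J0 * phi (tup k u J0))) / P ?nm ?np"
    if "i \<in> ?T" for i
    unfolding ex[OF that] using D[OF that, of ?nm ?np, symmetric] C by simp
   then show ?thesis unfolding tuple_avg_def C_def[symmetric] sum_divide_distrib by (rule sum.cong[OF refl])
  qed
  also have "... = sign_value k phi n ?nm ?np"
   unfolding sum_divide_distrib[symmetric] N[OF sum] using P by simp
  also have "... = U_stat k (step_kernel k phi) n u"
   using U_stat_step_kernel[OF f(1), of n u] elim(1) by simp
  finally show ?case .
 qed
qed

end

section \<open>Grid approximation of monotone functions\<close>

text \<open>On the half interval starting at \<open>a\<close> the \<open>m\<close> grid points of the approximate scores are the values of
 \<open>quant m a\<close>. Both \<open>t\<close> and \<open>quant m a t\<close> lie between \<open>low m a t\<close> and \<open>up m a t\<close>, and these two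
 bounds are affine in \<open>t\<close>.\<close>

definition quant :: "nat => real => real => real" where
 "quant m a t = (if m = 0 then t else a + (real_of_int \<lfloor>2 * real m * (t - a)\<rfloor> + 1) / (2 * (real m + 1)))"

definition low :: "nat => real => real => real" where
 "low m a t = a * (1 - real m / (real m + 1)) + real m / (real m + 1) * t"

definition up :: "nat => real => real => real" where
 "up m a t = a * (1 - real m / (real m + 1)) + 1 / (2 * (real m + 1)) + real m / (real m + 1) * t"

text \<open>If one half contains no observation, \<open>quant\<close> is the identity there, so that
  the map sends the unit interval into itself for all counts.\<close>

definition grid_map :: "nat => nat => real => real" where
 "grid_map nm np t = (if t < 1/2 then quant nm 0 t else quant np (1/2) t)"

lemma low_up_alt:
 "low m a t = a + (t - a) * real m / (real m + 1)" "up m a t = low m a t + 1 / (2 * (real m + 1))"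
 by (simp_all add: low_def up_def algebra_simps diff_divide_distrib)

text \<open>Subtract \<open>a\<close> and multiply by \<open>2(m+1)\<close>: with
  \<open>s = t - a\<close>, the bounds become \<open>2ms\<close> and \<open>2ms+1\<close>, the
  quantized value becomes the integer part of \<open>2ms\<close> plus 1, and \<open>t\<close>
  becomes \<open>2ms + 2s\<close> with \<open>0 < 2s < 1\<close>.\<close>

lemma low_up_bounds:
 assumes m: "m > 0" and t: "a < t" "t < a + 1/2"
 shows "a < low m a t" "low m a t <= t" "t <= up m a t" "up m a t < a + 1/2"
  "low m a t <= quant m a t" "quant m a t <= up m a t"
proof -
 define s where "s = t - a"
 have s: "0 < s" "s < 1/2" using t by (auto simp: s_def)
 have M: "real m + 1 > 0" "real m > 0" using m by auto
 have l: "low m a t = a + s * real m / (real m + 1)" by (simp add: low_up_alt s_def)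
 have q: "quant m a t = a + (real_of_int \<lfloor>2 * real m * s\<rfloor> + 1) / (2 * (real m + 1))"
  using m by (simp add: quant_def s_def)
 have l2: "low m a t = a + (2 * real m * s) / (2 * (real m + 1))"
  unfolding l using M by (simp add: field_simps)
 have u2: "up m a t = a + (2 * real m * s + 1) / (2 * (real m + 1))"
  unfolding low_up_alt(2) l2 by (simp add: add_divide_distrib)
 have M2: "2 * (real m + 1) > 0" by simp
 have sm: "real m * s < real m * (1/2)" using s M by (intro mult_strict_left_mono) auto
 show "a < low m a t" unfolding l2 using M s by simp
 have "(2 * real m * s) / (2 * (real m + 1)) <= s"
  using M2 s by (simp add: pos_divide_le_eq algebra_simps)
 then show "low m a t <= t" unfolding l2 s_def by simp
 have "s <= (2 * real m * s + 1) / (2 * (real m + 1))"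
  using M2 s by (simp add: pos_le_divide_eq algebra_simps)
 then show "t <= up m a t" unfolding u2 using s_def by linarith
 have "(2 * real m * s + 1) / (2 * (real m + 1)) < 1/2"
  using M2 sm by (simp add: pos_divide_less_eq mult_ac)
 then show "up m a t < a + 1/2" unfolding u2 by linarith
 show "low m a t <= quant m a t" unfolding q l2
  by (rule add_left_mono, rule divide_right_mono, linarith, simp)
 show "quant m a t <= up m a t" unfolding q u2
  by (rule add_left_mono, rule divide_right_mono, linarith, simp)
qed

lemma quant_in_half:
 assumes "a < t" "t < a + 1/2"
 shows "a < quant m a t" "quant m a t < a + 1/2"
proof -
 have "a < quant m a t \<and> quant m a t < a + 1/2"
 proof (cases "m = 0")
  case False
  then show ?thesis using assms low_up_bounds[of m a t] by linarith
 qed (use assms in \<open>simp add: quant_def\<close>)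
 then show "a < quant m a t" "quant m a t < a + 1/2" by auto
qed

lemma grid_map_range:
 assumes "t \<in> {0<..<1}" "t \<noteq> 1/2"
 shows "grid_map nm np t \<in> {0<..<1}"
 using assms quant_in_half[of 0 t nm] quant_in_half[of "1/2" t np] by (auto simp: grid_map_def)

lemma grid_map_in_unit:
 assumes "t \<in> {0<..<1}"
 shows "grid_map nm np t \<in> {0<..<1}"
proof (cases "t = 1/2")
 case True
 then show ?thesis
  by (cases "np = 0") (auto simp: grid_map_def quant_def field_simps)
qed (use grid_map_range[OF assms] in simp)

lemma grid_map_measurable: "grid_map nm np \<in> measurable uniform01 uniform01"
proof -
 have "grid_map nm np \<in> borel_measurable borel"
  unfolding grid_map_def[abs_def] quant_def by measurable
 from measurable_compose[OF id_uniform01 this]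
 have "grid_map nm np \<in> measurable uniform01 lborel" by simp
 moreover have "grid_map nm np \<in> space uniform01 \<rightarrow> {0<..<1}" using grid_map_in_unit by auto
 ultimately show ?thesis
  by (subst (2) uniform01_def) (rule measurable_restrict_space2)
qed

lemma nn_integral_uniform01_halves:
 fixes q :: "real => ennreal"
 assumes q: "q \<in> borel_measurable uniform01"
 shows "(\<lambda>t. q t * indicator {0<..<1/2} t) \<in> borel_measurable lborel"
  "(\<lambda>t. q t * indicator {1/2<..<1} t) \<in> borel_measurable lborel"
  "(\<integral>\<^sup>+t. q t \<partial>uniform01) = (\<integral>\<^sup>+t. q t * indicator {0<..<1/2} t \<partial>lborel) + (\<integral>\<^sup>+t. q t * indicator {1/2<..<1} t \<partial>lborel)"
proof -
 have m: "(\<lambda>t. q t * indicator {0<..<1} t) \<in> borel_measurable lborel"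
  using q unfolding uniform01_def by (subst (asm) borel_measurable_restrict_space_iff_ennreal) auto
 have e1: "q t * indicator {0<..<1/2} t = (q t * indicator {0<..<1} t) * indicator {0<..<1/2} t"
  and e2: "q t * indicator {1/2<..<1} t = (q t * indicator {0<..<1} t) * indicator {1/2<..<1} t" for t
  by (auto simp: indicator_def)
 show m1: "(\<lambda>t. q t * indicator {0<..<1/2} t) \<in> borel_measurable lborel"
  unfolding e1 by (rule borel_measurable_times_ennreal[OF m]) simp
 show m2: "(\<lambda>t. q t * indicator {1/2<..<1} t) \<in> borel_measurable lborel"
  unfolding e2 by (rule borel_measurable_times_ennreal[OF m]) simp
 have "(\<integral>\<^sup>+t. q t \<partial>uniform01) = (\<integral>\<^sup>+t. q t * indicator {0<..<1} t \<partial>lborel)"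
  unfolding uniform01_def by (rule nn_integral_restrict_space) simp
 also have "... = (\<integral>\<^sup>+t. q t * indicator {0<..<1/2} t + q t * indicator {1/2<..<1} t \<partial>lborel)"
 proof (rule nn_integral_cong_AE)
  have "AE t in lborel. t \<noteq> (1/2::real)" by (rule AE_lborel_singleton)
  then show "AE t in lborel. q t * indicator {0<..<1} t = q t * indicator {0<..<1/2} t + q t * indicator {1/2<..<1} t"
   by eventually_elim (auto simp: indicator_def)
 qed
 also have "... = (\<integral>\<^sup>+t. q t * indicator {0<..<1/2} t \<partial>lborel) + (\<integral>\<^sup>+t. q t * indicator {1/2<..<1} t \<partial>lborel)"
  using m1 m2 by (rule nn_integral_add)
 finally show "(\<integral>\<^sup>+t. q t \<partial>uniform01) = ..." .
qed

text \<open>A substitute for monotonicity that survives absolute values and truncation: the absolute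
  value of a monotone function need not be monotone, but between two points it is at most the sum of
  the values there.\<close>

definition squeezable :: "(real => ennreal) => bool" where
 "squeezable q \<longleftrightarrow> (\<forall>l x r. 0 < l --> l <= x --> x <= r --> r < 1 --> q x <= q l + q r)"

text \<open>The slope \<open>m/(m+1)\<close> is at least 1/2, so the substitution costs at most a
  factor 2.\<close>

lemma nn_integral_affine_le:
 fixes p :: "real => ennreal"
 assumes p: "p \<in> borel_measurable lborel" and m: "m > 0"
 shows "(\<integral>\<^sup>+t. p (b + real m / (real m + 1) * t) \<partial>lborel) <= 2 * (\<integral>\<^sup>+t. p t \<partial>lborel)"
proof -
 define c where "c = real m / (real m + 1)"
 have c: "c >= 1/2" using m by (simp add: c_def field_simps)
 have "(\<integral>\<^sup>+t. p t \<partial>lborel) = ennreal \<bar>c\<bar> * (\<integral>\<^sup>+t. p (b + c * t) \<partial>lborel)"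
  using p c by (intro nn_integral_real_affine) auto
 then have "2 * (\<integral>\<^sup>+t. p t \<partial>lborel) = (2 * ennreal c) * (\<integral>\<^sup>+t. p (b + c * t) \<partial>lborel)"
  using c by (simp add: mult.assoc)
 moreover have "1 <= 2 * ennreal c"
 proof -
  have "ennreal 1 <= ennreal (2 * c)" using c by (intro ennreal_leI) simp
  then show ?thesis using c by (simp add: ennreal_mult)
 qed
 ultimately show ?thesis
  using mult_right_mono[of 1 "2 * ennreal c" "\<integral>\<^sup>+t. p (b + c * t) \<partial>lborel"] by (simp add: c_def)
qed

text \<open>Squeezing bounds the value at the grid point by those at \<open>low\<close> and
  \<open>up\<close>, and each of the two affine substitutions costs a factor 2. The constant 4 is
  uniform in \<open>m\<close>.\<close>

lemma half_grid_dominated: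
 fixes q :: "real => ennreal"
 assumes q: "(\<lambda>t. q t * indicator {a<..<a + 1/2} t) \<in> borel_measurable lborel"
  and s: "squeezable q" and a: "0 <= a" "a <= 1/2"
 shows "(\<integral>\<^sup>+t. q (quant m a t) * indicator {a<..<a + 1/2} t \<partial>lborel) <= 4 * (\<integral>\<^sup>+t. q t * indicator {a<..<a + 1/2} t \<partial>lborel)"
proof (cases "m = 0")
 case True
 have "1 * (\<integral>\<^sup>+t. q t * indicator {a<..<a + 1/2} t \<partial>lborel) <= 4 * (\<integral>\<^sup>+t. q t * indicator {a<..<a + 1/2} t \<partial>lborel)"
  by (intro mult_right_mono) auto
 then show ?thesis using True by (simp add: quant_def)
next
 case False
 then have m: "m > 0" by simp
 let ?p = "\<lambda>t. q t * indicator {a<..<a + 1/2} t"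
 have "(\<integral>\<^sup>+t. q (quant m a t) * indicator {a<..<a + 1/2} t \<partial>lborel) <= (\<integral>\<^sup>+t. ?p (low m a t) + ?p (up m a t) \<partial>lborel)"
 proof (rule nn_integral_mono)
  fix t
  show "q (quant m a t) * indicator {a<..<a + 1/2} t <= ?p (low m a t) + ?p (up m a t)"
  proof (cases "t \<in> {a<..<a + 1/2}")
   case True
   then have t: "a < t" "t < a + 1/2" by auto
   note b = low_up_bounds[OF m t]
   have "q (quant m a t) <= q (low m a t) + q (up m a t)"
    by (rule s[unfolded squeezable_def, rule_format]) (use b a in linarith)+
   then show ?thesis using True b by (auto simp: indicator_def)
  qed simp
 qed
 also have "... = (\<integral>\<^sup>+t. ?p (low m a t) \<partial>lborel) + (\<integral>\<^sup>+t. ?p (up m a t) \<partial>lborel)"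
 proof (rule nn_integral_add)
  have lm: "low m a \<in> measurable lborel lborel" "up m a \<in> measurable lborel lborel"
   unfolding low_def[abs_def] up_def[abs_def] by measurable
  show "(\<lambda>t. ?p (low m a t)) \<in> borel_measurable lborel" by (rule measurable_compose[OF lm(1) q])
  show "(\<lambda>t. ?p (up m a t)) \<in> borel_measurable lborel" by (rule measurable_compose[OF lm(2) q])
 qed
 also have "... <= 2 * (\<integral>\<^sup>+t. ?p t \<partial>lborel) + 2 * (\<integral>\<^sup>+t. ?p t \<partial>lborel)"
  unfolding low_def up_def by (intro add_mono nn_integral_affine_le[OF q m])
 also have "... = 4 * (\<integral>\<^sup>+t. ?p t \<partial>lborel)" by (simp add: distrib_right[symmetric])
 finally show ?thesis .
qed

lemma grid_dominated:
 fixes q :: "real => ennreal"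
 assumes q: "q \<in> borel_measurable uniform01" and s: "squeezable q"
 shows "(\<integral>\<^sup>+t. q (grid_map nm np t) \<partial>uniform01) <= 4 * (\<integral>\<^sup>+t. q t \<partial>uniform01)"
proof -
 note h = nn_integral_uniform01_halves[OF q]
 have "(\<integral>\<^sup>+t. q (grid_map nm np t) \<partial>uniform01)
  = (\<integral>\<^sup>+t. q (grid_map nm np t) * indicator {0<..<1/2} t \<partial>lborel) + (\<integral>\<^sup>+t. q (grid_map nm np t) * indicator {1/2<..<1} t \<partial>lborel)"
  by (rule nn_integral_uniform01_halves(3)) (rule measurable_compose[OF grid_map_measurable q])
 also have "(\<integral>\<^sup>+t. q (grid_map nm np t) * indicator {0<..<1/2} t \<partial>lborel) = (\<integral>\<^sup>+t. q (quant nm 0 t) * indicator {0<..<0 + 1/2} t \<partial>lborel)"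
  by (intro nn_integral_cong) (auto simp: indicator_def grid_map_def)
 also have "(\<integral>\<^sup>+t. q (grid_map nm np t) * indicator {1/2<..<1} t \<partial>lborel) = (\<integral>\<^sup>+t. q (quant np (1/2) t) * indicator {1/2<..<1/2 + 1/2} t \<partial>lborel)"
  by (intro nn_integral_cong) (auto simp: indicator_def grid_map_def)
 also have "(\<integral>\<^sup>+t. q (quant nm 0 t) * indicator {0<..<0 + 1/2} t \<partial>lborel) + (\<integral>\<^sup>+t. q (quant np (1/2) t) * indicator {1/2<..<1/2 + 1/2} t \<partial>lborel)
   <= 4 * (\<integral>\<^sup>+t. q t * indicator {0<..<0 + 1/2} t \<partial>lborel) + 4 * (\<integral>\<^sup>+t. q t * indicator {1/2<..<1/2 + 1/2} t \<partial>lborel)"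
  using h(1,2) by (intro add_mono half_grid_dominated s) auto
 also have "... = 4 * (\<integral>\<^sup>+t. q t \<partial>uniform01)"
  unfolding h(3) by (simp add: distrib_left)
 finally show ?thesis .
qed

text \<open>Strips at the ends of both half intervals: only there do the images of a half interval
  under \<open>low\<close> and \<open>up\<close> differ.\<close>

definition grid_edge :: "nat => real set" where
 "grid_edge m = {t. t <= 1 / (2 * real m) \<or> \<bar>t - 1/2\<bar> <= 1 / (2 * real m) \<or> 1 - 1 / (2 * real m) <= t}"

text \<open>For increasing \<open>G\<close> both values lie between \<open>G (low m a t)\<close> and
  \<open>G (up m a t)\<close>, so the error is at most the difference of these. After the affine
  substitutions the two integrals run over the half interval shortened at opposite ends; the common
  part cancels and only strips of length \<open>\<delta>\<close> remain.\<close>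

lemma half_grid_error:
 fixes G :: "real => real"
 assumes G: "integrable lborel (\<lambda>t. G t * indicator {a<..<a + 1/2} t)" and a: "a = 0 \<or> a = 1/2"
  and mono: "\<And>x y. 0 < x ==> x <= y ==> y < 1 ==> G x <= G y" and m: "0 < m0" "m0 <= m"
 shows "(\<integral>\<^sup>+t. ennreal \<bar>G (quant m a t) - G t\<bar> * indicator {a<..<a + 1/2} t \<partial>lborel)
  <= 2 * (\<integral>\<^sup>+t. ennreal \<bar>G t\<bar> * indicator (grid_edge m0) t * indicator {a<..<a + 1/2} t \<partial>lborel)"
proof -
 have m': "m > 0" using m by simp
 define c where "c = real m / (real m + 1)"
 define \<delta> where "\<delta> = 1 / (2 * (real m + 1))"
 have c: "c >= 1/2" using m' by (simp add: c_def field_simps)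
 have c1: "c * (1 / 2) = 1/2 - \<delta>" by (simp add: c_def \<delta>_def field_simps)
 have d0: "\<delta> > 0" by (simp add: \<delta>_def)
 have d1: "\<delta> <= 1 / (2 * real m0)" using m by (simp add: \<delta>_def frac_le)
 let ?H = "{a<..<a + 1/2}"
 let ?g = "\<lambda>t. G t * indicator ?H t"
 \<comment> \<open>Cut off to zero outside the images, so that substituting back yields exactly the
   indicator of the half interval.\<close>
 define f1 where "f1 t = ?g t * indicator {a + \<delta><..<a + 1/2} t" for t
 define f2 where "f2 t = ?g t * indicator {a<..<a + 1/2 - \<delta>} t" for t
 have i1: "integrable lborel f1" unfolding f1_def[abs_def]
  using integrable_mult_indicator[OF _ G, of "{a + \<delta><..<a + 1/2}"] by (simp add: mult.commute)
 have i2: "integrable lborel f2" unfolding f2_def[abs_def]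
  using integrable_mult_indicator[OF _ G, of "{a<..<a + 1/2 - \<delta>}"] by (simp add: mult.commute)
 have e1: "f1 (up m a t) = G (up m a t) * indicator ?H t" for t
 proof -
  have u: "up m a t = a + \<delta> + c * (t - a)" by (simp add: up_def c_def \<delta>_def algebra_simps diff_divide_distrib)
  have "up m a t \<in> {a + \<delta><..<a + 1/2} \<longleftrightarrow> 0 < c * (t - a) \<and> c * (t - a) < c * (1/2)"
   unfolding u c1 by auto
  also have "... \<longleftrightarrow> t \<in> ?H"
   using c unfolding mult_less_cancel_left zero_less_mult_iff by auto
  finally show ?thesis using d0 by (auto simp: f1_def indicator_def)
 qed
 have e2: "f2 (low m a t) = G (low m a t) * indicator ?H t" for t
 proof -
  have u: "low m a t = a + c * (t - a)" by (simp add: low_def c_def algebra_simps diff_divide_distrib)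
  have "low m a t \<in> {a<..<a + 1/2 - \<delta>} \<longleftrightarrow> 0 < c * (t - a) \<and> c * (t - a) < c * (1/2)"
   unfolding u c1 by auto
  also have "... \<longleftrightarrow> t \<in> ?H"
   using c unfolding mult_less_cancel_left zero_less_mult_iff by auto
  finally show ?thesis using d0 by (auto simp: f2_def indicator_def)
 qed
 have c0: "c \<noteq> 0" using c by auto
 have a1: "(LINT t|lborel. f1 t) = c * (LINT t|lborel. f1 (up m a t))"
  using lborel_integral_real_affine[OF c0, of f1 "a * (1 - c) + \<delta>"] c by (simp add: up_def c_def \<delta>_def)
 have a2: "(LINT t|lborel. f2 t) = c * (LINT t|lborel. f2 (low m a t))"
  using lborel_integral_real_affine[OF c0, of f2 "a * (1 - c)"] c by (simp add: low_def c_def)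
 have j1: "integrable lborel (\<lambda>t. f1 (up m a t))"
  using lborel_integrable_real_affine[OF i1 c0, of "a * (1 - c) + \<delta>"] by (simp add: up_def c_def \<delta>_def)
 have j2: "integrable lborel (\<lambda>t. f2 (low m a t))"
  using lborel_integrable_real_affine[OF i2 c0, of "a * (1 - c)"] by (simp add: low_def c_def)
 let ?E = "\<lambda>t. \<bar>G t\<bar> * indicator (grid_edge m0) t * indicator ?H t"
 have Em: "grid_edge m0 \<in> sets lborel" unfolding grid_edge_def by measurable
 have iE: "integrable lborel ?E"
 proof -
  have "integrable lborel (\<lambda>t. indicator (grid_edge m0) t *\<^sub>R \<bar>?g t\<bar>)"
   by (rule integrable_mult_indicator[OF Em]) (use G in simp)
  then show ?thesis by (rule L1_integrable_cong[THEN iffD1, rotated -1]) (auto simp: indicator_def)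
 qed
 have pos: "f1 (up m a t) - f2 (low m a t) >= 0" for t
  unfolding e1 e2 using low_up_bounds[OF m', of a t] a
  by (cases "t \<in> ?H") (auto simp: indicator_def intro!: mono)
 have "(\<integral>\<^sup>+t. ennreal \<bar>G (quant m a t) - G t\<bar> * indicator ?H t \<partial>lborel) <= (\<integral>\<^sup>+t. ennreal (f1 (up m a t) - f2 (low m a t)) \<partial>lborel)"
 proof (rule nn_integral_mono)
  fix t
  show "ennreal \<bar>G (quant m a t) - G t\<bar> * indicator ?H t <= ennreal (f1 (up m a t) - f2 (low m a t))"
  proof (cases "t \<in> ?H")
   case True
   then have t: "a < t" "t < a + 1/2" by auto
   note b = low_up_bounds[OF m' t]
   have a01: "0 <= a" "a + 1/2 <= 1" using a by auto
   have "G (low m a t) <= G (quant m a t)" "G (quant m a t) <= G (up m a t)" "G (low m a t) <= G t" "G t <= G (up m a t)"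
    using b a01 by (intro mono; linarith)+
   then have "\<bar>G (quant m a t) - G t\<bar> <= G (up m a t) - G (low m a t)" by linarith
   then show ?thesis unfolding e1 e2 using True by (simp add: ennreal_leI)
  qed simp
 qed
 also have "... = ennreal (LINT t|lborel. f1 (up m a t) - f2 (low m a t))"
  by (rule nn_integral_eq_integral) (use j1 j2 pos in auto)
 also have "... <= ennreal (2 * (LINT t|lborel. ?E t))"
 proof (rule ennreal_leI)
  have "c * (LINT t|lborel. f1 (up m a t) - f2 (low m a t)) = (LINT t|lborel. f1 t - f2 t)"
   using j1 j2 i1 i2 a1 a2 by (simp add: algebra_simps)
  also have "... <= (LINT t|lborel. ?E t)"
  proof (rule integral_mono[OF _ iE])
   show "integrable lborel (\<lambda>t. f1 t - f2 t)" using i1 i2 by simp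
   fix t
   show "f1 t - f2 t <= ?E t"
   proof (cases "t \<in> ?H \<and> \<not> (t \<in> {a + \<delta><..<a + 1/2} \<and> t \<in> {a<..<a + 1/2 - \<delta>})")
    case True
    then have "t \<in> grid_edge m0" using a d1 d0 by (auto simp: grid_edge_def)
    then show ?thesis using True by (auto simp: f1_def f2_def indicator_def)
   qed (auto simp: f1_def f2_def indicator_def)
  qed
  finally have "c * (LINT t|lborel. f1 (up m a t) - f2 (low m a t)) <= (LINT t|lborel. ?E t)" .
  moreover have "0 <= (LINT t|lborel. f1 (up m a t) - f2 (low m a t))" using pos by (intro integral_nonneg_AE) auto
  then have "1/2 * (LINT t|lborel. f1 (up m a t) - f2 (low m a t)) <= c * (LINT t|lborel. f1 (up m a t) - f2 (low m a t))"
   using c by (intro mult_right_mono)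
  ultimately show "(LINT t|lborel. f1 (up m a t) - f2 (low m a t)) <= 2 * (LINT t|lborel. ?E t)" by linarith
 qed
 also have "... = 2 * (\<integral>\<^sup>+t. ennreal (?E t) \<partial>lborel)"
  using iE by (subst nn_integral_eq_integral) (auto simp: ennreal_mult)
 also have "(\<integral>\<^sup>+t. ennreal (?E t) \<partial>lborel) = (\<integral>\<^sup>+t. ennreal \<bar>G t\<bar> * indicator (grid_edge m0) t * indicator ?H t \<partial>lborel)"
  by (intro nn_integral_cong) (auto simp: indicator_def)
 finally show ?thesis .
qed

lemma grid_error_increasing:
 fixes G :: "real => real"
 assumes G: "integrable uniform01 G"
  and mono: "\<And>x y. 0 < x ==> x <= y ==> y < 1 ==> G x <= G y" and m: "0 < m" "m <= nm" "m <= np"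
 shows "(\<integral>\<^sup>+t. ennreal \<bar>G (grid_map nm np t) - G t\<bar> \<partial>uniform01) <= 2 * (\<integral>\<^sup>+t. ennreal \<bar>G t\<bar> * indicator (grid_edge m) t \<partial>uniform01)"
proof -
 have i: "integrable lborel (\<lambda>t. indicator {0<..<1} t *\<^sub>R G t)"
  using G unfolding uniform01_def by (subst (asm) integrable_restrict_space) auto
 have i1: "integrable lborel (\<lambda>t. G t * indicator {0<..<0 + 1/2} t)"
 proof -
  have "integrable lborel (\<lambda>t. indicator {0<..<1/2} t *\<^sub>R (indicator {0<..<1} t *\<^sub>R G t))"
   by (rule integrable_mult_indicator[OF _ i]) simp
  then show ?thesis by (rule L1_integrable_cong[THEN iffD1, rotated -1]) (auto simp: indicator_def)
 qed
 have i2: "integrable lborel (\<lambda>t. G t * indicator {1/2<..<1/2 + 1/2} t)"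
 proof -
  have "integrable lborel (\<lambda>t. indicator {1/2<..<1} t *\<^sub>R (indicator {0<..<1} t *\<^sub>R G t))"
   by (rule integrable_mult_indicator[OF _ i]) simp
  then show ?thesis by (rule L1_integrable_cong[THEN iffD1, rotated -1]) (auto simp: indicator_def)
 qed
 have Gm: "G \<in> borel_measurable uniform01" using G by (rule borel_measurable_integrable)
 have Em: "(\<lambda>t. indicator (grid_edge m) t :: ennreal) \<in> borel_measurable uniform01"
 proof -
  have "(\<lambda>t. indicator (grid_edge m) t :: ennreal) \<in> borel_measurable borel"
   unfolding grid_edge_def by measurable
  from measurable_compose[OF id_uniform01 this] show ?thesis by simp
 qed
 have m1: "(\<lambda>t. ennreal \<bar>G (grid_map nm np t) - G t\<bar>) \<in> borel_measurable uniform01"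
  using Gm measurable_compose[OF grid_map_measurable Gm] by simp
 have m2: "(\<lambda>t. ennreal \<bar>G t\<bar> * indicator (grid_edge m) t) \<in> borel_measurable uniform01"
  using Gm Em by simp
 have "(\<integral>\<^sup>+t. ennreal \<bar>G (grid_map nm np t) - G t\<bar> \<partial>uniform01)
  = (\<integral>\<^sup>+t. ennreal \<bar>G (grid_map nm np t) - G t\<bar> * indicator {0<..<1/2} t \<partial>lborel)
   + (\<integral>\<^sup>+t. ennreal \<bar>G (grid_map nm np t) - G t\<bar> * indicator {1/2<..<1} t \<partial>lborel)"
  by (rule nn_integral_uniform01_halves(3)[OF m1])
 also have "(\<integral>\<^sup>+t. ennreal \<bar>G (grid_map nm np t) - G t\<bar> * indicator {0<..<1/2} t \<partial>lborel)
  = (\<integral>\<^sup>+t. ennreal \<bar>G (quant nm 0 t) - G t\<bar> * indicator {0<..<0 + 1/2} t \<partial>lborel)"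
  by (intro nn_integral_cong) (auto simp: indicator_def grid_map_def)
 also have "(\<integral>\<^sup>+t. ennreal \<bar>G (grid_map nm np t) - G t\<bar> * indicator {1/2<..<1} t \<partial>lborel)
  = (\<integral>\<^sup>+t. ennreal \<bar>G (quant np (1/2) t) - G t\<bar> * indicator {1/2<..<1/2 + 1/2} t \<partial>lborel)"
  by (intro nn_integral_cong) (auto simp: indicator_def grid_map_def)
 also have "(\<integral>\<^sup>+t. ennreal \<bar>G (quant nm 0 t) - G t\<bar> * indicator {0<..<0 + 1/2} t \<partial>lborel)
   + (\<integral>\<^sup>+t. ennreal \<bar>G (quant np (1/2) t) - G t\<bar> * indicator {1/2<..<1/2 + 1/2} t \<partial>lborel)
  <= 2 * (\<integral>\<^sup>+t. ennreal \<bar>G t\<bar> * indicator (grid_edge m) t * indicator {0<..<0 + 1/2} t \<partial>lborel)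
   + 2 * (\<integral>\<^sup>+t. ennreal \<bar>G t\<bar> * indicator (grid_edge m) t * indicator {1/2<..<1/2 + 1/2} t \<partial>lborel)"
  by (intro add_mono half_grid_error[OF i1 _ mono] half_grid_error[OF i2 _ mono]) (use m in auto)
 also have "... = 2 * (\<integral>\<^sup>+t. ennreal \<bar>G t\<bar> * indicator (grid_edge m) t \<partial>uniform01)"
  using nn_integral_uniform01_halves(3)[OF m2] by (simp add: distrib_left)
 finally show ?thesis .
qed

lemma grid_error:
 fixes G :: "real => real"
 assumes G: "integrable uniform01 G"
  and mono: "monotone_on {0<..<1} (<=) (<=) G \<or> monotone_on {0<..<1} (<=) (>=) G" and m: "0 < m" "m <= nm" "m <= np"
 shows "(\<integral>\<^sup>+t. ennreal \<bar>G (grid_map nm np t) - G t\<bar> \<partial>uniform01) <= 2 * (\<integral>\<^sup>+t. ennreal \<bar>G t\<bar> * indicator (grid_edge m) t \<partial>uniform01)"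
 using mono
proof
 assume "monotone_on {0<..<1} (<=) (<=) G"
 then show ?thesis by (intro grid_error_increasing G m) (auto simp: monotone_on_def)
next
 assume "monotone_on {0<..<1} (<=) (>=) G"
 then have "(\<integral>\<^sup>+t. ennreal \<bar>- G (grid_map nm np t) - (- G t)\<bar> \<partial>uniform01) <= 2 * (\<integral>\<^sup>+t. ennreal \<bar>- G t\<bar> * indicator (grid_edge m) t \<partial>uniform01)"
  using G m by (intro grid_error_increasing) (auto simp: monotone_on_def)
 moreover have "\<bar>- G (grid_map nm np t) - (- G t)\<bar> = \<bar>G (grid_map nm np t) - G t\<bar>" for t by linarith
 ultimately show ?thesis by simp
qed

section \<open>Quantization of several coordinates, one at a time\<close>

definition quantize :: "nat => nat => nat set => (nat => real) => nat => real" where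
 "quantize nm np S w = (\<lambda>i. if i \<in> S then grid_map nm np (w i) else w i)"

lemma cube_component: "i <= k ==> (\<lambda>w. w i) \<in> measurable (cube k) uniform01"
 unfolding cube_def by (rule measurable_component_singleton) simp

lemma cube_component_borel: "i <= k ==> (\<lambda>w. w i) \<in> borel_measurable (cube k)"
 unfolding cube_def by (rule uniform_component_measurable) simp

lemma quantize_measurable:
 assumes "S \<subseteq> {..k}"
 shows "quantize nm np S \<in> measurable (cube k) (cube k)"
proof -
 have "(\<lambda>w. \<lambda>i\<in>{..k}. if i \<in> S then grid_map nm np (w i) else w i) \<in> measurable (cube k) (unif {..k})"
 proof (rule measurable_restrict)
  fix i assume "i \<in> {..k}"
  then have c: "(\<lambda>w. w i) \<in> measurable (cube k) uniform01" by (intro cube_component) simp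
  show "(\<lambda>w. if i \<in> S then grid_map nm np (w i) else w i) \<in> measurable (cube k) uniform01"
   using measurable_compose[OF c grid_map_measurable] c by (cases "i \<in> S") simp_all
 qed
 moreover have "(\<lambda>i\<in>{..k}. if i \<in> S then grid_map nm np (w i) else w i) = quantize nm np S w" if "w \<in> space (cube k)" for w
  using that assms by (auto simp: space_cube PiE_iff extensional_def quantize_def fun_eq_iff)
 ultimately show ?thesis
  by (subst measurable_cong[where g = "\<lambda>w. \<lambda>i\<in>{..k}. if i \<in> S then grid_map nm np (w i) else w i"])
    (simp_all add: cube_def)
qed

lemma quantize_in_space: "S \<subseteq> {..k} ==> w \<in> space (cube k) ==> quantize nm np S w \<in> space (cube k)"
 using measurable_space[OF quantize_measurable] .

lemma update_measurable_pair:
 assumes i: "i <= k"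
 shows "(\<lambda>x. (fst x)(i := snd x)) \<in> measurable (cube k \<Otimes>\<^sub>M uniform01) (cube k)"
proof -
 let ?P = "cube k \<Otimes>\<^sub>M uniform01"
 have "(\<lambda>x. \<lambda>j\<in>{..k}. if j = i then snd x else fst x j) \<in> measurable ?P (unif {..k})"
 proof (rule measurable_restrict)
  fix j assume j: "j \<in> {..k}"
  have c: "(\<lambda>x. fst x j) \<in> measurable ?P uniform01"
   by (rule measurable_compose[OF measurable_fst cube_component]) (use j in simp)
  show "(\<lambda>x. if j = i then snd x else fst x j) \<in> measurable ?P uniform01"
   using c measurable_snd by (cases "j = i") simp_all
 qed
 moreover have "(\<lambda>j\<in>{..k}. if j = i then snd x else fst x j) = (fst x)(i := snd x)" if "x \<in> space ?P" for x
  using that i by (auto simp: space_pair_measure space_cube PiE_iff extensional_def fun_eq_iff)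
 ultimately show ?thesis
  by (subst measurable_cong[where g = "\<lambda>x. \<lambda>j\<in>{..k}. if j = i then snd x else fst x j"]) (simp_all add: cube_def)
qed

lemma update_measurable:
 assumes i: "i <= k"
 shows "u \<in> space (cube k) ==> (\<lambda>t. u(i := t)) \<in> measurable uniform01 (cube k)"
  "t \<in> {0<..<1} ==> (\<lambda>u. u(i := t)) \<in> measurable (cube k) (cube k)"
 using measurable_compose[OF measurable_Pair1' update_measurable_pair[OF i], of u]
  measurable_compose[OF measurable_Pair2' update_measurable_pair[OF i], of t] by simp_all

lemma inner_integral_measurable:
 assumes "F \<in> borel_measurable (cube k)" "i <= k"
 shows "(\<lambda>u. \<integral>\<^sup>+t. F (u(i := t)) \<partial>uniform01) \<in> borel_measurable (cube k)"
 by (rule U01.borel_measurable_nn_integral)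
   (use measurable_compose[OF update_measurable_pair assms(1)] assms(2) in \<open>simp add: case_prod_unfold\<close>)

text \<open>The outer variable keeps a coordinate \<open>u i\<close> that is overwritten, so the
  outer integral may run over the whole cube.\<close>

lemma nn_integral_cube_coordinate:
 fixes F :: "(nat => real) => ennreal"
 assumes F: "F \<in> borel_measurable (cube k)" and i: "i <= k"
 shows "(\<integral>\<^sup>+w. F w \<partial>cube k) = (\<integral>\<^sup>+u. \<integral>\<^sup>+t. F (u(i := t)) \<partial>uniform01 \<partial>cube k)"
proof -
 have "(\<integral>\<^sup>+w. F w \<partial>cube k) = (\<integral>\<^sup>+u. \<integral>\<^sup>+v. F (mix {i} v u) \<partial>cube k \<partial>cube k)"
  unfolding cube_def by (rule nn_integral_mix[symmetric]) (use F prob_space_uniform01 in \<open>auto simp: cube_def\<close>)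
 also have "... = (\<integral>\<^sup>+u. \<integral>\<^sup>+t. F (u(i := t)) \<partial>uniform01 \<partial>cube k)"
 proof (rule nn_integral_cong)
  fix u assume u: "u \<in> space (cube k)"
  have d: "distr (cube k) uniform01 (\<lambda>v. v i) = uniform01"
   unfolding cube_def using i by (intro distr_PiM_component prob_space_uniform01) simp
  have "(\<integral>\<^sup>+v. F (mix {i} v u) \<partial>cube k) = (\<integral>\<^sup>+v. F (u(i := v i)) \<partial>cube k)"
   by (intro nn_integral_cong arg_cong[of _ _ F]) (auto simp: mix_def)
  also have "... = (\<integral>\<^sup>+t. F (u(i := t)) \<partial>distr (cube k) uniform01 (\<lambda>v. v i))"
   by (rule nn_integral_distr[symmetric, OF cube_component[OF i]])
     (use measurable_compose[OF update_measurable(1)[OF i u] F] in simp)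
  finally show "(\<integral>\<^sup>+v. F (mix {i} v u) \<partial>cube k) = (\<integral>\<^sup>+t. F (u(i := t)) \<partial>uniform01)" unfolding d .
 qed
 finally show ?thesis .
qed

definition coord_squeezable :: "nat => ((nat => real) => ennreal) => bool" where
 "coord_squeezable k q \<longleftrightarrow> (\<forall>w\<in>space (cube k). \<forall>i\<le>k. squeezable (\<lambda>t. q (w(i := t))))"

lemma quantize_update:
 "i \<notin> S ==> quantize nm np S (u(i := t)) = (quantize nm np S u)(i := t)"
 "quantize nm np (insert i S) (u(i := t)) = (quantize nm np S u)(i := grid_map nm np t)"
 by (auto simp: quantize_def)

text \<open>Induction over the quantized coordinates, each costing the factor 4 of
  \<open>grid_dominated\<close>. The weight \<open>W\<close> must not see these coordinates; it will
  carry the edge indicator of a coordinate that is still unquantized.\<close>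

lemma quantize_dominated:
 assumes q: "q \<in> borel_measurable (cube k)" and s: "coord_squeezable k q"
  and W: "W \<in> borel_measurable (cube k)" and S: "S \<subseteq> {..k}"
  and WS: "\<And>w i t. w \<in> space (cube k) ==> i \<in> S ==> t \<in> {0<..<1} ==> W (w(i := t)) = W w"
 shows "(\<integral>\<^sup>+w. q (quantize nm np S w) * W w \<partial>cube k) <= 4 ^ card S * (\<integral>\<^sup>+w. q w * W w \<partial>cube k)"
proof -
 have "finite S" using S finite_subset by auto
 then show ?thesis using S WS
 proof (induction S rule: finite_induct)
  case empty
  then show ?case by (simp add: quantize_def)
 next
  case (insert i S)
  have i: "i <= k" and S: "S \<subseteq> {..k}" using insert.prems by auto
  have m: "(\<lambda>w. q (quantize nm np S w) * W w) \<in> borel_measurable (cube k)" if "S \<subseteq> {..k}" for S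
   using measurable_compose[OF quantize_measurable[OF that] q] W by simp
  have "(\<integral>\<^sup>+w. q (quantize nm np (insert i S) w) * W w \<partial>cube k)
    = (\<integral>\<^sup>+u. \<integral>\<^sup>+t. q (quantize nm np (insert i S) (u(i := t))) * W (u(i := t)) \<partial>uniform01 \<partial>cube k)"
   by (rule nn_integral_cube_coordinate[OF m[OF insert.prems(1)] i])
  also have "... = (\<integral>\<^sup>+u. (\<integral>\<^sup>+t. q ((quantize nm np S u)(i := grid_map nm np t)) \<partial>uniform01) * W u \<partial>cube k)"
  proof (rule nn_integral_cong)
   fix u assume u: "u \<in> space (cube k)"
   have Wu: "W (u(i := t)) = W u" if "t \<in> space uniform01" for t
    by (rule insert.prems(2)[OF u]) (use that in auto)
   have "(\<integral>\<^sup>+t. q (quantize nm np (insert i S) (u(i := t))) * W (u(i := t)) \<partial>uniform01)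
    = (\<integral>\<^sup>+t. q ((quantize nm np S u)(i := grid_map nm np t)) * W u \<partial>uniform01)"
    using Wu by (intro nn_integral_cong) (simp add: quantize_update)
   also have "... = (\<integral>\<^sup>+t. q ((quantize nm np S u)(i := grid_map nm np t)) \<partial>uniform01) * W u"
    by (rule nn_integral_multc)
      (rule measurable_compose[OF grid_map_measurable
       measurable_compose[OF update_measurable(1)[OF i quantize_in_space[OF S u]] q]])
   finally show "(\<integral>\<^sup>+t. q (quantize nm np (insert i S) (u(i := t))) * W (u(i := t)) \<partial>uniform01) = ..." .
  qed
  also have "... <= (\<integral>\<^sup>+u. 4 * ((\<integral>\<^sup>+t. q ((quantize nm np S u)(i := t)) \<partial>uniform01) * W u) \<partial>cube k)"
  proof (rule nn_integral_mono)
   fix u assume u: "u \<in> space (cube k)"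
   have u': "quantize nm np S u \<in> space (cube k)" by (rule quantize_in_space[OF S u])
   have "(\<integral>\<^sup>+t. q ((quantize nm np S u)(i := grid_map nm np t)) \<partial>uniform01)
     <= 4 * (\<integral>\<^sup>+t. q ((quantize nm np S u)(i := t)) \<partial>uniform01)"
   proof (rule grid_dominated)
    show "(\<lambda>t. q ((quantize nm np S u)(i := t))) \<in> borel_measurable uniform01"
     by (rule measurable_compose[OF update_measurable(1)[OF i u'] q])
    show "squeezable (\<lambda>t. q ((quantize nm np S u)(i := t)))"
     using s u' i by (auto simp: coord_squeezable_def)
   qed
   then show "(\<integral>\<^sup>+t. q ((quantize nm np S u)(i := grid_map nm np t)) \<partial>uniform01) * W u
    <= 4 * ((\<integral>\<^sup>+t. q ((quantize nm np S u)(i := t)) \<partial>uniform01) * W u)"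
    unfolding mult.assoc[symmetric] by (rule mult_right_mono) simp
  qed
  also have "... = (\<integral>\<^sup>+u. 4 * (\<integral>\<^sup>+t. q (quantize nm np S (u(i := t))) * W (u(i := t)) \<partial>uniform01) \<partial>cube k)"
  proof (rule nn_integral_cong)
   fix u assume u: "u \<in> space (cube k)"
   have Wu: "W (u(i := t)) = W u" if "t \<in> space uniform01" for t
    by (rule insert.prems(2)[OF u]) (use that in auto)
   have "(\<integral>\<^sup>+t. q (quantize nm np S (u(i := t))) * W (u(i := t)) \<partial>uniform01)
    = (\<integral>\<^sup>+t. q ((quantize nm np S u)(i := t)) * W u \<partial>uniform01)"
    using Wu insert.hyps by (intro nn_integral_cong) (simp add: quantize_update)
   also have "... = (\<integral>\<^sup>+t. q ((quantize nm np S u)(i := t)) \<partial>uniform01) * W u"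
    by (rule nn_integral_multc)
      (rule measurable_compose[OF update_measurable(1)[OF i quantize_in_space[OF S u]] q])
   finally show "4 * ((\<integral>\<^sup>+t. q ((quantize nm np S u)(i := t)) \<partial>uniform01) * W u)
    = 4 * (\<integral>\<^sup>+t. q (quantize nm np S (u(i := t))) * W (u(i := t)) \<partial>uniform01)" by simp
  qed
  also have "... = 4 * (\<integral>\<^sup>+w. q (quantize nm np S w) * W w \<partial>cube k)"
  proof -
   note inner_integral_measurable[OF m[OF S] i]
   then show ?thesis
    by (subst nn_integral_cmult) (simp_all add: nn_integral_cube_coordinate[OF m[OF S] i])
  qed
  also have "... <= 4 * (4 ^ card S * (\<integral>\<^sup>+w. q w * W w \<partial>cube k))"
   using insert.prems S by (intro mult_left_mono insert.IH) auto
  also have "... = 4 ^ card (insert i S) * (\<integral>\<^sup>+w. q w * W w \<partial>cube k)"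
   using insert.hyps by (simp add: mult.assoc)
  finally show ?case .
 qed
qed

text \<open>The middle value of a monotone section lies between the end values, so its absolute
  value is bounded by one of theirs. \<open>\<Psi>\<close> will be the identity or a truncated
  square.\<close>

lemma monotone_coord_squeezable:
 fixes \<Psi> :: "real => ennreal"
 assumes g: "monotone_in_each k g" and \<Psi>: "\<And>x y. 0 <= x ==> x <= y ==> \<Psi> x <= \<Psi> y"
 shows "coord_squeezable k (\<lambda>w. \<Psi> \<bar>g w\<bar>)"
 unfolding coord_squeezable_def squeezable_def
proof (intro ballI allI impI)
 fix w i and l x r :: real
 assume w: "w \<in> space (cube k)" and i: "i <= k" and *: "0 < l" "l <= x" "x <= r" "r < 1"
 let ?G = "\<lambda>x. g (w(i := x))"
 have "monotone_on {0<..<1} (<=) (<=) ?G \<or> monotone_on {0<..<1} (<=) (>=) ?G"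
  using g w i by (auto simp: monotone_in_each_def)
 then have "?G l <= ?G x \<and> ?G x <= ?G r \<or> ?G r <= ?G x \<and> ?G x <= ?G l"
  using * by (auto simp: monotone_on_def)
 then consider "\<bar>?G x\<bar> <= \<bar>?G l\<bar>" | "\<bar>?G x\<bar> <= \<bar>?G r\<bar>" by linarith
 then show "\<Psi> \<bar>?G x\<bar> <= \<Psi> \<bar>?G l\<bar> + \<Psi> \<bar>?G r\<bar>"
 proof cases
  case 1
  then have "\<Psi> \<bar>?G x\<bar> <= \<Psi> \<bar>?G l\<bar>" by (intro \<Psi>) auto
  then show ?thesis by (rule order_trans) simp
 next
  case 2
  then have "\<Psi> \<bar>?G x\<bar> <= \<Psi> \<bar>?G r\<bar>" by (intro \<Psi>) auto
  then show ?thesis by (rule order_trans) simp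
 qed
qed

lemma grid_edge_measurable: "(\<lambda>t. indicator (grid_edge m) t :: ennreal) \<in> borel_measurable uniform01"
proof -
 have "(\<lambda>t. indicator (grid_edge m) t :: ennreal) \<in> borel_measurable borel"
  unfolding grid_edge_def by measurable
 from measurable_compose[OF id_uniform01 this] show ?thesis by simp
qed

text \<open>\<open>grid_error\<close> is applied to the section in coordinate \<open>j\<close> at a
  point whose earlier coordinates are already quantized; these are then restored by
  \<open>quantize_dominated\<close> with the edge indicator of coordinate \<open>j\<close> as
  weight, which costs \<open>4 ^ j\<close>.\<close>

lemma quantize_step_error:
 assumes g: "g \<in> borel_measurable (cube k)" "integrable (cube k) g" and mono: "monotone_in_each k g"
  and m: "0 < m" "m <= nm" "m <= np" and j: "j <= k"
 shows "(\<integral>\<^sup>+w. ennreal \<bar>g (quantize nm np {..<Suc j} w) - g (quantize nm np {..<j} w)\<bar> \<partial>cube k)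
  <= 2 * 4 ^ j * (\<integral>\<^sup>+w. ennreal \<bar>g w\<bar> * indicator (grid_edge m) (w j) \<partial>cube k)"
proof -
 let ?Q = "quantize nm np {..<j}"
 have S: "{..<j} \<subseteq> {..k}" "{..<Suc j} \<subseteq> {..k}" using j by auto
 have ins: "{..<Suc j} = insert j {..<j}" by auto
 have gQ: "(\<lambda>w. g (quantize nm np S w)) \<in> borel_measurable (cube k)" if "S \<subseteq> {..k}" for S
  using measurable_compose[OF quantize_measurable[OF that] g(1)] .
 have sq: "coord_squeezable k (\<lambda>w. ennreal \<bar>g w\<bar>)"
  by (rule monotone_coord_squeezable[OF mono]) (auto intro: ennreal_leI)
 have cs: "card {..<j} = j" by simp
 have Em: "(\<lambda>w. indicator (grid_edge m) (w j) :: ennreal) \<in> borel_measurable (cube k)"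
  by (rule measurable_compose[OF cube_component[OF j] grid_edge_measurable])
 have m1: "(\<lambda>w. ennreal \<bar>g (?Q w)\<bar>) \<in> borel_measurable (cube k)" using gQ[OF S(1)] by simp
 have fin: "(\<integral>\<^sup>+u. \<integral>\<^sup>+t. ennreal \<bar>g (?Q (u(j := t)))\<bar> \<partial>uniform01 \<partial>cube k) < \<infinity>"
 proof -
  have "(\<integral>\<^sup>+u. \<integral>\<^sup>+t. ennreal \<bar>g (?Q (u(j := t)))\<bar> \<partial>uniform01 \<partial>cube k) = (\<integral>\<^sup>+w. ennreal \<bar>g (?Q w)\<bar> * 1 \<partial>cube k)"
   using nn_integral_cube_coordinate[OF m1 j] by simp
  also have "... <= 4 ^ card {..<j} * (\<integral>\<^sup>+w. ennreal \<bar>g w\<bar> * 1 \<partial>cube k)"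
   by (rule quantize_dominated[OF _ sq _ S(1)]) (use g in auto)
  also have "... < \<infinity>"
   using g(2) by (simp add: integrable_iff_bounded ennreal_mult_less_top power_less_top_ennreal)
  finally show ?thesis .
 qed
 \<comment> \<open>\<open>grid_error\<close> needs an integrable section, and integrability of
   sections is available only almost everywhere.\<close>
 have AEfin: "AE u in cube k. (\<integral>\<^sup>+t. ennreal \<bar>g (?Q (u(j := t)))\<bar> \<partial>uniform01) \<noteq> \<infinity>"
  by (rule nn_integral_PInf_AE[OF inner_integral_measurable[OF m1 j]]) (use fin in auto)
 have "(\<integral>\<^sup>+w. ennreal \<bar>g (quantize nm np {..<Suc j} w) - g (?Q w)\<bar> \<partial>cube k)
   = (\<integral>\<^sup>+u. \<integral>\<^sup>+t. ennreal \<bar>g (quantize nm np {..<Suc j} (u(j := t))) - g (?Q (u(j := t)))\<bar> \<partial>uniform01 \<partial>cube k)"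
  by (rule nn_integral_cube_coordinate[OF _ j]) (use gQ[OF S(1)] gQ[OF S(2)] in simp)
 also have "... <= (\<integral>\<^sup>+u. 2 * (\<integral>\<^sup>+t. ennreal \<bar>g (?Q (u(j := t)))\<bar> * indicator (grid_edge m) ((u(j := t)) j) \<partial>uniform01) \<partial>cube k)"
 proof (rule nn_integral_mono_AE)
  show "AE u in cube k. (\<integral>\<^sup>+t. ennreal \<bar>g (quantize nm np {..<Suc j} (u(j := t))) - g (?Q (u(j := t)))\<bar> \<partial>uniform01)
   <= 2 * (\<integral>\<^sup>+t. ennreal \<bar>g (?Q (u(j := t)))\<bar> * indicator (grid_edge m) ((u(j := t)) j) \<partial>uniform01)"
   using AEfin AE_space
  proof eventually_elim
   case (elim u)
   let ?G = "\<lambda>t. g ((?Q u)(j := t))"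
   have Qu: "?Q u \<in> space (cube k)" by (rule quantize_in_space[OF S(1) elim(2)])
   have Q1: "?Q (u(j := t)) = (?Q u)(j := t)" for t by (rule quantize_update) simp
   have Q2: "quantize nm np {..<Suc j} (u(j := t)) = (?Q u)(j := grid_map nm np t)" for t
    unfolding ins by (rule quantize_update)
   have Gm: "?G \<in> borel_measurable uniform01"
    by (rule measurable_compose[OF update_measurable(1)[OF j Qu] g(1)])
   have "integrable uniform01 ?G"
    using elim(1) Gm unfolding Q1 by (intro integrableI_bounded) (auto simp: less_top)
   moreover have "monotone_on {0<..<1} (<=) (<=) ?G \<or> monotone_on {0<..<1} (<=) (>=) ?G"
    using mono Qu j by (auto simp: monotone_in_each_def)
   ultimately show ?case unfolding Q1 Q2 fun_upd_same by (intro grid_error m)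
  qed
 qed
 also have "... = 2 * (\<integral>\<^sup>+w. ennreal \<bar>g (?Q w)\<bar> * indicator (grid_edge m) (w j) \<partial>cube k)"
 proof -
  have M: "(\<lambda>w. ennreal \<bar>g (?Q w)\<bar> * indicator (grid_edge m) (w j)) \<in> borel_measurable (cube k)"
   using m1 Em by simp
  show ?thesis using inner_integral_measurable[OF M j] nn_integral_cube_coordinate[OF M j]
   by (subst nn_integral_cmult) simp_all
 qed
 also have "... <= 2 * (4 ^ card {..<j} * (\<integral>\<^sup>+w. ennreal \<bar>g w\<bar> * indicator (grid_edge m) (w j) \<partial>cube k))"
  by (intro mult_left_mono quantize_dominated[OF _ sq Em S(1)]) (use g(1) in auto)
 finally show ?thesis by (simp add: mult.assoc)
qed

text \<open>Telescoping over the coordinates 0 to \<open>k\<close>; each increment changes one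
  coordinate only.\<close>

lemma quantize_error:
 assumes g: "g \<in> borel_measurable (cube k)" "integrable (cube k) g" and mono: "monotone_in_each k g"
  and m: "0 < m" "m <= nm" "m <= np"
 shows "(\<integral>\<^sup>+w. ennreal \<bar>g (quantize nm np {..k} w) - g w\<bar> \<partial>cube k)
  <= (\<Sum>j\<le>k. 2 * 4 ^ j * (\<integral>\<^sup>+w. ennreal \<bar>g w\<bar> * indicator (grid_edge m) (w j) \<partial>cube k))"
proof -
 let ?D = "\<lambda>j w. \<bar>g (quantize nm np {..<Suc j} w) - g (quantize nm np {..<j} w)\<bar>"
 have gQ: "(\<lambda>w. g (quantize nm np S w)) \<in> borel_measurable (cube k)" if "S \<subseteq> {..k}" for S
  using measurable_compose[OF quantize_measurable[OF that] g(1)] .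
 have tele: "\<bar>g (quantize nm np {..<n} w) - g w\<bar> <= (\<Sum>j<n. ?D j w)" for n w
 proof (induction n)
  case 0
  then show ?case by (simp add: quantize_def)
 next
  case (Suc n)
  then show ?case by (simp only: sum.lessThan_Suc)
 qed
 have "(\<integral>\<^sup>+w. ennreal \<bar>g (quantize nm np {..k} w) - g w\<bar> \<partial>cube k) <= (\<integral>\<^sup>+w. (\<Sum>j\<le>k. ennreal (?D j w)) \<partial>cube k)"
  using tele[of "Suc k"] by (intro nn_integral_mono) (simp add: lessThan_Suc_atMost ennreal_leI sum_ennreal)
 also have "... = (\<Sum>j\<le>k. \<integral>\<^sup>+w. ennreal (?D j w) \<partial>cube k)"
 proof (rule nn_integral_sum)
  fix j assume "j \<in> {..k}"
  then have "{..<j} \<subseteq> {..k}" "{..<Suc j} \<subseteq> {..k}" by auto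
  from gQ[OF this(1)] gQ[OF this(2)] show "(\<lambda>w. ennreal (?D j w)) \<in> borel_measurable (cube k)" by simp
 qed
 also have "... <= (\<Sum>j\<le>k. 2 * 4 ^ j * (\<integral>\<^sup>+w. ennreal \<bar>g w\<bar> * indicator (grid_edge m) (w j) \<partial>cube k))"
  by (intro sum_mono quantize_step_error g mono m) simp
 finally show ?thesis .
qed

section \<open>Small sets\<close>

text \<open>The threshold \<open>1/(2m)\<close> bounds the length of a grid cell if both sign counts
  are at least \<open>m\<close>. Outside this set distinct coordinates lie in distinct
  cells.\<close>

definition near_tie :: "nat => nat => (nat => real) set" where
 "near_tie k m = {w. \<exists>i\<le>k. \<exists>j\<le>k. i \<noteq> j \<and> \<bar>w i - w j\<bar> < 1 / (2 * real m)}"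

definition tail_square :: "real => real => real" where
 "tail_square K y = (if K < y then y^2 else 0)"

lemma emeasure_grid_edge:
 assumes "m > 0"
 shows "(\<integral>\<^sup>+t. indicator (grid_edge m) t \<partial>uniform01) <= ennreal (2 / real m)"
proof -
 define h where "h = 1 / (2 * real m)"
 have h: "h > 0" using assms by (simp add: h_def)
 have "(\<integral>\<^sup>+t. indicator (grid_edge m) t \<partial>uniform01) = (\<integral>\<^sup>+t. indicator (grid_edge m) t * indicator {0<..<1} t \<partial>lborel)"
  unfolding uniform01_def by (rule nn_integral_restrict_space) simp
 also have "... <= (\<integral>\<^sup>+t. indicator {0..h} t + indicator {1/2 - h..1/2 + h} t + indicator {1 - h..1} t \<partial>lborel)"
  by (intro nn_integral_mono) (auto simp: grid_edge_def h_def[symmetric] indicator_def)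
 also have "... = ennreal h + ennreal (2 * h) + ennreal h"
  using h by (simp add: nn_integral_add)
 also have "... = ennreal (2 / real m)"
  using h by (simp flip: ennreal_plus) (simp add: h_def)
 finally show ?thesis .
qed

lemma nn_integral_edge:
 assumes m: "m > 0" and j: "j <= k"
 shows "(\<integral>\<^sup>+w. indicator (grid_edge m) (w j) \<partial>cube k) <= ennreal (2 / real m)"
proof -
 have d: "distr (cube k) uniform01 (\<lambda>v. v j) = uniform01"
  unfolding cube_def using j by (intro distr_PiM_component prob_space_uniform01) simp
 have "(\<integral>\<^sup>+w. indicator (grid_edge m) (w j) \<partial>cube k) = (\<integral>\<^sup>+t. indicator (grid_edge m) t \<partial>distr (cube k) uniform01 (\<lambda>v. v j))"
  by (rule nn_integral_distr[symmetric, OF cube_component[OF j]]) (use grid_edge_measurable in simp)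
 then show ?thesis using emeasure_grid_edge[OF m] unfolding d by simp
qed

lemma near_tie_measurable: "{w \<in> space (cube k). w \<in> near_tie k m} \<in> sets (cube k)"
proof -
 have "{w \<in> space (cube k). w \<in> near_tie k m}
  = {w \<in> space (cube k). \<exists>i\<in>{..k}. \<exists>j\<in>{..k}. i \<noteq> j \<and> \<bar>w i - w j\<bar> < 1 / (2 * real m)}"
  by (auto simp: near_tie_def)
 also have "... \<in> sets (cube k)"
 proof (intro sets.sets_Collect_finite_Ex sets.sets_Collect_conj sets.sets_Collect_const finite_atMost)
  fix i j assume "i \<in> {..k}" "j \<in> {..k}"
  then have "(\<lambda>w. \<bar>w i - w j\<bar>) \<in> borel_measurable (cube k)"
   using cube_component_borel[of i k] cube_component_borel[of j k] by simp
  then show "{w \<in> space (cube k). \<bar>w i - w j\<bar> < 1 / (2 * real m)} \<in> sets (cube k)"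
   by (rule borel_measurable_less) simp
 qed
 finally show ?thesis .
qed

lemma near_tie_indicator_measurable: "(\<lambda>w. indicator (near_tie k m) w :: ennreal) \<in> borel_measurable (cube k)"
 by (rule borel_measurable_indicator') (use near_tie_measurable in \<open>simp\<close>)

lemma nn_integral_near_pair:
 assumes m: "m > 0" and i: "i <= k" and j: "j <= k" and ij: "i \<noteq> j"
 shows "(\<integral>\<^sup>+w. indicator {w. \<bar>w i - w j\<bar> < 1 / (2 * real m)} w \<partial>cube k) <= ennreal (1 / real m)"
proof -
 define h where "h = 1 / (2 * real m)"
 have h: "h > 0" using m by (simp add: h_def)
 have M: "(\<lambda>w. indicator {w. \<bar>w i - w j\<bar> < h} w :: ennreal) \<in> borel_measurable (cube k)"
 proof (rule borel_measurable_indicator')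
  have "(\<lambda>w. \<bar>w i - w j\<bar>) \<in> borel_measurable (cube k)"
   using cube_component_borel[OF i] cube_component_borel[OF j] by simp
  then show "{w \<in> space (cube k). w \<in> {w. \<bar>w i - w j\<bar> < h}} \<in> sets (cube k)"
   by (simp add: borel_measurable_less)
 qed
 have "(\<integral>\<^sup>+w. indicator {w. \<bar>w i - w j\<bar> < h} w \<partial>cube k)
  = (\<integral>\<^sup>+u. \<integral>\<^sup>+t. indicator {w. \<bar>w i - w j\<bar> < h} (u(i := t)) \<partial>uniform01 \<partial>cube k)"
  by (rule nn_integral_cube_coordinate[OF M i])
 also have "... <= (\<integral>\<^sup>+u. ennreal (2 * h) \<partial>cube k)"
 proof (rule nn_integral_mono)
  fix u
  have "(\<integral>\<^sup>+t. indicator {w. \<bar>w i - w j\<bar> < h} (u(i := t)) \<partial>uniform01)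
   = (\<integral>\<^sup>+t. indicator {w. \<bar>w i - w j\<bar> < h} (u(i := t)) * indicator {0<..<1} t \<partial>lborel)"
   unfolding uniform01_def by (rule nn_integral_restrict_space) simp
  also have "... <= (\<integral>\<^sup>+t. indicator {u j - h..u j + h} t \<partial>lborel)"
   using ij by (intro nn_integral_mono) (auto simp: indicator_def)
  also have "... = ennreal (2 * h)" using h by simp
  finally show "(\<integral>\<^sup>+t. indicator {w. \<bar>w i - w j\<bar> < h} (u(i := t)) \<partial>uniform01) <= ennreal (2 * h)" .
 qed
 also have "... = ennreal (1 / real m)" using m by (simp add: CU.emeasure_space_1 h_def)
 finally show ?thesis by (simp add: h_def)
qed

lemma nn_integral_near_tie:
 assumes m: "m > 0"
 shows "(\<integral>\<^sup>+w. indicator (near_tie k m) w \<partial>cube k) <= ennreal ((real k + 1)^2 / real m)"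
proof -
 let ?N = "\<lambda>p. {w. \<bar>w (fst p) - w (snd p)\<bar> < 1 / (2 * real m)} :: (nat => real) set"
 let ?D = "{p \<in> {..k} \<times> {..k}. fst p \<noteq> snd p}"
 have "(\<integral>\<^sup>+w. indicator (near_tie k m) w \<partial>cube k) <= (\<integral>\<^sup>+w. (\<Sum>p\<in>?D. indicator (?N p) w) \<partial>cube k)"
 proof (rule nn_integral_mono)
  fix w :: "nat => real"
  show "indicator (near_tie k m) w <= (\<Sum>p\<in>?D. indicator (?N p) w :: ennreal)"
  proof (cases "w \<in> near_tie k m")
   case True
   then obtain i j where ij: "i <= k" "j <= k" "i \<noteq> j" "\<bar>w i - w j\<bar> < 1 / (2 * real m)"
    by (auto simp: near_tie_def)
   then have "indicator (?N (i, j)) w <= (\<Sum>p\<in>?D. indicator (?N p) w :: ennreal)"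
    by (intro member_le_sum) auto
   then show ?thesis using True ij by simp
  qed simp
 qed
 also have "... = (\<Sum>p\<in>?D. \<integral>\<^sup>+w. indicator (?N p) w \<partial>cube k)"
 proof (rule nn_integral_sum)
  fix p assume "p \<in> ?D"
  then have "(\<lambda>w. \<bar>w (fst p) - w (snd p)\<bar>) \<in> borel_measurable (cube k)"
   using cube_component_borel[of "fst p" k] cube_component_borel[of "snd p" k] by auto
  then have "{w \<in> space (cube k). \<bar>w (fst p) - w (snd p)\<bar> < 1 / (2 * real m)} \<in> sets (cube k)"
   by (rule borel_measurable_less) simp
  then show "(\<lambda>w. indicator (?N p) w :: ennreal) \<in> borel_measurable (cube k)"
   by (intro borel_measurable_indicator') simp
 qed
 also have "... <= (\<Sum>p\<in>?D. ennreal (1 / real m))"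
  by (rule sum_mono) (use nn_integral_near_pair[OF m] in auto)
 also have "... <= (\<Sum>p\<in>{..k} \<times> {..k}. ennreal (1 / real m))"
  by (rule sum_mono2) auto
 also have "... = ennreal (\<Sum>p\<in>{..k} \<times> {..k}. 1 / real m)" by (rule sum_ennreal) simp
 also have "(\<Sum>p\<in>{..k} \<times> {..k}. 1 / real m) = (real k + 1)^2 / real m"
  by (simp add: power2_eq_square algebra_simps add_divide_distrib)
 finally show ?thesis .
qed

text \<open>The inequality \<open>y <= \<theta> y^2 / 2 + 1 / (2 \<theta>)\<close>, used only where \<open>y > K\<close>, gives the uniform
 integrability estimate without taking square roots of integrals.\<close>

lemma truncation_bound:
 assumes "0 <= y" "0 <= K" "0 < \<theta>"
 shows "ennreal y * indicator D x <= ennreal (K + 1 / (2 * \<theta>)) * indicator D x + ennreal (\<theta> / 2) * ennreal (tail_square K y)"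
proof (cases "x \<in> D")
 case True
 have "y <= K + 1 / (2 * \<theta>) + \<theta> / 2 * tail_square K y"
 proof (cases "K < y")
  case True
  have "0 <= (\<theta> * y - 1)^2" by simp
  then have "2 * \<theta> * y <= \<theta>^2 * y^2 + 1" by (simp add: power2_diff power_mult_distrib)
  then have "2 * \<theta> * y / (2 * \<theta>) <= (\<theta>^2 * y^2 + 1) / (2 * \<theta>)" using assms by (intro divide_right_mono) auto
  then have "y <= \<theta> / 2 * y^2 + 1 / (2 * \<theta>)" using assms by (simp add: add_divide_distrib power2_eq_square)
  then show ?thesis using True assms by (simp add: tail_square_def)
 qed (use assms in \<open>simp add: tail_square_def add_increasing2\<close>)
 then have "ennreal y <= ennreal (K + 1 / (2 * \<theta>) + \<theta> / 2 * tail_square K y)" by (rule ennreal_leI)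
 also have "... = ennreal (K + 1 / (2 * \<theta>)) + ennreal (\<theta> / 2) * ennreal (tail_square K y)"
 proof -
  have "ennreal (\<theta> / 2) * ennreal (tail_square K y) = ennreal (\<theta> / 2 * tail_square K y)"
   using assms by (intro ennreal_mult[symmetric]) (auto simp: tail_square_def)
  then show ?thesis
   using assms by (simp only:) (rule ennreal_plus, auto simp: tail_square_def)
 qed
 finally show ?thesis using True by simp
qed simp

text \<open>Dominated convergence with the square of \<open>g\<close> as majorant.\<close>

lemma tail_square_small:
 assumes g: "square_integrable k g" and t: "t > 0"
 shows "\<exists>K\<ge>0. (\<integral>\<^sup>+w. ennreal (tail_square K \<bar>g w\<bar>) \<partial>cube k) <= ennreal t"
proof -
 note gf = phi_facts[OF g]
 have m: "(\<lambda>w. tail_square K \<bar>g w\<bar>) \<in> borel_measurable (cube k)" for K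
 proof -
  have "tail_square K \<in> borel_measurable borel" unfolding tail_square_def[abs_def] by measurable
  moreover have "(\<lambda>w. \<bar>g w\<bar>) \<in> borel_measurable (cube k)" using gf(1) by simp
  ultimately show ?thesis by (rule measurable_compose[rotated])
 qed
 have le: "norm (tail_square K \<bar>g w\<bar>) <= (g w)^2" for K w by (simp add: tail_square_def)
 have "(\<lambda>n. LINT w|cube k. tail_square (real n) \<bar>g w\<bar>) \<longlonglongrightarrow> (LINT w|cube k. 0)"
 proof (rule integral_dominated_convergence[where w = "\<lambda>w. (g w)^2"])
  show "AE w in cube k. (\<lambda>n. tail_square (real n) \<bar>g w\<bar>) \<longlonglongrightarrow> 0"
  proof (rule AE_I2, rule tendsto_eventually)
   fix w
   obtain N where "\<bar>g w\<bar> <= real N" using real_arch_simple by blast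
   then show "\<forall>\<^sub>F n in sequentially. tail_square (real n) \<bar>g w\<bar> = 0"
    by (intro eventually_sequentiallyI[of N]) (auto simp: tail_square_def)
  qed
 qed (use gf m le in auto)
 then have "\<forall>\<^sub>F n in sequentially. (LINT w|cube k. tail_square (real n) \<bar>g w\<bar>) < t"
  using t by (intro order_tendstoD(2)) auto
 then obtain n where n: "(LINT w|cube k. tail_square (real n) \<bar>g w\<bar>) < t"
  by (meson eventually_sequentially order_refl)
 have i: "integrable (cube k) (\<lambda>w. tail_square (real n) \<bar>g w\<bar>)"
  by (rule L1_integrable_bound[OF gf(2) m]) (use le in auto)
 have "(\<integral>\<^sup>+w. ennreal (tail_square (real n) \<bar>g w\<bar>) \<partial>cube k) = ennreal (LINT w|cube k. tail_square (real n) \<bar>g w\<bar>)"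
  by (rule nn_integral_eq_integral[OF i]) (auto simp: tail_square_def)
 also have "... <= ennreal t" using n by (intro ennreal_leI) simp
 finally show ?thesis by (intro exI[of _ "real n"]) auto
qed

text \<open>\<open>D\<close> and \<open>d\<close> are kept apart to cover both applications: a
  condition on one coordinate \<open>w j\<close>, and a condition on the whole point.\<close>

lemma truncation_integral_bound:
 assumes X: "X \<in> borel_measurable (cube k)" "\<And>w. 0 <= X w" and D: "(\<lambda>w. indicator (D w) (d w) :: ennreal) \<in> borel_measurable (cube k)"
  and K: "0 <= K" and \<theta>: "0 < \<theta>" and p: "(\<integral>\<^sup>+w. indicator (D w) (d w) \<partial>cube k) <= ennreal p" "0 <= p"
  and T: "(\<integral>\<^sup>+w. ennreal (tail_square K (X w)) \<partial>cube k) <= ennreal t" "0 <= t"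
 shows "(\<integral>\<^sup>+w. ennreal (X w) * indicator (D w) (d w) \<partial>cube k) <= ennreal ((K + 1 / (2 * \<theta>)) * p + \<theta> / 2 * t)"
proof -
 have m: "(\<lambda>w. ennreal (tail_square K (X w))) \<in> borel_measurable (cube k)"
 proof -
  have "tail_square K \<in> borel_measurable borel" unfolding tail_square_def[abs_def] by measurable
  from measurable_compose[OF X(1) this] show ?thesis by simp
 qed
 have "(\<integral>\<^sup>+w. ennreal (X w) * indicator (D w) (d w) \<partial>cube k)
  <= (\<integral>\<^sup>+w. ennreal (K + 1 / (2 * \<theta>)) * indicator (D w) (d w) + ennreal (\<theta> / 2) * ennreal (tail_square K (X w)) \<partial>cube k)"
  by (intro nn_integral_mono truncation_bound X K \<theta>)
 also have "... = ennreal (K + 1 / (2 * \<theta>)) * (\<integral>\<^sup>+w. indicator (D w) (d w) \<partial>cube k)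
   + ennreal (\<theta> / 2) * (\<integral>\<^sup>+w. ennreal (tail_square K (X w)) \<partial>cube k)"
  using m D by (simp add: nn_integral_add nn_integral_cmult)
 also have "... <= ennreal (K + 1 / (2 * \<theta>)) * ennreal p + ennreal (\<theta> / 2) * ennreal t"
  by (intro add_mono mult_left_mono p T) auto
 also have "... = ennreal ((K + 1 / (2 * \<theta>)) * p + \<theta> / 2 * t)"
  using K \<theta> p T by (simp add: ennreal_mult[symmetric] ennreal_plus[symmetric] del: ennreal_plus)
 finally show ?thesis .
qed

text \<open>The exceptional sets have measure \<open>O(1/m)\<close>, so a square-integrable function
  contributes \<open>O(1 / sqrt m)\<close> there, as with Cauchy-Schwarz; truncating at a level
  \<open>K\<close> makes the constant small, which yields the little o needed at the scale
  \<open>1 / sqrt n\<close>.\<close>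

lemma quantize_small_monotone:
 assumes g: "square_integrable k g" and mono: "monotone_in_each k g" and eps: "eps > 0"
 shows "\<exists>m0>0. \<forall>m nm np. m0 <= m --> m <= nm --> m <= np -->
  (\<integral>\<^sup>+w. ennreal \<bar>g (quantize nm np {..k} w) - g w\<bar> \<partial>cube k) <= ennreal (eps / sqrt (real m)) \<and>
  (\<integral>\<^sup>+w. ennreal \<bar>g (quantize nm np {..k} w)\<bar> * indicator (near_tie k m) w \<partial>cube k) <= ennreal (eps / sqrt (real m))"
proof -
 note gf = phi_facts[OF g]
 define c0 where "c0 = (\<Sum>j\<le>k. 2 * 4 ^ j :: real)"
 have c0: "c0 >= 0" unfolding c0_def by (intro sum_nonneg) auto
 \<comment> \<open>\<open>A\<close> dominates the measures of the exceptional sets and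
   \<open>B\<close> the factors of the tail integrals in both estimates, so that one bound
   \<open>R\<close> serves for both.\<close>
 define A where "A = 2 * c0 + (real k + 1)^2"
 define B where "B = c0 + 4 ^ (k + 1)"
 have A: "A > 0" "2 * c0 <= A" "(real k + 1)^2 <= A" using c0 by (auto simp: A_def add_nonneg_pos)
 have B: "B > 0" "c0 <= B" "4 ^ (k + 1) <= B" using c0 by (auto simp: B_def add_nonneg_pos)
 \<comment> \<open>With \<open>\<theta> = L / sqrt m\<close> the term
   \<open>A / (2 \<theta> m)\<close> becomes \<open>eps / 4 / sqrt m\<close>; the choice of
   \<open>t\<close> does the same for the tail term, and \<open>m0\<close> makes the term with
   \<open>K\<close> at most \<open>eps / 2 / sqrt m\<close>.\<close>
 define L where "L = 2 * A / eps"
 have L: "L > 0" using A eps by (simp add: L_def)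
 define t where "t = eps / (2 * L * B)"
 have t: "t > 0" using L B eps by (simp add: t_def)
 obtain K where K: "K >= 0" "(\<integral>\<^sup>+w. ennreal (tail_square K \<bar>g w\<bar>) \<partial>cube k) <= ennreal t"
  using tail_square_small[OF g t] by blast
 define m0 where "m0 = nat \<lceil>(2 * K * A / eps)^2\<rceil> + 1"
 show ?thesis
 proof (intro exI[of _ m0] conjI allI impI)
  show "m0 > 0" by (simp add: m0_def)
  fix m nm np assume m: "m0 <= m" and mnm: "m <= nm" and mnp: "m <= np"
  have mp: "m > 0" using m by (simp add: m0_def)
  define s where "s = sqrt (real m)"
  have s: "s > 0" "s * s = real m" using mp by (auto simp: s_def)
  define \<theta> where "\<theta> = L / s"
  have \<theta>: "\<theta> > 0" using L s by (simp add: \<theta>_def)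
  define R where "R = (K + 1 / (2 * \<theta>)) * (A / real m) + \<theta> / 2 * (B * t)"
  have "(2 * K * A / eps)^2 <= real m" using m unfolding m0_def by linarith
  then have "2 * K * A / eps <= s" unfolding s_def by (rule real_le_rsqrt)
  then have sK: "K * A <= eps / 2 * s" using eps by (simp add: pos_divide_le_eq mult_ac)
  have "R = K * A / real m + A / (2 * L * s) + L * B * t / (2 * s)"
   using s L unfolding R_def \<theta>_def s(2)[symmetric] by (simp add: field_simps)
  also have "A / (2 * L * s) = eps / 4 / s" using A eps s by (simp add: L_def field_simps)
  also have "L * B * t / (2 * s) = eps / 4 / s" using L B s by (simp add: t_def field_simps)
  also have "K * A / real m <= eps / 2 * s / real m" using sK by (intro divide_right_mono) auto
  also have "eps / 2 * s / real m = eps / 2 / s" unfolding s(2)[symmetric] using s(1) by simp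
  also have "eps / 2 / s + eps / 4 / s + eps / 4 / s = eps / s" using s by (simp add: field_simps)
  finally have R: "R <= eps / s" by simp
  have "(\<integral>\<^sup>+w. ennreal \<bar>g (quantize nm np {..k} w) - g w\<bar> \<partial>cube k)
   <= (\<Sum>j\<le>k. 2 * 4 ^ j * (\<integral>\<^sup>+w. ennreal \<bar>g w\<bar> * indicator (grid_edge m) (w j) \<partial>cube k))"
   by (rule quantize_error[OF gf(1,3) mono mp mnm mnp])
  also have "... <= (\<Sum>j\<le>k. ennreal (2 * 4 ^ j) * ennreal ((K + 1 / (2 * \<theta>)) * (2 / real m) + \<theta> / 2 * t))"
  proof (rule sum_mono)
   fix j assume j: "j \<in> {..k}"
   have "(\<integral>\<^sup>+w. ennreal \<bar>g w\<bar> * indicator (grid_edge m) (w j) \<partial>cube k) <= ennreal ((K + 1 / (2 * \<theta>)) * (2 / real m) + \<theta> / 2 * t)"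
    by (rule truncation_integral_bound[where d = "\<lambda>w. w j" and D = "\<lambda>_. grid_edge m"])
      (use gf(1) j K \<theta> t measurable_compose[OF cube_component grid_edge_measurable, of j k m] nn_integral_edge[OF mp, of j k] in auto)
   then show "2 * 4 ^ j * (\<integral>\<^sup>+w. ennreal \<bar>g w\<bar> * indicator (grid_edge m) (w j) \<partial>cube k)
    <= ennreal (2 * 4 ^ j) * ennreal ((K + 1 / (2 * \<theta>)) * (2 / real m) + \<theta> / 2 * t)"
    by (intro mult_mono) (auto simp: ennreal_mult ennreal_power[symmetric])
  qed
  also have "... = ennreal (c0 * ((K + 1 / (2 * \<theta>)) * (2 / real m) + \<theta> / 2 * t))"
  proof -
   have "(K + 1 / (2 * \<theta>)) * (2 / real m) + \<theta> / 2 * t >= 0" using K \<theta> t by simp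
   then show ?thesis
    unfolding sum_distrib_right[symmetric] c0_def
    by (subst ennreal_mult) (auto intro!: sum_nonneg simp: sum_ennreal)
  qed
  also have "... <= ennreal R"
  proof (rule ennreal_leI)
   have "c0 * ((K + 1 / (2 * \<theta>)) * (2 / real m) + \<theta> / 2 * t) = (K + 1 / (2 * \<theta>)) * (2 * c0 / real m) + \<theta> / 2 * (c0 * t)"
    by (simp add: algebra_simps)
   also have "... <= R" unfolding R_def
    using A B K \<theta> t by (intro add_mono mult_left_mono divide_right_mono mult_right_mono) auto
   finally show "c0 * ((K + 1 / (2 * \<theta>)) * (2 / real m) + \<theta> / 2 * t) <= R" .
  qed
  also have "... <= ennreal (eps / sqrt (real m))" using R unfolding s_def by (rule ennreal_leI)
  finally show "(\<integral>\<^sup>+w. ennreal \<bar>g (quantize nm np {..k} w) - g w\<bar> \<partial>cube k) <= ennreal (eps / sqrt (real m))" .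
  have Qm: "(\<lambda>w. \<bar>g (quantize nm np {..k} w)\<bar>) \<in> borel_measurable (cube k)"
   using measurable_compose[OF quantize_measurable[OF subset_refl] gf(1)] by simp
  have tm: "(\<lambda>w. ennreal (tail_square K \<bar>g w\<bar>)) \<in> borel_measurable (cube k)"
  proof -
   have "tail_square K \<in> borel_measurable borel" unfolding tail_square_def[abs_def] by measurable
   moreover have "(\<lambda>w. \<bar>g w\<bar>) \<in> borel_measurable (cube k)" using gf(1) by simp
   ultimately have "(\<lambda>w. tail_square K \<bar>g w\<bar>) \<in> borel_measurable (cube k)" by (rule measurable_compose[rotated])
   then show ?thesis by simp
  qed
  have "(\<integral>\<^sup>+w. ennreal (tail_square K \<bar>g (quantize nm np {..k} w)\<bar>) * 1 \<partial>cube k)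
   <= 4 ^ card {..k} * (\<integral>\<^sup>+w. ennreal (tail_square K \<bar>g w\<bar>) * 1 \<partial>cube k)"
  proof (rule quantize_dominated[OF tm _ _ subset_refl])
   show "coord_squeezable k (\<lambda>w. ennreal (tail_square K \<bar>g w\<bar>))"
    by (rule monotone_coord_squeezable[OF mono, where \<Psi> = "\<lambda>y. ennreal (tail_square K y)"])
      (auto intro!: ennreal_leI power_mono simp: tail_square_def)
  qed auto
  also have "... <= 4 ^ card {..k} * ennreal t" using K by (intro mult_left_mono) auto
  also have "... = ennreal (4 ^ (k + 1) * t)"
   using t by (simp add: ennreal_mult ennreal_power[symmetric])
  finally have T: "(\<integral>\<^sup>+w. ennreal (tail_square K \<bar>g (quantize nm np {..k} w)\<bar>) \<partial>cube k) <= ennreal (4 ^ (k + 1) * t)" by simp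
  have "(\<integral>\<^sup>+w. ennreal \<bar>g (quantize nm np {..k} w)\<bar> * indicator (near_tie k m) w \<partial>cube k)
   <= ennreal ((K + 1 / (2 * \<theta>)) * ((real k + 1)^2 / real m) + \<theta> / 2 * (4 ^ (k + 1) * t))"
   by (rule truncation_integral_bound[where d = "\<lambda>w. w" and D = "\<lambda>_. near_tie k m"])
     (use Qm K \<theta> t T near_tie_indicator_measurable nn_integral_near_tie[OF mp] in auto)
  also have "... <= ennreal R" unfolding R_def
   using A B K \<theta> t by (intro ennreal_leI add_mono mult_left_mono divide_right_mono mult_right_mono) auto
  also have "... <= ennreal (eps / sqrt (real m))" using R unfolding s_def by (rule ennreal_leI)
  finally show "(\<integral>\<^sup>+w. ennreal \<bar>g (quantize nm np {..k} w)\<bar> * indicator (near_tie k m) w \<partial>cube k) <= ennreal (eps / sqrt (real m))" .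
 qed
qed

context
 fixes k :: nat and phi :: "(nat => real) => real"
 assumes comb: "comb_of_monotone k phi" and phi: "square_integrable k phi"
begin

lemma quantized_measurable: "(\<lambda>w. phi (quantize nm np {..k} w)) \<in> borel_measurable (cube k)"
 using measurable_compose[OF quantize_measurable[OF subset_refl] phi_facts(1)[OF phi]] .

lemma quantize_small:
 assumes eps: "eps > 0"
 shows "\<exists>m0>0. \<forall>m nm np. m0 <= m --> m <= nm --> m <= np -->
  (\<integral>\<^sup>+w. ennreal \<bar>phi (quantize nm np {..k} w) - phi w\<bar> \<partial>cube k) <= ennreal (eps / sqrt (real m)) \<and>
  (\<integral>\<^sup>+w. ennreal \<bar>phi (quantize nm np {..k} w)\<bar> * indicator (near_tie k m) w \<partial>cube k) <= ennreal (eps / sqrt (real m))"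
proof -
 obtain M c g where g: "\<And>i. i < M ==> square_integrable k (g i)" "\<And>i. i < M ==> monotone_in_each k (g i)"
  and eq: "\<And>u. u \<in> space (cube k) ==> phi u = (\<Sum>i<(M::nat). c i * g i u)"
  using comb unfolding comb_of_monotone_def by blast
 define S where "S = (\<Sum>i<M. \<bar>c i\<bar>)"
 have S: "S >= 0" unfolding S_def by (intro sum_nonneg) auto
 \<comment> \<open>\<open>1 + S\<close> avoids division by 0 if all coefficients vanish.\<close>
 define eps' where "eps' = eps / (1 + S)"
 have eps': "eps' > 0" using eps S by (simp add: eps'_def)
 have Seps: "S * eps' <= eps" using eps S by (simp add: eps'_def field_simps)
 have "\<forall>i\<in>{..<M}. \<exists>m0>0. \<forall>m nm np. m0 <= m --> m <= nm --> m <= np -->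
  (\<integral>\<^sup>+w. ennreal \<bar>g i (quantize nm np {..k} w) - g i w\<bar> \<partial>cube k) <= ennreal (eps' / sqrt (real m)) \<and>
  (\<integral>\<^sup>+w. ennreal \<bar>g i (quantize nm np {..k} w)\<bar> * indicator (near_tie k m) w \<partial>cube k) <= ennreal (eps' / sqrt (real m))"
  using quantize_small_monotone[OF g eps'] by blast
 from bchoice[OF this] obtain f where f: "\<forall>i\<in>{..<M}. f i > 0 \<and> (\<forall>m nm np. f i <= m --> m <= nm --> m <= np -->
  (\<integral>\<^sup>+w. ennreal \<bar>g i (quantize nm np {..k} w) - g i w\<bar> \<partial>cube k) <= ennreal (eps' / sqrt (real m)) \<and>
  (\<integral>\<^sup>+w. ennreal \<bar>g i (quantize nm np {..k} w)\<bar> * indicator (near_tie k m) w \<partial>cube k) <= ennreal (eps' / sqrt (real m)))"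
  ..
 define m0 where "m0 = 1 + (\<Sum>i<M. f i)"
 show ?thesis
 proof (intro exI[of _ m0] conjI allI impI)
  show "m0 > 0" by (simp add: m0_def)
  fix m nm np assume m: "m0 <= m" "m <= nm" "m <= np"
  let ?Q = "quantize nm np {..k}"
  have fi: "f i <= m" if "i < M" for i
   using member_le_sum[of i "{..<M}" f] that m(1) by (auto simp: m0_def)
  have gm: "g i \<in> borel_measurable (cube k)" "(\<lambda>w. g i (?Q w)) \<in> borel_measurable (cube k)" if "i < M" for i
   using phi_facts(1)[OF g(1)[OF that]] measurable_compose[OF quantize_measurable[OF subset_refl] phi_facts(1)[OF g(1)[OF that]]]
   by auto
  have bound: "(\<Sum>i<M. ennreal \<bar>c i\<bar> * ennreal (eps' / sqrt (real m))) <= ennreal (eps / sqrt (real m))"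
  proof -
   have "(\<Sum>i<M. ennreal \<bar>c i\<bar> * ennreal (eps' / sqrt (real m))) = ennreal (S * (eps' / sqrt (real m)))"
    unfolding sum_distrib_right[symmetric] S_def
    using eps' by (subst ennreal_mult) (auto intro!: sum_nonneg simp: sum_ennreal)
   also have "... <= ennreal (eps / sqrt (real m))"
    using Seps by (intro ennreal_leI) (simp add: divide_right_mono)
   finally show ?thesis .
  qed
  have "(\<integral>\<^sup>+w. ennreal \<bar>phi (?Q w) - phi w\<bar> \<partial>cube k) <= (\<integral>\<^sup>+w. (\<Sum>i<M. ennreal \<bar>c i\<bar> * ennreal \<bar>g i (?Q w) - g i w\<bar>) \<partial>cube k)"
  proof (rule nn_integral_mono)
   fix w assume w: "w \<in> space (cube k)"
   have "\<bar>phi (?Q w) - phi w\<bar> = \<bar>\<Sum>i<M. c i * (g i (?Q w) - g i w)\<bar>"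
    using eq[OF w] eq[OF quantize_in_space[OF subset_refl w]] by (simp add: sum_subtractf right_diff_distrib)
   also have "... <= (\<Sum>i<M. \<bar>c i\<bar> * \<bar>g i (?Q w) - g i w\<bar>)"
    by (rule order_trans[OF sum_abs]) (simp add: abs_mult)
   finally have "ennreal \<bar>phi (?Q w) - phi w\<bar> <= ennreal (\<Sum>i<M. \<bar>c i\<bar> * \<bar>g i (?Q w) - g i w\<bar>)" by (rule ennreal_leI)
   then show "ennreal \<bar>phi (?Q w) - phi w\<bar> <= (\<Sum>i<M. ennreal \<bar>c i\<bar> * ennreal \<bar>g i (?Q w) - g i w\<bar>)"
    by (simp add: sum_ennreal[symmetric] ennreal_mult)
  qed
  also have "... = (\<Sum>i<M. ennreal \<bar>c i\<bar> * (\<integral>\<^sup>+w. ennreal \<bar>g i (?Q w) - g i w\<bar> \<partial>cube k))"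
   using gm by (subst nn_integral_sum) (auto simp: nn_integral_cmult)
  also have "... <= (\<Sum>i<M. ennreal \<bar>c i\<bar> * ennreal (eps' / sqrt (real m)))"
   using f fi m by (intro sum_mono mult_left_mono) auto
  also note bound
  finally show "(\<integral>\<^sup>+w. ennreal \<bar>phi (?Q w) - phi w\<bar> \<partial>cube k) <= ennreal (eps / sqrt (real m))" .
  have "(\<integral>\<^sup>+w. ennreal \<bar>phi (?Q w)\<bar> * indicator (near_tie k m) w \<partial>cube k)
   <= (\<integral>\<^sup>+w. (\<Sum>i<M. ennreal \<bar>c i\<bar> * (ennreal \<bar>g i (?Q w)\<bar> * indicator (near_tie k m) w)) \<partial>cube k)"
  proof (rule nn_integral_mono)
   fix w assume w: "w \<in> space (cube k)"
   have "\<bar>phi (?Q w)\<bar> <= (\<Sum>i<M. \<bar>c i\<bar> * \<bar>g i (?Q w)\<bar>)"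
    unfolding eq[OF quantize_in_space[OF subset_refl w]]
    by (rule order_trans[OF sum_abs]) (simp add: abs_mult)
   then have "ennreal \<bar>phi (?Q w)\<bar> <= ennreal (\<Sum>i<M. \<bar>c i\<bar> * \<bar>g i (?Q w)\<bar>)" by (rule ennreal_leI)
   then have "ennreal \<bar>phi (?Q w)\<bar> <= (\<Sum>i<M. ennreal \<bar>c i\<bar> * ennreal \<bar>g i (?Q w)\<bar>)"
    by (simp add: sum_ennreal[symmetric] ennreal_mult)
   from mult_right_mono[OF this, of "indicator (near_tie k m) w"]
   show "ennreal \<bar>phi (?Q w)\<bar> * indicator (near_tie k m) w
    <= (\<Sum>i<M. ennreal \<bar>c i\<bar> * (ennreal \<bar>g i (?Q w)\<bar> * indicator (near_tie k m) w))"
    by (simp add: sum_distrib_right mult.assoc)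
  qed
  also have "... = (\<Sum>i<M. ennreal \<bar>c i\<bar> * (\<integral>\<^sup>+w. ennreal \<bar>g i (?Q w)\<bar> * indicator (near_tie k m) w \<partial>cube k))"
   using gm near_tie_indicator_measurable[of k m] by (subst nn_integral_sum) (auto simp: nn_integral_cmult)
  also have "... <= (\<Sum>i<M. ennreal \<bar>c i\<bar> * ennreal (eps' / sqrt (real m)))"
   using f fi m by (intro sum_mono mult_left_mono) auto
  also note bound
  finally show "(\<integral>\<^sup>+w. ennreal \<bar>phi (?Q w)\<bar> * indicator (near_tie k m) w \<partial>cube k) <= ennreal (eps / sqrt (real m))" .
 qed
qed

text \<open>Uniform in both counts, however unbalanced. Where one sign is rare, boundedness suffices
  because such samples have probability \<open>O(1/n)\<close>.\<close>

lemma quantize_bounded: "\<exists>B\<ge>0. \<forall>nm np. (\<integral>\<^sup>+w. ennreal \<bar>phi (quantize nm np {..k} w)\<bar> \<partial>cube k) <= ennreal B"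
proof -
 obtain M c g where g: "\<And>i. i < M ==> square_integrable k (g i)" "\<And>i. i < M ==> monotone_in_each k (g i)"
  and eq: "\<And>u. u \<in> space (cube k) ==> phi u = (\<Sum>i<(M::nat). c i * g i u)"
  using comb unfolding comb_of_monotone_def by blast
 define B where "B = (\<Sum>i<M. \<bar>c i\<bar> * (4 ^ (k + 1) * (LINT w|cube k. \<bar>g i w\<bar>)))"
 have "(\<integral>\<^sup>+w. ennreal \<bar>phi (quantize nm np {..k} w)\<bar> \<partial>cube k) <= ennreal B" for nm np
 proof -
  let ?Q = "quantize nm np {..k}"
  have gm: "(\<lambda>w. g i (?Q w)) \<in> borel_measurable (cube k)" if "i < M" for i
   using measurable_compose[OF quantize_measurable[OF subset_refl] phi_facts(1)[OF g(1)[OF that]]] .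
  have "(\<integral>\<^sup>+w. ennreal \<bar>phi (?Q w)\<bar> \<partial>cube k) <= (\<integral>\<^sup>+w. (\<Sum>i<M. ennreal \<bar>c i\<bar> * ennreal \<bar>g i (?Q w)\<bar>) \<partial>cube k)"
  proof (rule nn_integral_mono)
   fix w assume w: "w \<in> space (cube k)"
   have "\<bar>phi (?Q w)\<bar> <= (\<Sum>i<M. \<bar>c i\<bar> * \<bar>g i (?Q w)\<bar>)"
    unfolding eq[OF quantize_in_space[OF subset_refl w]]
    by (rule order_trans[OF sum_abs]) (simp add: abs_mult)
   then have "ennreal \<bar>phi (?Q w)\<bar> <= ennreal (\<Sum>i<M. \<bar>c i\<bar> * \<bar>g i (?Q w)\<bar>)" by (rule ennreal_leI)
   then show "ennreal \<bar>phi (?Q w)\<bar> <= (\<Sum>i<M. ennreal \<bar>c i\<bar> * ennreal \<bar>g i (?Q w)\<bar>)"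
    by (simp add: sum_ennreal[symmetric] ennreal_mult)
  qed
  also have "... = (\<Sum>i<M. ennreal \<bar>c i\<bar> * (\<integral>\<^sup>+w. ennreal \<bar>g i (?Q w)\<bar> \<partial>cube k))"
   using gm by (subst nn_integral_sum) (auto simp: nn_integral_cmult)
  also have "... <= (\<Sum>i<M. ennreal (\<bar>c i\<bar> * (4 ^ (k + 1) * (LINT w|cube k. \<bar>g i w\<bar>))))"
  proof (rule sum_mono)
   fix i assume "i \<in> {..<M}"
   then have i: "i < M" by simp
   note gf = phi_facts[OF g(1)[OF i]]
   have sq: "coord_squeezable k (\<lambda>w. ennreal \<bar>g i w\<bar>)"
    by (rule monotone_coord_squeezable[OF g(2)[OF i]]) (auto intro: ennreal_leI)
   have "(\<integral>\<^sup>+w. ennreal \<bar>g i (?Q w)\<bar> * 1 \<partial>cube k) <= 4 ^ card {..k} * (\<integral>\<^sup>+w. ennreal \<bar>g i w\<bar> * 1 \<partial>cube k)"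
    by (rule quantize_dominated[OF _ sq _ subset_refl]) (use gf in auto)
   also have "(\<integral>\<^sup>+w. ennreal \<bar>g i w\<bar> * 1 \<partial>cube k) = ennreal (LINT w|cube k. \<bar>g i w\<bar>)"
    using gf(3) by (simp add: nn_integral_eq_integral)
   also have "4 ^ card {..k} * ... = ennreal (4 ^ (k + 1) * (LINT w|cube k. \<bar>g i w\<bar>))"
    by (simp add: ennreal_mult ennreal_power[symmetric])
   finally have "(\<integral>\<^sup>+w. ennreal \<bar>g i (?Q w)\<bar> \<partial>cube k) <= ennreal (4 ^ (k + 1) * (LINT w|cube k. \<bar>g i w\<bar>))" by simp
   then show "ennreal \<bar>c i\<bar> * (\<integral>\<^sup>+w. ennreal \<bar>g i (?Q w)\<bar> \<partial>cube k) <= ennreal (\<bar>c i\<bar> * (4 ^ (k + 1) * (LINT w|cube k. \<bar>g i w\<bar>)))"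
    by (subst ennreal_mult) (auto intro!: mult_left_mono)
  qed
  also have "... = ennreal B" unfolding B_def by (rule sum_ennreal) simp
  finally show ?thesis .
 qed
 moreover have "B >= 0" unfolding B_def by (intro sum_nonneg) simp
 ultimately show ?thesis by blast
qed

end

section \<open>Grid cells\<close>

text \<open>The cell of rank \<open>i\<close>: each half interval is cut into as many equal pieces
  as it has observations, so that \<open>grid_map\<close> is constant on a cell. Half-open pieces do
  not overlap.\<close>

definition cell :: "nat => nat => nat => real set" where
 "cell nm np i = (if i <= nm then {(real i - 1) / (2 * real nm)..<real i / (2 * real nm)}
   else {1/2 + (real i - real nm - 1) / (2 * real np)..<1/2 + (real i - real nm) / (2 * real np)})"

definition cell_weight :: "nat => nat => nat => real" where
 "cell_weight nm np i = (if i <= nm then 2 * real nm else 2 * real np)"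

lemma cell_lower:
 assumes i: "1 <= i" "i <= nm" and t: "t \<in> cell nm np i"
 shows "t < 1/2" "real i - 1 <= 2 * real nm * t" "2 * real nm * t < real i"
proof -
 have nm: "real nm > 0" using i by simp
 show a: "real i - 1 <= 2 * real nm * t" and b: "2 * real nm * t < real i"
  using t i nm by (simp_all add: cell_def pos_divide_le_eq pos_less_divide_eq mult_ac)
 have "real nm * (2 * t) < real nm * 1" using b i by linarith
 then have "2 * t < 1" using nm by (simp only: mult_less_cancel_left_pos)
 then show "t < 1/2" by simp
qed

lemma cell_upper:
 assumes i: "nm < i" "i <= nm + np" and t: "t \<in> cell nm np i"
 shows "1/2 <= t" "real i - real nm - 1 <= 2 * real np * (t - 1/2)" "2 * real np * (t - 1/2) < real i - real nm"
proof -
 have np: "real np > 0" using i by simp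
 have t': "(real i - real nm - 1) / (2 * real np) <= t - 1/2" "t - 1/2 < (real i - real nm) / (2 * real np)"
  using t i by (auto simp: cell_def)
 show "real i - real nm - 1 <= 2 * real np * (t - 1/2)" "2 * real np * (t - 1/2) < real i - real nm"
  using t' np by (simp_all add: pos_divide_le_eq pos_less_divide_eq mult_ac)
 have "0 <= (real i - real nm - 1) / (2 * real np)" using i by simp
 then show "1/2 <= t" using t' by linarith
qed

text \<open>On the cell of rank \<open>i\<close> the integer part in \<open>quant\<close> is
  \<open>i - 1\<close>, or \<open>i - nm - 1\<close> in the upper half; adding 1 gives the numerator
  in \<open>appr_point\<close>.\<close>

lemma cell_grid_map:
 assumes i: "1 <= i" "i <= n" and n: "nm + np = n" and t: "t \<in> cell nm np i"
 shows "grid_map nm np t = appr_point n nm np i"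
proof (cases "i <= nm")
 case True
 note c = cell_lower[OF i(1) True t]
 have "\<lfloor>2 * real nm * t\<rfloor> = int i - 1" using c by (simp add: floor_eq_iff)
 then have "grid_map nm np t = real i / (2 * (real nm + 1))"
  using c True i by (simp add: grid_map_def quant_def)
 moreover have "\<not> real i > real n - real np" using True n by linarith
 ultimately show ?thesis using True by (simp add: appr_point_def)
next
 case False
 then have i': "nm < i" "i <= nm + np" using i n by auto
 note c = cell_upper[OF i' t]
 have "\<lfloor>2 * real np * (t - 1/2)\<rfloor> = int i - int nm - 1" using c by (simp add: floor_eq_iff)
 then have "grid_map nm np t = 1/2 + (real i - real nm) / (2 * (real np + 1))"
  using c i' by (simp add: grid_map_def quant_def)
 moreover have "real n - real np = real nm" using n by linarith
 ultimately show ?thesis using i' by (simp add: appr_point_def)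
qed

lemma cell_disjoint:
 assumes "1 <= i" "i <= nm + np" "1 <= i'" "i' <= nm + np" "t \<in> cell nm np i" "t \<in> cell nm np i'"
 shows "i = i'"
proof (cases "i <= nm")
 case True
 note c = cell_lower[OF assms(1) True assms(5)]
 have "i' <= nm"
  using c cell_upper(1)[OF _ assms(4,6)] by (meson not_le)
 note c' = cell_lower[OF assms(3) this assms(6)]
 have "real i - 1 < real i'" "real i' - 1 < real i" using c(2,3) c'(2,3) by linarith+
 then show ?thesis by linarith
next
 case False
 then have "nm < i" by simp
 note c = cell_upper[OF this assms(2) assms(5)]
 have "nm < i'"
  using c cell_lower(1)[OF assms(3) _ assms(6)] by (meson not_le)
 note c' = cell_upper[OF this assms(4) assms(6)]
 have "real i - 1 < real i'" "real i' - 1 < real i" using c(2,3) c'(2,3) by linarith+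
 then show ?thesis by linarith
qed

lemma cell_cover:
 assumes t: "t \<in> {0<..<1}" and nm: "nm > 0" and np: "np > 0"
 shows "\<exists>i\<in>{1..nm + np}. t \<in> cell nm np i"
proof (cases "t < 1/2")
 case True
 define z where "z = \<lfloor>2 * real nm * t\<rfloor>"
 have z: "0 <= z" "real_of_int z <= 2 * real nm * t" "2 * real nm * t < real_of_int z + 1"
  using t nm by (auto simp: z_def)
 have "2 * real nm * t < real nm" using True nm mult_strict_left_mono[OF True, of "2 * real nm"] by simp
 then have "z < int nm" using z by linarith
 define i where "i = nat z + 1"
 have i: "i <= nm" "1 <= i" "real i = real_of_int z + 1" using z \<open>z < int nm\<close> by (auto simp: i_def)
 have "t \<in> cell nm np i"
  using i z nm by (simp add: cell_def pos_divide_le_eq pos_less_divide_eq mult_ac)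
 then show ?thesis using i by (intro bexI[of _ i]) auto
next
 case False
 define s where "s = t - 1/2"
 have s: "0 <= s" "s < 1/2" using False t by (auto simp: s_def)
 define z where "z = \<lfloor>2 * real np * s\<rfloor>"
 have z: "0 <= z" "real_of_int z <= 2 * real np * s" "2 * real np * s < real_of_int z + 1"
  using s np by (auto simp: z_def)
 have "2 * real np * s < real np" using np mult_strict_left_mono[OF s(2), of "2 * real np"] by simp
 then have "z < int np" using z by linarith
 define i where "i = nm + nat z + 1"
 have i: "i <= nm + np" "nm < i" "real i - real nm = real_of_int z + 1" using z \<open>z < int np\<close> by (auto simp: i_def)
 have "(real i - real nm - 1) / (2 * real np) <= s" "s < (real i - real nm) / (2 * real np)"
  using i z np by (simp_all add: pos_divide_le_eq pos_less_divide_eq mult_ac)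
 then have "t \<in> cell nm np i"
  using i by (simp add: cell_def s_def)
 then show ?thesis using i by (intro bexI[of _ i]) auto
qed

lemma cell_width:
 assumes i: "1 <= i" "i <= nm + np" and m: "0 < m" "m <= nm" "m <= np" and t: "t \<in> cell nm np i" "t' \<in> cell nm np i"
 shows "\<bar>t - t'\<bar> < 1 / (2 * real m)"
proof -
 have "\<exists>M\<ge>m. 2 * real M * \<bar>t - t'\<bar> < 1"
 proof (cases "i <= nm")
  case True
  have "2 * real nm * (t - t') < 1" "2 * real nm * (t' - t) < 1"
   using cell_lower(2,3)[OF i(1) True t(1)] cell_lower(2,3)[OF i(1) True t(2)] by (simp_all add: right_diff_distrib)
  then show ?thesis using m by (intro exI[of _ nm]) (auto simp: abs_if)
 next
  case False
  then have e: "nm < i" by simp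
  have "2 * real np * (t - t') < 1" "2 * real np * (t' - t) < 1"
   using cell_upper(2,3)[OF e i(2) t(1)] cell_upper(2,3)[OF e i(2) t(2)] by (simp_all add: right_diff_distrib)
  then show ?thesis using m by (intro exI[of _ np]) (auto simp: abs_if)
 qed
 then obtain M where M: "m <= M" "2 * real M * \<bar>t - t'\<bar> < 1" by blast
 have "2 * real m * \<bar>t - t'\<bar> <= 2 * real M * \<bar>t - t'\<bar>" using M by (intro mult_right_mono) auto
 then have "2 * real m * \<bar>t - t'\<bar> < 1" using M by linarith
 then show ?thesis using m by (simp add: pos_less_divide_eq mult_ac)
qed

lemma measure_cell:
 assumes i: "1 <= i" "i <= nm + np"
 shows "measure uniform01 (cell nm np i \<inter> {0<..<1}) * cell_weight nm np i = 1" "cell nm np i \<inter> {0<..<1} \<in> sets uniform01"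
proof -
 show s: "cell nm np i \<inter> {0<..<1} \<in> sets uniform01" by (auto simp: sets_uniform01 cell_def)
 define a b where "a = (if i <= nm then (real i - 1) / (2 * real nm) else 1/2 + (real i - real nm - 1) / (2 * real np))"
  and "b = (if i <= nm then real i / (2 * real nm) else 1/2 + (real i - real nm) / (2 * real np))"
 have c: "cell nm np i = {a..<b}" by (simp add: cell_def a_def b_def)
 have w: "cell_weight nm np i > 0" using i by (auto simp: cell_weight_def)
 have ba: "(b - a) * cell_weight nm np i = 1"
  using i by (auto simp: a_def b_def cell_weight_def field_simps)
 then have ab: "a < b" using w by (smt (verit) mult_nonpos_nonneg)
 have a0: "0 <= a" using i by (auto simp: a_def)
 have b1: "b <= 1"
 proof (cases "i <= nm")
  case True
  then have "real i / (2 * real nm) <= real nm / (2 * real nm)" by (intro divide_right_mono) auto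
  also have "... <= 1" by simp
  finally show ?thesis using True by (simp add: b_def)
 next
  case False
  then have "(real i - real nm) / (2 * real np) <= real np / (2 * real np)" using i by (intro divide_right_mono) auto
  also have "... <= 1/2" by simp
  finally have "(real i - real nm) / (2 * real np) <= 1/2" .
  moreover have "b = 1/2 + (real i - real nm) / (2 * real np)" using False by (simp add: b_def)
  ultimately show ?thesis by linarith
 qed
 have "measure uniform01 (cell nm np i \<inter> {0<..<1}) = measure lborel (cell nm np i \<inter> {0<..<1})"
  using emeasure_uniform01[OF s] by (simp add: measure_def)
 also have "... = b - a"
 proof (cases "a = 0")
  case True
  then have "cell nm np i \<inter> {0<..<1} = {a<..<b}" using b1 ab by (auto simp: c)
  then show ?thesis using ab by simp
 next
  case False
  then have "cell nm np i \<inter> {0<..<1} = {a..<b}" using b1 a0 by (auto simp: c)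
  then show ?thesis using ab by simp
 qed
 finally show "measure uniform01 (cell nm np i \<inter> {0<..<1}) * cell_weight nm np i = 1" using ba by simp
qed

text \<open>Independence: after resampling, \<open>f\<close> depends on the new coordinates only and
  \<open>g\<close> on the old ones only.\<close>

lemma integral_mix_product:
 fixes f g :: "_ => real"
 assumes M: "\<And>i. i \<in> J ==> prob_space (M i)" and i: "integrable (PiM J M) (\<lambda>u. f u * g u)"
  and f: "\<And>u v. u \<in> space (PiM J M) ==> v \<in> space (PiM J M) ==> f (mix K v u) = f v"
  and g: "\<And>u v. u \<in> space (PiM J M) ==> v \<in> space (PiM J M) ==> g (mix K v u) = g u"
 shows "(LINT u|PiM J M. f u * g u) = (LINT u|PiM J M. f u) * (LINT u|PiM J M. g u)"
proof -
 have "(LINT u|PiM J M. f u * g u) = (LINT u|PiM J M. LINT v|PiM J M. f (mix K v u) * g (mix K v u))"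
  by (rule integral_mix(2)[OF M i, symmetric])
 also have "... = (LINT u|PiM J M. LINT v|PiM J M. f v * g u)"
  by (intro L1_integral_cong refl) (simp add: f g)
 finally show ?thesis by simp
qed

lemma integral_abs_le_of_nn_integral:
 assumes "integrable M X" "(\<integral>\<^sup>+w. ennreal \<bar>X w\<bar> \<partial>M) <= ennreal c" "0 <= c"
 shows "(LINT w|M. \<bar>X w\<bar>) <= c"
proof -
 have "ennreal (LINT w|M. \<bar>X w\<bar>) = (\<integral>\<^sup>+w. ennreal \<bar>X w\<bar> \<partial>M)"
  by (rule nn_integral_eq_integral[symmetric]) (use assms(1) in auto)
 then have "ennreal (LINT w|M. \<bar>X w\<bar>) <= ennreal c" using assms(2) by simp
 then show ?thesis using assms(3) by (simp add: ennreal_le_iff)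
qed

lemma falling_lower_bound:
 assumes "2 * k <= n"
 shows "(real n / 2) ^ (k + 1) <= falling n (k + 1)"
proof -
 have "(real n / 2) ^ (k + 1) = (\<Prod>j<k + 1. real n / 2)" by simp
 also have "... <= (\<Prod>j<k + 1. real n - real j)"
  using assms by (intro prod_mono) auto
 finally show ?thesis by (simp add: falling_def)
qed

section \<open>Approximate scores\<close>

definition cell_box :: "nat => nat => nat => (nat => nat) => (nat => real) set" where
 "cell_box k nm np I = {w \<in> space (cube k). \<forall>j\<le>k. w j \<in> cell nm np (I j)}"

text \<open>The reciprocal volume of a cell box. It depends on the tuple through the pattern only,
  and so the residual is orthogonal to it.\<close>

definition pattern_weight :: "nat => nat => nat => nat set => real" where
 "pattern_weight k nm np A = (\<Prod>j\<le>k. if j \<in> A then 2 * real np else 2 * real nm)"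

lemma cell_box:
 assumes I: "I \<in> tuples k (nm + np)"
 shows "cell_box k nm np I \<in> sets (cube k)"
  "measure (cube k) (cell_box k nm np I) * (\<Prod>j\<le>k. cell_weight nm np (I j)) = 1"
proof -
 interpret finite_product_prob_space "\<lambda>_. uniform01" "{..k}" by unfold_locales auto
 let ?S = "\<lambda>j. cell nm np (I j) \<inter> {0<..<1}"
 have Ij: "1 <= I j" "I j <= nm + np" if "j <= k" for j using tuplesD(2)[OF I that] by auto
 have e: "cell_box k nm np I = Pi\<^sub>E {..k} ?S"
  by (auto simp: cell_box_def space_cube PiE_iff extensional_def)
 have mS: "?S j \<in> sets uniform01" if "j \<in> {..k}" for j
  using that by (intro measure_cell Ij) auto
 show "cell_box k nm np I \<in> sets (cube k)"
  unfolding e cube_def by (rule sets_PiM_I_finite) (use mS in auto)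
 have "measure (cube k) (cell_box k nm np I) = (\<Prod>j\<le>k. measure uniform01 (?S j))"
  unfolding e cube_def by (rule prob_times) (rule mS)
 then have "measure (cube k) (cell_box k nm np I) * (\<Prod>j\<le>k. cell_weight nm np (I j))
  = (\<Prod>j\<le>k. measure uniform01 (?S j) * cell_weight nm np (I j))"
  by (simp add: prod.distrib)
 also have "... = 1" by (intro prod.neutral) (use measure_cell(1) Ij in auto)
 finally show "measure (cube k) (cell_box k nm np I) * (\<Prod>j\<le>k. cell_weight nm np (I j)) = 1" .
qed

text \<open>An artificial sample whose indices play the role of ranks, the first \<open>nm\<close>
  of them below 1/2. Evaluating the step kernel on it expresses \<open>sign_value\<close> as an
  average over rank tuples.\<close>

definition half_sample :: "nat => nat => real" where
 "half_sample nm i = (if i <= nm then 1/4 else 3/4)"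

lemma cell_box_values:
 assumes I: "I \<in> tuples k (nm + np)" and w: "w \<in> cell_box k nm np I"
 shows "pattern k w = pattern k (tup k (half_sample nm) I)"
  "quantize nm np {..k} w = tup k (appr_point (nm + np) nm np) I"
  "pattern_weight k nm np (pattern k w) = (\<Prod>j\<le>k. cell_weight nm np (I j))"
proof -
 have Ij: "1 <= I j" "I j <= nm + np" if "j <= k" for j using tuplesD(2)[OF I that] by auto
 have wj: "w j \<in> cell nm np (I j)" if "j <= k" for j using w that by (auto simp: cell_box_def)
 have half: "1/2 <= w j \<longleftrightarrow> nm < I j" if j: "j <= k" for j
  using cell_lower(1)[OF Ij(1)[OF j] _ wj[OF j]] cell_upper(1)[OF _ Ij(2)[OF j] wj[OF j]] by (cases "I j <= nm") auto
 then show "pattern k w = pattern k (tup k (half_sample nm) I)"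
  by (auto simp: pattern_def tup_def half_sample_def split: if_splits)
 have "w \<in> extensional {..k}" using w by (auto simp: cell_box_def space_cube PiE_iff)
 then show "quantize nm np {..k} w = tup k (appr_point (nm + np) nm np) I"
  using cell_grid_map[OF Ij refl wj] by (auto simp: quantize_def tup_def fun_eq_iff extensional_def)
 show "pattern_weight k nm np (pattern k w) = (\<Prod>j\<le>k. cell_weight nm np (I j))"
  unfolding pattern_weight_def
 proof (intro prod.cong refl)
  fix j assume "j \<in> {..k}"
  then have "j \<in> pattern k w \<longleftrightarrow> nm < I j" using half[of j] by (simp add: pattern_def)
  then show "(if j \<in> pattern k w then 2 * real np else 2 * real nm) = cell_weight nm np (I j)"
   by (simp add: cell_weight_def not_less)
 qed
qed

lemma cell_box_disjoint:
 assumes "I \<in> tuples k (nm + np)" "I' \<in> tuples k (nm + np)" "w \<in> cell_box k nm np I" "w \<in> cell_box k nm np I'"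
 shows "I = I'"
proof -
 have "I j = I' j" if "j <= k" for j
  using tuplesD(2)[OF assms(1) that] tuplesD(2)[OF assms(2) that] assms(3,4) that
  by (intro cell_disjoint[of "I j" nm np "I' j" "w j"]) (auto simp: cell_box_def)
 then show ?thesis using tuplesD(4)[OF assms(1)] tuplesD(4)[OF assms(2)]
  by (auto simp: fun_eq_iff extensional_def) (metis)
qed

lemma cell_box_cover:
 assumes w: "w \<in> space (cube k)" and m: "0 < m" "m <= nm" "m <= np" and N: "w \<notin> near_tie k m"
 shows "\<exists>I\<in>tuples k (nm + np). w \<in> cell_box k nm np I"
proof -
 have "\<forall>j\<in>{..k}. \<exists>i. i \<in> {1..nm + np} \<and> w j \<in> cell nm np i"
 proof
  fix j assume "j \<in> {..k}"
  then have "w j \<in> {0<..<1}" using w by (auto simp: space_cube PiE_iff)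
  from cell_cover[OF this, of nm np] show "\<exists>i. i \<in> {1..nm + np} \<and> w j \<in> cell nm np i" using m by auto
 qed
 from bchoice[OF this] obtain h where h: "\<forall>j\<in>{..k}. h j \<in> {1..nm + np} \<and> w j \<in> cell nm np (h j)" ..
 have "inj_on h {..k}"
 proof (rule inj_onI, rule ccontr)
  fix i j assume ij: "i \<in> {..k}" "j \<in> {..k}" "h i = h j" "i \<noteq> j"
  have "\<bar>w i - w j\<bar> < 1 / (2 * real m)"
  proof (rule cell_width[OF _ _ m])
   show "1 <= h i" "h i <= nm + np" "w i \<in> cell nm np (h i)" using h ij(1) by auto
   show "w j \<in> cell nm np (h i)" unfolding ij(3) using h ij(2) by auto
  qed
  then show False using N ij by (auto simp: near_tie_def)
 qed
 then have "restrict h {..k} \<in> tuples k (nm + np)" using h by (auto simp: tuples_def inj_on_def)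
 moreover have "w \<in> cell_box k nm np (restrict h {..k})" using w h by (auto simp: cell_box_def)
 ultimately show ?thesis by blast
qed

lemma pattern_weight_bounds: "0 <= pattern_weight k nm np A" "pattern_weight k nm np A <= (2 * real (nm + np)) ^ (k + 1)"
proof -
 show "0 <= pattern_weight k nm np A" unfolding pattern_weight_def by (intro prod_nonneg) auto
 have "pattern_weight k nm np A <= (\<Prod>j\<le>k. 2 * real (nm + np))"
  unfolding pattern_weight_def by (intro prod_mono) auto
 then show "pattern_weight k nm np A <= (2 * real (nm + np)) ^ (k + 1)" by simp
qed

text \<open>By symmetry in the ranks, the difference to be estimated is almost surely a function of
  the sign counts alone; this is that function.\<close>

definition appr_gap :: "nat => ((nat => real) => real) => nat => nat => real" where
 "appr_gap k phi nm np = tuple_avg k (nm + np) (\<lambda>I. phi (tup k (appr_point (nm + np) nm np) I)) - sign_value k phi (nm + np) nm np"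

context
 fixes k :: nat and phi :: "(nat => real) => real"
 assumes comb: "comb_of_monotone k phi" and phi: "square_integrable k phi"
begin

lemma quantized_integrable: "integrable (cube k) (\<lambda>w. phi (quantize nm np {..k} w))"
proof -
 obtain B where "(\<integral>\<^sup>+w. ennreal \<bar>phi (quantize nm np {..k} w)\<bar> \<partial>cube k) <= ennreal B"
  using quantize_bounded[OF comb phi] by blast
 then have "(\<integral>\<^sup>+w. ennreal (norm (phi (quantize nm np {..k} w))) \<partial>cube k) < \<infinity>"
  by (simp add: le_less_trans)
 then show ?thesis using quantized_measurable[OF comb phi] by (intro integrableI_bounded)
qed

text \<open>Each summand is constant on the box of its tuple, hence equals its integral over the box
  divided by the volume. A sum over rank tuples thus becomes one integral over the cube, in which
  \<open>s\<close> indicates the union of the boxes.\<close>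

lemma appr_gap_integral:
 assumes n: "k + 1 <= nm + np"
 defines "s \<equiv> \<lambda>w. \<Sum>I\<in>tuples k (nm + np). indicator (cell_box k nm np I) w :: real"
 shows "real (card (tuples k (nm + np))) * appr_gap k phi nm np
  = (LINT w|cube k. pattern_weight k nm np (pattern k w) * (phi (quantize nm np {..k} w) - step_kernel k phi w) * s w)"
  "s \<in> borel_measurable (cube k)" "\<And>w. s w = of_bool (\<exists>I\<in>tuples k (nm + np). w \<in> cell_box k nm np I)"
proof -
 let ?n = "nm + np" and ?Q = "quantize nm np {..k}" and ?h = "step_kernel k phi"
 let ?T = "tuples k ?n" and ?u = "half_sample nm"
 let ?F = "\<lambda>w. pattern_weight k nm np (pattern k w) * (phi (?Q w) - ?h w)"
 define C where "C = real (card ?T)"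
 have C: "C > 0" using card_tuples_pos[of k ?n] n by (simp add: C_def)
 show "s \<in> borel_measurable (cube k)"
  unfolding s_def by (rule borel_measurable_sum) (rule borel_measurable_indicator[OF cell_box(1)])
 show "s w = of_bool (\<exists>I\<in>?T. w \<in> cell_box k nm np I)" for w
 proof (cases "\<exists>I\<in>?T. w \<in> cell_box k nm np I")
  case True
  then obtain I0 where I0: "I0 \<in> ?T" "w \<in> cell_box k nm np I0" by blast
  have "s w = (\<Sum>I\<in>?T. if I = I0 then 1 else 0)"
   unfolding s_def
  proof (rule sum.cong[OF refl])
   fix I assume I: "I \<in> ?T"
   show "indicator (cell_box k nm np I) w = (if I = I0 then 1 else 0 :: real)"
   proof (cases "I = I0")
    case False
    then have "w \<notin> cell_box k nm np I" using cell_box_disjoint[OF I I0(1) _ I0(2)] by blast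
    then show ?thesis using False by simp
   qed (use I0(2) in simp)
  qed
  then show ?thesis using I0 True by simp
 qed (auto simp: s_def intro!: sum.neutral)
 have "n_below (1/2) ?n ?u = nm"
 proof -
  have "{i \<in> {1..?n}. ?u i < 1/2} = {1..nm}" by (auto simp: half_sample_def)
  then show ?thesis by (simp add: n_below_def)
 qed
 moreover have "n_above (1/2) ?n ?u = np"
 proof -
  have "{i \<in> {1..?n}. ?u i > 1/2} = {nm + 1..nm + np}" by (auto simp: half_sample_def)
  then show ?thesis by (simp add: n_above_def)
 qed
 ultimately have SV: "sign_value k phi ?n nm np = U_stat k ?h ?n ?u"
  using U_stat_step_kernel[OF phi_facts(1)[OF phi], of ?n ?u] by (simp add: half_sample_def)
 have I: "phi (tup k (appr_point ?n nm np) I) - ?h (tup k ?u I) = (LINT w|cube k. ?F w * indicator (cell_box k nm np I) w)"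
  if I: "I \<in> ?T" for I
 proof -
  let ?W = "\<Prod>j\<le>k. cell_weight nm np (I j)"
  have "(LINT w|cube k. ?F w * indicator (cell_box k nm np I) w)
   = (LINT w|cube k. ?W * (phi (tup k (appr_point ?n nm np) I) - ?h (tup k ?u I)) * indicator (cell_box k nm np I) w)"
  proof (rule L1_integral_cong[OF refl])
   fix w
   show "?F w * indicator (cell_box k nm np I) w = ?W * (phi (tup k (appr_point ?n nm np) I) - ?h (tup k ?u I)) * indicator (cell_box k nm np I) w"
   proof (cases "w \<in> cell_box k nm np I")
    case True
    have h: "?h w = ?h (tup k ?u I)"
     unfolding step_kernel_def cell_box_values(1)[OF I True] ..
    show ?thesis unfolding cell_box_values(3)[OF I True] cell_box_values(2)[OF I True] h ..
   qed simp
  qed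
  also have "... = ?W * (phi (tup k (appr_point ?n nm np) I) - ?h (tup k ?u I)) * measure (cube k) (cell_box k nm np I)"
   using cell_box(1)[OF I] by simp
  also have "... = (phi (tup k (appr_point ?n nm np) I) - ?h (tup k ?u I)) * (measure (cube k) (cell_box k nm np I) * ?W)"
   by (simp only: mult_ac)
  finally show ?thesis using cell_box(2)[OF I] by simp
 qed
 have Fi: "integrable (cube k) ?F"
 proof -
  have "integrable (cube k) (\<lambda>w. phi (?Q w) - ?h w)"
   using quantized_integrable phi_facts(3)[OF step_kernel_square_integrable[OF phi]] by simp
  from pattern_product_integrable[OF phi this] show ?thesis .
 qed
 have "C * appr_gap k phi nm np = (\<Sum>I\<in>?T. phi (tup k (appr_point ?n nm np) I) - ?h (tup k ?u I))"
  unfolding appr_gap_def SV U_stat_def tuple_avg_def C_def[symmetric] using C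
  by (simp add: right_diff_distrib sum_subtractf)
 also have "... = (\<Sum>I\<in>?T. LINT w|cube k. ?F w * indicator (cell_box k nm np I) w)"
  by (rule sum.cong[OF refl I])
 also have "... = (LINT w|cube k. (\<Sum>I\<in>?T. ?F w * indicator (cell_box k nm np I) w))"
  using integrable_mult_indicator[OF cell_box(1) Fi]
  by (intro L1_integral_sum[symmetric]) (simp add: mult.commute)
 also have "... = (LINT w|cube k. ?F w * s w)"
  unfolding s_def by (simp only: sum_distrib_left)
 finally show "real (card ?T) * appr_gap k phi nm np = (LINT w|cube k. ?F w * s w)" by (simp add: C_def)
qed

text \<open>For the second bound the integrand splits into the quantization error, the residual, and
  the part outside the boxes. The residual integrates to 0 against \<open>pattern_weight\<close>,
  and points outside the boxes are near ties. The first bound uses sizes only and covers unbalanced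
  counts.\<close>

lemma appr_gap_bounds:
 assumes n: "k + 1 <= nm + np" "2 * k <= nm + np" and H: "\<And>w. \<bar>step_kernel k phi w\<bar> <= H" "0 <= H"
 shows "\<bar>appr_gap k phi nm np\<bar> <= 4 ^ (k + 1) * ((LINT w|cube k. \<bar>phi (quantize nm np {..k} w)\<bar>) + H)"
  "0 < m ==> m <= nm ==> m <= np ==> \<bar>appr_gap k phi nm np\<bar> <= 4 ^ (k + 1) * ((LINT w|cube k. \<bar>phi (quantize nm np {..k} w) - phi w\<bar>)
   + (LINT w|cube k. \<bar>phi (quantize nm np {..k} w) * indicator (near_tie k m) w\<bar>) + H * (LINT w|cube k. indicator (near_tie k m) w))"
proof -
 let ?n = "nm + np" and ?Q = "quantize nm np {..k}" and ?h = "step_kernel k phi"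
 let ?T = "tuples k ?n" and ?V = "\<lambda>w. pattern_weight k nm np (pattern k w)"
 define s :: "(nat => real) => real" where "s w = (\<Sum>I\<in>?T. indicator (cell_box k nm np I) w)" for w
 note gap = appr_gap_integral[OF n(1), folded s_def]
 define C where "C = real (card ?T)"
 have C0: "C > 0" using card_tuples_pos[of k ?n] n by (simp add: C_def)
 have C: "(real ?n / 2) ^ (k + 1) <= C" unfolding C_def card_tuples by (rule falling_lower_bound[OF n(2)])
 define D where "D = (2 * real ?n) ^ (k + 1)"
 have D0: "D >= 0" by (simp add: D_def)
 \<comment> \<open>The weight is at most \<open>(2n) ^ (k + 1)\<close> and there are at least
   \<open>(n/2) ^ (k + 1)\<close> tuples; the quotient is the constant
   \<open>4 ^ (k + 1)\<close>.\<close>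
 have "D = 4 ^ (k + 1) * (real ?n / 2) ^ (k + 1)"
 proof -
  have "2 * real ?n = 4 * (real ?n / 2)" by simp
  then show ?thesis unfolding D_def by (simp only: power_mult_distrib)
 qed
 then have DC: "D <= 4 ^ (k + 1) * C" using C by (simp only:) (intro mult_left_mono, auto)
 have V: "\<bar>?V w\<bar> <= D" for w
  using pattern_weight_bounds[of k nm np "pattern k w"] by (simp add: D_def)
 have s01: "0 <= s w" "s w <= 1" for w using gap(3)[of w] by auto
 note Qi = quantized_integrable[of nm np]
 note hi = phi_facts(3)[OF step_kernel_square_integrable[OF phi]]
 note fi = phi_facts(3)[OF phi]
 have fin: "\<bar>appr_gap k phi nm np\<bar> <= 4 ^ (k + 1) * R" if R: "\<bar>C * appr_gap k phi nm np\<bar> <= D * R" "0 <= R" for R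
 proof -
  have "C * \<bar>appr_gap k phi nm np\<bar> <= D * R" using R C0 by (simp add: abs_mult)
  also have "... <= 4 ^ (k + 1) * C * R" using DC R(2) by (rule mult_right_mono)
  finally have "C * \<bar>appr_gap k phi nm np\<bar> <= C * (4 ^ (k + 1) * R)" by (simp only: mult_ac)
  then show ?thesis using C0 by (simp only: mult_le_cancel_left_pos)
 qed
 have Vi: "integrable (cube k) (\<lambda>w. ?V w * g w)" if "integrable (cube k) g" for g
  by (rule pattern_product_integrable[OF phi that])
 have si: "integrable (cube k) (\<lambda>w. g w * c w)"
  if "integrable (cube k) g" "c \<in> borel_measurable (cube k)" "\<And>w. \<bar>c w\<bar> <= 1" for g c :: "(nat => real) => real"
 proof (rule L1_integrable_bound[OF that(1)])
  show "(\<lambda>w. g w * c w) \<in> borel_measurable (cube k)" using that(1,2) by simp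
  show "AE w in cube k. norm (g w * c w) <= norm (g w)"
   using that(3) by (intro AE_I2) (simp add: abs_mult mult_left_le)
 qed
 have Qhi: "integrable (cube k) (\<lambda>w. phi (?Q w) - ?h w)" using Qi hi by simp
 have "\<bar>C * appr_gap k phi nm np\<bar> = \<bar>LINT w|cube k. ?V w * (phi (?Q w) - ?h w) * s w\<bar>"
  unfolding C_def gap(1) ..
 also have "... <= (LINT w|cube k. \<bar>?V w * (phi (?Q w) - ?h w) * s w\<bar>)" by (rule integral_abs_bound)
 also have "... <= (LINT w|cube k. D * (\<bar>phi (?Q w)\<bar> + H))"
 proof (rule integral_mono)
  show "integrable (cube k) (\<lambda>w. \<bar>?V w * (phi (?Q w) - ?h w) * s w\<bar>)"
   using si[OF Vi[OF Qhi] gap(2)] s01 by simp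
  show "integrable (cube k) (\<lambda>w. D * (\<bar>phi (?Q w)\<bar> + H))" using Qi by simp
  fix w
  have "\<bar>?V w * (phi (?Q w) - ?h w) * s w\<bar> = \<bar>?V w\<bar> * \<bar>phi (?Q w) - ?h w\<bar> * s w"
   using s01 by (simp add: abs_mult)
  also have "... <= D * (\<bar>phi (?Q w)\<bar> + H) * 1"
   using V[of w] s01[of w] H(1)[of w] D0 H(2) by (intro mult_mono) auto
  finally show "\<bar>?V w * (phi (?Q w) - ?h w) * s w\<bar> <= D * (\<bar>phi (?Q w)\<bar> + H)" by simp
 qed
 also have "... = D * ((LINT w|cube k. \<bar>phi (?Q w)\<bar>) + H)"
  using Qi by (simp add: CU.prob_space)
 finally show "\<bar>appr_gap k phi nm np\<bar> <= 4 ^ (k + 1) * ((LINT w|cube k. \<bar>phi (?Q w)\<bar>) + H)"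
  by (rule fin) (use H in auto)
 assume m: "0 < m" "m <= nm" "m <= np"
 let ?N = "\<lambda>w. indicator (near_tie k m) w :: real"
 have Nm: "?N \<in> borel_measurable (cube k)"
  by (rule borel_measurable_indicator') (use near_tie_measurable in simp)
 have sN: "\<bar>1 - s w\<bar> <= ?N w" if "w \<in> space (cube k)" for w
  using gap(3)[of w] cell_box_cover[OF that m] by (auto simp: indicator_def)
 have Qfi: "integrable (cube k) (\<lambda>w. phi (?Q w) - phi w)" using Qi fi by simp
 have fhi: "integrable (cube k) (\<lambda>w. phi w - ?h w)" using hi fi by simp
 have m1: "(\<lambda>w. 1 - s w) \<in> borel_measurable (cube k)" using gap(2) by simp
 have "C * appr_gap k phi nm np = (LINT w|cube k. ?V w * (phi (?Q w) - phi w) + ?V w * (phi w - ?h w) - ?V w * (phi (?Q w) - ?h w) * (1 - s w))"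
  unfolding C_def gap(1) by (intro L1_integral_cong refl) (simp add: algebra_simps)
 also have "... = (LINT w|cube k. ?V w * (phi (?Q w) - phi w)) + (LINT w|cube k. ?V w * (phi w - ?h w))
   - (LINT w|cube k. ?V w * (phi (?Q w) - ?h w) * (1 - s w))"
  using Vi[OF Qfi] Vi[OF fhi] si[OF Vi[OF Qhi] m1] s01 by simp
 also have "(LINT w|cube k. ?V w * (phi w - ?h w)) = 0" by (rule residual_pattern_orthogonal[OF phi])
 finally have "\<bar>C * appr_gap k phi nm np\<bar> <= \<bar>LINT w|cube k. ?V w * (phi (?Q w) - phi w)\<bar>
   + \<bar>LINT w|cube k. ?V w * (phi (?Q w) - ?h w) * (1 - s w)\<bar>" by linarith
 also have "\<bar>LINT w|cube k. ?V w * (phi (?Q w) - phi w)\<bar> <= (LINT w|cube k. D * \<bar>phi (?Q w) - phi w\<bar>)"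
 proof (rule order_trans[OF integral_abs_bound integral_mono])
  show "integrable (cube k) (\<lambda>w. \<bar>?V w * (phi (?Q w) - phi w)\<bar>)" by (rule integrable_abs[OF Vi[OF Qfi]])
  show "integrable (cube k) (\<lambda>w. D * \<bar>phi (?Q w) - phi w\<bar>)" using integrable_abs[OF Qfi] by simp
  show "\<bar>?V w * (phi (?Q w) - phi w)\<bar> <= D * \<bar>phi (?Q w) - phi w\<bar>" for w
   unfolding abs_mult using V by (rule mult_right_mono) simp
 qed
 also have "\<bar>LINT w|cube k. ?V w * (phi (?Q w) - ?h w) * (1 - s w)\<bar> <= (LINT w|cube k. D * (\<bar>phi (?Q w) * ?N w\<bar> + H * ?N w))"
 proof (rule order_trans[OF integral_abs_bound integral_mono])
  show "integrable (cube k) (\<lambda>w. \<bar>?V w * (phi (?Q w) - ?h w) * (1 - s w)\<bar>)"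
   using si[OF Vi[OF Qhi] m1] s01 by simp
  have "integrable (cube k) (\<lambda>w. phi (?Q w) * ?N w)" by (rule si[OF Qi Nm]) (simp add: indicator_def)
  moreover have "integrable (cube k) (\<lambda>w. H * ?N w)"
   by (rule si[OF _ Nm]) (simp_all add: indicator_def)
  ultimately show "integrable (cube k) (\<lambda>w. D * (\<bar>phi (?Q w) * ?N w\<bar> + H * ?N w))" by simp
  fix w assume w: "w \<in> space (cube k)"
  have "\<bar>?V w * (phi (?Q w) - ?h w) * (1 - s w)\<bar> = \<bar>?V w\<bar> * \<bar>phi (?Q w) - ?h w\<bar> * \<bar>1 - s w\<bar>"
   by (simp add: abs_mult)
  also have "... <= D * (\<bar>phi (?Q w)\<bar> + H) * ?N w"
   using V[of w] sN[OF w] H(1)[of w] D0 H(2) by (intro mult_mono) auto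
  also have "... = D * (\<bar>phi (?Q w) * ?N w\<bar> + H * ?N w)" by (simp add: abs_mult algebra_simps)
  finally show "\<bar>?V w * (phi (?Q w) - ?h w) * (1 - s w)\<bar> <= D * (\<bar>phi (?Q w) * ?N w\<bar> + H * ?N w)" .
 qed
 also have "(LINT w|cube k. D * \<bar>phi (?Q w) - phi w\<bar>) + (LINT w|cube k. D * (\<bar>phi (?Q w) * ?N w\<bar> + H * ?N w))
  = D * ((LINT w|cube k. \<bar>phi (?Q w) - phi w\<bar>) + (LINT w|cube k. \<bar>phi (?Q w) * ?N w\<bar>) + H * (LINT w|cube k. ?N w))"
 proof -
  have "integrable (cube k) (\<lambda>w. phi (?Q w) * ?N w)" by (rule si[OF Qi Nm]) (simp add: indicator_def)
  moreover have "integrable (cube k) (\<lambda>w. H * ?N w)"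
   by (rule si[OF _ Nm]) (simp_all add: indicator_def)
  ultimately show ?thesis by (simp add: distrib_left)
 qed
 finally show "\<bar>appr_gap k phi nm np\<bar> <= 4 ^ (k + 1) * ((LINT w|cube k. \<bar>phi (?Q w) - phi w\<bar>)
   + (LINT w|cube k. \<bar>phi (?Q w) * ?N w\<bar>) + H * (LINT w|cube k. ?N w))"
  by (rule fin) (use H in \<open>auto intro!: add_nonneg_nonneg\<close>)
qed

end

section \<open>The mean gap under random sign counts\<close>

lemma inverse_sqrt_tendsto_0: "(\<lambda>n. c / sqrt (real n)) \<longlonglongrightarrow> 0"
 by (intro tendsto_divide_0[OF tendsto_const] filterlim_at_top_imp_at_infinity
   filterlim_compose[OF sqrt_at_top] filterlim_real_sequentially)

lemma component_integral:
 assumes "i \<in> J" "g \<in> borel_measurable uniform01"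
 shows "(LINT u|(unif J). (g (u i) :: real)) = (LINT x|uniform01. g x)"
  "integrable (unif J) (\<lambda>u. (g (u i) :: real)) \<longleftrightarrow> integrable uniform01 g"
proof -
 have d: "distr (unif J) uniform01 (\<lambda>u. u i) = uniform01"
  by (rule distr_PiM_component) (use prob_space_uniform01 assms in auto)
 have m: "(\<lambda>u. u i) \<in> measurable (unif J) uniform01" using assms by simp
 show "(LINT u|(unif J). (g (u i) :: real)) = (LINT x|uniform01. g x)"
  using integral_distr[OF m assms(2)] d by simp
 show "integrable (unif J) (\<lambda>u. (g (u i) :: real)) \<longleftrightarrow> integrable uniform01 g"
  using integrable_distr_eq[OF m assms(2)] d by simp
qed

text \<open>Chebyshev for a sum of \<open>n\<close> centred signs: variance \<open>n/4\<close> and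
  deviation at least \<open>n/4\<close>. The rate \<open>1/n\<close> beats the factor
  \<open>sqrt n\<close> in \<open>appr_score_average\<close>.\<close>

lemma unbalanced_probability:
 assumes n: "n > 0"
 shows "{u \<in> space uniform_seq. \<not> (n <= 4 * n_below (1/2) n u \<and> 4 * n_below (1/2) n u <= 3 * n)} \<in> sets uniform_seq"
  "measure uniform_seq {u \<in> space uniform_seq. \<not> (n <= 4 * n_below (1/2) n u \<and> 4 * n_below (1/2) n u <= 3 * n)} <= 4 / real n"
proof -
 let ?bad = "{u \<in> space uniform_seq. \<not> (n <= 4 * n_below (1/2) n u \<and> 4 * n_below (1/2) n u <= 3 * n)}"
 have nbm: "n_below (1/2) n \<in> measurable uniform_seq (count_space UNIV)"
  unfolding uniform_seq_def by (rule n_below_measurable[OF id_uniform01]) auto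
 show badm: "?bad \<in> sets uniform_seq" using nbm by measurable
 define x where "x t = of_bool (t < 1/2) - (1/2 :: real)" for t :: real
 have xm: "x \<in> borel_measurable uniform01"
 proof -
  have "x \<in> borel_measurable borel" unfolding x_def[abs_def] by measurable
  from measurable_compose[OF id_uniform01 this] show ?thesis by simp
 qed
 have xc: "\<bar>x t\<bar> <= 1/2" "(x t)^2 = 1/4" for t by (auto simp: x_def power2_eq_square)
 have "(LINT t|uniform01. x t) = (LINT t|uniform01. indicator {x \<in> {0<..<1}. x < (1/2::real)} t - 1/2)"
  by (intro L1_integral_cong) (auto simp: x_def indicator_def)
 also have "... = measure uniform01 {x \<in> {0<..<1}. x < (1/2::real)} - 1/2"
 proof -
  define S where "S = {x \<in> {0<..<1}. x < (1/2::real)}"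
  have "S \<in> sets uniform01" "S \<inter> {0<..<1} = S" by (auto simp: S_def sets_uniform01)
  then show ?thesis unfolding S_def[symmetric] using U01.prob_space
   by (subst L1_integral_diff) (auto simp: U01.emeasure_eq_measure)
 qed
 also have "... = 0" using measure_uniform01_Iio(1)[of "1/2"] by simp
 finally have x0: "(LINT t|uniform01. x t) = 0" .
 have Xm: "(\<lambda>u. x (u i)) \<in> borel_measurable uniform_seq" if "i \<in> {1..n}" for i
  unfolding uniform_seq_def
  by (rule measurable_compose[OF measurable_component_singleton[of i "{1..}" "\<lambda>_. uniform01"] xm]) (use that in auto)
 have Xsq: "integrable uniform_seq (\<lambda>u. (x (u i))^2)" for i by (simp add: xc)
 have sm: "(EU u. (\<Sum>i\<in>{1..n}. x (u i))^2) <= real (card {1..n}) * (2 * real 0 + 1) * (1/4) + (real (card {1..n}))^2 * 0"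
 proof (rule second_moment_local_dependence)
  fix i j assume ij: "i \<in> {1..n}" "j \<in> {1..n}"
  show "\<bar>LINT u|uniform_seq. x (u i) * x (u j)\<bar> <= 1/4"
   using integral_product_le[OF Xm[OF ij(1)] Xm[OF ij(2)] Xsq Xsq] by (simp add: xc US.prob_space)
  assume "i + 0 < j \<or> j + 0 < i"
  then have ne: "i \<noteq> j" by auto
  have "(EU u. x (u i) * x (u j)) = (EU u. x (u i)) * (EU u. x (u j))"
   unfolding uniform_seq_def
   by (rule integral_mix_product[where K = "{i}"])
     (use integrable_product_of_squares[OF Xm[OF ij(1)] Xm[OF ij(2)] Xsq Xsq] ne prob_space_uniform01
     in \<open>auto simp: mix_def uniform_seq_def\<close>)
  also have "(EU u. x (u i)) = 0"
   unfolding uniform_seq_def using component_integral(1)[OF _ xm, of i "{1..}"] x0 ij by simp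
  finally show "\<bar>LINT u|uniform_seq. x (u i) * x (u j)\<bar> <= 0" by simp
 qed (use Xm Xsq in auto)
 have sum: "(\<Sum>i\<in>{1..n}. x (u i)) = real (n_below (1/2) n u) - real n / 2" for u
  unfolding x_def sum_subtractf n_below_def card_as_sum[OF finite_atLeastAtMost]
  by (simp add: of_bool_def if_distrib[of real] cong: if_cong)
 have "measure uniform_seq ?bad <= measure uniform_seq {u \<in> space uniform_seq. (real n / 4)^2 <= (\<Sum>i\<in>{1..n}. x (u i))^2}"
 proof (rule US.finite_measure_mono)
  show "?bad \<subseteq> {u \<in> space uniform_seq. (real n / 4)^2 <= (\<Sum>i\<in>{1..n}. x (u i))^2}"
  proof
   fix u assume u: "u \<in> ?bad"
   have "real n / 4 <= \<bar>real (n_below (1/2) n u) - real n / 2\<bar>"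
    using u by auto
   from power_mono[OF this, of 2] show "u \<in> {u \<in> space uniform_seq. (real n / 4)^2 <= (\<Sum>i\<in>{1..n}. x (u i))^2}"
    using u unfolding sum by simp
  qed
  have "(\<lambda>u. (\<Sum>i\<in>{1..n}. x (u i))^2) \<in> borel_measurable uniform_seq"
   by (intro borel_measurable_power borel_measurable_sum Xm)
  then show "{u \<in> space uniform_seq. (real n / 4)^2 <= (\<Sum>i\<in>{1..n}. x (u i))^2} \<in> sets uniform_seq"
   by (intro borel_measurable_le) auto
 qed
 also have "... <= (EU u. (\<Sum>i\<in>{1..n}. x (u i))^2) / (real n / 4)^2"
  by (rule integral_Markov_inequality_measure[where A = "{}"])
    (use integrable_sum_square(1)[of "{1..n}" "\<lambda>i u. x (u i)" uniform_seq] Xm Xsq n in auto)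
 also have "... <= (real n / 4) / (real n / 4)^2"
  using sm by (intro divide_right_mono) auto
 also have "... = 4 / real n" using n by (simp add: power2_eq_square)
 finally show "measure uniform_seq ?bad <= 4 / real n" .
qed

lemma score_at_measurable_seq: "I \<in> tuples k n ==> (\<lambda>u. score_at k a n c u I) \<in> borel_measurable uniform_seq"
 unfolding uniform_seq_def by (rule score_at_measurable[OF id_uniform01]) auto

lemma score_at_integrable: "I \<in> tuples k n ==> integrable uniform_seq (\<lambda>u. score_at k a n c u I)"
 by (rule US.integrable_const_bound[where B = "score_bound k a n"])
   (use score_at_bounded score_at_measurable_seq in auto)

lemma score_avg_integrable: "integrable uniform_seq (\<lambda>u. tuple_avg k n (score_at k a n c u))"
 unfolding tuple_avg_def using score_at_integrable by auto

lemma U_stat_integrable: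
 assumes "square_integrable k g"
 shows "integrable uniform_seq (U_stat k g n)"
proof -
 have "integrable uniform_seq (\<lambda>u. g (tup k u I))" if "I \<in> tuples k n" for I
  using integrable_tup[OF that phi_facts(1)[OF assms]] phi_facts(3)[OF assms] by simp
 then show ?thesis unfolding U_stat_def[abs_def] tuple_avg_def by auto
qed

lemma appr_score_average:
 assumes comb: "comb_of_monotone k phi" and phi: "square_integrable k phi"
 shows "(\<lambda>n. sqrt (real n) * (EU u. \<bar>tuple_avg k n (score_at k (appr_score k phi) n (1/2) u) - U_stat k (step_kernel k phi) n u\<bar>)) \<longlonglongrightarrow> 0"
proof -
 let ?h = "step_kernel k phi"
 let ?f = "\<lambda>n u. \<bar>tuple_avg k n (score_at k (appr_score k phi) n (1/2) u) - U_stat k ?h n u\<bar>"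
 obtain H where H: "\<And>w. \<bar>?h w\<bar> <= H" using step_kernel_bounded[OF phi] by blast
 have H0: "H >= 0" using H[of undefined] by linarith
 obtain B where B: "B >= 0" "\<And>nm np. (\<integral>\<^sup>+w. ennreal \<bar>phi (quantize nm np {..k} w)\<bar> \<partial>cube k) <= ennreal B"
  using quantize_bounded[OF comb phi] by blast
 define c where "c = (4::real) ^ (k + 1)"
 have c: "c > 0" by (simp add: c_def)
 define Bc where "Bc = c * (B + H)"
 have Bc: "Bc >= 0" using c B H0 by (simp add: Bc_def)
 have gen: "AE u in uniform_seq. inj_on u {1..n} \<and> (\<forall>i\<in>{1..n}. u i \<noteq> 1/2)" for n
  unfolding uniform_seq_def by (rule AE_generic) auto
 have val: "?f n u = \<bar>appr_gap k phi (n_below (1/2) n u) (n_above (1/2) n u)\<bar> \<and> n_below (1/2) n u + n_above (1/2) n u = n"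
  if u: "inj_on u {1..n} \<and> (\<forall>i\<in>{1..n}. u i \<noteq> 1/2)" for n u
 proof -
  let ?nm = "n_below (1/2) n u" and ?np = "n_above (1/2) n u"
  have sum: "?nm + ?np = n" using u by (intro n_below_add_above) auto
  obtain per where per: "per permutes {1..n}" "\<forall>I\<in>tuples k n. tup k (rank n u) I = tup k per I"
   using rank_permutation u by blast
  have "tuple_avg k n (score_at k (appr_score k phi) n (1/2) u) = tuple_avg k n (\<lambda>I. phi (tup k (appr_point n ?nm ?np) (tup k per I)))"
   unfolding tuple_avg_def score_at_def appr_score_def
   using per(2) by (intro arg_cong2[of _ _ _ _ "(/)"] sum.cong) (auto simp: tup_def)
  also have "... = tuple_avg k n (\<lambda>I. phi (tup k (appr_point n ?nm ?np) I))" by (rule tuple_avg_permute[OF per(1)])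
  finally show ?thesis
   using U_stat_step_kernel[OF phi_facts(1)[OF phi], of n u] u sum by (simp add: appr_gap_def)
 qed
 have fi: "integrable uniform_seq (?f n)" for n
  using score_avg_integrable U_stat_integrable[OF step_kernel_square_integrable[OF phi]] by (intro integrable_abs L1_integrable_diff)
 have main: "\<forall>\<^sub>F n in sequentially. sqrt (real n) * (EU u. ?f n u) < eps" if eps: "eps > 0" for eps
 proof -
  \<comment> \<open>Two errors of size \<open>eps' / sqrt m\<close>, multiplied by \<open>c\<close>
    and by \<open>sqrt n / sqrt m <= 3\<close>, make up \<open>eps / 2\<close>.\<close>
  define eps' where "eps' = eps / (12 * c)"
  have eps': "eps' > 0" using eps c by (simp add: eps'_def)
  obtain m0 where m0: "m0 > 0" "\<And>m nm np. m0 <= m ==> m <= nm ==> m <= np ==>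
   (\<integral>\<^sup>+w. ennreal \<bar>phi (quantize nm np {..k} w) - phi w\<bar> \<partial>cube k) <= ennreal (eps' / sqrt (real m)) \<and>
   (\<integral>\<^sup>+w. ennreal \<bar>phi (quantize nm np {..k} w)\<bar> * indicator (near_tie k m) w \<partial>cube k) <= ennreal (eps' / sqrt (real m))"
   using quantize_small[OF comb phi eps'] by blast
  \<comment> \<open>Collects the terms that become \<open>O(1 / sqrt n)\<close>: the near ties for
    the bounded step kernel, with 8 from \<open>n <= 8 m\<close>, and the unbalanced samples, with 4
    from their probability \<open>4 / n\<close>.\<close>
  define E where "E = c * (8 * (H * (real k + 1)^2)) + 4 * Bc"
  have "(\<lambda>n. eps / 2 + E / sqrt (real n)) \<longlonglongrightarrow> eps / 2 + 0"
   by (intro tendsto_add tendsto_const inverse_sqrt_tendsto_0)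
  from order_tendstoD(2)[OF this, of eps] eps
  have "\<forall>\<^sub>F n in sequentially. eps / 2 + E / sqrt (real n) < eps" by simp
  moreover have "\<forall>\<^sub>F n in sequentially. n >= 4 * m0 + 2 * k + 8" by (rule eventually_ge_at_top)
  ultimately show ?thesis
  proof eventually_elim
   case (elim n)
   \<comment> \<open>A common lower bound for both sign counts of a balanced sample.\<close>
   define m where "m = n div 4"
   have m: "m0 <= m" "m > 0" "4 * m <= n" "n <= 8 * m" using elim(2) m0(1) by (auto simp: m_def)
   have n0: "n > 0" using elim by simp
   let ?bad = "{u \<in> space uniform_seq. \<not> (n <= 4 * n_below (1/2) n u \<and> 4 * n_below (1/2) n u <= 3 * n)}"
   note bad = unbalanced_probability[OF n0]
   define gb where "gb = c * (eps' / sqrt (real m) + eps' / sqrt (real m) + H * ((real k + 1)^2 / real m))"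
   have gb0: "gb >= 0" using c eps' H0 by (simp add: gb_def)
   have "AE u in uniform_seq. ?f n u <= Bc * indicator ?bad u + gb"
    using gen[of n] AE_space
   proof eventually_elim
    case (elim u)
    let ?nm = "n_below (1/2) n u" and ?np = "n_above (1/2) n u"
    note v = val[OF elim(1)]
    have k1: "k + 1 <= ?nm + ?np" "2 * k <= ?nm + ?np" using v \<open>n >= 4 * m0 + 2 * k + 8\<close> by auto
    note gap = appr_gap_bounds[OF comb phi k1 H H0]
    show ?case
    proof (cases "u \<in> ?bad")
     case True
     have "(LINT w|cube k. \<bar>phi (quantize ?nm ?np {..k} w)\<bar>) <= B"
      by (rule integral_abs_le_of_nn_integral[OF quantized_integrable[OF comb phi] B(2,1)])
     then have "c * ((LINT w|cube k. \<bar>phi (quantize ?nm ?np {..k} w)\<bar>) + H) <= Bc"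
      unfolding Bc_def using c by (intro mult_left_mono) auto
     then show ?thesis using gap(1) v True gb0 unfolding c_def[symmetric] by simp
    next
     case False
     then have "n <= 4 * ?nm" "4 * ?nm <= 3 * n" using elim(2) by auto
     then have mnm: "m <= ?nm" "m <= ?np" using m(3) v by linarith+
     note q = m0(2)[OF m(1) mnm]
     have Qi: "integrable (cube k) (\<lambda>w. phi (quantize ?nm ?np {..k} w))" by (rule quantized_integrable[OF comb phi])
     have q1: "(LINT w|cube k. \<bar>phi (quantize ?nm ?np {..k} w) - phi w\<bar>) <= eps' / sqrt (real m)"
      by (rule integral_abs_le_of_nn_integral) (use q Qi phi_facts(3)[OF phi] eps' in auto)
     have q2: "(LINT w|cube k. \<bar>phi (quantize ?nm ?np {..k} w) * indicator (near_tie k m) w\<bar>) <= eps' / sqrt (real m)"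
     proof (rule integral_abs_le_of_nn_integral)
      have Nm: "(\<lambda>w. indicator (near_tie k m) w :: real) \<in> borel_measurable (cube k)"
       by (rule borel_measurable_indicator') (use near_tie_measurable in simp)
      show "integrable (cube k) (\<lambda>w. phi (quantize ?nm ?np {..k} w) * indicator (near_tie k m) w)"
       by (rule L1_integrable_bound[OF Qi])
         (use Nm borel_measurable_integrable[OF Qi] in \<open>auto simp: indicator_def\<close>)
      have "(\<integral>\<^sup>+w. ennreal \<bar>phi (quantize ?nm ?np {..k} w) * indicator (near_tie k m) w\<bar> \<partial>cube k)
       = (\<integral>\<^sup>+w. ennreal \<bar>phi (quantize ?nm ?np {..k} w)\<bar> * indicator (near_tie k m) w \<partial>cube k)"
       by (intro nn_integral_cong) (auto simp: indicator_def)
      then show "(\<integral>\<^sup>+w. ennreal \<bar>phi (quantize ?nm ?np {..k} w) * indicator (near_tie k m) w\<bar> \<partial>cube k) <= ennreal (eps' / sqrt (real m))"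
       using q by simp
     qed (use eps' in auto)
     have "(LINT w|cube k. indicator (near_tie k m) w) <= (real k + 1)^2 / real m"
     proof -
      have Ni: "integrable (cube k) (\<lambda>w. indicator (near_tie k m) w :: real)"
       by (rule CU.integrable_const_bound[where B = 1])
         (auto intro!: borel_measurable_indicator' near_tie_measurable)
      have "(LINT w|cube k. \<bar>indicator (near_tie k m) w :: real\<bar>) <= (real k + 1)^2 / real m"
      proof (rule integral_abs_le_of_nn_integral[OF Ni])
       have "(\<integral>\<^sup>+w. ennreal \<bar>indicator (near_tie k m) w\<bar> \<partial>cube k) = (\<integral>\<^sup>+w. indicator (near_tie k m) w \<partial>cube k)"
        by (intro nn_integral_cong) (auto simp: indicator_def)
       then show "(\<integral>\<^sup>+w. ennreal \<bar>indicator (near_tie k m) w\<bar> \<partial>cube k) <= ennreal ((real k + 1)^2 / real m)"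
        using nn_integral_near_tie[OF m(2), of k] by simp
      qed simp
      then show ?thesis by simp
     qed
     then have q3: "H * (LINT w|cube k. indicator (near_tie k m) w) <= H * ((real k + 1)^2 / real m)"
      using H0 by (rule mult_left_mono)
     have "c * ((LINT w|cube k. \<bar>phi (quantize ?nm ?np {..k} w) - phi w\<bar>)
      + (LINT w|cube k. \<bar>phi (quantize ?nm ?np {..k} w) * indicator (near_tie k m) w\<bar>) + H * (LINT w|cube k. indicator (near_tie k m) w)) <= gb"
      unfolding gb_def by (rule mult_left_mono[OF add_mono[OF add_mono[OF q1 q2] q3]]) (use c in simp)
     then show ?thesis using gap(2)[OF m(2) mnm] v False unfolding c_def[symmetric] by simp
    qed
   qed
   moreover have bi: "integrable uniform_seq (\<lambda>u. Bc * indicator ?bad u)"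
    by (rule integrable_mult_right, rule integrable_real_indicator[OF bad(1)]) (simp add: US.emeasure_eq_measure)
   then have "integrable uniform_seq (\<lambda>u. Bc * indicator ?bad u + gb)" by (rule L1_integrable_add) simp
   ultimately have "(EU u. ?f n u) <= (EU u. Bc * indicator ?bad u + gb)"
    by (intro integral_mono_AE[OF fi])
   also have "... = (EU u. Bc * indicator ?bad u) + gb"
    by (subst L1_integral_add[OF bi]) (auto simp: US.prob_space)
   also have "(EU u. Bc * indicator ?bad u) = Bc * measure uniform_seq ?bad"
    using sets.Int_space_eq2[OF bad(1)] by simp
   also have "... + gb <= Bc * (4 / real n) + gb" using bad(2) Bc by (intro add_right_mono mult_left_mono)
   finally have "sqrt (real n) * (EU u. ?f n u) <= sqrt (real n) * (Bc * (4 / real n) + gb)"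
    by (rule mult_left_mono) simp
   also have "... = 4 * Bc * (sqrt (real n) / real n) + sqrt (real n) * gb" by (simp add: distrib_left)
   also have "sqrt (real n) / real n = 1 / sqrt (real n)" using n0 by (simp add: real_div_sqrt field_simps)
   also have "sqrt (real n) * gb <= eps / 2 + c * (8 * (H * (real k + 1)^2)) / sqrt (real n)"
   proof -
    have "sqrt (real n) <= sqrt (9 * real m)" using m(4) by (intro real_sqrt_le_mono) linarith
    also have "... = 3 * sqrt (real m)" by (simp add: real_sqrt_mult)
    finally have s: "sqrt (real n) / sqrt (real m) <= 3" using m(2) by (simp add: pos_divide_le_eq)
    have r: "sqrt (real n) / real m <= 8 / sqrt (real n)"
    proof -
     have "sqrt (real n) * sqrt (real n) <= 8 * real m" using m(4) by simp
     then show ?thesis using m(2) n0 by (simp add: field_simps)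
    qed
    have "sqrt (real n) * gb = c * (2 * eps' * (sqrt (real n) / sqrt (real m))) + c * (H * (real k + 1)^2) * (sqrt (real n) / real m)"
     unfolding gb_def by (simp add: algebra_simps)
    also have "... <= c * (2 * eps' * 3) + c * (H * (real k + 1)^2) * (8 / sqrt (real n))"
     using s r c eps' H0 by (intro add_mono mult_left_mono) auto
    also have "c * (2 * eps' * 3) = eps / 2" using c by (simp add: eps'_def)
    finally show ?thesis by (simp add: mult_ac)
   qed
   finally have "sqrt (real n) * (EU u. ?f n u) <= 4 * Bc * (1 / sqrt (real n)) + (eps / 2 + c * (8 * (H * (real k + 1)^2)) / sqrt (real n))"
    by simp
   also have "... = eps / 2 + E / sqrt (real n)" by (simp add: E_def add_divide_distrib)
   finally show ?case using elim(1) by linarith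
  qed
 qed
 show ?thesis
 proof (rule order_tendstoI)
  fix y :: real assume "y < 0"
  moreover have "0 <= sqrt (real n) * (EU u. ?f n u)" for n by simp
  ultimately show "\<forall>\<^sub>F n in sequentially. y < sqrt (real n) * (EU u. ?f n u)"
   by (intro always_eventually allI) (meson less_le_trans)
 qed (rule main)
qed

section \<open>The asymptotic representation\<close>

lemma distr_restrict_uniform_seq:
 "distr uniform_seq (unif {1..n}) (\<lambda>u. restrict u {1..n}) = (unif {1..n})"
 "(\<lambda>u. restrict u {1..n}) \<in> measurable uniform_seq (unif {1..n})"
proof -
 show "distr uniform_seq (unif {1..n}) (\<lambda>u. restrict u {1..n}) = (unif {1..n})"
  unfolding uniform_seq_def restrict_def[abs_def]
  using distr_PiM_reindex[of "{1..}" "\<lambda>_. uniform01" "\<lambda>i. i" "{1..n}"] prob_space_uniform01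
  by (auto simp: restrict_def)
 show "(\<lambda>u. restrict u {1..n}) \<in> measurable uniform_seq (unif {1..n})"
  unfolding uniform_seq_def by (intro measurable_restrict) auto
qed

lemma restrict_tuple_cong:
 assumes "\<And>i. i \<in> {1..n} ==> u i = v i"
 shows "uniform_stat k a n u = uniform_stat k a n v" "lag_avg k g n u = lag_avg k g n v" "U_stat k g n u = U_stat k g n v"
  "tuple_avg k n (score_at k a n c u) = tuple_avg k n (score_at k a n c v)"
proof -
 have t: "tup k u I = tup k v I" if "I \<in> tuples k n" for I
  by (intro tup_cong assms tuplesD(2)[OF that])
 have l: "lag_index k t \<in> tuples k n" if "t \<in> {k+1..n}" for t
  using that by (intro lag_index_in_tuples) auto
 show "uniform_stat k a n u = uniform_stat k a n v"
  unfolding uniform_stat_def using score_at_cong[of n u v, OF assms] l by (intro arg_cong2[of _ _ _ _ "(/)"] sum.cong) auto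
 show "lag_avg k g n u = lag_avg k g n v"
  unfolding lag_avg_def using t l by (intro arg_cong2[of _ _ _ _ "(/)"] sum.cong) auto
 show "U_stat k g n u = U_stat k g n v"
  unfolding U_stat_def tuple_avg_def using t by (intro arg_cong2[of _ _ _ _ "(/)"] sum.cong) auto
 show "tuple_avg k n (score_at k a n c u) = tuple_avg k n (score_at k a n c v)"
  unfolding tuple_avg_def using score_at_cong[of n u v, OF assms] by (intro arg_cong2[of _ _ _ _ "(/)"] sum.cong) auto
qed

lemma exact_score_average_seq:
 assumes phi: "square_integrable k phi" and n: "k + 1 <= n"
 shows "AE u in uniform_seq. tuple_avg k n (score_at k (exact_score k phi) n (1/2) u) = U_stat k (step_kernel k phi) n u"
proof -
 note ex = exact_score_average[OF phi n]
 have "AE u in distr uniform_seq (unif {1..n}) (\<lambda>u. restrict u {1..n}).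
  tuple_avg k n (score_at k (exact_score k phi) n (1/2) u) = U_stat k (step_kernel k phi) n u"
  using ex unfolding distr_restrict_uniform_seq(1) .
 from AE_distrD[OF distr_restrict_uniform_seq(2) this] show ?thesis
 proof eventually_elim
  case (elim u)
  have r: "restrict u {1..n} i = u i" if "i \<in> {1..n}" for i using that by simp
  show ?case using elim
   by (simp only: restrict_tuple_cong(3)[of n "restrict u {1..n}" u, OF r] restrict_tuple_cong(4)[of n "restrict u {1..n}" u, OF r])
 qed
qed

text \<open>By exchangeability successive tuples and all tuples have the same mean, so centering is
  compatible with the reduction to tuple averages.\<close>

lemma integral_uniform_stat:
 assumes n: "k + 1 <= n"
 shows "integrable uniform_seq (uniform_stat k a n)"
  "(EU u. uniform_stat k a n u) = (EU u. tuple_avg k n (score_at k a n (1/2) u))"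
proof -
 let ?e = "score_at k a n (1/2)"
 have l: "lag_index k t \<in> tuples k n" if "t \<in> {k+1..n}" for t
  using that by (intro lag_index_in_tuples) auto
 have I0: "lag_index k n \<in> tuples k n" using n by (intro lag_index_in_tuples) auto
 have eq: "(EU u. ?e u I) = (EU u. ?e u (lag_index k n))" if "I \<in> tuples k n" for I
  unfolding uniform_seq_def
  by (rule integral_equivariant[OF prob_space_uniform01 _ _ _ that I0])
    (auto intro!: equivariantI score_at_permute score_at_measurable[OF id_uniform01])
 show "integrable uniform_seq (uniform_stat k a n)"
  unfolding uniform_stat_def[abs_def]
  by (intro integrable_divide_zero L1_integrable_sum score_at_integrable l)
 have "(EU u. uniform_stat k a n u) = (\<Sum>t=k+1..n. LINT u|uniform_seq. ?e u (lag_index k t)) / (real n - real k)"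
  unfolding uniform_stat_def using score_at_integrable l
  by (subst integral_divide_zero, subst L1_integral_sum) auto
 also have "(\<Sum>t=k+1..n. LINT u|uniform_seq. ?e u (lag_index k t)) = (\<Sum>t=k+1..n. LINT u|uniform_seq. ?e u (lag_index k n))"
  by (rule sum.cong[OF refl], rule eq, rule l)
 also have "... / (real n - real k) = (EU u. ?e u (lag_index k n))"
  using n by (simp add: of_nat_diff)
 also have "... = (EU u. (\<Sum>I\<in>tuples k n. ?e u I)) / real (card (tuples k n))"
 proof -
  have "(EU u. ?e u (lag_index k n)) * real (card (tuples k n)) = (EU u. (\<Sum>I\<in>tuples k n. ?e u I))"
   unfolding uniform_seq_def
   by (rule integral_equivariant_sum[OF prob_space_uniform01 _ _ _ I0])
     (auto intro!: equivariantI score_at_permute simp del: One_nat_def simp flip: uniform_seq_def simp: score_at_integrable)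
  then show ?thesis using card_tuples_pos[of k n] n by (auto simp: field_simps card_gt_0_iff)
 qed
 also have "... = (EU u. tuple_avg k n (?e u))" by (simp add: tuple_avg_def)
 finally show "(EU u. uniform_stat k a n u) = (EU u. tuple_avg k n (?e u))" .
qed

lemma integral_U_stat:
 assumes g: "square_integrable k g" and n: "k + 1 <= n"
 shows "(EU u. U_stat k g n u) = (LINT w|cube k. g w)"
proof -
 have i: "integrable uniform_seq (\<lambda>u. g (tup k u I))" if "I \<in> tuples k n" for I
  using integrable_tup[OF that phi_facts(1)[OF g]] phi_facts(3)[OF g] by simp
 have "(EU u. U_stat k g n u) = (\<Sum>I\<in>tuples k n. LINT u|uniform_seq. g (tup k u I)) / real (card (tuples k n))"
  unfolding U_stat_def tuple_avg_def using i
  by (subst integral_divide_zero, subst L1_integral_sum) auto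
 also have "(\<Sum>I\<in>tuples k n. LINT u|uniform_seq. g (tup k u I)) = (\<Sum>I\<in>tuples k n. LINT w|cube k. g w)"
  by (rule sum.cong[OF refl], rule integral_tup[OF _ phi_facts(1)[OF g]])
 also have "... / real (card (tuples k n)) = (LINT w|cube k. g w)"
  using card_tuples_pos[of k n] n by (auto simp: card_gt_0_iff)
 finally show ?thesis .
qed

context
 fixes k :: nat and phi :: "(nat => real) => real" and a :: score
 assumes phi: "square_integrable k phi"
  and a: "a = exact_score k phi \<or> (a = appr_score k phi \<and> comb_of_monotone k phi)"
begin

text \<open>The two kinds of scores are told apart here: for exact scores the mean is 0 as soon as
  \<open>n > k\<close>, for approximate ones it has a rate.\<close>

lemma score_average_limit:
 "(\<lambda>n. sqrt (real n) * (EU u. \<bar>tuple_avg k n (score_at k a n (1/2) u) - U_stat k (step_kernel k phi) n u\<bar>)) \<longlonglongrightarrow> 0"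
 using a
proof
 assume e: "a = exact_score k phi"
 have "(EU u. \<bar>tuple_avg k n (score_at k a n (1/2) u) - U_stat k (step_kernel k phi) n u\<bar>) = 0" if n: "k + 1 <= n" for n
 proof -
  have "AE u in uniform_seq. \<bar>tuple_avg k n (score_at k a n (1/2) u) - U_stat k (step_kernel k phi) n u\<bar> = 0"
   using exact_score_average_seq[OF phi n] unfolding e by eventually_elim simp
  then show ?thesis by (rule integral_eq_zero_AE)
 qed
 then show ?thesis
  by (intro tendsto_eventually eventually_sequentiallyI[of "k + 1"]) simp
next
 assume "a = appr_score k phi \<and> comb_of_monotone k phi"
 then show ?thesis using appr_score_average[OF _ phi] by simp
qed

text \<open>\<open>?X\<close> is the fluctuation handled by the conditional Chebyshev inequality,
  \<open>?Y\<close> the centred difference of the tuple averages. The constant \<open>mu\<close>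
  appears because the step kernel has the same mean as \<open>phi\<close>.\<close>

lemma uniform_representation:
 assumes sg: "small_oP (\<lambda>n. uniform_seq) (\<lambda>n u. tuple_avg k n (\<lambda>I. (score_diff k a phi n u I)^2)) (\<lambda>n. 1)"
 shows "small_oP (\<lambda>n. uniform_seq)
  (\<lambda>n u. (uniform_stat k a n u - (EU v. uniform_stat k a n v))
   - (lag_avg k phi n u - U_stat k phi n u + U_stat k (step_kernel k phi) n u - mu k phi)) (\<lambda>n. 1 / sqrt (real n))"
proof -
 let ?h = "step_kernel k phi"
 note h = step_kernel_square_integrable[OF phi]
 let ?\<Delta> = "\<lambda>n u. tuple_avg k n (score_at k a n (1/2) u) - U_stat k ?h n u"
 let ?Y = "\<lambda>n u. ?\<Delta> n u - (EU v. ?\<Delta> n v)"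
 let ?X = "\<lambda>n u. uniform_stat k a n u - lag_avg k phi n u - tuple_avg k n (score_diff k a phi n u)"
 have \<Delta>i: "integrable uniform_seq (?\<Delta> n)" for n
  using score_avg_integrable U_stat_integrable[OF h] by (rule L1_integrable_diff)
 have Um: "U_stat k g n \<in> borel_measurable uniform_seq" if "square_integrable k g" for g n
  using U_stat_integrable[OF that] by (rule borel_measurable_integrable)
 have Sm: "uniform_stat k a n \<in> borel_measurable uniform_seq" "lag_avg k phi n \<in> borel_measurable uniform_seq" for n
  unfolding uniform_seq_def by (auto intro!: uniform_stat_measurable[OF phi] lag_avg_measurable[OF phi] phi_facts[OF phi])
 have Am: "(\<lambda>u. tuple_avg k n (score_at k a n (1/2) u)) \<in> borel_measurable uniform_seq" for n
  using score_avg_integrable by (rule borel_measurable_integrable)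
 have Xm: "?X n \<in> borel_measurable uniform_seq" for n
  unfolding score_diff_tuple_avg[OF phi] using Sm Um[OF phi] Am by (intro borel_measurable_diff)
 have Ym: "?Y n \<in> borel_measurable uniform_seq" for n
  using borel_measurable_integrable[OF \<Delta>i] by simp
 have X: "small_oP (\<lambda>n. uniform_seq) ?X (\<lambda>n. 1 / sqrt (real n))"
  by (rule score_diff_negligible[OF phi sg])
 have Y: "small_oP (\<lambda>n. uniform_seq) ?Y (\<lambda>n. 1 / sqrt (real n))"
 proof (rule small_oP_first_moment)
  show "integrable uniform_seq (?Y n)" for n using \<Delta>i by simp
  \<comment> \<open>Closeness in mean controls both the difference and its expectation, whence the
    factor 2.\<close>
  have "(\<lambda>n. 2 * (sqrt (real n) * (EU u. \<bar>?\<Delta> n u\<bar>))) \<longlonglongrightarrow> 2 * 0"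
   by (intro tendsto_mult tendsto_const score_average_limit)
  then have lim: "(\<lambda>n. 2 * (sqrt (real n) * (EU u. \<bar>?\<Delta> n u\<bar>))) \<longlonglongrightarrow> 0" by simp
  show "(\<lambda>n. (EU u. \<bar>?Y n u\<bar>) / (1 / sqrt (real n))) \<longlonglongrightarrow> 0"
  proof (rule tendsto_sandwich[OF _ _ tendsto_const lim])
   show "\<forall>\<^sub>F n in sequentially. (EU u. \<bar>?Y n u\<bar>) / (1 / sqrt (real n)) <= 2 * (sqrt (real n) * (EU u. \<bar>?\<Delta> n u\<bar>))"
   proof (rule always_eventually, rule allI)
    fix n
    have "(EU u. \<bar>?Y n u\<bar>) <= (EU u. \<bar>?\<Delta> n u\<bar> + \<bar>LINT v|uniform_seq. ?\<Delta> n v\<bar>)"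
     using \<Delta>i by (intro integral_mono) (auto intro!: integrable_abs abs_triangle_ineq4)
    also have "... = (EU u. \<bar>?\<Delta> n u\<bar>) + \<bar>LINT v|uniform_seq. ?\<Delta> n v\<bar>"
     using \<Delta>i by (subst L1_integral_add) (auto simp: US.prob_space)
    also have "... <= 2 * (EU u. \<bar>?\<Delta> n u\<bar>)"
     using integral_abs_bound[of uniform_seq "?\<Delta> n"] by simp
    finally have "sqrt (real n) * (EU u. \<bar>?Y n u\<bar>) <= sqrt (real n) * (2 * (EU u. \<bar>?\<Delta> n u\<bar>))"
     by (rule mult_left_mono) simp
    then show "(EU u. \<bar>?Y n u\<bar>) / (1 / sqrt (real n)) <= 2 * (sqrt (real n) * (EU u. \<bar>?\<Delta> n u\<bar>))"
     by (simp add: mult_ac)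
   qed
  qed (auto intro!: always_eventually)
 qed (auto intro: prob_space_uniform_seq)
 have XY: "small_oP (\<lambda>n. uniform_seq) (\<lambda>n u. ?X n u + ?Y n u) (\<lambda>n. 1 / sqrt (real n))"
  by (rule small_oP_add[OF prob_space_uniform_seq Xm Ym X Y])
 show ?thesis
 proof (rule small_oP_cong_AE[OF XY])
  show "(\<lambda>u. ?X n u + ?Y n u) \<in> borel_measurable uniform_seq" for n using Xm Ym by (rule borel_measurable_add)
  show "(\<lambda>u. (uniform_stat k a n u - (EU v. uniform_stat k a n v))
   - (lag_avg k phi n u - U_stat k phi n u + U_stat k ?h n u - mu k phi)) \<in> borel_measurable uniform_seq" for n
   using Sm Um[OF phi] Um[OF h] by (intro borel_measurable_diff borel_measurable_add borel_measurable_const)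
  show "\<forall>\<^sub>F n in sequentially. AE u in uniform_seq. ?X n u + ?Y n u = (uniform_stat k a n u - (EU v. uniform_stat k a n v))
   - (lag_avg k phi n u - U_stat k phi n u + U_stat k ?h n u - mu k phi)"
  proof (rule eventually_sequentiallyI[of "k + 1"], rule AE_I2)
   fix n u assume n: "k + 1 <= n"
   have "(EU v. ?\<Delta> n v) = (EU v. uniform_stat k a n v) - mu k phi"
    using score_avg_integrable U_stat_integrable[OF h] integral_uniform_stat(2)[OF n, of a] integral_U_stat[OF h n] integral_step_kernel[OF phi]
    by simp
   then show "?X n u + ?Y n u = (uniform_stat k a n u - (EU v. uniform_stat k a n v))
    - (lag_avg k phi n u - U_stat k phi n u + U_stat k ?h n u - mu k phi)"
    unfolding score_diff_tuple_avg[OF phi] by simp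
  qed
 qed
qed

end

section \<open>Transfer to the sample\<close>

context
 fixes f assumes f: "f \<in> \<F>0"
begin

abbreviation "cdf_sample n z \<equiv> compose {1..n} (cdf (law f)) z"

text \<open>The equality is asked for almost surely and eventually: conditional expectations are
  fixed up to null sets, and for \<open>n <= k\<close> there are no tuples.\<close>

lemma small_oP_transfer:
 assumes Y: "\<And>n. Y n \<in> borel_measurable (unif {1..n})"
  and loc: "\<And>n u. u \<in> space uniform_seq ==> Y n (restrict u {1..n}) = Y n u"
  and X: "\<And>n. X n \<in> borel_measurable (H0 f n)"
  and eq: "\<forall>\<^sub>F n in sequentially. AE z in H0 f n. X n z = Y n (cdf_sample n z)"
 shows "small_oP (H0 f) X r \<longleftrightarrow> small_oP (\<lambda>n. uniform_seq) Y r"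
proof -
 have Yc: "(\<lambda>z. Y n (cdf_sample n z)) \<in> borel_measurable (H0 f n)" for n
  by (rule measurable_compose[OF compose_cdf_measurable[OF f] Y])
 have Yu: "Y n \<in> borel_measurable uniform_seq" for n
 proof -
  have "(\<lambda>u. Y n (restrict u {1..n})) \<in> borel_measurable uniform_seq"
   by (rule measurable_compose[OF distr_restrict_uniform_seq(2) Y])
  then show ?thesis by (subst measurable_cong[where g = "\<lambda>u. Y n (restrict u {1..n})"]) (simp_all del: One_nat_def add: loc)
 qed
 have "small_oP (H0 f) X r \<longleftrightarrow> small_oP (H0 f) (\<lambda>n z. Y n (cdf_sample n z)) r"
 proof
  assume "small_oP (H0 f) X r"
  then show "small_oP (H0 f) (\<lambda>n z. Y n (cdf_sample n z)) r"
   by (rule small_oP_cong_AE) (use X Yc eq in auto)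
 next
  assume "small_oP (H0 f) (\<lambda>n z. Y n (cdf_sample n z)) r"
  then show "small_oP (H0 f) X r"
   by (rule small_oP_cong_AE) (use X Yc eq in \<open>auto elim!: eventually_mono\<close>)
 qed
 also have "... \<longleftrightarrow> small_oP (\<lambda>n. uniform_seq) Y r"
 proof -
  have "measure (H0 f n) {z \<in> space (H0 f n). \<bar>Y n (cdf_sample n z)\<bar> > c} = measure uniform_seq {u \<in> space uniform_seq. \<bar>Y n u\<bar> > c}" for n c
  proof -
   have S: "{x::real. \<bar>x\<bar> > c} \<in> sets borel" by measurable
   have "measure (H0 f n) {z \<in> space (H0 f n). \<bar>Y n (cdf_sample n z)\<bar> > c}
    = measure (distr (H0 f n) borel (\<lambda>z. Y n (cdf_sample n z))) {x. \<bar>x\<bar> > c}"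
    by (subst measure_distr[OF Yc S]) (auto intro!: arg_cong2[of _ _ _ _ measure])
   also have "... = measure (distr uniform_seq borel (Y n)) {x. \<bar>x\<bar> > c}"
    using distr_transfer[OF f Y loc] by simp
   also have "... = measure uniform_seq {u \<in> space uniform_seq. \<bar>Y n u\<bar> > c}"
    by (subst measure_distr[OF Yu S]) (auto intro!: arg_cong2[of _ _ _ _ measure])
   finally show ?thesis .
  qed
  then show ?thesis unfolding small_oP_def by simp
 qed
 finally show ?thesis .
qed

lemma cdf_sample_apply: "i \<in> {1..n} ==> cdf_sample n z i = cdf (law f) (z i)"
 by (simp add: compose_def)

lemma n_below_sample: "n_below (1/2) n (cdf_sample n z) = N_minus n z"
proof -
 have "n_below (1/2) n (cdf_sample n z) = n_below (cdf (law f) 0) n (\<lambda>i. cdf (law f) (z i))"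
  unfolding cdf_law_0[OF f] by (rule n_below_cong) (rule cdf_sample_apply)
 then show ?thesis by (simp add: n_below_strict_mono[OF cdf_law_strict_mono[OF f]])
qed

lemma n_above_sample: "n_above (1/2) n (cdf_sample n z) = N_plus n z"
proof -
 have "n_above (1/2) n (cdf_sample n z) = n_above (cdf (law f) 0) n (\<lambda>i. cdf (law f) (z i))"
  unfolding cdf_law_0[OF f] by (rule n_above_cong) (rule cdf_sample_apply)
 then show ?thesis by (simp add: n_above_strict_mono[OF cdf_law_strict_mono[OF f]])
qed

lemma tup_sample: "I \<in> tuples k n ==> tup k (cdf_sample n z) I = tup k (\<lambda>i. cdf (law f) (z i)) I"
 by (intro tup_cong cdf_sample_apply tuplesD(2))

lemma score_at_sample:
 assumes I: "I \<in> tuples k n"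
 shows "score_at k a n (1/2) (cdf_sample n z) I = a n (N_minus n z) (N_plus n z) (tup k (rank n z) I)"
proof -
 have "tup k (rank n (cdf_sample n z)) I = tup k (rank n z) I"
 proof (rule tup_cong)
  fix j assume "j <= k"
  then have j: "I j \<in> {1..n}" by (rule tuplesD(2)[OF I])
  have "rank n (cdf_sample n z) (I j) = rank n (\<lambda>i. cdf (law f) (z i)) (I j)"
   by (rule rank_cong[OF cdf_sample_apply j])
  then show "rank n (cdf_sample n z) (I j) = rank n z (I j)"
   by (simp add: rank_strict_mono[OF cdf_law_strict_mono[OF f]])
 qed
 then show ?thesis unfolding score_at_def n_below_sample n_above_sample by simp
qed

lemma S_stat_sample: "S_stat k a n z = uniform_stat k a n (cdf_sample n z)"
 unfolding S_stat_def uniform_stat_def lags_eq_tup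
 by (intro arg_cong2[of _ _ _ _ "(/)"] sum.cong refl score_at_sample[symmetric] lag_index_in_tuples) auto

lemma T_stat_sample: "T_stat k phi f n z = lag_avg k phi n (cdf_sample n z)"
 unfolding T_stat_def lag_avg_def lags_eq_tup
 by (intro arg_cong2[of _ _ _ _ "(/)"] sum.cong refl arg_cong[of _ _ phi] tup_sample[symmetric] lag_index_in_tuples) auto

lemma integrable_transfer:
 assumes Y: "Y \<in> borel_measurable (unif {1..n})"
  and loc: "\<And>u. u \<in> space uniform_seq ==> Y (restrict u {1..n}) = Y u"
 shows "integrable (H0 f n) (\<lambda>z. Y (cdf_sample n z)) \<longleftrightarrow> integrable uniform_seq Y"
  "(LINT z|H0 f n. Y (cdf_sample n z)) = (EU u. (Y u :: real))"
proof -
 have Yc: "(\<lambda>z. Y (cdf_sample n z)) \<in> borel_measurable (H0 f n)"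
  by (rule measurable_compose[OF compose_cdf_measurable[OF f] Y])
 have Yu: "Y \<in> borel_measurable uniform_seq"
 proof -
  have "(\<lambda>u. Y (restrict u {1..n})) \<in> borel_measurable uniform_seq"
   by (rule measurable_compose[OF distr_restrict_uniform_seq(2) Y])
  then show ?thesis by (subst measurable_cong[where g = "\<lambda>u. Y (restrict u {1..n})"]) (simp_all del: One_nat_def add: loc)
 qed
 note d = distr_transfer[OF f Y loc]
 have id: "(\<lambda>x::real. x) \<in> borel_measurable borel" by simp
 show "integrable (H0 f n) (\<lambda>z. Y (cdf_sample n z)) \<longleftrightarrow> integrable uniform_seq Y"
  using integrable_distr_eq[OF Yc id] integrable_distr_eq[OF Yu id] d by simp
 show "(LINT z|H0 f n. Y (cdf_sample n z)) = (EU u. (Y u :: real))"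
  using integral_distr[OF Yc id] integral_distr[OF Yu id] d by simp
qed

lemma cdf_sample_permute:
 assumes "per permutes {1..n}"
 shows "cdf_sample n (z \<circ> per) = cdf_sample n z \<circ> per"
proof
 fix i
 show "cdf_sample n (z \<circ> per) i = (cdf_sample n z \<circ> per) i"
  using permutes_in_image[OF assms, of i] by (simp add: compose_def)
qed

lemma cond_order_sample:
 assumes e: "\<And>per u I. per permutes {1..n} ==> I \<in> tuples k n ==> e (u \<circ> per) I = e u (tup k per I)"
  and m: "\<And>I. I \<in> tuples k n ==> (\<lambda>u. e u I) \<in> borel_measurable (unif {1..n})"
  and loc: "\<And>u I. I \<in> tuples k n ==> u \<in> space uniform_seq ==> e (restrict u {1..n}) I = e u I"
  and i: "\<And>I. I \<in> tuples k n ==> integrable uniform_seq (\<lambda>u. e u I)"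
  and Q: "finite A" "A \<noteq> {}" "\<And>t. t \<in> A ==> q t \<in> tuples k n"
  and X: "\<And>z. X z = (\<Sum>t\<in>A. e (cdf_sample n z) (q t)) / real (card A)"
 shows "AE z in H0 f n. cond_order f n X z = tuple_avg k n (e (cdf_sample n z))"
proof -
 have X': "X = (\<lambda>z. (\<Sum>t\<in>A. e (cdf_sample n z) (q t)) / real (card A))" using X by auto
 show ?thesis unfolding X'
 proof (rule cond_order_tuples[OF prob_space_law[OF f] _ _ Q])
  show "equivariant (H0 f n) k n (\<lambda>z. e (cdf_sample n z))"
   by (rule equivariantI) (simp only: cdf_sample_permute e)
  show "integrable (H0 f n) (\<lambda>z. e (cdf_sample n z) I)" if "I \<in> tuples k n" for I
   using integrable_transfer(1)[OF m[OF that] loc[OF that]] i[OF that] by simp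
 qed
qed

text \<open>The score condition concerns one squared error, at a single tuple; conditioning on the
  order statistics turns it into the mean over all tuples.\<close>

lemma score_generating_uniform:
 assumes phi: "square_integrable k phi" and sg: "score_generating k a phi"
 shows "small_oP (\<lambda>n. uniform_seq) (\<lambda>n u. tuple_avg k n (\<lambda>I. (score_diff k a phi n u I)^2)) (\<lambda>n. 1)"
proof -
 let ?X = "\<lambda>n z. (a n (N_minus n z) (N_plus n z) (lags k (rank n z) (k + 1)) - phi (lags k (\<lambda>i. cdf (law f) (z i)) (k + 1)))^2"
 let ?e = "\<lambda>n u I. (score_diff k a phi n u I)^2"
 have sgX: "small_oP (H0 f) (\<lambda>n. cond_order f n (?X n)) (\<lambda>n. 1)"
  using sg f unfolding score_generating_def by blast
 have loc: "?e n (restrict u {1..n}) I = ?e n u I" if "I \<in> tuples k n" for n u I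
 proof -
  have "score_diff k a phi n (restrict u {1..n}) I = score_diff k a phi n u I"
   by (rule score_diff_cong[OF phi _ that]) simp
  then show ?thesis by simp
 qed
 have m: "(\<lambda>u. ?e n u I) \<in> borel_measurable (unif {1..n})" if "I \<in> tuples k n" for n I
  by (rule borel_measurable_power[OF score_diff_measurable[OF phi subset_refl that]])
 show ?thesis
 proof (rule small_oP_transfer[THEN iffD1, OF _ _ _ _ sgX])
  show "(\<lambda>u. tuple_avg k n (?e n u)) \<in> borel_measurable (unif {1..n})" for n
   unfolding tuple_avg_def using m by (intro borel_measurable_divide borel_measurable_sum borel_measurable_const)
  show "tuple_avg k n (?e n (restrict u {1..n})) = tuple_avg k n (?e n u)" for n u
   unfolding tuple_avg_def using loc by (intro arg_cong2[of _ _ _ _ "(/)"] sum.cong) auto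
  show "cond_order f n (?X n) \<in> borel_measurable (H0 f n)" for n
   unfolding cond_order_def by (rule borel_measurable_cond_exp2)
  show "\<forall>\<^sub>F n in sequentially. AE z in H0 f n. cond_order f n (?X n) z = tuple_avg k n (?e n (cdf_sample n z))"
  proof (rule eventually_sequentiallyI[of "k + 1"])
   fix n assume n: "k + 1 <= n"
   have l: "lag_index k (k + 1) \<in> tuples k n" using n by (intro lag_index_in_tuples) auto
   show "AE z in H0 f n. cond_order f n (?X n) z = tuple_avg k n (?e n (cdf_sample n z))"
   proof (rule cond_order_sample[where A = "{0::nat}" and q = "\<lambda>_. lag_index k (k + 1)"])
    show "?e n (u \<circ> per) I = ?e n u (tup k per I)" if "per permutes {1..n}" for per u I
     using that by (simp add: score_diff_def score_at_permute tup_comp)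
    show "?X n z = (\<Sum>t\<in>{0::nat}. ?e n (cdf_sample n z) (lag_index k (k + 1))) / real (card {0::nat})" for z
     unfolding score_diff_def score_at_sample[OF l] tup_sample[OF l] lags_eq_tup by simp
    show "?e n (restrict u {1..n}) I = ?e n u I" if "I \<in> tuples k n" for u I by (rule loc[OF that])
   qed (use m score_diff_square_integrable[OF phi] l in auto)
  qed
 qed
qed

lemma cond_order_T_stat:
 assumes phi: "square_integrable k phi" and n: "k + 1 <= n"
 shows "AE z in H0 f n. cond_order f n (T_stat k phi f n) z = U_stat k phi n (cdf_sample n z)"
proof -
 let ?e = "\<lambda>u I. phi (tup k u I)"
 have "AE z in H0 f n. cond_order f n (T_stat k phi f n) z = tuple_avg k n (?e (cdf_sample n z))"
 proof (rule cond_order_sample[where A = "{k+1..n}" and q = "lag_index k"])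
  show "?e (restrict u {1..n}) I = ?e u I" if "I \<in> tuples k n" for u I
  proof -
   have "tup k (restrict u {1..n}) I = tup k u I"
    by (rule tup_cong) (use tuplesD(2)[OF that] in auto)
   then show ?thesis by simp
  qed
  show "?e (u \<circ> per) I = ?e u (tup k per I)" for u per I by (simp only: tup_comp)
  show "integrable uniform_seq (\<lambda>u. ?e u I)" if "I \<in> tuples k n" for I
   using integrable_tup[OF that phi_facts(1)[OF phi]] phi_facts(3)[OF phi] by simp
  show "T_stat k phi f n z = (\<Sum>t\<in>{k+1..n}. ?e (cdf_sample n z) (lag_index k t)) / real (card {k+1..n})" for z
   unfolding T_stat_sample lag_avg_def using n by (simp add: of_nat_diff)
 qed (use n phi_tup_measurable[OF phi_facts(1)[OF phi]] lag_index_in_tuples in auto)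
 then show ?thesis by (simp add: U_stat_def)
qed

theorem representation:
 assumes phi: "square_integrable k phi"
  and a: "a = exact_score k phi \<or> (a = appr_score k phi \<and> comb_of_monotone k phi)"
  and sg: "score_generating k a phi"
 shows "small_oP (H0 f)
  (\<lambda>n z. (S_stat k a n z - (LINT y|H0 f n. S_stat k a n y))
    - (T_stat k phi f n z - cond_order f n (T_stat k phi f n) z + sign_term k phi n z - mu k phi))
  (\<lambda>n. 1 / sqrt (real n))"
proof -
 let ?h = "step_kernel k phi"
 note h = step_kernel_square_integrable[OF phi]
 let ?c = "\<lambda>n. LINT v|uniform_seq. uniform_stat k a n v"
 let ?Y = "\<lambda>n u. (uniform_stat k a n u - ?c n) - (lag_avg k phi n u - U_stat k phi n u + U_stat k ?h n u - mu k phi)"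
 have Sm: "uniform_stat k a n \<in> borel_measurable (unif {1..n})"
  "lag_avg k phi n \<in> borel_measurable (unif {1..n})"
  "U_stat k phi n \<in> borel_measurable (unif {1..n})"
  "U_stat k ?h n \<in> borel_measurable (unif {1..n})" for n
  by (auto intro!: uniform_stat_measurable[OF phi] lag_avg_measurable[OF phi] U_stat_measurable[OF phi] phi_facts[OF phi] phi_facts[OF h])
 have loc: "uniform_stat k a n (restrict u {1..n}) = uniform_stat k a n u" "lag_avg k phi n (restrict u {1..n}) = lag_avg k phi n u"
  "U_stat k g n (restrict u {1..n}) = U_stat k g n u" for n u g
  by (rule restrict_tuple_cong; simp)+
 have Sc: "S_stat k a n = (\<lambda>z. uniform_stat k a n (cdf_sample n z))" "T_stat k phi f n = (\<lambda>z. lag_avg k phi n (cdf_sample n z))" for n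
  by (auto simp: S_stat_sample T_stat_sample)
 have comp: "(\<lambda>z. Y (cdf_sample n z)) \<in> borel_measurable (H0 f n)"
  if "Y \<in> borel_measurable (unif {1..n})" for Y :: "_ => real" and n
  by (rule measurable_compose[OF compose_cdf_measurable[OF f] that])
 have Ec: "(LINT y|H0 f n. S_stat k a n y) = ?c n" for n
  unfolding Sc by (rule integrable_transfer(2)[OF Sm(1) loc(1)])
 have sv: "sign_term k phi n = (\<lambda>z. sign_value k phi n (n_below (1/2) n (cdf_sample n z)) (n_above (1/2) n (cdf_sample n z)))" for n
  unfolding n_below_sample n_above_sample by (auto simp: sign_term_eq)
 have svm: "(\<lambda>u. sign_value k phi n (n_below (1/2) n u) (n_above (1/2) n u)) \<in> borel_measurable (unif {1..n})" for n
 proof (rule measurable_compose_countable[OF _ n_below_measurable[OF id_uniform01 subset_refl]])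
  show "(\<lambda>u. sign_value k phi n \<eta> (n_above (1/2) n u)) \<in> borel_measurable (unif {1..n})" for \<eta>
   by (rule measurable_compose[OF n_above_measurable[OF id_uniform01 subset_refl]]) simp
 qed
 show ?thesis
 proof (rule small_oP_transfer[THEN iffD2, OF _ _ _ _ uniform_representation[OF phi a score_generating_uniform[OF phi sg]]])
  show "?Y n \<in> borel_measurable (unif {1..n})" for n
   using Sm[of n] by (intro borel_measurable_diff borel_measurable_add borel_measurable_const)
  show "?Y n (restrict u {1..n}) = ?Y n u" for n u unfolding loc ..
  show "(\<lambda>z. (S_stat k a n z - (LINT y|H0 f n. S_stat k a n y))
    - (T_stat k phi f n z - cond_order f n (T_stat k phi f n) z + sign_term k phi n z - mu k phi)) \<in> borel_measurable (H0 f n)" for n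
  proof -
   have "cond_order f n (T_stat k phi f n) \<in> borel_measurable (H0 f n)"
    unfolding cond_order_def by (rule borel_measurable_cond_exp2)
   moreover have "S_stat k a n \<in> borel_measurable (H0 f n)" "T_stat k phi f n \<in> borel_measurable (H0 f n)"
    unfolding Sc using comp[OF Sm(1)] comp[OF Sm(2)] by auto
   moreover have "sign_term k phi n \<in> borel_measurable (H0 f n)" unfolding sv by (rule comp[OF svm])
   ultimately show ?thesis by (intro borel_measurable_diff borel_measurable_add borel_measurable_const)
  qed
  show "\<forall>\<^sub>F n in sequentially. AE z in H0 f n. (S_stat k a n z - (LINT y|H0 f n. S_stat k a n y))
    - (T_stat k phi f n z - cond_order f n (T_stat k phi f n) z + sign_term k phi n z - mu k phi) = ?Y n (cdf_sample n z)"
  proof (rule eventually_sequentiallyI[of "k + 1"])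
   fix n assume n: "k + 1 <= n"
   \<comment> \<open>The sign term agrees with the U-statistic of the step kernel when no
     transformed observation equals 1/2.\<close>
   have "AE u in distr (H0 f n) (unif {1..n}) (compose {1..n} (cdf (law f))). \<forall>i\<in>{1..n}. u i \<noteq> 1/2"
    unfolding distr_H0[OF f] using AE_generic[of n "{1..n}"] by (auto elim: eventually_mono)
   from AE_distrD[OF compose_cdf_measurable[OF f] this] cond_order_T_stat[OF phi n]
   show "AE z in H0 f n. (S_stat k a n z - (LINT y|H0 f n. S_stat k a n y))
    - (T_stat k phi f n z - cond_order f n (T_stat k phi f n) z + sign_term k phi n z - mu k phi) = ?Y n (cdf_sample n z)"
   proof eventually_elim
    case (elim z)
    show ?case unfolding Ec elim(2) unfolding Sc sv U_stat_step_kernel[OF phi_facts(1)[OF phi] elim(1)] ..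
   qed
  qed
 qed
qed

end

section \<open>Projection on sums of functions of one variable\<close>

text \<open>The conditional mean used in Hoeffding's first-order projection onto coordinate
  \<open>l\<close>. Where the section is not integrable it is 0 by convention.\<close>

definition proj :: "nat => nat => ((nat => real) => real) => real => real" where
 "proj k l g x = (LINT w|cube k. g (w(l := x)))"

lemma mix_coordinate:
 assumes "u \<in> space (cube k)" "v \<in> space (cube k)" "l <= k"
 shows "mix ({..k} - {l}) v u = v(l := u l)"
 using assms by (auto simp: mix_def space_cube PiE_iff extensional_def fun_eq_iff)

lemma integral_mix_coordinate:
 assumes "u \<in> space (cube k)" "l <= k"
 shows "(LINT v|cube k. g (mix ({..k} - {l}) v u)) = proj k l g (u l)"
 unfolding proj_def using mix_coordinate[OF assms(1) _ assms(2)]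
 by (intro L1_integral_cong) auto

lemma proj_measurable:
 assumes g: "g \<in> borel_measurable (cube k)" and l: "l <= k"
 shows "proj k l g \<in> borel_measurable uniform01"
proof -
 have "(\<lambda>p. g ((snd p)(l := fst p))) \<in> borel_measurable (uniform01 \<Otimes>\<^sub>M cube k)"
  using measurable_compose[OF measurable_pair_swap' measurable_compose[OF update_measurable_pair[OF l] g]]
  by (simp add: split_beta')
 then show ?thesis unfolding proj_def[abs_def]
  by (intro CU.borel_measurable_lebesgue_integral) (simp add: split_beta')
qed

lemma cube_coordinate_integral:
 assumes "l <= k" "g \<in> borel_measurable uniform01"
 shows "(LINT w|cube k. (g (w l) :: real)) = (LINT x|uniform01. g x)"
  "integrable (cube k) (\<lambda>w. (g (w l) :: real)) \<longleftrightarrow> integrable uniform01 g"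
 using component_integral[of l "{..k}" g] assms by (simp_all add: cube_def)

lemma square_integrable_coordinate:
 assumes "l <= k" "g \<in> borel_measurable uniform01" "integrable uniform01 (\<lambda>x. (g x)^2)"
 shows "square_integrable k (\<lambda>w. g (w l))"
 unfolding square_integrable_def
 using cube_coordinate_integral(2)[OF assms(1) borel_measurable_power[OF assms(2)]] assms(3)
  measurable_compose[OF cube_component[OF assms(1)] assms(2)] by simp

text \<open>Square integrability is the conditional Jensen inequality, read off from the nonnegative
  variance of the section.\<close>

lemma proj_facts:
 assumes g: "square_integrable k g" and l: "l <= k"
 shows "integrable uniform01 (proj k l g)" "integrable uniform01 (\<lambda>x. (proj k l g x)^2)"
  "(LINT x|uniform01. proj k l g x) = (LINT w|cube k. g w)"
proof -
 note gf = phi_facts[OF g]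
 note m = proj_measurable[OF gf(1) l]
 let ?K = "{..k} - {l}"
 note mix1 = integral_mix[of "{..k}" "\<lambda>_. uniform01" g ?K, folded cube_def, OF prob_space_uniform01 gf(3)]
 note mix2 = integral_mix[of "{..k}" "\<lambda>_. uniform01" "\<lambda>w. (g w)^2" ?K, folded cube_def, OF prob_space_uniform01 gf(2)]
 have "integrable (cube k) (\<lambda>w. proj k l g (w l))"
  using mix1(1) by (subst L1_integrable_cong[OF refl integral_mix_coordinate[OF _ l, symmetric]])
 then show 1: "integrable uniform01 (proj k l g)" using cube_coordinate_integral(2)[OF l m] by simp
 have "(LINT w|cube k. proj k l g (w l)) = (LINT w|cube k. g w)"
  using mix1(2) by (subst L1_integral_cong[OF refl integral_mix_coordinate[OF _ l, symmetric]])
 then show "(LINT x|uniform01. proj k l g x) = (LINT w|cube k. g w)" using cube_coordinate_integral(1)[OF l m] by simp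
 have "integrable (cube k) (\<lambda>w. (proj k l g (w l))^2)"
 proof (rule L1_integrable_bound[OF mix2(1)])
  show "(\<lambda>w. (proj k l g (w l))^2) \<in> borel_measurable (cube k)"
   by (intro borel_measurable_power measurable_compose[OF cube_component[OF l] m])
  show "AE u in cube k. norm ((proj k l g (u l))^2) <= norm (LINT v|cube k. (g (mix ?K v u))^2)"
   using mix2(3) mix1(3) AE_space
  proof eventually_elim
   case (elim u)
   have "0 <= CU.variance k (\<lambda>v. g (mix ?K v u))" by simp
   then have "(LINT v|cube k. g (mix ?K v u))^2 <= (LINT v|cube k. (g (mix ?K v u))^2)"
    using CU.variance_eq[OF elim(2,1)] by simp
   then show ?case unfolding integral_mix_coordinate[OF elim(3) l] by simp
  qed
 qed
 then show "integrable uniform01 (\<lambda>x. (proj k l g x)^2)"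
  using cube_coordinate_integral(2)[OF l borel_measurable_power[OF m]] by simp
qed

lemma U_stat_square_integrable:
 assumes "square_integrable k g"
 shows "integrable uniform_seq (\<lambda>u. (U_stat k g n u)^2)"
 unfolding U_stat_def tuple_avg_def power_divide
 using integrable_tup[of _ k n "\<lambda>w. (g w)^2"] phi_facts[OF assms]
 by (intro integrable_divide_zero integrable_sum_square(1) phi_tup_measurable') auto

text \<open>The Hoeffding remainder of a kernel of mean 0, which is why no constant is added
  back.\<close>

definition degenerate_part :: "nat => ((nat => real) => real) => (nat => real) => real" where
 "degenerate_part k g w = g w - (\<Sum>l\<le>k. proj k l g (w l))"

context
 fixes k :: nat and g :: "(nat => real) => real"
 assumes g: "square_integrable k g" and g0: "(LINT w|cube k. g w) = 0"
begin

lemma degenerate_square_integrable: "square_integrable k (degenerate_part k g)"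
proof -
 have "(\<lambda>w. proj k l g (w l)) \<in> borel_measurable (cube k)" "integrable (cube k) (\<lambda>w. (proj k l g (w l))^2)" if "l \<in> {..k}" for l
  using that square_integrable_coordinate[of l k "proj k l g"] proj_measurable[OF phi_facts(1)[OF g]] proj_facts(2)[OF g]
  by (auto simp: square_integrable_def)
 then have "square_integrable k (\<lambda>w. \<Sum>l\<le>k. proj k l g (w l))"
  unfolding square_integrable_def by (intro conjI integrable_sum_square(1) borel_measurable_sum)
 then show ?thesis unfolding degenerate_part_def[abs_def] by (rule square_integrable_diff[OF g])
qed

text \<open>If \<open>w \<mapsto> g (w(a := x))\<close> is not integrable, both sides vanish by convention.\<close>

lemma degenerate_conditional:
 assumes a: "a <= k" and x: "x \<in> {0<..<1}"
 shows "(LINT w|cube k. degenerate_part k g (w(a := x))) = 0"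
proof -
 have pi: "integrable (cube k) (\<lambda>w. proj k l g ((w(a := x)) l))" if "l <= k" for l
  using cube_coordinate_integral(2)[OF that proj_measurable[OF phi_facts(1)[OF g] that]] proj_facts(1)[OF g that]
  by (cases "l = a") simp_all
 have p: "(LINT w|cube k. proj k l g ((w(a := x)) l)) = (if l = a then proj k a g x else 0)" if "l <= k" for l
  using cube_coordinate_integral(1)[OF that proj_measurable[OF phi_facts(1)[OF g] that]] proj_facts(3)[OF g that] g0
  by (simp add: CU.prob_space)
 have Si: "integrable (cube k) (\<lambda>w. \<Sum>l\<le>k. proj k l g ((w(a := x)) l))"
  by (intro L1_integrable_sum pi) simp
 have S: "(LINT w|cube k. (\<Sum>l\<le>k. proj k l g ((w(a := x)) l))) = proj k a g x"
  using pi p a by (subst L1_integral_sum) auto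
 show ?thesis
 proof (cases "integrable (cube k) (\<lambda>w. g (w(a := x)))")
  case True
  have "(LINT w|cube k. degenerate_part k g (w(a := x))) = (LINT w|cube k. g (w(a := x))) - proj k a g x"
   unfolding degenerate_part_def by (subst L1_integral_diff[OF True Si]) (simp only: S)
  then show ?thesis by (simp add: proj_def)
 next
  case False
  then have "\<not> integrable (cube k) (\<lambda>w. degenerate_part k g (w(a := x)))"
   using L1_integrable_add[OF _ Si, of "\<lambda>w. degenerate_part k g (w(a := x))"]
   by (auto simp: degenerate_part_def)
  then show ?thesis by (rule not_integrable_integral_eq)
 qed
qed

text \<open>If \<open>J\<close> meets \<open>I\<close> at most at position \<open>a\<close>,
  resample the other positions of \<open>I\<close>: the factor of \<open>J\<close> is frozen, and
  the factor of \<open>I\<close> has conditional mean 0 given its coordinate at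
  \<open>a\<close>.\<close>

lemma degenerate_orthogonal:
 assumes I: "I \<in> tuples k n" and J: "J \<in> tuples k n" and a: "a <= k" and d: "I ` ({..k} - {a}) \<inter> J ` {..k} = {}"
 shows "(EU u. degenerate_part k g (tup k u I) * degenerate_part k g (tup k u J)) = 0"
proof -
 let ?d = "degenerate_part k g" and ?K = "I ` ({..k} - {a})"
 note df = phi_facts[OF degenerate_square_integrable]
 note P = prob_space_uniform01
 have i: "integrable uniform_seq (\<lambda>u. ?d (tup k u I) * ?d (tup k u J))"
  using integrable_tup[OF I, of "\<lambda>w. (?d w)^2"] integrable_tup[OF J, of "\<lambda>w. (?d w)^2"] df
  by (auto intro!: integrable_product_of_squares phi_tup_measurable'[OF df(1) I] phi_tup_measurable'[OF df(1) J])
 have "(EU u. ?d (tup k u I) * ?d (tup k u J))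
  = (EU u. LINT v|uniform_seq. ?d (tup k (mix ?K v u) I) * ?d (tup k (mix ?K v u) J))"
  using integral_mix(2)[of "{1..}" "\<lambda>_. uniform01" _ ?K, folded uniform_seq_def, OF P i] by simp
 also have "... = (EU u. 0)"
 proof (rule L1_integral_cong[OF refl])
  fix u assume u: "u \<in> space uniform_seq"
  have x: "u (I a) \<in> {0<..<1}" using u tuplesD(2)[OF I a] by (auto simp: space_uniform_seq PiE_iff)
  have tJ: "tup k (mix ?K v u) J = tup k u J" for v
   using d by (intro tup_cong) (auto simp: mix_def)
  have aK: "I a \<notin> ?K"
  proof
   assume "I a \<in> ?K"
   then obtain j where "j <= k" "j \<noteq> a" "I a = I j" by auto
   then show False using inj_onD[OF tuplesD(1)[OF I], of a j] a by auto
  qed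
  have tI: "tup k (mix ?K v u) I = (tup k v I)(a := u (I a))" for v
   using aK a by (auto simp: mix_def tup_def fun_eq_iff)
  have "(\<lambda>w. ?d (w(a := u (I a)))) \<in> borel_measurable (cube k)"
   by (rule measurable_compose[OF update_measurable(2)[OF a x] df(1)])
  from integral_tup[OF I this] degenerate_conditional[OF a x]
  show "(EU v. ?d (tup k (mix ?K v u) I) * ?d (tup k (mix ?K v u) J)) = 0"
   unfolding tI tJ by simp
 qed
 finally show ?thesis by simp
qed

text \<open>If no single position of \<open>I\<close> accounts for the overlap, two indices are
  shared. There are at most \<open>(k+1)^4\<close> choices of positions, each with a proportion
  \<open>1/(n(n-1))\<close> of all tuples.\<close>

lemma card_tuples_meeting_twice:
 assumes I: "I \<in> tuples k n" and k: "k >= 1"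
 shows "real (card {J \<in> tuples k n. \<forall>a\<le>k. I ` ({..k} - {a}) \<inter> J ` {..k} \<noteq> {}}) * (real n * (real n - 1))
  <= (real k + 1) ^ 4 * real (card (tuples k n))"
proof -
 let ?B = "{J \<in> tuples k n. \<forall>a\<le>k. I ` ({..k} - {a}) \<inter> J ` {..k} \<noteq> {}}"
 let ?S = "\<lambda>(p, q, b, c). {J \<in> tuples k n. J b = I p \<and> J c = I q}"
 let ?Q = "{(p, q, b, c). p <= k \<and> q <= k \<and> b <= k \<and> c <= k \<and> p \<noteq> q \<and> b \<noteq> c}"
 have QA: "?Q \<subseteq> {..k} \<times> {..k} \<times> {..k} \<times> {..k}" by auto
 then have fQ: "finite ?Q" by (rule finite_subset) simp
 have cQ: "card ?Q <= (k + 1) ^ 4"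
 proof -
  have "card ?Q <= card ({..k} \<times> {..k} \<times> {..k} \<times> {..k})" by (rule card_mono[OF _ QA]) simp
  also have "... = (k + 1) ^ 4"
   by (simp only: card_cartesian_product card_atMost Suc_eq_plus1 power4_eq_xxxx mult.assoc)
  finally show ?thesis .
 qed
 have "?B \<subseteq> (\<Union>s\<in>?Q. ?S s)"
 proof
  fix J assume J: "J \<in> ?B"
  have h: "\<exists>p\<le>k. p \<noteq> a \<and> (\<exists>b\<le>k. J b = I p)" if "a <= k" for a
  proof -
   have "I ` ({..k} - {a}) \<inter> J ` {..k} \<noteq> {}" using J that by blast
   then obtain p b where "p \<in> {..k} - {a}" "b \<in> {..k}" "I p = J b" by fastforce
   then show ?thesis by (intro exI[of _ p]) (auto intro!: exI[of _ b])
  qed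
  \<comment> \<open>Discarding any one position leaves an overlap elsewhere: discarding position 0
    yields some \<open>p\<close>, and discarding \<open>p\<close> yields a different
    \<open>q\<close>.\<close>
  obtain p b where p: "p <= k" "b <= k" "J b = I p" using h[of 0] by auto
  obtain q c where q: "q <= k" "q \<noteq> p" "c <= k" "J c = I q" using h[OF p(1)] by auto
  have "I p \<noteq> I q" using inj_onD[OF tuplesD(1)[OF I], of p q] p q by auto
  then have "b \<noteq> c" using p q by auto
  with J p q show "J \<in> (\<Union>s\<in>?Q. ?S s)" by (intro UN_I[of "(p, q, b, c)"]) auto
 qed
 moreover have fS: "finite (\<Union>s\<in>?Q. ?S s)"
  by (rule finite_subset[OF _ finite_tuples[of k n]]) auto
 ultimately have "card ?B <= card (\<Union>s\<in>?Q. ?S s)" by (intro card_mono)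
 also have "... <= (\<Sum>s\<in>?Q. card (?S s))" by (rule card_UN_le[OF fQ])
 finally have c: "real (card ?B) <= (\<Sum>s\<in>?Q. real (card (?S s)))" by (simp flip: of_nat_sum)
 have n1: "real n >= 1" using tuplesD(2)[OF I, of 0] by auto
 have "real (card ?B) * (real n * (real n - 1)) <= (\<Sum>s\<in>?Q. real (card (?S s))) * (real n * (real n - 1))"
  using c n1 by (intro mult_right_mono) auto
 also have "... = (\<Sum>s\<in>?Q. real (card (tuples k n)))"
  unfolding sum_distrib_right
 proof (rule sum.cong[OF refl])
  fix s assume "s \<in> ?Q"
  then obtain p q b c where s: "s = (p, q, b, c)" "p <= k" "q <= k" "b <= k" "c <= k" "p \<noteq> q" "b \<noteq> c" by auto
  have "I p \<noteq> I q" using inj_onD[OF tuplesD(1)[OF I], of p q] s by auto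
  from card_tuples_fix2[OF s(4,5,7) tuplesD(2)[OF I s(2)] tuplesD(2)[OF I s(3)] this]
  show "real (card (?S s)) * (real n * (real n - 1)) = real (card (tuples k n))" by (simp add: s(1))
 qed
 also have "... = real (card ?Q) * real (card (tuples k n))" by simp
 also have "... <= (real k + 1) ^ 4 * real (card (tuples k n))"
 proof (rule mult_right_mono)
  have "real (card ?Q) <= real ((k + 1) ^ 4)" using cQ by (rule of_nat_mono)
  then show "real (card ?Q) <= (real k + 1) ^ 4" by (simp add: add.commute)
 qed simp
 finally show ?thesis .
qed

text \<open>Only pairs sharing two indices contribute, so the second moment is
  \<open>O(1/n^2)\<close> and the remainder vanishes even after multiplication by
  \<open>sqrt n\<close>.\<close>

lemma degenerate_second_moment:
 assumes k: "k >= 1" and n: "k + 1 <= n"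
 shows "(EU u. (U_stat k (degenerate_part k g) n u)^2)
   <= (real k + 1) ^ 4 * (LINT w|cube k. (degenerate_part k g w)^2) / (real n * (real n - 1))"
proof -
 let ?d = "degenerate_part k g"
 let ?D = "\<lambda>I u. ?d (tup k u I)" and ?T = "tuples k n"
 let ?v = "LINT w|cube k. (?d w)^2"
 note df = phi_facts[OF degenerate_square_integrable]
 have m: "?D I \<in> borel_measurable uniform_seq" if "I \<in> ?T" for I
  by (rule phi_tup_measurable'[OF df(1) that])
 have i: "integrable uniform_seq (\<lambda>u. (?D I u)^2)" if "I \<in> ?T" for I
  using integrable_tup[OF that, of "\<lambda>w. (?d w)^2"] df by simp
 have e: "(EU u. (?D I u)^2) = ?v" if "I \<in> ?T" for I
  using integral_tup[OF that, of "\<lambda>w. (?d w)^2"] df by simp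
 have v0: "0 <= ?v" by simp
 have c0: "real (card ?T) > 0" using card_tuples_pos[of k n] n by simp
 have n1: "real n * (real n - 1) > 0" using k n by simp
 let ?meet = "\<lambda>I J. \<forall>a\<le>k. I ` ({..k} - {a}) \<inter> J ` {..k} \<noteq> {}"
 have "(EU u. (\<Sum>I\<in>?T. ?D I u)^2) = (\<Sum>I\<in>?T. \<Sum>J\<in>?T. LINT u|uniform_seq. ?D I u * ?D J u)"
  by (rule integrable_sum_square(2)[OF m i])
 also have "... <= (\<Sum>I\<in>?T. \<Sum>J\<in>?T. of_bool (?meet I J) * ?v)"
 proof (intro sum_mono)
  fix I J assume I: "I \<in> ?T" and J: "J \<in> ?T"
  show "(EU u. ?D I u * ?D J u) <= of_bool (?meet I J) * ?v"
  proof (cases "?meet I J")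
   case True
   then show ?thesis using integral_product_le[OF m[OF I] m[OF J] i[OF I] i[OF J]] e[OF I] e[OF J] by simp
  next
   case False
   then obtain a where "a <= k" "I ` ({..k} - {a}) \<inter> J ` {..k} = {}" by blast
   from degenerate_orthogonal[OF I J this] show ?thesis by simp
  qed
 qed
 also have "... = (\<Sum>I\<in>?T. real (card {J \<in> ?T. ?meet I J}) * ?v)"
  by (intro sum.cong refl) (simp add: sum_distrib_right[symmetric] Int_def)
 also have "... <= (\<Sum>I\<in>?T. ((real k + 1) ^ 4 * real (card ?T) / (real n * (real n - 1))) * ?v)"
  by (intro sum_mono mult_right_mono v0) (simp add: pos_le_divide_eq[OF n1] card_tuples_meeting_twice[OF _ k])
 also have "... = (real (card ?T))^2 * ((real k + 1) ^ 4 * ?v / (real n * (real n - 1)))"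
  by (simp add: power2_eq_square mult_ac)
 also have "... = ((real k + 1) ^ 4 * ?v / (real n * (real n - 1))) * (real (card ?T))^2" by (rule mult.commute)
 finally have "(EU u. (\<Sum>I\<in>?T. ?D I u)^2) / (real (card ?T))^2 <= (real k + 1) ^ 4 * ?v / (real n * (real n - 1))"
  by (simp only: pos_divide_le_eq[OF zero_less_power[OF c0]])
 then show "(EU u. (U_stat k ?d n u)^2) <= (real k + 1) ^ 4 * ?v / (real n * (real n - 1))"
  unfolding U_stat_def tuple_avg_def power_divide by simp
qed

text \<open>Every index occurs equally often at each position, so tuple averages of functions of one
  position are sample means.\<close>

lemma U_stat_projection:
 assumes n: "k + 1 <= n"
 shows "U_stat k g n u = U_stat k (degenerate_part k g) n u + (\<Sum>i=1..n. \<Sum>l\<le>k. proj k l g (u i)) / real n"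
proof -
 let ?T = "tuples k n"
 have c0: "real (card ?T) > 0" using card_tuples_pos[of k n] n by simp
 have s: "(\<Sum>I\<in>?T. proj k l g (tup k u I l)) = real (card ?T) / real n * (\<Sum>i=1..n. proj k l g (u i))" if l: "l <= k" for l
 proof -
  have "(\<Sum>I\<in>?T. proj k l g (tup k u I l)) = (\<Sum>I\<in>?T. proj k l g (u (I l)))"
   using l by (simp add: tup_def)
  also have "... = (\<Sum>i=1..n. \<Sum>I | I \<in> ?T \<and> I l = i. proj k l g (u (I l)))"
   by (rule sum.group[symmetric, OF finite_tuples]) (use tuplesD(2) l in auto)
  also have "... = (\<Sum>i=1..n. real (card {I \<in> ?T. I l = i}) * proj k l g (u i))"
   by (intro sum.cong refl) simp
  also have "... = (\<Sum>i=1..n. real (card ?T) / real n * proj k l g (u i))"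
  proof (rule sum.cong[OF refl])
   fix i assume "i \<in> {1..n}"
   from card_tuples_fix1[OF l this] n show "real (card {I \<in> ?T. I l = i}) * proj k l g (u i) = real (card ?T) / real n * proj k l g (u i)"
    by (simp add: field_simps)
  qed
  finally show ?thesis by (simp add: sum_distrib_left)
 qed
 have "(\<Sum>I\<in>?T. \<Sum>l\<le>k. proj k l g (tup k u I l)) = (\<Sum>l\<le>k. \<Sum>I\<in>?T. proj k l g (tup k u I l))" by (rule sum.swap)
 also have "... = (\<Sum>l\<le>k. real (card ?T) / real n * (\<Sum>i=1..n. proj k l g (u i)))" using s by simp
 also have "... = real (card ?T) / real n * (\<Sum>i=1..n. \<Sum>l\<le>k. proj k l g (u i))"
  by (subst sum.swap) (simp add: sum_distrib_left)
 finally have "(\<Sum>I\<in>?T. \<Sum>l\<le>k. proj k l g (tup k u I l)) = real (card ?T) / real n * (\<Sum>i=1..n. \<Sum>l\<le>k. proj k l g (u i))" .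
 moreover have "?T \<noteq> {}" using c0 by auto
 ultimately show ?thesis using c0
  by (simp add: U_stat_def tuple_avg_def degenerate_part_def sum_subtractf diff_divide_distrib)
qed

end

section \<open>Linearization\<close>

text \<open>The projections of all positions are evaluated at the last coordinate, so that one
  function of \<open>k+1\<close> successive observations absorbs them; this is also the coordinate
  used in \<open>phi_star\<close>.\<close>

definition lin_kernel :: "nat => ((nat => real) => real) => (nat => real) => real" where
 "lin_kernel k phi w = phi w - mu k phi - (\<Sum>l\<le>k. proj k l (\<lambda>w. phi w - step_kernel k phi w) (w k))"

lemma proj_sum_facts:
 assumes "square_integrable k g"
 shows "(\<lambda>x. \<Sum>l\<le>k. proj k l g x) \<in> borel_measurable uniform01"
  "integrable uniform01 (\<lambda>x. (\<Sum>l\<le>k. proj k l g x)^2)" "integrable uniform01 (\<lambda>x. \<Sum>l\<le>k. proj k l g x)"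
  "(LINT x|uniform01. (\<Sum>l\<le>k. proj k l g x)) = (real k + 1) * (LINT w|cube k. g w)"
proof -
 have m: "proj k l g \<in> borel_measurable uniform01" if "l \<in> {..k}" for l
  using that proj_measurable[OF phi_facts(1)[OF assms]] by simp
 note pf = proj_facts[OF assms]
 show "(\<lambda>x. \<Sum>l\<le>k. proj k l g x) \<in> borel_measurable uniform01" by (intro borel_measurable_sum m)
 show "integrable uniform01 (\<lambda>x. (\<Sum>l\<le>k. proj k l g x)^2)"
  by (rule integrable_sum_square(1)[OF m]) (simp_all add: pf)
 show "integrable uniform01 (\<lambda>x. \<Sum>l\<le>k. proj k l g x)"
  by (intro L1_integrable_sum) (simp add: pf)
 show "(LINT x|uniform01. (\<Sum>l\<le>k. proj k l g x)) = (real k + 1) * (LINT w|cube k. g w)"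
  by (subst L1_integral_sum) (simp_all add: pf)
qed

context
 fixes k :: nat and phi :: "(nat => real) => real"
 assumes phi: "square_integrable k phi"
begin

lemma residual_mean_zero: "(LINT w|cube k. phi w - step_kernel k phi w) = 0"
 using integral_step_kernel[OF phi] phi_facts(3)[OF phi] phi_facts(3)[OF step_kernel_square_integrable[OF phi]]
 by (simp add: mu_def)

lemma lin_kernel_square_integrable: "square_integrable k (lin_kernel k phi)"
 unfolding lin_kernel_def[abs_def] using proj_sum_facts[OF residual_square_integrable[OF phi]]
 by (intro square_integrable_diff phi square_integrable_coordinate) (auto simp: square_integrable_def)

lemma lin_kernel_mean_zero: "(LINT w|cube k. lin_kernel k phi w) = 0"
proof -
 note p = proj_sum_facts[OF residual_square_integrable[OF phi]]
 note q = cube_coordinate_integral[OF order_refl p(1)]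
 show ?thesis unfolding lin_kernel_def
  using phi_facts(3)[OF phi] p q residual_mean_zero by (simp add: mu_def CU.prob_space)
qed

text \<open>Two remainders: the degenerate U-statistic, with second moment \<open>O(1/n^2)\<close>,
  and the edge effect of averaging the projections over the first \<open>n - k\<close> observations
  instead of all \<open>n\<close>.\<close>

lemma linearization_negligible:
 assumes k: "k >= 1"
 shows "small_oP (\<lambda>n. uniform_seq)
  (\<lambda>n u. (lag_avg k phi n u - U_stat k phi n u + U_stat k (step_kernel k phi) n u - mu k phi) - lag_avg k (lin_kernel k phi) n u)
  (\<lambda>n. 1 / sqrt (real n))"
proof -
 let ?g = "\<lambda>w. phi w - step_kernel k phi w"
 let ?d = "degenerate_part k ?g"
 define \<psi> where "\<psi> x = (\<Sum>l\<le>k. proj k l ?g x)" for x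
 note g = residual_square_integrable[OF phi] and g0 = residual_mean_zero
 note p = proj_sum_facts[OF g, folded \<psi>_def]
 let ?D = "\<lambda>n u. (\<Sum>t=k+1..n. \<psi> (u (t - k))) / (real n - real k) - (\<Sum>i=1..n. \<psi> (u i)) / real n"
 have c: "integrable uniform_seq (\<lambda>u. \<psi> (u i))" "(EU u. \<bar>\<psi> (u i)\<bar>) = (LINT x|uniform01. \<bar>\<psi> x\<bar>)" if "i >= 1" for i
  using component_integral(2)[of i "{1..}" \<psi>] component_integral(1)[of i "{1..}" "\<lambda>x. \<bar>\<psi> x\<bar>"] that p
  by (simp_all add: uniform_seq_def)
 let ?E = "LINT x|uniform01. \<bar>\<psi> x\<bar>"
 have Di: "integrable uniform_seq (?D n)" for n
  using c(1) by (intro L1_integrable_diff integrable_divide_zero L1_integrable_sum) auto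
 note d = degenerate_square_integrable[OF g g0]
 let ?C = "(real k + 1) ^ 4 * (LINT w|cube k. (?d w)^2)"
 have Um: "(\<lambda>u. - U_stat k ?d n u) \<in> borel_measurable uniform_seq" for n
  using borel_measurable_integrable[OF U_stat_integrable[OF d]] by simp
 have X: "small_oP (\<lambda>n. uniform_seq) (\<lambda>n u. - U_stat k ?d n u) (\<lambda>n. 1 / sqrt (real n))"
 proof (rule small_oP_second_moment[OF prob_space_uniform_seq _ Um])
  have lim: "(\<lambda>n. ?C / (real n - 1)) \<longlonglongrightarrow> 0"
   by (intro real_tendsto_divide_at_top[OF tendsto_const]) real_asymp
  show "(\<lambda>n. (EU u. (- U_stat k ?d n u)^2) / (1 / sqrt (real n))^2) \<longlonglongrightarrow> 0"
  proof (rule tendsto_sandwich[OF _ _ tendsto_const lim])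
   show "\<forall>\<^sub>F n in sequentially. (EU u. (- U_stat k ?d n u)^2) / (1 / sqrt (real n))^2 <= ?C / (real n - 1)"
   proof (rule eventually_sequentiallyI[of "k + 1"])
    fix n assume n: "k + 1 <= n"
    have "(EU u. (U_stat k ?d n u)^2) * real n <= ?C / (real n * (real n - 1)) * real n"
     by (intro mult_right_mono degenerate_second_moment[OF g g0 k n]) simp
    also have "... = ?C / (real n - 1)" using n by simp
    finally show "(EU u. (- U_stat k ?d n u)^2) / (1 / sqrt (real n))^2 <= ?C / (real n - 1)"
     by (simp add: power_divide)
   qed
  qed (auto intro!: always_eventually)
 qed (auto intro: U_stat_square_integrable[OF d])
 have Y: "small_oP (\<lambda>n. uniform_seq) ?D (\<lambda>n. 1 / sqrt (real n))"
 proof (rule small_oP_first_moment)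
  have "(\<lambda>n. 2 * real k * ?E / sqrt (real n)) \<longlonglongrightarrow> 0"
   by (intro real_tendsto_divide_at_top[OF tendsto_const] filterlim_compose[OF sqrt_at_top filterlim_real_sequentially])
  show "(\<lambda>n. (EU u. \<bar>?D n u\<bar>) / (1 / sqrt (real n))) \<longlonglongrightarrow> 0"
  proof (rule tendsto_sandwich[OF _ _ tendsto_const \<open>(\<lambda>n. 2 * real k * ?E / sqrt (real n)) \<longlonglongrightarrow> 0\<close>])
   show "\<forall>\<^sub>F n in sequentially. (EU u. \<bar>?D n u\<bar>) / (1 / sqrt (real n)) <= 2 * real k * ?E / sqrt (real n)"
   proof (rule eventually_sequentiallyI[of "k + 1"])
    fix n assume n: "k + 1 <= n"
    \<comment> \<open>The absolute differences of the two systems of weights: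
      \<open>1/(n-k) - 1/n\<close> for the first \<open>n - k\<close> observations and
      \<open>1/n\<close> for the last \<open>k\<close>. They add up to \<open>2k/n\<close>.\<close>
    define w where "w i = (if i <= n - k then real k / (real n * (real n - real k)) else 1 / real n)" for i
    have D: "\<bar>?D n u\<bar> <= (\<Sum>i=1..n. w i * \<bar>\<psi> (u i)\<bar>)" for u
    proof -
     have "(\<Sum>t=k+1..n. \<psi> (u (t - k))) = (\<Sum>i=1..n-k. \<psi> (u i))"
      using n by (intro sum.reindex_bij_witness[of _ "\<lambda>i. i + k" "\<lambda>t. t - k"]) auto
     also have "... = (\<Sum>i=1..n. of_bool (i <= n - k) * \<psi> (u i))"
      by (intro sum.mono_neutral_cong_left) auto
     finally have "?D n u = (\<Sum>i=1..n. (of_bool (i <= n - k) / (real n - real k) - 1 / real n) * \<psi> (u i))"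
      by (simp only: sum_divide_distrib left_diff_distrib sum_subtractf times_divide_eq_left mult_1_left)
     also have "\<bar>...\<bar> <= (\<Sum>i=1..n. \<bar>(of_bool (i <= n - k) / (real n - real k) - 1 / real n) * \<psi> (u i)\<bar>)" by (rule sum_abs)
     also have "... = (\<Sum>i=1..n. w i * \<bar>\<psi> (u i)\<bar>)"
     proof (rule sum.cong[OF refl])
      fix i
      have "of_bool (i <= n - k) / (real n - real k) - 1 / real n = (if i <= n - k then w i else - w i)"
       using n by (auto simp: w_def field_simps)
      moreover have "w i >= 0" using n by (auto simp: w_def)
      ultimately show "\<bar>(of_bool (i <= n - k) / (real n - real k) - 1 / real n) * \<psi> (u i)\<bar> = w i * \<bar>\<psi> (u i)\<bar>"
       by (simp add: abs_mult)
     qed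
     finally show ?thesis .
    qed
    have w: "(\<Sum>i=1..n. w i) = 2 * real k / real n"
    proof -
     have "{1..n} = {1..n-k} \<union> {n-k+1..n}" by auto
     then have "(\<Sum>i=1..n. w i) = (\<Sum>i\<in>{1..n-k}. w i) + (\<Sum>i\<in>{n-k+1..n}. w i)"
      by (simp only:) (rule sum.union_disjoint; auto)
     also have "... = real (n - k) * (real k / (real n * (real n - real k))) + real k * (1 / real n)"
      using n by (intro arg_cong2[of _ _ _ _ "(+)"]) (simp_all add: w_def)
     also have "... = 2 * real k / real n" using n by (simp add: of_nat_diff field_simps)
     finally show ?thesis .
    qed
    have ai: "integrable uniform_seq (\<lambda>u. w i * \<bar>\<psi> (u i)\<bar>)" if "i \<in> {1..n}" for i
     using c(1)[of i] that by simp
    have "(EU u. \<bar>?D n u\<bar>) <= (EU u. (\<Sum>i=1..n. w i * \<bar>\<psi> (u i)\<bar>))"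
     using D by (intro integral_mono integrable_abs Di L1_integrable_sum ai)
    also have "... = (\<Sum>i=1..n. w i * ?E)"
     using ai c(2) by (subst L1_integral_sum) (auto intro!: sum.cong)
    also have "... = 2 * real k * ?E / real n"
     using w by (simp add: sum_distrib_right[symmetric])
    finally have "(EU u. \<bar>?D n u\<bar>) * sqrt (real n) <= 2 * real k * ?E / real n * sqrt (real n)"
     by (rule mult_right_mono) simp
    also have "... = 2 * real k * ?E / sqrt (real n)"
     using n by (simp add: field_simps)
    finally show "(EU u. \<bar>?D n u\<bar>) / (1 / sqrt (real n)) <= 2 * real k * ?E / sqrt (real n)" by simp
   qed
  qed (auto intro!: always_eventually)
 qed (use Di prob_space_uniform_seq in auto)
 have XY: "small_oP (\<lambda>n. uniform_seq) (\<lambda>n u. - U_stat k ?d n u + ?D n u) (\<lambda>n. 1 / sqrt (real n))"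
  by (rule small_oP_add[OF prob_space_uniform_seq Um borel_measurable_integrable[OF Di] X Y])
 note h = step_kernel_square_integrable[OF phi]
 show ?thesis
 proof (rule small_oP_cong_AE[OF XY])
  show "(\<lambda>u. - U_stat k ?d n u + ?D n u) \<in> borel_measurable uniform_seq" for n
   using Um borel_measurable_integrable[OF Di] by (rule borel_measurable_add)
  have "lag_avg k phi n \<in> borel_measurable uniform_seq" "lag_avg k (lin_kernel k phi) n \<in> borel_measurable uniform_seq" for n
   unfolding uniform_seq_def
   by (auto intro!: lag_avg_measurable[OF phi] phi_facts[OF phi] phi_facts[OF lin_kernel_square_integrable])
  then show "(\<lambda>u. (lag_avg k phi n u - U_stat k phi n u + U_stat k (step_kernel k phi) n u - mu k phi) - lag_avg k (lin_kernel k phi) n u) \<in> borel_measurable uniform_seq" for n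
   using borel_measurable_integrable[OF U_stat_integrable[OF phi]] borel_measurable_integrable[OF U_stat_integrable[OF h]]
   by (intro borel_measurable_diff borel_measurable_add borel_measurable_const)
  show "\<forall>\<^sub>F n in sequentially. AE u in uniform_seq. - U_stat k ?d n u + ?D n u
   = (lag_avg k phi n u - U_stat k phi n u + U_stat k (step_kernel k phi) n u - mu k phi) - lag_avg k (lin_kernel k phi) n u"
  proof (rule eventually_sequentiallyI[of "k + 1"], rule AE_I2)
   fix n u assume n: "k + 1 <= n"
   have "U_stat k phi n u - U_stat k (step_kernel k phi) n u = U_stat k ?g n u"
    by (simp add: U_stat_def tuple_avg_def sum_subtractf diff_divide_distrib)
   also have "... = U_stat k ?d n u + (\<Sum>i=1..n. \<psi> (u i)) / real n"
    using U_stat_projection[OF g g0 n] by (simp only: \<psi>_def)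
   finally have 1: "U_stat k phi n u - U_stat k (step_kernel k phi) n u = U_stat k ?d n u + (\<Sum>i=1..n. \<psi> (u i)) / real n" .
   have "lag_avg k (lin_kernel k phi) n u = (\<Sum>t=k+1..n. phi (tup k u (lag_index k t)) - mu k phi - \<psi> (u (t - k))) / (real n - real k)"
    unfolding lag_avg_def lin_kernel_def \<psi>_def by (simp add: tup_def lag_index_def)
   also have "... = lag_avg k phi n u - mu k phi - (\<Sum>t=k+1..n. \<psi> (u (t - k))) / (real n - real k)"
    using n by (simp add: lag_avg_def sum_subtractf diff_divide_distrib of_nat_diff)
   finally show "- U_stat k ?d n u + ?D n u
    = (lag_avg k phi n u - U_stat k phi n u + U_stat k (step_kernel k phi) n u - mu k phi) - lag_avg k (lin_kernel k phi) n u"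
    using 1 by linarith
  qed
 qed
qed

end

section \<open>A central limit theorem for functions of successive observations\<close>

lemma norm_iexp_diff_le: "cmod (iexp x - iexp y) <= \<bar>x - y\<bar>"
proof -
 have "iexp x - iexp y = iexp y * (iexp (x - y) - 1)"
  by (simp add: right_diff_distrib flip: exp_add distrib_left of_real_diff)
    (simp add: algebra_simps)
 then have "cmod (iexp x - iexp y) = cmod (iexp (x - y) - 1)" by (simp add: norm_mult)
 also have "... <= \<bar>x - y\<bar>" using iexp_approx1[of "x - y" 0] by simp
 finally show ?thesis .
qed

text \<open>The approximating sequence may depend on \<open>eps\<close>, which spares a diagonal
  choice of block lengths. Characteristic functions are compared, as complex exponentials are
  Lipschitz and bounded.\<close>

lemma (in prob_space) weak_conv_approx:
 fixes X :: "nat => 'a => real"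
 assumes X: "\<And>n. X n \<in> borel_measurable M" and N: "real_distribution N"
  and ex: "\<And>eps. eps > 0 ==> \<exists>Y. (\<forall>n. Y n \<in> borel_measurable M) \<and> weak_conv_m (\<lambda>n. distr M borel (Y n)) N
   \<and> (\<forall>\<^sub>F n in sequentially. measure M {\<omega> \<in> space M. \<bar>X n \<omega> - Y n \<omega>\<bar> > eps} <= eps)"
 shows "weak_conv_m (\<lambda>n. distr M borel (X n)) N"
proof (rule levy_continuity[OF real_distribution_distr[OF X] N])
 fix t :: real
 show "(\<lambda>n. char (distr M borel (X n)) t) \<longlonglongrightarrow> char N t"
 proof (rule LIMSEQ_I)
  fix r :: real assume r: "r > 0"
  \<comment> \<open>The exponentials differ by at most \<open>\<bar>t\<bar> eps\<close> where the
    variables are close and by 2 on an event of probability at most \<open>eps\<close>, in total by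
    \<open>r/2\<close> in mean.\<close>
  define eps where "eps = r / (2 * (\<bar>t\<bar> + 2))"
  have eps: "eps > 0" using r by (simp add: eps_def add_nonneg_pos)
  have epsr: "\<bar>t\<bar> * eps + 2 * eps = r / 2"
  proof -
   have "\<bar>t\<bar> * eps + 2 * eps = (\<bar>t\<bar> + 2) * eps" by (simp add: distrib_right)
   also have "... = r / 2" unfolding eps_def using abs_ge_zero[of t] by (simp add: field_simps)
   finally show ?thesis .
  qed
  from ex[OF eps] obtain Y where Y[measurable]: "\<And>n. Y n \<in> borel_measurable M"
   and W: "weak_conv_m (\<lambda>n. distr M borel (Y n)) N"
   and ev: "\<forall>\<^sub>F n in sequentially. measure M {\<omega> \<in> space M. \<bar>X n \<omega> - Y n \<omega>\<bar> > eps} <= eps" by blast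
  note X[measurable]
  have "(\<lambda>n. char (distr M borel (Y n)) t) \<longlonglongrightarrow> char N t"
   by (rule levy_continuity1[OF real_distribution_distr[OF Y] N W])
  then have "\<forall>\<^sub>F n in sequentially. cmod (char (distr M borel (Y n)) t - char N t) < r / 2"
   using r tendstoD[of _ "char N t" sequentially "r / 2"] by (simp add: dist_norm)
  with ev have "\<forall>\<^sub>F n in sequentially. cmod (char (distr M borel (X n)) t - char N t) < r"
  proof eventually_elim
   case (elim n)
   let ?B = "{\<omega> \<in> space M. \<bar>X n \<omega> - Y n \<omega>\<bar> > eps}"
   have B[measurable]: "?B \<in> sets M" by measurable
   have i: "complex_integrable M (\<lambda>\<omega>. iexp (t * X n \<omega>))" "complex_integrable M (\<lambda>\<omega>. iexp (t * Y n \<omega>))"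
    by (auto intro!: integrable_iexp)
   have "char (distr M borel (X n)) t - char (distr M borel (Y n)) t = (CLINT \<omega>|M. iexp (t * X n \<omega>) - iexp (t * Y n \<omega>))"
    using i by (simp add: char_def integral_distr)
   also have "cmod ... <= (LINT \<omega>|M. cmod (iexp (t * X n \<omega>) - iexp (t * Y n \<omega>)))"
    by (rule integral_norm_bound)
   also have "... <= (LINT \<omega>|M. \<bar>t\<bar> * eps + 2 * indicator ?B \<omega>)"
   proof (rule integral_mono)
    show "integrable M (\<lambda>\<omega>. cmod (iexp (t * X n \<omega>) - iexp (t * Y n \<omega>)))"
     by (intro integrable_norm L1_integrable_diff i)
    show "integrable M (\<lambda>\<omega>. \<bar>t\<bar> * eps + 2 * indicator ?B \<omega>)"
     by (intro L1_integrable_add integrable_mult_right integrable_const integrable_real_indicator B)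
       (simp add: emeasure_eq_measure)
    fix \<omega> assume \<omega>: "\<omega> \<in> space M"
    show "cmod (iexp (t * X n \<omega>) - iexp (t * Y n \<omega>)) <= \<bar>t\<bar> * eps + 2 * indicator ?B \<omega>"
    proof (cases "\<omega> \<in> ?B")
     case True
     have "cmod (iexp (t * X n \<omega>) - iexp (t * Y n \<omega>)) <= cmod (iexp (t * X n \<omega>)) + cmod (iexp (t * Y n \<omega>))"
      by (rule norm_triangle_ineq4)
     also have "... = 2" by simp
     finally show ?thesis using True eps by (auto intro: order_trans)
    next
     case False
     have "cmod (iexp (t * X n \<omega>) - iexp (t * Y n \<omega>)) <= \<bar>t * X n \<omega> - t * Y n \<omega>\<bar>" by (rule norm_iexp_diff_le)
     also have "... = \<bar>t\<bar> * \<bar>X n \<omega> - Y n \<omega>\<bar>" by (simp flip: abs_mult right_diff_distrib)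
     also have "... <= \<bar>t\<bar> * eps" using False \<omega> by (intro mult_left_mono) auto
     finally show ?thesis using False by simp
    qed
   qed
   also have "... = \<bar>t\<bar> * eps + 2 * measure M ?B"
    using B by (subst L1_integral_add) (auto simp: prob_space emeasure_eq_measure)
   also have "... <= r / 2" using elim epsr by simp
   finally have "cmod (char (distr M borel (X n)) t - char (distr M borel (Y n)) t) <= r / 2" .
   moreover have "cmod (char (distr M borel (X n)) t - char N t)
    <= cmod (char (distr M borel (X n)) t - char (distr M borel (Y n)) t) + cmod (char (distr M borel (Y n)) t - char N t)"
    using norm_triangle_ineq[of "char (distr M borel (X n)) t - char (distr M borel (Y n)) t" "char (distr M borel (Y n)) t - char N t"]
    by simp
   ultimately show ?case using elim by linarith
  qed
  then show "\<exists>no. \<forall>n\<ge>no. cmod (char (distr M borel (X n)) t - char N t) < r"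
   by (simp add: eventually_sequentially)
 qed
qed

lemma weak_conv_m_compose:
 assumes "weak_conv_m D N" "filterlim q sequentially sequentially"
 shows "weak_conv_m (\<lambda>m. D (q m)) N"
 unfolding weak_conv_m_def weak_conv_def
proof (intro allI impI)
 fix x assume "isCont (cdf N) x"
 then have "(\<lambda>q. cdf (D q) x) \<longlonglongrightarrow> cdf N x"
  using assms(1) unfolding weak_conv_m_def weak_conv_def by simp
 from filterlim_compose[OF this assms(2)] show "(\<lambda>m. cdf (D (q m)) x) \<longlonglongrightarrow> cdf N x" .
qed

section \<open>Moments of a stationary sequence with dependence of range \<open>k\<close>\<close>

definition shift :: "nat => (nat => real) => nat => real" where
 "shift d u = (\<lambda>i\<in>{1..}. u (i + d))"

lemma distr_shift: "distr uniform_seq uniform_seq (shift d) = uniform_seq"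
 and shift_measurable: "shift d \<in> measurable uniform_seq uniform_seq"
proof -
 show "distr uniform_seq uniform_seq (shift d) = uniform_seq"
  unfolding uniform_seq_def shift_def[abs_def]
  using distr_PiM_reindex[of "{1..}" "\<lambda>_. uniform01" "\<lambda>i. i + d" "{1..}"] prob_space_uniform01
  by (auto simp: inj_on_def)
 show "shift d \<in> measurable uniform_seq uniform_seq"
  unfolding uniform_seq_def shift_def[abs_def]
  by (intro measurable_restrict measurable_component_singleton) auto
qed

text \<open>Counting starts at \<open>s = 0\<close>, and the term reads the coordinates
  \<open>s + 1\<close> to \<open>s + k + 1\<close>. Terms more than \<open>k\<close> apart are
  therefore independent.\<close>

definition lag_seq :: "nat => ((nat => real) => real) => nat => (nat => real) => real" where
 "lag_seq k \<xi> s u = \<xi> (tup k u (lag_index k (s + k + 1)))"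

definition autocov :: "nat => ((nat => real) => real) => nat => real" where
 "autocov k \<xi> j = (EU u. lag_seq k \<xi> 0 u * lag_seq k \<xi> j u)"

text \<open>For a centred stationary sequence whose autocovariances vanish beyond \<open>k\<close>,
  the limit of the variance of a partial sum divided by its length.\<close>

definition long_run_var :: "nat => ((nat => real) => real) => real" where
 "long_run_var k \<xi> = autocov k \<xi> 0 + 2 * (\<Sum>j=1..k. autocov k \<xi> j)"

lemma lag_seq_shift: "lag_seq k \<xi> (s + d) u = lag_seq k \<xi> s (shift d u)"
proof -
 have "tup k u (lag_index k (s + d + k + 1)) = tup k (shift d u) (lag_index k (s + k + 1))"
  by (auto simp: tup_def lag_index_def shift_def fun_eq_iff intro!: arg_cong[of _ _ u])
 then show ?thesis by (simp add: lag_seq_def)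
qed

lemma lag_seq_cong:
 "(\<And>i. i \<in> {s+1..s+k+1} ==> u i = v i) ==> lag_seq k \<xi> s u = lag_seq k \<xi> s v"
 unfolding lag_seq_def by (intro arg_cong[of _ _ \<xi>] tup_cong) (auto simp: lag_index_def)

context
 fixes k :: nat and \<xi> :: "(nat => real) => real"
 assumes \<xi>: "square_integrable k \<xi>"
begin

abbreviation "Y \<equiv> lag_seq k \<xi>"
abbreviation "\<gamma> \<equiv> autocov k \<xi>"

lemma lag_seq_index: "lag_index k (s + k + 1) \<in> tuples k (s + k + 1)"
 by (rule lag_index_in_tuples) simp_all

lemma lag_seq_measurable: "Y s \<in> borel_measurable uniform_seq"
 unfolding lag_seq_def[abs_def] by (rule phi_tup_measurable'[OF phi_facts(1)[OF \<xi>] lag_seq_index])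

lemma lag_seq_square_integrable: "integrable uniform_seq (\<lambda>u. (Y s u)^2)"
 unfolding lag_seq_def using integrable_tup[OF lag_seq_index, of "\<lambda>w. (\<xi> w)^2"] phi_facts[OF \<xi>] by simp

lemma lag_seq_product_integrable: "integrable uniform_seq (\<lambda>u. Y s u * Y t u)"
 by (intro integrable_product_of_squares lag_seq_measurable lag_seq_square_integrable)

lemma lag_seq_product: "(EU u. Y s u * Y (s + j) u) = \<gamma> j"
proof -
 have m: "(\<lambda>u. Y 0 u * Y j u) \<in> borel_measurable uniform_seq" by (intro borel_measurable_times lag_seq_measurable)
 have "(EU u. Y s u * Y (s + j) u) = (EU u. Y 0 (shift s u) * Y j (shift s u))"
  using lag_seq_shift[of k \<xi> 0 s] lag_seq_shift[of k \<xi> j s] by (simp add: add.commute)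
 also have "... = (LINT u|distr uniform_seq uniform_seq (shift s). Y 0 u * Y j u)"
  by (rule integral_distr[OF shift_measurable m, symmetric])
 finally show ?thesis by (simp add: distr_shift autocov_def)
qed

lemma lag_seq_product': "(EU u. Y s u * Y t u) = \<gamma> (if s <= t then t - s else s - t)"
proof (cases "s <= t")
 case True
 then show ?thesis using lag_seq_product[of s "t - s"] by simp
next
 case False
 then show ?thesis using lag_seq_product[of t "s - t"] by (simp add: mult.commute)
qed

context
 assumes \<xi>0: "(LINT w|cube k. \<xi> w) = 0"
begin

lemma lag_seq_mean: "integrable uniform_seq (Y s)" "(EU u. Y s u) = 0"
 unfolding lag_seq_def[abs_def] using integrable_tup[OF lag_seq_index] integral_tup[OF lag_seq_index] phi_facts[OF \<xi>] \<xi>0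
 by simp_all

lemma autocov_far: "j > k ==> \<gamma> j = 0"
proof -
 assume j: "j > k"
 have "\<gamma> j = (EU u. Y 0 u) * (EU u. Y j u)"
  unfolding autocov_def uniform_seq_def
 proof (rule integral_mix_product[where K = "{1..k+1}"])
  show "integrable (unif {1..}) (\<lambda>u. Y 0 u * Y j u)"
   using lag_seq_product_integrable by (simp add: uniform_seq_def)
  show "Y 0 (mix {1..k+1} v u) = Y 0 v" for u v by (rule lag_seq_cong) (simp add: mix_def)
  show "Y j (mix {1..k+1} v u) = Y j u" for u v by (rule lag_seq_cong) (use j in \<open>simp add: mix_def\<close>)
 qed (rule prob_space_uniform01)
 then show ?thesis by (simp add: lag_seq_mean)
qed

lemma autocov_bound: "\<bar>\<gamma> j\<bar> <= \<gamma> 0" "0 <= \<gamma> 0"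
proof -
 have e: "(EU u. (Y s u)^2) = \<gamma> 0" for s
  using lag_seq_product[of s 0] by (simp add: power2_eq_square)
 show "\<bar>\<gamma> j\<bar> <= \<gamma> 0" unfolding autocov_def
  using integral_product_le[OF lag_seq_measurable lag_seq_measurable lag_seq_square_integrable lag_seq_square_integrable, of 0 j] e
  by (simp add: autocov_def)
 then show "0 <= \<gamma> 0" by linarith
qed

text \<open>Stated for arbitrary finite index sets, because the terms left over by the blocks are
  scattered.\<close>

lemma partial_sum_second_moment:
 assumes "finite A"
 shows "integrable uniform_seq (\<lambda>u. (\<Sum>s\<in>A. Y s u)^2)"
  "(EU u. (\<Sum>s\<in>A. Y s u)^2) <= real (card A) * (2 * real k + 1) * \<gamma> 0"
proof -
 show "integrable uniform_seq (\<lambda>u. (\<Sum>s\<in>A. Y s u)^2)"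
  by (rule integrable_sum_square(1)[OF lag_seq_measurable lag_seq_square_integrable])
 have "(EU u. (\<Sum>s\<in>A. Y s u)^2) <= real (card A) * (2 * real k + 1) * \<gamma> 0 + (real (card A))^2 * 0"
  by (rule second_moment_local_dependence[where k = k, OF assms lag_seq_measurable lag_seq_square_integrable])
    (use autocov_bound autocov_far in \<open>auto simp: lag_seq_product'\<close>)
 then show "(EU u. (\<Sum>s\<in>A. Y s u)^2) <= real (card A) * (2 * real k + 1) * \<gamma> 0" by simp
qed

definition block_var :: "nat => real" where
 "block_var p = (EU u. (\<Sum>s<p. Y s u)^2)"

text \<open>From \<open>p = k\<close> on, the new term sees all autocovariances up to lag
  \<open>k\<close>, so the variance grows by the same amount at each step.\<close>

lemma block_var_Suc: "k <= p ==> block_var (Suc p) = block_var p + long_run_var k \<xi>"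
proof -
 assume p: "k <= p"
 let ?S = "\<lambda>u. \<Sum>s<p. Y s u"
 have i: "integrable uniform_seq (\<lambda>u. ?S u * Y p u)"
  unfolding sum_distrib_right by (intro L1_integrable_sum lag_seq_product_integrable)
 have "block_var (Suc p) = (EU u. (?S u)^2 + (Y p u)^2 + 2 * (?S u * Y p u))"
  unfolding block_var_def by (simp add: power2_sum mult.assoc)
 also have "... = block_var p + (EU u. (Y p u)^2) + 2 * (EU u. ?S u * Y p u)"
  using i partial_sum_second_moment(1)[of "{..<p}"] lag_seq_square_integrable by (simp add: block_var_def)
 also have "(EU u. ?S u * Y p u) = (\<Sum>s<p. \<gamma> (p - s))"
  unfolding sum_distrib_right using lag_seq_product_integrable
  by (subst L1_integral_sum) (auto simp: lag_seq_product')
 also have "... = (\<Sum>j=1..p. \<gamma> j)"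
  by (rule sum.reindex_bij_witness[of _ "\<lambda>j. p - j" "\<lambda>s. p - s"]) auto
 also have "... = (\<Sum>j=1..k. \<gamma> j)"
  using p autocov_far by (intro sum.mono_neutral_right) auto
 also have "(EU u. (Y p u)^2) = \<gamma> 0"
  using lag_seq_product[of p 0] by (simp add: power2_eq_square)
 finally show ?thesis by (simp add: long_run_var_def)
qed

lemma block_var_eq: "k <= p ==> block_var p = block_var k + real (p - k) * long_run_var k \<xi>"
 by (induction p rule: dec_induct) (simp_all add: block_var_Suc Suc_diff_le algebra_simps)

section \<open>Independent blocks\<close>

lemma coordinates_indep: "US.indep_vars (\<lambda>_. uniform01) (\<lambda>i u. u i) {1..}"
proof -
 have m: "(\<lambda>u. u i) \<in> measurable uniform_seq uniform01" if "i \<in> {1..}" for i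
  unfolding uniform_seq_def by (rule measurable_component_singleton[OF that])
 have "distr uniform_seq (unif {1..}) (\<lambda>u. \<lambda>i\<in>{1..}. u i) = (unif {1..})"
  using distr_PiM_reindex[of "{1..}" "\<lambda>_. uniform01" "\<lambda>i. i" "{1..}"] prob_space_uniform01
  by (auto simp del: One_nat_def simp: uniform_seq_def)
 also have "... = (\<Pi>\<^sub>M i\<in>{1..}. distr uniform_seq uniform01 (\<lambda>u. u i))"
 proof (rule PiM_cong[OF refl])
  fix i :: nat assume "i \<in> {1..}"
  then show "uniform01 = distr uniform_seq uniform01 (\<lambda>u. u i)"
   unfolding uniform_seq_def by (intro distr_PiM_component[symmetric] prob_space_uniform01)
 qed
 finally show ?thesis
  using US.indep_vars_iff_distr_eq_PiM'[of "{1..}" "\<lambda>i u. u i" "\<lambda>_. uniform01"] m by simp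
qed

text \<open>The block sums over \<open>{b(p+k), ..., b(p+k)+p-1}\<close> involve disjoint sets of coordinates.\<close>

definition block_sum :: "nat => nat => (nat => real) => real" where
 "block_sum p b u = (\<Sum>s<p. Y (s + b * (p + k)) u)"

lemma block_sum_shift: "block_sum p b u = block_sum p 0 (shift (b * (p + k)) u)"
 by (simp add: block_sum_def lag_seq_shift)

lemma block_sum_measurable: "block_sum p b \<in> borel_measurable uniform_seq"
 unfolding block_sum_def[abs_def] by (intro borel_measurable_sum lag_seq_measurable)

lemma block_sum_square_integrable: "integrable uniform_seq (\<lambda>u. (block_sum p b u)^2)"
 unfolding block_sum_def by (rule integrable_sum_square(1)[OF lag_seq_measurable lag_seq_square_integrable])

lemma block_sum_product: "(EU u. block_sum p b u * block_sum p c u) = (if b = c then block_var p else 0)"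
proof (cases "b = c")
 case True
 have "(EU u. (block_sum p 0 (shift (b * (p + k)) u))^2) = (EU u. (block_sum p 0 u)^2)"
  using integral_distr[OF shift_measurable borel_measurable_power[OF block_sum_measurable], of "b * (p + k)" p 0 2] by (simp add: distr_shift)
 then show ?thesis using True block_sum_shift[of p b]
  by (simp add: block_var_def block_sum_def power2_eq_square)
next
 case False
 have f: "s + b * (p + k) + k < t + c * (p + k)" if "s < p" "b < c" for s t b c
 proof -
  have "(b + 1) * (p + k) <= c * (p + k)" using that by (intro mult_right_mono) auto
  then show ?thesis using that by simp
 qed
 have "\<gamma> (if s + b * (p + k) <= t + c * (p + k) then t + c * (p + k) - (s + b * (p + k)) else s + b * (p + k) - (t + c * (p + k))) = 0"
  if "s < p" "t < p" for s t
  using f[of s b c t] f[of t c b s] that False by (intro autocov_far) (cases "b < c"; simp)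
 then show ?thesis using False lag_seq_product_integrable unfolding block_sum_def sum_product
  by (simp add: lag_seq_product')
qed

lemma block_sum_indep: "US.indep_vars (\<lambda>_. borel) (block_sum p) UNIV"
proof -
 let ?K = "\<lambda>b. {b * (p + k) + 1..(b + 1) * (p + k)}"
 have "US.indep_vars (\<lambda>b. PiM (?K b) (\<lambda>_. uniform01)) (\<lambda>b u. restrict (\<lambda>i. u i) (?K b)) UNIV"
 proof (rule US.indep_vars_restrict[OF coordinates_indep])
  show "?K b \<subseteq> {1..}" for b by auto
  show "disjoint_family_on ?K UNIV"
   unfolding disjoint_family_on_def
  proof (intro ballI impI)
   have "?K b \<inter> ?K c = {}" if "b < c" for b c
   proof -
    have "(b + 1) * (p + k) <= c * (p + k)" using that by (intro mult_right_mono) auto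
    then show ?thesis by auto
   qed
   then show "?K b \<inter> ?K c = {}" if "b \<noteq> c" for b c
    using that by (metis Int_commute linorder_neqE_nat)
  qed
 qed
 moreover have "block_sum p b \<in> borel_measurable (PiM (?K b) (\<lambda>_. uniform01))" for b
  unfolding block_sum_def[abs_def] lag_seq_def
 proof (intro borel_measurable_sum measurable_compose[OF tup_measurable phi_facts(1)[OF \<xi>, unfolded cube_def]])
  fix s j assume "s \<in> {..<p}" "j <= k"
  then show "lag_index k (s + b * (p + k) + k + 1) j \<in> ?K b" by (auto simp: lag_index_def)
 qed
 ultimately have "US.indep_vars (\<lambda>_. borel) (\<lambda>b u. block_sum p b (restrict (\<lambda>i. u i) (?K b))) UNIV"
  by (rule US.indep_vars_compose2)
 moreover have "block_sum p b (restrict (\<lambda>i. u i) (?K b)) = block_sum p b u" for b u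
  unfolding block_sum_def by (intro sum.cong refl lag_seq_cong) auto
 ultimately show ?thesis by simp
qed

text \<open>The blocks are identically distributed because each is the first block of a shifted
  sequence.\<close>

lemma block_clt:
 assumes "block_var p > 0"
 shows "weak_conv_m (\<lambda>q. distr uniform_seq borel (\<lambda>u. (\<Sum>b<q. block_sum p b u) / sqrt (real q * block_var p))) std_normal_distribution"
proof -
 have m0: "US.expectation (block_sum p b) = 0" for b
  unfolding block_sum_def using lag_seq_mean by (simp add: L1_integral_sum)
 have s: "(sqrt (block_var p))^2 = block_var p" using assms by simp
 have "weak_conv_m (\<lambda>q. distr uniform_seq borel (\<lambda>u. (\<Sum>b<q. block_sum p b u) / sqrt (real q * (sqrt (block_var p))^2))) std_normal_distribution"
 proof (rule US.central_limit_theorem_zero_mean[OF block_sum_indep m0 _ block_sum_square_integrable])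
  show "sqrt (block_var p) > 0" using assms by simp
  show "US.variance (block_sum p b) = (sqrt (block_var p))^2" for b
   using block_sum_product[of p b b] s m0 by (simp add: power2_eq_square)
  show "distr uniform_seq borel (block_sum p b) = distr uniform_seq borel (block_sum p 0)" for b
  proof -
   have "distr (distr uniform_seq uniform_seq (shift (b * (p + k)))) borel (block_sum p 0)
    = distr uniform_seq borel (block_sum p 0 \<circ> shift (b * (p + k)))"
    by (rule distr_distr[OF block_sum_measurable shift_measurable])
   also have "block_sum p 0 \<circ> shift (b * (p + k)) = block_sum p b" by (auto simp: block_sum_shift[of p b])
   finally show ?thesis by (simp add: distr_shift)
  qed
 qed
 then show ?thesis unfolding s .
qed

lemma blocks_second_moment:
 "integrable uniform_seq (\<lambda>u. (\<Sum>b<q. block_sum p b u)^2)"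
 "(EU u. (\<Sum>b<q. block_sum p b u)^2) = real q * block_var p"
 using integrable_sum_square[OF block_sum_measurable block_sum_square_integrable, where A = "{..<q}"]
 by (simp_all add: block_sum_product)

text \<open>Left over are \<open>q\<close> gaps of length \<open>k\<close> and an incomplete last
  block, shorter than \<open>p + k\<close>; together \<open>m - qp\<close> terms.\<close>

lemma block_decomposition:
 fixes m p :: nat
 assumes L: "p + k > 0"
 defines "q \<equiv> m div (p + k)"
 obtains R where "finite R" "card R <= q * k + (p + k)"
  "\<And>u. (\<Sum>s<m. Y s u) = (\<Sum>b<q. block_sum p b u) + (\<Sum>s\<in>R. Y s u)"
proof
 let ?f = "\<lambda>(b, s). s + b * (p + k)"
 define A where "A = ?f ` ({..<q} \<times> {..<p})"
 have inj: "inj_on ?f ({..<q} \<times> {..<p})"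
 proof (rule inj_onI)
  fix x y assume xy: "x \<in> {..<q} \<times> {..<p}" "y \<in> {..<q} \<times> {..<p}" "?f x = ?f y"
  obtain b s c t where e: "x = (b, s)" "y = (c, t)" by (cases x, cases y)
  have "s < p + k" "t < p + k" "s + b * (p + k) = t + c * (p + k)" using xy e by auto
  note st = this
  have "s = (s + b * (p + k)) mod (p + k)" using st(1) by simp
  also have "... = t" unfolding st(3) using st(2) by simp
  finally show "x = y" using e L st(3) by auto
 qed
 have qm: "q * (p + k) <= m" "m < q * (p + k) + (p + k)"
  using L dividend_less_div_times[of "p + k" m] by (simp_all add: q_def)
 have A: "A \<subseteq> {..<m}"
 proof
  fix x assume "x \<in> A"
  then obtain b s where x: "x = s + b * (p + k)" "b < q" "s < p" by (auto simp: A_def)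
  have "(b + 1) * (p + k) <= q * (p + k)" using x by (intro mult_right_mono) auto
  then show "x \<in> {..<m}" using x qm by simp
 qed
 have cA: "card A = q * p" unfolding A_def using card_image[OF inj] by (simp add: card_cartesian_product)
 show "finite ({..<m} - A)" by simp
 have "card ({..<m} - A) = m - q * p" using A cA by (subst card_Diff_subset) (auto intro: finite_subset)
 then show "card ({..<m} - A) <= q * k + (p + k)" using qm by (simp add: algebra_simps)
 fix u
 have "(\<Sum>s\<in>A. Y s u) = (\<Sum>b<q. block_sum p b u)"
  unfolding A_def block_sum_def sum.cartesian_product
  by (subst sum.reindex[OF inj]) (simp add: comp_def split_beta')
 then show "(\<Sum>s<m. Y s u) = (\<Sum>b<q. block_sum p b u) + (\<Sum>s\<in>{..<m} - A. Y s u)"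
  using sum.subset_diff[OF A, of "\<lambda>s. Y s u"] by simp
qed

text \<open>The first summand is the mismatch of the two normalizations, the second the omitted
  terms. For fixed \<open>p\<close> both have limits in \<open>m\<close>, and these are small for
  large \<open>p\<close>.\<close>

lemma block_approx_second_moment:
 assumes per: "per > 0" and v: "block_var p > 0" and L: "p + k > 0" and m: "m >= p + k"
 defines "q \<equiv> m div (p + k)"
 shows "integrable uniform_seq (\<lambda>u. ((\<Sum>s<m. Y s u) / sqrt (real m * per) - (\<Sum>b<q. block_sum p b u) / sqrt (real q * block_var p))^2)"
  "(EU u. ((\<Sum>s<m. Y s u) / sqrt (real m * per) - (\<Sum>b<q. block_sum p b u) / sqrt (real q * block_var p))^2)
   <= 2 * (sqrt (real q / real m * (block_var p / per)) - 1)^2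
    + 2 * ((real q / real m * real k + real (p + k) / real m) * (2 * real k + 1) * \<gamma> 0 / per)"
proof -
 obtain R where R: "finite R" "card R <= q * k + (p + k)"
  "\<And>u. (\<Sum>s<m. Y s u) = (\<Sum>b<q. block_sum p b u) + (\<Sum>s\<in>R. Y s u)"
  using block_decomposition[OF L, of m] unfolding q_def by metis
 let ?T = "\<lambda>u. \<Sum>b<q. block_sum p b u" and ?R = "\<lambda>u. \<Sum>s\<in>R. Y s u"
 let ?c = "1 / sqrt (real m * per) - 1 / sqrt (real q * block_var p)"
 let ?D = "\<lambda>u. (\<Sum>s<m. Y s u) / sqrt (real m * per) - ?T u / sqrt (real q * block_var p)"
 have q0: "q > 0" unfolding q_def using m L by (simp add: div_greater_zero_iff)
 have m0: "m > 0" using m L by linarith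
 have D: "?D u = ?c * ?T u + ?R u / sqrt (real m * per)" for u
  unfolding R(3) by (simp add: add_divide_distrib left_diff_distrib)
 have bound: "(?D u)^2 <= 2 * ?c^2 * (?T u)^2 + 2 / (real m * per) * (?R u)^2" for u
 proof -
  have "(?D u)^2 <= 2 * (?c * ?T u)^2 + 2 * (?R u / sqrt (real m * per))^2"
   unfolding D using sum_squares_bound[of "?c * ?T u" "?R u / sqrt (real m * per)"] by (simp add: power2_sum)
  also have "... = 2 * ?c^2 * (?T u)^2 + 2 / (real m * per) * (?R u)^2"
   using per by (simp add: power_mult_distrib power_divide)
  finally show ?thesis .
 qed
 note T = blocks_second_moment[where q = q and p = p] and Rm = partial_sum_second_moment[OF R(1)]
 have bi: "integrable uniform_seq (\<lambda>u. 2 * ?c^2 * (?T u)^2 + 2 / (real m * per) * (?R u)^2)"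
  by (intro L1_integrable_add integrable_mult_right T Rm)
 have Dm: "?D \<in> borel_measurable uniform_seq"
  by (intro borel_measurable_diff borel_measurable_divide borel_measurable_sum lag_seq_measurable block_sum_measurable borel_measurable_const)
 show i: "integrable uniform_seq (\<lambda>u. (?D u)^2)"
  by (rule L1_integrable_bound[OF bi borel_measurable_power[OF Dm]])
    (use bound in \<open>auto intro!: AE_I2 order_trans[OF _ abs_ge_self]\<close>)
 have "(EU u. (?D u)^2) <= (EU u. 2 * ?c^2 * (?T u)^2 + 2 / (real m * per) * (?R u)^2)"
  using bound by (intro integral_mono i bi)
 also have "... = 2 * (?c^2 * (real q * block_var p)) + 2 / (real m * per) * (EU u. (?R u)^2)"
  using T Rm(1) by simp
 also have "?c^2 * (real q * block_var p) = (sqrt (real q / real m * (block_var p / per)) - 1)^2"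
 proof -
  let ?v = "real q * block_var p"
  have v0: "?v > 0" using v q0 by simp
  have "?c^2 * ?v = (?c * sqrt ?v)^2" using v0 by (simp add: power_mult_distrib)
  also have "?c * sqrt ?v = sqrt ?v / sqrt (real m * per) - 1" using v q0 by (simp add: left_diff_distrib)
  also have "sqrt ?v / sqrt (real m * per) = sqrt (real q / real m * (block_var p / per))"
   by (simp flip: real_sqrt_divide)
  finally show ?thesis .
 qed
 also have "2 / (real m * per) * (EU u. (?R u)^2) <= 2 / (real m * per) * ((real q * real k + real (p + k)) * (2 * real k + 1) * \<gamma> 0)"
 proof (rule mult_left_mono)
  have "real (card R) <= real q * real k + real (p + k)" using R(2) by (simp flip: of_nat_mult of_nat_add)
  then have "real (card R) * (2 * real k + 1) * \<gamma> 0 <= (real q * real k + real (p + k)) * (2 * real k + 1) * \<gamma> 0"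
   by (intro mult_right_mono autocov_bound(2)) auto
  then show "(EU u. (?R u)^2) <= (real q * real k + real (p + k)) * (2 * real k + 1) * \<gamma> 0"
   using Rm(2) by linarith
 qed (use per in simp)
 also have "2 / (real m * per) * ((real q * real k + real (p + k)) * (2 * real k + 1) * \<gamma> 0)
  = 2 * ((real q / real m * real k + real (p + k) / real m) * (2 * real k + 1) * \<gamma> 0 / per)"
  using m0 per by (simp add: field_simps)
 finally show "(EU u. (?D u)^2) <= 2 * (sqrt (real q / real m * (block_var p / per)) - 1)^2
    + 2 * ((real q / real m * real k + real (p + k) / real m) * (2 * real k + 1) * \<gamma> 0 / per)" by simp
qed

lemma inverse_shift_limit: "(\<lambda>p. x / real (p + d)) \<longlonglongrightarrow> 0"
 by (intro real_tendsto_divide_at_top[OF tendsto_const] filterlim_compose[OF filterlim_real_sequentially] filterlim_add_const_nat_at_top)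

lemma block_var_limit: "(\<lambda>p. block_var p / real (p + k)) \<longlonglongrightarrow> long_run_var k \<xi>"
proof (rule Lim_transform_eventually)
 show "(\<lambda>p. block_var k / real (p + k) + (1 - 2 * real k / real (p + k)) * long_run_var k \<xi>) \<longlonglongrightarrow> long_run_var k \<xi>"
  using tendsto_add[OF inverse_shift_limit[of "block_var k" k] tendsto_mult[OF tendsto_diff[OF tendsto_const[of 1] inverse_shift_limit[of "2 * real k" k]] tendsto_const[of "long_run_var k \<xi>"]]]
  by simp
 show "\<forall>\<^sub>F p in sequentially. block_var k / real (p + k) + (1 - 2 * real k / real (p + k)) * long_run_var k \<xi> = block_var p / real (p + k)"
 proof (rule eventually_sequentiallyI[of "k + 1"])
  fix p assume p: "k + 1 <= p"
  then have "1 - 2 * real k / real (p + k) = real (p - k) / real (p + k)" by (simp add: field_simps of_nat_diff)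
  then show "block_var k / real (p + k) + (1 - 2 * real k / real (p + k)) * long_run_var k \<xi> = block_var p / real (p + k)"
   using block_var_eq[of p] p by (simp add: add_divide_distrib)
 qed
qed

lemma div_ratio_limit:
 assumes "L > 0"
 shows "(\<lambda>m. real (m div L) / real m) \<longlonglongrightarrow> 1 / real L"
proof (rule tendsto_sandwich)
 show "(\<lambda>m. (real m / real L - 1) / real m) \<longlonglongrightarrow> 1 / real L"
 proof -
  have "(\<lambda>m. (real m / real L - 1) / real m) \<longlonglongrightarrow> inverse (real L)" using assms by real_asymp
  then show ?thesis by (simp add: inverse_eq_divide)
 qed
 show "\<forall>\<^sub>F m in sequentially. real (m div L) / real m <= 1 / real L"
 proof (rule eventually_sequentiallyI[of 1])
  fix m :: nat assume "1 <= m"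
  moreover have "real (m div L) * real L <= real m" by (simp flip: of_nat_mult)
  ultimately show "real (m div L) / real m <= 1 / real L" using assms by (simp add: field_simps)
 qed
 show "\<forall>\<^sub>F m in sequentially. (real m / real L - 1) / real m <= real (m div L) / real m"
 proof (intro always_eventually allI divide_right_mono)
  fix m show "real m / real L - 1 <= real (m div L)"
  proof -
   have "real m < real (m div L * L + L)" using dividend_less_div_times[OF assms, of m] by (simp only: of_nat_less_iff)
   then show ?thesis using assms by (simp add: field_simps)
  qed
 qed simp
qed simp

theorem lag_sum_clt:
 assumes per: "long_run_var k \<xi> > 0"
 shows "weak_conv_m (\<lambda>m. distr uniform_seq borel (\<lambda>u. (\<Sum>s<m. Y s u) / sqrt (real m * long_run_var k \<xi>))) std_normal_distribution"
proof (rule US.weak_conv_approx)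
 let ?per = "long_run_var k \<xi>"
 let ?X = "\<lambda>m u. (\<Sum>s<m. Y s u) / sqrt (real m * ?per)"
 show "?X m \<in> borel_measurable uniform_seq" for m
  by (intro borel_measurable_divide borel_measurable_sum lag_seq_measurable borel_measurable_const)
 show "real_distribution std_normal_distribution" by (rule real_dist_normal_dist)
 fix eps :: real assume eps: "eps > 0"
 \<comment> \<open>For fixed \<open>p\<close> the second-moment bound tends to this expression at
   \<open>r = 1/(p+k)\<close>. It tends to 0 as \<open>p\<close> grows: the normalizations match in
   the limit and the gaps become a negligible fraction.\<close>
 define c where "c r x = 2 * (sqrt (r * x) - 1)^2 + 2 * (r * real k * (2 * real k + 1) * \<gamma> 0 / ?per)" for r x
 have c_lim: "(\<lambda>m. c (r m) x) \<longlonglongrightarrow> c r' x" if "r \<longlonglongrightarrow> r'" for r r' x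
  unfolding c_def using that per by (intro tendsto_intros) auto
 have "(\<lambda>p. c (1 / real (p + k)) (block_var p / ?per)) \<longlonglongrightarrow> 2 * (sqrt (?per / ?per) - 1)^2 + 2 * (0 * real k * (2 * real k + 1) * \<gamma> 0 / ?per)"
 proof -
  have "(\<lambda>p. 1 / real (p + k)) \<longlonglongrightarrow> 0" by (rule inverse_shift_limit)
  moreover have "(\<lambda>p. (1 / real (p + k)) * (block_var p / ?per)) \<longlonglongrightarrow> ?per / ?per"
   using tendsto_divide[OF block_var_limit tendsto_const, of ?per] per by (simp add: field_simps)
  ultimately show ?thesis unfolding c_def by (intro tendsto_intros) (use per in auto)
 qed
 then have "(\<lambda>p. c (1 / real (p + k)) (block_var p / ?per)) \<longlonglongrightarrow> 0" using per by simp
 \<comment> \<open>The third power, because Chebyshev divides by \<open>eps^2\<close> and a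
   probability of at most \<open>eps\<close> is wanted.\<close>
 then have "\<forall>\<^sub>F p in sequentially. c (1 / real (p + k)) (block_var p / ?per) < eps ^ 3"
  using eps by (intro order_tendstoD) auto
 moreover have "\<forall>\<^sub>F p in sequentially. 0 < block_var p / real (p + k)"
  by (rule order_tendstoD(1)[OF block_var_limit per])
 ultimately have "\<forall>\<^sub>F p in sequentially. c (1 / real (p + k)) (block_var p / ?per) < eps ^ 3 \<and> 0 < block_var p / real (p + k)"
  by (rule eventually_conj)
 then obtain p where p: "c (1 / real (p + k)) (block_var p / ?per) < eps ^ 3" and "0 < block_var p / real (p + k)"
  by (auto simp: eventually_sequentially)
 then have v: "block_var p > 0" and L: "p + k > 0" by (auto simp: zero_less_divide_iff)
 let ?W = "\<lambda>q u. (\<Sum>b<q. block_sum p b u) / sqrt (real q * block_var p)"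
 let ?q = "\<lambda>m. m div (p + k)"
 have Wm: "?W q \<in> borel_measurable uniform_seq" for q
  by (intro borel_measurable_divide borel_measurable_sum block_sum_measurable borel_measurable_const)
 have qinf: "filterlim ?q sequentially sequentially"
  unfolding filterlim_at_top
 proof
  fix Z
  have "Z <= ?q m" if "Z * (p + k) <= m" for m
   using that less_eq_div_iff_mult_less_eq[OF L] by blast
  then show "\<forall>\<^sub>F m in sequentially. Z <= ?q m" by (auto simp: eventually_sequentially)
 qed
 have conv: "weak_conv_m (\<lambda>m. distr uniform_seq borel (?W (?q m))) std_normal_distribution"
  by (rule weak_conv_m_compose[OF block_clt[OF v] qinf])
 have ev: "\<forall>\<^sub>F m in sequentially. measure uniform_seq {u \<in> space uniform_seq. \<bar>?X m u - ?W (?q m) u\<bar> > eps} <= eps"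
 proof -
  let ?b = "\<lambda>m. c (real (?q m) / real m) (block_var p / ?per) + 2 * (real (p + k) / real m * (2 * real k + 1) * \<gamma> 0 / ?per)"
  have "(\<lambda>m. real (p + k) / real m) \<longlonglongrightarrow> 0" using inverse_shift_limit[of "real (p + k)" 0] by simp
  then have "?b \<longlonglongrightarrow> c (1 / real (p + k)) (block_var p / ?per) + 2 * (0 * (2 * real k + 1) * \<gamma> 0 / ?per)"
   using per by (intro tendsto_add c_lim[OF div_ratio_limit[OF L]] tendsto_mult tendsto_divide[OF _ tendsto_const] tendsto_const) simp_all
  then have "\<forall>\<^sub>F m in sequentially. ?b m < eps ^ 3" using p by (intro order_tendstoD) auto
  then show ?thesis using eventually_ge_at_top[of "p + k"]
  proof eventually_elim
   case (elim m)
   let ?D = "\<lambda>u. ?X m u - ?W (?q m) u"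
   note bm = block_approx_second_moment[OF per v L elim(2)]
   have Dm: "?D \<in> borel_measurable uniform_seq"
    by (intro borel_measurable_diff Wm borel_measurable_divide borel_measurable_sum lag_seq_measurable borel_measurable_const)
   have "(EU u. (?D u)^2) <= ?b m"
    using bm(2) by (simp add: c_def distrib_right add_divide_distrib)
   then have E: "(EU u. (?D u)^2) <= eps ^ 3" using elim(1) by linarith
   have "measure uniform_seq {u \<in> space uniform_seq. \<bar>?D u\<bar> > eps} <= measure uniform_seq {u \<in> space uniform_seq. (?D u)^2 >= eps^2}"
   proof (rule US.finite_measure_mono)
    show "{u \<in> space uniform_seq. \<bar>?D u\<bar> > eps} \<subseteq> {u \<in> space uniform_seq. (?D u)^2 >= eps^2}"
     using eps by (auto simp: abs_le_square_iff[symmetric])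
    show "{u \<in> space uniform_seq. (?D u)^2 >= eps^2} \<in> sets uniform_seq"
     using borel_measurable_power[OF Dm, of 2] by (intro borel_measurable_le borel_measurable_const)
   qed
   also have "... <= (EU u. (?D u)^2) / eps^2"
    using integral_Markov_inequality_measure[OF bm(1), of "space uniform_seq" "eps^2"] eps by simp
   also have "... <= eps ^ 3 / eps^2" using E by (rule divide_right_mono) simp
   also have "... = eps" using eps by (simp add: power3_eq_cube power2_eq_square)
   finally show ?case .
  qed
 qed
 show "\<exists>W. (\<forall>m. W m \<in> borel_measurable uniform_seq) \<and> weak_conv_m (\<lambda>m. distr uniform_seq borel (W m)) std_normal_distribution
   \<and> (\<forall>\<^sub>F m in sequentially. measure uniform_seq {u \<in> space uniform_seq. \<bar>?X m u - W m u\<bar> > eps} <= eps)"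
  by (rule exI[of _ "\<lambda>m. ?W (?q m)"], intro conjI allI Wm conv ev)
qed

end

end

section \<open>The asymptotic variance\<close>

text \<open>Testing against bounded functions of coordinate \<open>l\<close> characterizes the
  projection as a conditional expectation; it is applied to indicators and to
  \<open>half_sign\<close>.\<close>

lemma proj_test:
 assumes g: "square_integrable k g" and l: "l <= k" and b: "b \<in> borel_measurable uniform01" and B: "\<And>x. \<bar>b x\<bar> <= (1 :: real)"
 shows "integrable (cube k) (\<lambda>w. b (w l) * g w)" "integrable uniform01 (\<lambda>x. b x * proj k l g x)"
  "(LINT w|cube k. b (w l) * g w) = (LINT x|uniform01. b x * proj k l g x)"
proof -
 note gf = phi_facts[OF g]
 let ?K = "{..k} - {l}"
 have bm: "(\<lambda>w. b (w l)) \<in> borel_measurable (cube k)" by (rule measurable_compose[OF cube_component[OF l] b])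
 show i: "integrable (cube k) (\<lambda>w. b (w l) * g w)"
 proof (rule L1_integrable_bound[OF gf(3) borel_measurable_times[OF bm gf(1)]])
  show "AE w in cube k. norm (b (w l) * g w) <= norm (g w)"
   using B by (intro AE_I2) (simp add: abs_mult mult_left_le_one_le)
 qed
 have pm: "(\<lambda>x. b x * proj k l g x) \<in> borel_measurable uniform01"
  by (intro borel_measurable_times b proj_measurable gf(1) l)
 show "integrable uniform01 (\<lambda>x. b x * proj k l g x)"
 proof (rule L1_integrable_bound[OF proj_facts(1)[OF g l] pm])
  show "AE x in uniform01. norm (b x * proj k l g x) <= norm (proj k l g x)"
   using B by (intro AE_I2) (simp add: abs_mult mult_left_le_one_le)
 qed
 have "(LINT w|cube k. b (w l) * g w) = (LINT u|cube k. LINT v|cube k. b (mix ?K v u l) * g (mix ?K v u))"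
  using integral_mix(2)[of "{..k}" "\<lambda>_. uniform01" "\<lambda>w. b (w l) * g w" ?K, folded cube_def, OF prob_space_uniform01 i] by simp
 also have "... = (LINT u|cube k. b (u l) * proj k l g (u l))"
 proof (rule L1_integral_cong[OF refl])
  fix u assume u: "u \<in> space (cube k)"
  have "mix ?K v u l = u l" for v by (simp add: mix_def)
  then show "(LINT v|cube k. b (mix ?K v u l) * g (mix ?K v u)) = b (u l) * proj k l g (u l)"
   using integral_mix_coordinate[OF u l, of g] by simp
 qed
 also have "... = (LINT x|uniform01. b x * proj k l g x)" by (rule cube_coordinate_integral(1)[OF l pm])
 finally show "(LINT w|cube k. b (w l) * g w) = (LINT x|uniform01. b x * proj k l g x)" .
qed

lemma AE_coordinate:
 assumes "l <= k" "{x \<in> space uniform01. P x} \<in> sets uniform01"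
 shows "(AE w in cube k. P (w l)) \<longleftrightarrow> (AE x in uniform01. P x)"
proof -
 have "distr (cube k) uniform01 (\<lambda>w. w l) = uniform01"
  unfolding cube_def by (rule distr_PiM_component) (use prob_space_uniform01 assms in auto)
 then show ?thesis using AE_distr_iff[OF cube_component[OF assms(1)] assms(2)] by metis
qed

text \<open>Almost everywhere only, since at exceptional points a section of \<open>g\<close> or
  \<open>h\<close> may fail to be integrable.\<close>

lemma proj_diff:
 assumes g: "square_integrable k g" and h: "square_integrable k h" and l: "l <= k"
 shows "AE x in uniform01. proj k l (\<lambda>w. g w - h w) x = proj k l g x - proj k l h x"
proof -
 have m: "proj k l (\<lambda>w. g w - h w) \<in> borel_measurable uniform01" "proj k l g \<in> borel_measurable uniform01" "proj k l h \<in> borel_measurable uniform01"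
  using phi_facts(1)[OF g] phi_facts(1)[OF h] by (auto intro!: proj_measurable l)
 have S: "{x \<in> space uniform01. proj k l (\<lambda>w. g w - h w) x = proj k l g x - proj k l h x} \<in> sets uniform01"
  using m by (intro borel_measurable_eq borel_measurable_diff)
 note i = integral_mix(3)[of "{..k}" "\<lambda>_. uniform01" _ "{..k} - {l}", folded cube_def, OF prob_space_uniform01]
 have "AE u in cube k. proj k l (\<lambda>w. g w - h w) (u l) = proj k l g (u l) - proj k l h (u l)"
  using i[OF phi_facts(3)[OF g]] i[OF phi_facts(3)[OF h]] AE_space
 proof eventually_elim
  case (elim u)
  then show ?case by (simp flip: integral_mix_coordinate[OF elim(3) l])
 qed
 then show ?thesis using AE_coordinate[OF l S] by simp
qed

definition half_sign :: "real => real" where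
 "half_sign x = (if 1/2 <= x then 1 else - 1)"

lemma half_measurable:
 "half_sign \<in> borel_measurable uniform01" "(\<lambda>x. of_bool (1/2 <= x) :: real) \<in> borel_measurable uniform01"
proof -
 have "{x \<in> space uniform01. 1/2 <= x} \<in> sets uniform01"
  by (intro borel_measurable_le id_uniform01 borel_measurable_const)
 then show "half_sign \<in> borel_measurable uniform01" "(\<lambda>x. of_bool (1/2 <= x) :: real) \<in> borel_measurable uniform01"
  unfolding half_sign_def[abs_def] of_bool_def by (auto intro!: measurable_If)
qed

lemma half_integrals:
 "integrable uniform01 (\<lambda>x. of_bool (1/2 <= x) :: real)" "(LINT x|uniform01. of_bool (1/2 <= x)) = (1/2 :: real)"
 "integrable uniform01 half_sign" "(LINT x|uniform01. half_sign x) = 0"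
proof -
 show i: "integrable uniform01 (\<lambda>x. of_bool (1/2 <= x) :: real)"
  by (rule U01.integrable_const_bound[where B = 1]) (use half_measurable in auto)
 have "(LINT x|uniform01. of_bool (1/2 <= x)) = (LINT x|uniform01. 1 - indicator {x \<in> {0<..<1}. x < 1/2} x :: real)"
  by (rule L1_integral_cong) auto
 also have "... = 1 - measure uniform01 {x \<in> {0<..<1}. x < 1/2}"
 proof -
  have "{x \<in> space uniform01. x < 1/2} \<in> sets uniform01"
   by (intro borel_measurable_less id_uniform01 borel_measurable_const)
  then show ?thesis
   by (subst L1_integral_diff) (auto simp: U01.prob_space[simplified] U01.emeasure_eq_measure intro!: arg_cong[of _ _ "measure uniform01"])
 qed
 also have "... = 1/2" using measure_uniform01_Iio(1)[of "1/2"] by simp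
 finally show I: "(LINT x|uniform01. of_bool (1/2 <= x)) = (1/2 :: real)" .
 have e: "half_sign = (\<lambda>x. 2 * of_bool (1/2 <= x) - 1)" by (auto simp: half_sign_def)
 show "integrable uniform01 half_sign" unfolding e using i by simp
 show "(LINT x|uniform01. half_sign x) = 0" unfolding e using i I U01.prob_space by simp
qed

context
 fixes k :: nat and phi :: "(nat => real) => real"
 assumes phi: "square_integrable k phi"
begin

definition half_moment :: "nat => real" where
 "half_moment j = (LINT w|cube k. of_bool (1/2 <= w j) * phi w)"

text \<open>The coefficient of \<open>half_sign\<close> in the sum of the projections of the step
  kernel; its square is the second summand of \<open>asymp_var\<close>.\<close>

definition sign_coefficient :: real where
 "sign_coefficient = 2 * (\<Sum>j\<le>k. half_moment j) - (real k + 1) * mu k phi"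

text \<open>The projection takes one value on each half interval. Its integral over the upper half
  and its total integral determine both values.\<close>

lemma proj_step_kernel:
 assumes j: "j <= k" and x: "x \<in> {0<..<1}"
 shows "proj k j (step_kernel k phi) x = mu k phi + (2 * half_moment j - mu k phi) * half_sign x"
proof -
 let ?h = "step_kernel k phi" and ?p = "proj k j (step_kernel k phi)"
 let ?b = "\<lambda>x. of_bool (1/2 <= x) :: real"
 note h = step_kernel_square_integrable[OF phi]
 have eq: "?p y = ?p y'" if "1/2 <= y \<longleftrightarrow> 1/2 <= y'" for y y'
 proof -
  have "pattern k (w(j := y)) = pattern k (w(j := y'))" for w using that by (auto simp: pattern_def)
  then show ?thesis by (simp add: proj_def step_kernel_def)
 qed
 define C where "C = ?p (1/2)"
 define D where "D = ?p (1/4)"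
 have p: "?p y = (if 1/2 <= y then C else D)" for y
  using eq[of y "1/2"] eq[of y "1/4"] by (simp add: C_def D_def)
 have t: "(LINT w|cube k. ?b (w j) * phi w) = (LINT w|cube k. ?b (w j) * ?h w)"
 proof -
  have "(LINT w|cube k. of_bool (j \<in> pattern k w) * (phi w - ?h w)) = 0"
   by (rule residual_pattern_orthogonal[OF phi])
  then have "(LINT w|cube k. ?b (w j) * phi w - ?b (w j) * ?h w) = 0"
   using j by (simp add: pattern_def right_diff_distrib)
  then show ?thesis
   using proj_test(1)[OF phi j half_measurable(2)] proj_test(1)[OF h j half_measurable(2)] by simp
 qed
 have "half_moment j = (LINT x|uniform01. ?b x * ?p x)"
  unfolding half_moment_def t by (rule proj_test(3)[OF h j half_measurable(2)]) simp
 also have "... = (LINT x|uniform01. ?b x * C)" by (intro L1_integral_cong) (auto simp: p)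
 also have "... = C / 2" using half_integrals by simp
 finally have c: "C = 2 * half_moment j" by simp
 have "mu k phi = (LINT x|uniform01. ?p x)"
  using proj_facts(3)[OF h j] integral_step_kernel[OF phi] by simp
 also have "... = (LINT x|uniform01. ?b x * (C - D) + D)" by (intro L1_integral_cong) (auto simp: p)
 also have "... = (C - D) / 2 + D" using half_integrals U01.prob_space by simp
 finally have "D = 2 * mu k phi - 2 * half_moment j" using c by (simp add: field_simps)
 with c show ?thesis by (simp add: p half_sign_def)
qed

text \<open>The number of coordinates in the upper half is the size of the pattern; grouping
  orthants by that size produces the weights \<open>\<nu>\<close> of the theorem.\<close>

lemma sign_coefficient_eq: "sign_coefficient = 2 * (\<Sum>\<nu>=1..k+1. real \<nu> * mu_part k phi \<nu>) - (real k + 1) * mu k phi"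
proof -
 have Ai: "integrable (cube k) (\<lambda>w. of_bool (pattern k w = A) * phi w)" for A
  using pattern_product_integrable[OF phi phi_facts(3)[OF phi], of "\<lambda>B. of_bool (B = A)"] .
 have "(\<Sum>j\<le>k. half_moment j) = (LINT w|cube k. (\<Sum>j\<le>k. of_bool (1/2 <= w j) * phi w))"
  unfolding half_moment_def
  by (rule L1_integral_sum[symmetric]) (use proj_test(1)[OF phi _ half_measurable(2)] in simp)
 also have "... = (LINT w|cube k. (\<Sum>A\<in>Pow {..k}. real (card A) * (of_bool (pattern k w = A) * phi w)))"
 proof (rule L1_integral_cong[OF refl])
  fix w
  have "(\<Sum>A\<in>Pow {..k}. real (card A) * (of_bool (pattern k w = A) * phi w)) = (\<Sum>A\<in>Pow {..k}. if pattern k w = A then real (card A) * phi w else 0)"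
   by (intro sum.cong) auto
  also have "... = real (card (pattern k w)) * phi w" using pattern_subset[of k w] by simp
  also have "... = (\<Sum>j\<le>k. of_bool (1/2 <= w j) * phi w)"
   by (simp add: sum_distrib_right[symmetric] pattern_def Int_def)
  finally show "(\<Sum>j\<le>k. of_bool (1/2 <= w j) * phi w) = (\<Sum>A\<in>Pow {..k}. real (card A) * (of_bool (pattern k w = A) * phi w))" ..
 qed
 also have "... = (\<Sum>A\<in>Pow {..k}. real (card A) * orth_int k phi A)"
  unfolding orth_int_def using Ai by (subst L1_integral_sum) auto
 also have "... = (\<Sum>\<nu>\<in>{0..k+1}. \<Sum>A | A \<in> Pow {..k} \<and> card A = \<nu>. real (card A) * orth_int k phi A)"
  by (rule sum.group[symmetric]) (use card_mono[of "{..k}"] in fastforce)+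
 also have "... = (\<Sum>\<nu>\<in>{0..k+1}. real \<nu> * mu_part k phi \<nu>)"
  unfolding mu_part_eq[OF phi_facts(1)[OF phi]] sum_distrib_left by (intro sum.cong) auto
 also have "... = (\<Sum>\<nu>=1..k+1. real \<nu> * mu_part k phi \<nu>)"
  by (rule sum.mono_neutral_right) auto
 finally show ?thesis by (simp add: sign_coefficient_def)
qed

text \<open>An explicit version of \<open>phi_star\<close>, with \<open>proj\<close> in place of the
  chosen conditional expectations.\<close>

definition centered_kernel :: "(nat => real) => real" where
 "centered_kernel w = phi w - (\<Sum>l\<le>k. proj k l phi (w k)) + real k * mu k phi"

text \<open>The projections of the residual are those of \<open>phi\<close> minus those of the step
  kernel. The latter give back \<open>k + 1\<close> times the mean, of which \<open>k\<close> times
  the mean survives the centering, and a multiple of a sign.\<close>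

lemma lin_kernel_decomposition:
 "AE w in cube k. lin_kernel k phi w = centered_kernel w + sign_coefficient * half_sign (w k)"
proof -
 note h = step_kernel_square_integrable[OF phi]
 let ?r = "\<lambda>w. phi w - step_kernel k phi w"
 have "AE w in cube k. proj k l ?r (w k) = proj k l phi (w k) - proj k l (step_kernel k phi) (w k)" if "l \<in> {..k}" for l
 proof -
  have l: "l <= k" using that by simp
  have "{x \<in> space uniform01. proj k l ?r x = proj k l phi x - proj k l (step_kernel k phi) x} \<in> sets uniform01"
   using phi_facts(1)[OF phi] phi_facts(1)[OF h]
   by (intro borel_measurable_eq borel_measurable_diff proj_measurable l)
  from AE_coordinate[OF order_refl this] proj_diff[OF phi h l] show ?thesis by simp
 qed
 then have "AE w in cube k. \<forall>l\<in>{..k}. proj k l ?r (w k) = proj k l phi (w k) - proj k l (step_kernel k phi) (w k)"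
  by (intro AE_finite_allI) auto
 then show ?thesis using AE_space
 proof eventually_elim
  case (elim w)
  have x: "w k \<in> {0<..<1}" using elim(2) by (auto simp: space_cube PiE_iff)
  have "(\<Sum>l\<le>k. proj k l ?r (w k)) = (\<Sum>l\<le>k. proj k l phi (w k)) - (\<Sum>l\<le>k. proj k l (step_kernel k phi) (w k))"
   using elim(1) by (simp add: sum_subtractf)
  also have "(\<Sum>l\<le>k. proj k l (step_kernel k phi) (w k)) = (\<Sum>l\<le>k. mu k phi + (2 * half_moment l - mu k phi) * half_sign (w k))"
   by (intro sum.cong refl proj_step_kernel x) simp
  also have "... = (real k + 1) * mu k phi + sign_coefficient * half_sign (w k)"
   by (simp add: sum.distrib sum_distrib_right[symmetric] sum_subtractf sign_coefficient_def sum_distrib_left[symmetric] add.commute)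
  finally show ?case by (simp add: lin_kernel_def centered_kernel_def algebra_simps)
 qed
qed

lemma centered_kernel_square_integrable: "square_integrable k centered_kernel"
proof -
 have "square_integrable k (\<lambda>w. phi w - (\<Sum>l\<le>k. proj k l phi (w k)) - - (real k * mu k phi))"
  using proj_sum_facts[OF phi]
  by (intro square_integrable_diff phi square_integrable_coordinate) (auto simp: square_integrable_def)
 then show ?thesis by (simp add: centered_kernel_def[abs_def])
qed

text \<open>The contributions of \<open>phi\<close> and of its projections, which are all evaluated at the last coordinate, cancel.\<close>

lemma centered_sign_covariances: "(\<Sum>j\<le>k. LINT w|cube k. half_sign (w j) * centered_kernel w) = 0"
proof -
 have b: "\<bar>half_sign x\<bar> <= 1" for x by (simp add: half_sign_def)
 let ?\<psi> = "\<lambda>x. \<Sum>l\<le>k. proj k l phi x" and ?s = half_sign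
 let ?I = "LINT x|uniform01. ?s x * ?\<psi> x"
 note p = proj_sum_facts[OF phi] and pt = proj_test[OF phi _ half_measurable(1) b]
 have si: "integrable uniform01 (\<lambda>x. ?s x * ?\<psi> x)"
  unfolding sum_distrib_left using pt(2) by (intro L1_integrable_sum) simp
 have sm: "(\<lambda>w. ?s (w j)) \<in> borel_measurable (cube k)" if "j <= k" for j
  by (rule measurable_compose[OF cube_component[OF that] half_measurable(1)])
 have "(LINT w|cube k. ?s (w j) * centered_kernel w) = (LINT x|uniform01. ?s x * proj k j phi x) - (if j = k then ?I else 0)"
  if j: "j <= k" for j
 proof -
  have i\<psi>: "integrable (cube k) (\<lambda>w. ?s (w j) * ?\<psi> (w k))"
  proof (rule L1_integrable_bound)
   show "integrable (cube k) (\<lambda>w. ?\<psi> (w k))"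
    using cube_coordinate_integral(2)[OF order_refl p(1)] p(3) by simp
   show "(\<lambda>w. ?s (w j) * ?\<psi> (w k)) \<in> borel_measurable (cube k)"
    by (intro borel_measurable_times sm j measurable_compose[OF cube_component p(1)]) simp
   show "AE w in cube k. norm (?s (w j) * ?\<psi> (w k)) <= norm (?\<psi> (w k))"
    by (intro AE_I2) (simp add: half_sign_def)
  qed
  \<comment> \<open>For \<open>j\<close> different from \<open>k\<close> the two factors are
    independent and the sign has mean 0.\<close>
  have I\<psi>: "(LINT w|cube k. ?s (w j) * ?\<psi> (w k)) = (if j = k then ?I else 0)"
  proof (cases "j = k")
   case True
   then show ?thesis using cube_coordinate_integral(1)[OF order_refl, of "\<lambda>x. ?s x * ?\<psi> x" k] si by simp
  next
   case False
   have "(LINT w|cube k. ?s (w j) * ?\<psi> (w k)) = (LINT w|cube k. ?s (w j)) * (LINT w|cube k. ?\<psi> (w k))"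
    unfolding cube_def
    by (rule integral_mix_product[where K = "{j}"])
      (use False i\<psi> prob_space_uniform01 in \<open>simp_all add: cube_def mix_def\<close>)
   also have "(LINT w|cube k. ?s (w j)) = 0"
    using cube_coordinate_integral(1)[OF j half_measurable(1)] half_integrals by simp
   finally show ?thesis using False by simp
  qed
  have s: "integrable (cube k) (\<lambda>w. ?s (w j))" "(LINT w|cube k. ?s (w j)) = 0"
   using cube_coordinate_integral[OF j half_measurable(1)] half_integrals by simp_all
  have "(LINT w|cube k. ?s (w j) * centered_kernel w) = (LINT w|cube k. ?s (w j) * phi w - ?s (w j) * ?\<psi> (w k) + ?s (w j) * (real k * mu k phi))"
   by (simp add: centered_kernel_def algebra_simps)
  also have "... = (LINT w|cube k. ?s (w j) * phi w) - (LINT w|cube k. ?s (w j) * ?\<psi> (w k))"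
   using pt(1)[OF j] i\<psi> s by simp
  finally show ?thesis using pt(3)[OF j] I\<psi> by simp
 qed
 then have "(\<Sum>j\<le>k. LINT w|cube k. ?s (w j) * centered_kernel w) = (\<Sum>j\<le>k. LINT x|uniform01. ?s x * proj k j phi x) - ?I"
  by (simp add: sum_subtractf)
 also have "(\<Sum>j\<le>k. LINT x|uniform01. ?s x * proj k j phi x) = ?I"
  unfolding sum_distrib_left using pt(2) by (subst L1_integral_sum) auto
 finally show ?thesis by simp
qed

text \<open>\<open>cond_exp_at\<close> picks an arbitrary version of the conditional expectation, so
  it is identified with a projection almost everywhere. \<open>U l\<close> stands at position
  \<open>k + 1 - l\<close> because lags run backwards.\<close>

lemma cond_exp_coordinate:
 assumes l: "l \<in> {1..k+1}"
 defines "X \<equiv> \<lambda>U. phi (lags k U (k + 1))"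
 shows "cond_exp_at uniform_seq X (\<lambda>U. U l) \<in> borel_measurable borel"
  "AE x in uniform01. cond_exp_at uniform_seq X (\<lambda>U. U l) x = proj k (k + 1 - l) phi x"
proof -
 define j where "j = k + 1 - l"
 have j: "j <= k" "k + 1 - j = l" using l by (auto simp: j_def)
 let ?T = "lag_index k (k + 1)" and ?C = "\<lambda>U :: nat => real. U l"
 let ?F = "vimage_algebra (space uniform_seq) ?C (borel :: real measure)"
 \<comment> \<open>A version must be a Borel function on the whole line, whereas measurability of
   \<open>proj\<close> is known on the unit interval only.\<close>
 let ?g = "\<lambda>x. indicator {0<..<1} x * proj k j phi x"
 note f = phi_facts[OF phi] and pf = proj_facts[OF phi j(1)]
 note pm = proj_measurable[OF f(1) j(1)]
 have T: "?T \<in> tuples k (k + 1)" by (rule lag_index_in_tuples) simp_all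
 have Tj: "tup k U ?T j = U l" for U :: "nat => real" using j by (simp add: tup_def lag_index_def)
 have X: "X U = phi (tup k U ?T)" for U by (simp add: X_def lags_eq_tup)
 have gm: "?g \<in> borel_measurable borel"
 proof -
  have "(\<lambda>x. indicator {0<..<1} x *\<^sub>R proj k j phi x) \<in> borel_measurable lborel"
   using pm unfolding uniform01_def by (subst (asm) borel_measurable_restrict_space_iff) auto
  then show ?thesis by simp
 qed
 have Cm: "?C \<in> borel_measurable uniform_seq"
  unfolding uniform_seq_def using l by (intro uniform_component_measurable) auto
 have Cs: "?C \<in> space uniform_seq \<rightarrow> space borel" by simp
 have sub: "subalgebra uniform_seq ?F"
  unfolding subalgebra_def sets_vimage_algebra2[OF Cs] using measurable_sets[OF Cm] by auto
 interpret finite_measure_subalgebra uniform_seq ?F by standard (rule sub)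
 have u: "U l \<in> {0<..<1}" if "U \<in> space uniform_seq" for U
  using that l by (auto simp: space_uniform_seq PiE_iff)
 have gi: "integrable uniform_seq (\<lambda>U. ?g (U l))"
 proof -
  have "integrable uniform_seq (\<lambda>U. proj k j phi (U l))"
   using component_integral(2)[of l "{1..}" "proj k j phi"] l pm pf(1) by (simp add: uniform_seq_def)
  then show ?thesis by (rule L1_integrable_cong[THEN iffD1, OF refl, rotated]) (use u in auto)
 qed
 have Xi: "integrable uniform_seq X" unfolding X using integrable_tup[OF T f(1)] f(3) by simp
 have ce: "AE U in uniform_seq. real_cond_exp uniform_seq ?F X U = ?g (U l)"
 proof (rule real_cond_exp_charact[OF _ Xi gi])
  fix A assume "A \<in> sets ?F"
  then obtain B where B: "B \<in> sets borel" "A = ?C -` B \<inter> space uniform_seq"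
   unfolding sets_vimage_algebra2[OF Cs] by auto
  have Bm: "(indicator B :: real => real) \<in> borel_measurable uniform01"
   by (rule measurable_compose[OF id_uniform01, of "indicator B"]) (use B in simp)
  have b: "\<bar>indicator B x :: real\<bar> <= 1" for x by (simp add: indicator_def)
  note pt = proj_test[OF phi j(1) Bm b]
  have "(LINT U:A|uniform_seq. X U) = (EU U. indicator B (tup k U ?T j) * phi (tup k U ?T))"
   unfolding set_lebesgue_integral_def Tj
   by (intro L1_integral_cong refl) (auto simp: B(2) X indicator_def)
  also have "... = (LINT w|cube k. indicator B (w j) * phi w)"
   by (rule integral_tup[OF T borel_measurable_integrable[OF pt(1)]])
  also have "... = (EU U. indicator B (U l) * proj k j phi (U l))"
   unfolding pt(3) using component_integral(1)[of l "{1..}" "\<lambda>x. indicator B x * proj k j phi x"] borel_measurable_integrable[OF pt(2)] l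
   by (simp add: uniform_seq_def)
  also have "... = (LINT U:A|uniform_seq. ?g (U l))"
   unfolding set_lebesgue_integral_def
   by (intro L1_integral_cong refl) (use u in \<open>auto simp: B(2) indicator_def\<close>)
  finally show "(LINT U:A|uniform_seq. X U) = (LINT U:A|uniform_seq. ?g (U l))" .
 next
  show "(\<lambda>U. ?g (U l)) \<in> borel_measurable ?F"
   by (rule measurable_compose[OF measurable_vimage_algebra1[OF Cs] gm])
 qed
 let ?h = "cond_exp_at uniform_seq X ?C"
 have "?h \<in> borel_measurable borel \<and> (AE U in uniform_seq. real_cond_exp uniform_seq ?F X U = ?h (U l))"
  unfolding cond_exp_at_def by (rule someI[of _ ?g]) (use gm ce in blast)
 then have hm: "?h \<in> borel_measurable borel" and ha: "AE U in uniform_seq. real_cond_exp uniform_seq ?F X U = ?h (U l)" by auto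
 show "?h \<in> borel_measurable borel" by (rule hm)
 have hg: "AE U in uniform_seq. ?h (U l) = proj k j phi (U l)"
  using ha ce AE_space by eventually_elim (use u in auto)
 have "{x \<in> space uniform01. ?h x = proj k j phi x} \<in> sets uniform01"
  by (intro borel_measurable_eq measurable_compose[OF id_uniform01 hm] pm)
 moreover have "distr uniform_seq uniform01 ?C = uniform01"
  unfolding uniform_seq_def by (rule distr_PiM_component) (use prob_space_uniform01 l in auto)
 moreover have "?C \<in> measurable uniform_seq uniform01"
  unfolding uniform_seq_def by (rule measurable_component_singleton) (use l in auto)
 ultimately show "AE x in uniform01. ?h x = proj k (k + 1 - l) phi x"
  using hg AE_distr_iff[of ?C uniform_seq uniform01 "\<lambda>x. ?h x = proj k j phi x"] unfolding j_def[symmetric] by metis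
qed

lemma phi_star_eq: "phi_star k phi \<in> borel_measurable (cube k)" "AE w in cube k. phi_star k phi w = centered_kernel w"
proof -
 let ?h = "\<lambda>l. cond_exp_at uniform_seq (\<lambda>U. phi (lags k U (k + 1))) (\<lambda>U. U l)"
 note c = cond_exp_coordinate
 have I: "(EU U. phi (lags k U (k + 1))) = mu k phi"
  unfolding lags_eq_tup mu_def by (rule integral_tup[OF lag_index_in_tuples phi_facts(1)[OF phi]]) auto
 show "phi_star k phi \<in> borel_measurable (cube k)"
  unfolding phi_star_def[abs_def]
  by (intro borel_measurable_add borel_measurable_diff borel_measurable_sum borel_measurable_const phi_facts(1)[OF phi]
   measurable_compose[OF cube_component_borel c(1)]) auto
 have "AE w in cube k. ?h l (w k) = proj k (k + 1 - l) phi (w k)" if l: "l \<in> {1..k+1}" for l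
 proof -
  have "k + 1 - l <= k" using l by auto
  then have "{x \<in> space uniform01. ?h l x = proj k (k + 1 - l) phi x} \<in> sets uniform01"
   by (intro borel_measurable_eq measurable_compose[OF id_uniform01 c(1)[OF l]] proj_measurable phi_facts(1)[OF phi])
  from AE_coordinate[OF order_refl this] c(2)[OF l] show ?thesis by simp
 qed
 then have "AE w in cube k. \<forall>l\<in>{1..k+1}. ?h l (w k) = proj k (k + 1 - l) phi (w k)"
  by (intro AE_finite_allI) auto
 then show "AE w in cube k. phi_star k phi w = centered_kernel w"
 proof eventually_elim
  case (elim w)
  have "(\<Sum>l=1..k+1. ?h l (w k)) = (\<Sum>l=1..k+1. proj k (k + 1 - l) phi (w k))" using elim by (intro sum.cong) auto
  also have "... = (\<Sum>j\<le>k. proj k j phi (w k))"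
   by (rule sum.reindex_bij_witness[of _ "\<lambda>j. k + 1 - j" "\<lambda>l. k + 1 - l"]) auto
  finally show ?case unfolding phi_star_def I by (simp add: centered_kernel_def)
 qed
qed

lemma AE_tup:
 assumes I: "I \<in> tuples k n" and P: "AE w in cube k. P w"
 shows "AE u in uniform_seq. P (tup k u I)"
proof -
 have d: "distr uniform_seq (cube k) (\<lambda>u. tup k u I) = cube k" and m: "(\<lambda>u. tup k u I) \<in> measurable uniform_seq (cube k)"
  using tuplesD(1,2)[OF I] by (auto intro!: distr_tup tup_measurable_cube)
 have "AE w in distr uniform_seq (cube k) (\<lambda>u. tup k u I). P w" unfolding d by (rule P)
 from AE_distrD[OF m this] show ?thesis .
qed

lemma autocov_cong_AE:
 assumes g: "g \<in> borel_measurable (cube k)" and h: "h \<in> borel_measurable (cube k)" and eq: "AE w in cube k. g w = h w"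
 shows "autocov k g j = autocov k h j"
proof -
 have T: "lag_index k (s + k + 1) \<in> tuples k (s + k + 1)" for s by (rule lag_index_in_tuples) simp_all
 have m: "lag_seq k f s \<in> borel_measurable uniform_seq" if "f \<in> borel_measurable (cube k)" for f s
  unfolding lag_seq_def[abs_def] by (rule phi_tup_measurable'[OF that T])
 show ?thesis unfolding autocov_def
 proof (rule integral_cong_AE)
  show "AE u in uniform_seq. lag_seq k g 0 u * lag_seq k g j u = lag_seq k h 0 u * lag_seq k h j u"
   unfolding lag_seq_def using AE_tup[OF T[of 0] eq] AE_tup[OF T[of j] eq] by eventually_elim simp
 qed (intro borel_measurable_times m g h)+
qed

lemma V_sq_eq: "V_sq k phi = long_run_var k centered_kernel"
proof -
 have "autocov k (phi_star k phi) j = autocov k centered_kernel j" for j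
  by (rule autocov_cong_AE[OF phi_star_eq(1) phi_facts(1)[OF centered_kernel_square_integrable] phi_star_eq(2)])
 moreover have "V_sq k phi = long_run_var k (phi_star k phi)"
  by (simp add: V_sq_def long_run_var_def autocov_def lag_seq_def lags_eq_tup power2_eq_square add.commute add.left_commute)
 ultimately show ?thesis by (simp add: long_run_var_def)
qed

text \<open>Signs of distinct observations are uncorrelated, and a sign is independent of later
  terms, which do not read its observation. The remaining cross covariances, of one term with the
  signs at lags 0 to \<open>k\<close>, add up to 0 by \<open>centered_sign_covariances\<close>; so
  the variances of the two parts add.\<close>

lemma long_run_var_lin_kernel: "long_run_var k (lin_kernel k phi) = asymp_var k phi"
proof -
 let ?c = centered_kernel and ?s = "\<lambda>w. half_sign (w k)" and ?\<rho> = sign_coefficient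
 note cs = centered_kernel_square_integrable
 have sm: "?s \<in> borel_measurable (cube k)" by (rule measurable_compose[OF cube_component[OF order_refl] half_measurable(1)])
 have ss: "square_integrable k ?s"
 proof -
  have "(?s w)^2 = 1" for w by (simp add: half_sign_def)
  then show ?thesis unfolding square_integrable_def using sm by simp
 qed
 let ?C = "lag_seq k ?c" and ?S = "lag_seq k ?s"
 have S: "?S j u = half_sign (u (j + 1))" for j u by (simp add: lag_seq_def tup_def lag_index_def)
 have C: "?C 0 u = ?c (tup k u (lag_index k (k + 1)))" for u by (simp add: lag_seq_def)
 have T: "lag_index k (k + 1) \<in> tuples k (k + 1)" by (rule lag_index_in_tuples) simp_all
 have pi: "integrable uniform_seq (\<lambda>u. lag_seq k f i u * lag_seq k g j u)" if "square_integrable k f" "square_integrable k g" for f g i j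
  using that by (intro integrable_product_of_squares lag_seq_measurable lag_seq_square_integrable)
 have Sm: "(EU u. ?S j u) = 0" for j
  unfolding S using component_integral(1)[of "j + 1" "{1..}" half_sign] half_measurable half_integrals by (simp add: uniform_seq_def)
 define x where "x i = (EU u. ?C 0 u * ?S i u)" for i
 have x: "x i = (LINT w|cube k. half_sign (w (k - i)) * ?c w)" if "i <= k" for i
 proof -
  have t: "tup k u (lag_index k (k + 1)) (k - i) = u (i + 1)" for u :: "nat => real"
   using that by (simp add: tup_def lag_index_def)
  have "(EU u. half_sign (tup k u (lag_index k (k + 1)) (k - i)) * ?c (tup k u (lag_index k (k + 1))))
   = (LINT w|cube k. half_sign (w (k - i)) * ?c w)"
   by (rule integral_tup[OF T]) (intro borel_measurable_times phi_facts(1)[OF cs] measurable_compose[OF cube_component half_measurable(1)], simp)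
  then show ?thesis unfolding x_def S C t by (simp add: mult.commute)
 qed
 have "(\<Sum>i\<le>k. x i) = (\<Sum>i\<le>k. LINT w|cube k. half_sign (w (k - i)) * ?c w)" using x by simp
 also have "... = (\<Sum>j\<le>k. LINT w|cube k. half_sign (w j) * ?c w)"
  by (rule sum.reindex_bij_witness[of _ "\<lambda>j. k - j" "\<lambda>j. k - j"]) auto
 also have "... = 0" by (rule centered_sign_covariances)
 finally have xsum: "x 0 + (\<Sum>j=1..k. x j) = 0"
  by (simp add: atMost_atLeast0 sum.atLeast_Suc_atMost)
 have SC: "(EU u. ?S 0 u * lag_seq k f j u) = 0" if j: "j >= 1" and f: "square_integrable k f" for j f
 proof -
  have "(EU u. ?S 0 u * lag_seq k f j u) = (EU u. ?S 0 u) * (EU u. lag_seq k f j u)"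
   unfolding uniform_seq_def
  proof (rule integral_mix_product[where K = "{1}"])
   show "integrable (unif {1..}) (\<lambda>u. ?S 0 u * lag_seq k f j u)"
    using pi[OF ss f] by (simp add: uniform_seq_def)
   show "?S 0 (mix {1} v u) = ?S 0 v" for u v by (simp add: S mix_def)
   show "lag_seq k f j (mix {1} v u) = lag_seq k f j u" for u v
    by (rule lag_seq_cong) (use j in \<open>auto simp: mix_def\<close>)
  qed (rule prob_space_uniform01)
  then show ?thesis using Sm by simp
 qed
 let ?l = "\<lambda>w. ?c w + ?\<rho> * ?s w"
 have lm: "?l \<in> borel_measurable (cube k)"
  using phi_facts(1)[OF cs] sm by (intro borel_measurable_add borel_measurable_times borel_measurable_const)
 have lin: "autocov k (lin_kernel k phi) j = autocov k ?l j" if "square_integrable k (lin_kernel k phi)" for j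
  using that phi_facts(1) by (intro autocov_cong_AE lm lin_kernel_decomposition)
 have exp: "autocov k ?l j = autocov k ?c j + ?\<rho> * x j + ?\<rho> * (EU u. ?S 0 u * ?C j u) + ?\<rho>^2 * (EU u. ?S 0 u * ?S j u)" for j
 proof -
  have "autocov k ?l j = (EU u. ?C 0 u * ?C j u + ?\<rho> * (?C 0 u * ?S j u) + ?\<rho> * (?S 0 u * ?C j u) + ?\<rho>^2 * (?S 0 u * ?S j u))"
   unfolding autocov_def by (intro L1_integral_cong refl) (simp add: lag_seq_def algebra_simps power2_eq_square)
  also have "... = autocov k ?c j + ?\<rho> * x j + ?\<rho> * (EU u. ?S 0 u * ?C j u) + ?\<rho>^2 * (EU u. ?S 0 u * ?S j u)"
   using pi[OF cs cs, of 0 j] pi[OF cs ss, of 0 j] pi[OF ss cs, of 0 j] pi[OF ss ss, of 0 j]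
   by (simp add: autocov_def x_def)
  finally show ?thesis .
 qed
 have e0: "autocov k ?l 0 = autocov k ?c 0 + 2 * ?\<rho> * x 0 + ?\<rho>^2"
 proof -
  have "(EU u. ?S 0 u * ?C 0 u) = x 0" by (simp add: x_def mult.commute)
  moreover have "?S 0 u * ?S 0 u = 1" for u unfolding S by (simp add: half_sign_def)
  then have "(EU u. ?S 0 u * ?S 0 u) = 1" by (simp add: US.prob_space)
  ultimately show ?thesis using exp[of 0] by simp
 qed
 have ej: "autocov k ?l j = autocov k ?c j + ?\<rho> * x j" if "j \<in> {1..k}" for j
  using exp[of j] SC[of j, OF _ cs] SC[of j, OF _ ss] that by simp
 have "long_run_var k ?l = long_run_var k ?c + 2 * ?\<rho> * (x 0 + (\<Sum>j=1..k. x j)) + ?\<rho>^2"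
  unfolding long_run_var_def e0 using ej by (simp add: sum.distrib sum_distrib_left algebra_simps)
 then have L: "long_run_var k ?l = V_sq k phi + ?\<rho>^2" using xsum by (simp add: V_sq_eq)
 have "?\<rho> = - ((real k + 1) * (mu k phi - 2 * (\<Sum>\<nu>=1..k+1. real \<nu> * mu_part k phi \<nu> / (real k + 1))))"
  unfolding sign_coefficient_eq by (simp add: sum_divide_distrib[symmetric] field_simps)
 then have "?\<rho>^2 = (real k + 1)^2 * (mu k phi - 2 * (\<Sum>\<nu>=1..k+1. real \<nu> * mu_part k phi \<nu> / (real k + 1)))^2"
  by (simp only: power2_minus power_mult_distrib)
 with L lin[OF lin_kernel_square_integrable[OF phi]] show ?thesis
  by (simp add: asymp_var_def long_run_var_def)
qed

end

section \<open>Asymptotic normality\<close>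

lemma lag_avg_eq_sum: "lag_avg k g n u = (\<Sum>s<n - k. lag_seq k g s u) / (real n - real k)"
proof -
 have "(\<Sum>t=k+1..n. g (tup k u (lag_index k t))) = (\<Sum>s<n - k. lag_seq k g s u)"
  unfolding lag_seq_def
  by (rule sum.reindex_bij_witness[of _ "\<lambda>s. s + k + 1" "\<lambda>t. t - k - 1"]) auto
 then show ?thesis by (simp add: lag_avg_def)
qed

context
 fixes k :: nat and phi :: "(nat => real) => real" and a :: score
 assumes phi: "square_integrable k phi" and k: "k >= 1"
  and a: "a = exact_score k phi \<or> (a = appr_score k phi \<and> comb_of_monotone k phi)"
  and sg: "score_generating k a phi"
begin

lemma centered_stat_measurable:
 "(\<lambda>u. uniform_stat k a n u - (EU v. uniform_stat k a n v)) \<in> borel_measurable uniform_seq"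
 "lag_avg k (lin_kernel k phi) n \<in> borel_measurable uniform_seq"
 unfolding uniform_seq_def
 by (auto intro!: uniform_stat_measurable[OF phi] lag_avg_measurable[OF phi] borel_measurable_diff borel_measurable_const
  phi_facts(1)[OF lin_kernel_square_integrable[OF phi]])

text \<open>The density \<open>f\<close> serves to pull the score condition back to uniform
  variables; the two error terms then add.\<close>

lemma uniform_linearization:
 assumes f: "f \<in> \<F>0"
 shows "small_oP (\<lambda>n. uniform_seq)
  (\<lambda>n u. (uniform_stat k a n u - (EU v. uniform_stat k a n v)) - lag_avg k (lin_kernel k phi) n u) (\<lambda>n. 1 / sqrt (real n))"
proof -
 note h = step_kernel_square_integrable[OF phi]
 let ?Z = "\<lambda>n u. uniform_stat k a n u - (EU v. uniform_stat k a n v)"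
 let ?T = "\<lambda>n u. lag_avg k phi n u - U_stat k phi n u + U_stat k (step_kernel k phi) n u - mu k phi"
 have Tm: "?T n \<in> borel_measurable uniform_seq" for n
  unfolding uniform_seq_def
  by (intro borel_measurable_diff borel_measurable_add borel_measurable_const lag_avg_measurable[OF phi] U_stat_measurable[OF phi]
   phi_facts(1)[OF phi] phi_facts(1)[OF h]) auto
 have "small_oP (\<lambda>n. uniform_seq) (\<lambda>n u. (?Z n u - ?T n u) + (?T n u - lag_avg k (lin_kernel k phi) n u)) (\<lambda>n. 1 / sqrt (real n))"
  by (rule small_oP_add[OF prob_space_uniform_seq _ _ uniform_representation[OF phi a score_generating_uniform[OF f phi sg]]
    linearization_negligible[OF phi k]])
    (intro borel_measurable_diff Tm centered_stat_measurable)+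
 moreover have "(?Z n u - ?T n u) + (?T n u - lag_avg k (lin_kernel k phi) n u) = ?Z n u - lag_avg k (lin_kernel k phi) n u" for n u
  by simp
 ultimately show ?thesis by (simp only:)
qed

lemma uniform_clt:
 assumes f: "f \<in> \<F>0" and V: "asymp_var k phi > 0"
 shows "weak_conv_m (\<lambda>n. distr uniform_seq borel
   (\<lambda>u. sqrt (real n - real k) * (uniform_stat k a n u - (EU v. uniform_stat k a n v)) / sqrt (asymp_var k phi)))
  std_normal_distribution"
proof (rule US.weak_conv_approx)
 let ?V = "asymp_var k phi" and ?l = "lin_kernel k phi"
 let ?Z = "\<lambda>n u. uniform_stat k a n u - (EU v. uniform_stat k a n v)"
 let ?X = "\<lambda>n u. sqrt (real n - real k) * ?Z n u / sqrt ?V"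
 let ?Y = "\<lambda>n u. (\<Sum>s<n - k. lag_seq k ?l s u) / sqrt (real (n - k) * ?V)"
 note l = lin_kernel_square_integrable[OF phi]
 show "?X n \<in> borel_measurable uniform_seq" for n
  by (intro borel_measurable_divide borel_measurable_times borel_measurable_const centered_stat_measurable)
 show "real_distribution std_normal_distribution" by (rule real_dist_normal_dist)
 fix eps :: real assume eps: "eps > 0"
 have Ym: "?Y n \<in> borel_measurable uniform_seq" for n
  by (intro borel_measurable_divide borel_measurable_sum lag_seq_measurable l borel_measurable_const)
 have conv: "weak_conv_m (\<lambda>n. distr uniform_seq borel (?Y n)) std_normal_distribution"
  using weak_conv_m_compose[OF lag_sum_clt[OF l lin_kernel_mean_zero[OF phi]], of "\<lambda>n. n - k"] V
  by (simp add: long_run_var_lin_kernel[OF phi] filterlim_minus_const_nat_at_top)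
 let ?D = "\<lambda>n u. ?Z n u - lag_avg k ?l n u"
 have Dm: "?D n \<in> borel_measurable uniform_seq" for n
  by (intro borel_measurable_diff centered_stat_measurable)
 have XY: "\<bar>?D n u\<bar> > eps * sqrt ?V * \<bar>1 / sqrt (real n)\<bar>" if n: "k + 1 <= n" and gt: "\<bar>?X n u - ?Y n u\<bar> > eps" for n u
 proof -
  let ?m = "real n - real k"
  have m: "?m > 0" "?m <= real n" "real (n - k) = ?m" using n by (auto simp: of_nat_diff)
  have "?Y n u = sqrt ?m * lag_avg k ?l n u / sqrt ?V"
  proof -
   have "sqrt ?m * (x / ?m) = x / sqrt ?m" for x
    using m(1) real_div_sqrt[of ?m] by (simp add: field_simps)
   then show ?thesis unfolding lag_avg_eq_sum m(3) by (simp add: real_sqrt_mult)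
  qed
  then have "?X n u - ?Y n u = sqrt ?m * ?D n u / sqrt ?V"
   by (simp add: right_diff_distrib diff_divide_distrib)
  then have "eps < sqrt ?m * \<bar>?D n u\<bar> / sqrt ?V" using gt m(1) V by (simp add: abs_mult)
  then have "eps * sqrt ?V < sqrt ?m * \<bar>?D n u\<bar>" using V by (simp add: pos_less_divide_eq)
  \<comment> \<open>The linearization error is measured against \<open>1 / sqrt n\<close>, while the
    statistic is scaled by the smaller \<open>sqrt (n - k)\<close>.\<close>
  also have "... <= sqrt (real n) * \<bar>?D n u\<bar>" using m(2) by (intro mult_right_mono) auto
  finally show ?thesis using n by (simp add: pos_divide_less_eq mult.commute)
 qed
 have "eps * sqrt ?V > 0" using eps V by simp
 then have "(\<lambda>n. measure uniform_seq {u \<in> space uniform_seq. \<bar>?D n u\<bar> > eps * sqrt ?V * \<bar>1 / sqrt (real n)\<bar>}) \<longlonglongrightarrow> 0"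
  using uniform_linearization[OF f] unfolding small_oP_def by blast
 then have "\<forall>\<^sub>F n in sequentially. measure uniform_seq {u \<in> space uniform_seq. \<bar>?D n u\<bar> > eps * sqrt ?V * \<bar>1 / sqrt (real n)\<bar>} < eps"
  using eps by (rule order_tendstoD)
 then have ev: "\<forall>\<^sub>F n in sequentially. measure uniform_seq {u \<in> space uniform_seq. \<bar>?X n u - ?Y n u\<bar> > eps} <= eps"
  using eventually_ge_at_top[of "k + 1"]
 proof eventually_elim
  case (elim n)
  have "measure uniform_seq {u \<in> space uniform_seq. \<bar>?X n u - ?Y n u\<bar> > eps}
   <= measure uniform_seq {u \<in> space uniform_seq. \<bar>?D n u\<bar> > eps * sqrt ?V * \<bar>1 / sqrt (real n)\<bar>}"
  proof (rule US.finite_measure_mono)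
   show "{u \<in> space uniform_seq. \<bar>?X n u - ?Y n u\<bar> > eps}
    \<subseteq> {u \<in> space uniform_seq. \<bar>?D n u\<bar> > eps * sqrt ?V * \<bar>1 / sqrt (real n)\<bar>}"
    using XY[OF elim(2)] by blast
   show "{u \<in> space uniform_seq. \<bar>?D n u\<bar> > eps * sqrt ?V * \<bar>1 / sqrt (real n)\<bar>} \<in> sets uniform_seq"
    by (intro borel_measurable_less borel_measurable_const borel_measurable_abs Dm)
  qed
  with elim(1) show ?case by linarith
 qed
 show "\<exists>Y. (\<forall>n. Y n \<in> borel_measurable uniform_seq) \<and> weak_conv_m (\<lambda>n. distr uniform_seq borel (Y n)) std_normal_distribution
   \<and> (\<forall>\<^sub>F n in sequentially. measure uniform_seq {u \<in> space uniform_seq. \<bar>?X n u - Y n u\<bar> > eps} <= eps)"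
  by (rule exI[of _ ?Y], intro conjI allI Ym conv ev)
qed

lemma sample_clt:
 assumes f: "f \<in> \<F>0" and V: "asymp_var k phi > 0"
 shows "weak_conv_m (\<lambda>n. distr (H0 f n) borel
   (\<lambda>z. sqrt (real n - real k) * (S_stat k a n z - (LINT y|H0 f n. S_stat k a n y)) / sqrt (asymp_var k phi)))
  std_normal_distribution"
proof -
 have Sm: "uniform_stat k a n \<in> borel_measurable (unif {1..n})" for n
  by (rule uniform_stat_measurable[OF phi subset_refl])
 have loc: "uniform_stat k a n (restrict u {1..n}) = uniform_stat k a n u" for n u
  by (rule restrict_tuple_cong) simp
 have E: "(LINT y|H0 f n. S_stat k a n y) = (EU v. uniform_stat k a n v)" for n
  unfolding S_stat_sample[OF f] by (rule integrable_transfer(2)[OF f Sm loc])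
 let ?Y = "\<lambda>n u. sqrt (real n - real k) * (uniform_stat k a n u - (EU v. uniform_stat k a n v)) / sqrt (asymp_var k phi)"
 have "distr (H0 f n) borel (\<lambda>z. ?Y n (cdf_sample f n z)) = distr uniform_seq borel (?Y n)" for n
 proof (rule distr_transfer[OF f])
  show "?Y n \<in> borel_measurable (unif {1..n})"
   by (intro borel_measurable_divide borel_measurable_times borel_measurable_diff borel_measurable_const Sm)
  show "?Y n (restrict u {1..n}) = ?Y n u" for u unfolding loc ..
 qed
 with uniform_clt[OF f V] show ?thesis unfolding E unfolding S_stat_sample[OF f] by simp
qed

end

text \<open>With \<open>asymp_var k \<phi> = 0\<close> the quotient in (ii) would be identically 0
  by the convention on division and could not have a normal limit; hence the positivity assumption
  there.\<close>

theorem proposition4p1: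
  fixes k :: nat and \<phi> :: "(nat \<Rightarrow> real) \<Rightarrow> real" and a :: score
  assumes "k \<ge> 1"
    and "nonconstant k \<phi>"
    and "square_integrable k \<phi>"
    and "a = exact_score k \<phi> \<or> (a = appr_score k \<phi> \<and> comb_of_monotone k \<phi>)"
    and "score_generating k a \<phi>"
  shows "(\<forall>f\<in>\<F>0. small_oP (H0 f)
            (\<lambda>n z. (S_stat k a n z - (LINT y|H0 f n. S_stat k a n y))
                   - (T_stat k \<phi> f n z - cond_order f n (T_stat k \<phi> f n) z
                      + sign_term k \<phi> n z - mu k \<phi>))
            (\<lambda>n. 1 / sqrt (real n)))
    \<and> ((\<exists>\<delta>>0. integrable (cube k) (\<lambda>u. \<bar>\<phi> u\<bar> powr (2 + \<delta>))) \<and> asymp_var k \<phi> > 0 \<longrightarrow>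
         (\<forall>f\<in>\<F>0. weak_conv_m
            (\<lambda>n. distr (H0 f n) borel
               (\<lambda>z. sqrt (real n - real k) * (S_stat k a n z - (LINT y|H0 f n. S_stat k a n y))
                      / sqrt (asymp_var k \<phi>)))
            std_normal_distribution))"
  using representation[OF _ assms(3-5)] sample_clt[OF assms(3,1,4,5)] by blast

end
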